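(* Let $\nu\in\mathbb N_+\cup\{\infty\}$, $\mathcal H=\mathcal H_\nu$, and let $\mathcal H_\hbar^{\vee}=\sum_{n\ge 0}\Bbbk[\hbar]\,\hbar^{-n}J^n\subseteq \mathcal H(\hbar)$ be the Rees algebra of the $J$-adic filtration of $\mathcal H$, with elements $\mathbf x_n:=\hbar^{-1}\mathbf a_n$ $(n\in\mathbb N_\nu)$. Then $\mathcal H_\hbar^{\vee}$ is a quantized universal enveloping algebra at $\hbar=0$. Namely, the assignment $\mathbf x_n \bmod \hbar\,\mathcal H_\hbar^{\vee}\mapsto x_n$ $(n\in\mathbb N_\nu)$ defines an isomorphism of Hopf algebras $$\mathcal H_\hbar^{\vee}\big|_{\hbar=0}:=\mathcal H_\hbar^{\vee}/\hbar\,\mathcal H_\hbar^{\vee}\;\cong\;U(\mathcal L_\nu),$$ which induces on $U(\mathcal L_\nu)$ the structure of co-Poisson Hopf algebra uniquely provided by the Lie bialgebra structure on $\mathcal L_\nu$ given by $$\delta(x_n)=\sum_{\ell=1}^{n-1}(\ell+1)\,x_\ell\wedge x_{n-\ell}\qquad(n\in\mathbb N_\nu).$$ In particular, the Lie bialgebra $\mathfrak g_-$ with $\mathcal H_\hbar^{\vee}|_{\hbar=0}=U(\mathfrak g_-)$ is $\mathfrak g_-=\mathcal L_\nu$. Finally, the grading $d$ given by $d(x_n):=1$ makes $\mathcal H_\hbar^{\vee}|_{\hbar=0}\cong U(\mathcal L_\nu)$ into a graded co-Poisson Hopf algebra; similarly, the grading $\partial$ given by $\partial(x_n):=n$ makes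 $\mathcal H_\hbar^{\vee}|_{\hbar=0}\cong U(\mathcal L_\nu)$ into a graded Hopf algebra and $\mathcal L_\nu$ into a graded Lie bialgebra.
   Context: $\Bbbk$ is a field of characteristic zero, $\mathbb N=\{0,1,2,\dots\}$, $\mathbb N_+=\mathbb N\setminus\{0\}$, $\mathbb N_\nu=\{1,\dots,\nu\}$ for $\nu\in\mathbb N_+$ and $\mathbb N_\infty=\mathbb N_+$. The Hopf algebra $\mathcal H_\nu$: as an algebra it is the free associative unital algebra $\Bbbk\langle \mathbf a_n\mid n\in\mathbb N_\nu\rangle$, with $\Delta(\mathbf a_n)=\mathbf a_n\otimes 1+1\otimes\mathbf a_n+\sum_{m=1}^{n-1}\mathbf a_m\otimes Q^m_{n-m}(\mathbf a_* )$, $\epsilon(\mathbf a_n)=0$, and antipode determined recursively by $S(\mathbf a_n)=-\mathbf a_n-\sum_{m=1}^{n-1}S(\mathbf a_m)\,Q^m_{n-m}(\mathbf a_* )$, where $Q^\ell_t(\mathbf a_* )=\sum_{k=1}^t\binom{\ell+1}{k}P^{(k)}_t(\mathbf a_* )$ and $P^{(k)}_t(\mathbf a_* )=\sum_{j_1,\dots,j_k>0,\;j_1+\cdots+j_k=t}\mathbf a_{j_1}\cdots\mathbf a_{j_k}$. It is an $\mathbb N$-graded Hopf algebra with $\partial(\mathbf a_n)=n$. $\hbar$ is an indeterminate, $\mathcal H_\hbar=\Bbbk[\hbar]\otimes_\Bbbk\mathcal H$, $\mathcal H(\hbar)=\Bbbk(\hbar)\otimes_\Bbbk\mathcal H$ (Hopf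 structures extended by scalars), and $J=\operatorname{Ker}(\epsilon:\mathcal H\to\Bbbk)$. $\mathcal L_\nu$ is the free Lie algebra over $\Bbbk$ on $\{x_n\}_{n\in\mathbb N_\nu}$ and $U(\mathcal L_\nu)=\Bbbk\langle x_n\mid n\in\mathbb N_\nu\rangle$ is its universal enveloping algebra with its standard Hopf structure (elements of $\mathcal L_\nu$ primitive). Notation: $a\wedge b:=a\otimes b-b\otimes a$. The Poisson cobracket on the cocommutative Hopf algebra $\mathcal H_\hbar^{\vee}|_{\hbar=0}$ is the one induced by $\delta(y\bmod\hbar):=\hbar^{-1}\big(\Delta(y)-\Delta^{\mathrm{op}}(y)\big)\bmod\hbar$. A Hopf $\Bbbk[\hbar]$-algebra is a quantized universal enveloping algebra (at $\hbar=0$) if its specialization at $\hbar=0$ is the universal enveloping algebra of a Lie algebra. A grading makes a Hopf algebra graded if all Hopf operations preserve degree; for a co-Poisson structure one moreover asks that the cobracket be homogeneous (possibly with a fixed degree shift). *)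

theory Defs
  imports
    "HOL-Algebra.Algebra"
    "HOL-Algebra.Algebraic_Closure_Type"
    "HOL-Library.Poly_Mapping"
    "HOL-Library.Extended_Nat"
    "HOL-Computational_Algebra.Computational_Algebra"
begin

section \<open>Free algebras\<close>

text \<open>
  Lists form the free monoid under concatenation.  With this instance, the convolution product of
  \<^typ>\<open>'x list \<Rightarrow>\<^sub>0 'r\<close> makes that type the free associative unital algebra on \<open>'x\<close> over \<open>'r\<close>.
\<close>

instantiation list :: (type) monoid_add
begin
definition zero_list :: "'a list" where "zero_list = []"
definition plus_list :: "'a list \<Rightarrow> 'a list \<Rightarrow> 'a list" where "plus_list xs ys = xs @ ys"
instance by standard (auto simp: zero_list_def plus_list_def)
end

abbreviation coef :: "('x \<Rightarrow>\<^sub>0 'r::zero) \<Rightarrow> 'x \<Rightarrow> 'r" where "coef \<equiv> Poly_Mapping.lookup"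
abbreviation supp :: "('x \<Rightarrow>\<^sub>0 'r::zero) \<Rightarrow> 'x set" where "supp \<equiv> Poly_Mapping.keys"
abbreviation basis :: "'x \<Rightarrow> 'x \<Rightarrow>\<^sub>0 'r::zero_neq_one" where "basis w \<equiv> Poly_Mapping.single w 1"

definition scale :: "'r::comm_ring_1 \<Rightarrow> ('x \<Rightarrow>\<^sub>0 'r) \<Rightarrow> 'x \<Rightarrow>\<^sub>0 'r" where
  "scale c f = Poly_Mapping.map ((*) c) f"

text \<open>The linear map with \<open>w \<mapsto> h w\<close> on basis elements.\<close>
definition lin :: "('x \<Rightarrow> 'y \<Rightarrow>\<^sub>0 'r::comm_ring_1) \<Rightarrow> ('x \<Rightarrow>\<^sub>0 'r) \<Rightarrow> 'y \<Rightarrow>\<^sub>0 'r" where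
  "lin h f = (\<Sum>w\<in>supp f. scale (coef f w) (h w))"

definition gen :: "'x \<Rightarrow> 'x list \<Rightarrow>\<^sub>0 'r::comm_ring_1" where
  "gen x = basis [x]"

definition free_alg :: "'x set \<Rightarrow> ('r::comm_ring_1, 'x list \<Rightarrow>\<^sub>0 'r) module" where
  "free_alg V = \<lparr>carrier = {f. \<forall>w\<in>supp f. set w \<subseteq> V}, monoid.mult = (*), one = 1,
     ring.zero = 0, add = (+), module.smult = scale\<rparr>"

inductive_set mspan :: "('r, 'a, 'm) module_scheme \<Rightarrow> 'a set \<Rightarrow> 'a set"
  for A :: "('r, 'a, 'm) module_scheme" and S :: "'a set" where
  zero: "\<zero>\<^bsub>A\<^esub> \<in> mspan A S"
| base: "x \<in> S \<Longrightarrow> x \<in> mspan A S"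
| add: "x \<in> mspan A S \<Longrightarrow> y \<in> mspan A S \<Longrightarrow> x \<oplus>\<^bsub>A\<^esub> y \<in> mspan A S"
| smult: "x \<in> mspan A S \<Longrightarrow> c \<odot>\<^bsub>A\<^esub> x \<in> mspan A S"

definition linear_on :: "('r, 'a, 'm) module_scheme \<Rightarrow> ('r, 'b, 'n) module_scheme \<Rightarrow> ('a \<Rightarrow> 'b) \<Rightarrow> bool"
  where "linear_on A B h \<longleftrightarrow> h \<in> carrier A \<rightarrow> carrier B \<and>
    (\<forall>x\<in>carrier A. \<forall>y\<in>carrier A. h (x \<oplus>\<^bsub>A\<^esub> y) = h x \<oplus>\<^bsub>B\<^esub> h y) \<and>
    (\<forall>c. \<forall>x\<in>carrier A. h (c \<odot>\<^bsub>A\<^esub> x) = c \<odot>\<^bsub>B\<^esub> h x)"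

text \<open>Not necessarily commutative, unlike the locale \<^locale>\<open>algebra\<close>; the base ring is a type.\<close>
definition assoc_algebra :: "('r::comm_ring_1, 'a, 'm) module_scheme \<Rightarrow> bool" where
  "assoc_algebra A \<longleftrightarrow> ring A \<and> module (ring_of_type_algebra :: 'r ring) A \<and>
    (\<forall>c. \<forall>x\<in>carrier A. \<forall>y\<in>carrier A.
       (c \<odot>\<^bsub>A\<^esub> x) \<otimes>\<^bsub>A\<^esub> y = c \<odot>\<^bsub>A\<^esub> (x \<otimes>\<^bsub>A\<^esub> y) \<and> x \<otimes>\<^bsub>A\<^esub> (c \<odot>\<^bsub>A\<^esub> y) = c \<odot>\<^bsub>A\<^esub> (x \<otimes>\<^bsub>A\<^esub> y))"


section \<open>Tensor powers\<close>

text \<open>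
  An element of the tensor power \<open>M\<^sup>\<otimes>\<^sup>n\<close> is represented by a formal linear combination of lists
  \<open>[x\<^sub>1, \<dots>, x\<^sub>n]\<close> of elements of \<open>M\<close>, standing for \<open>x\<^sub>1 \<otimes> \<cdots> \<otimes> x\<^sub>n\<close> (Sweedler notation).  Two
  such combinations are the same tensor, written \<open>teq M f g\<close>, iff they differ by a combination of
  the multilinearity relations; all identities between tensors are stated up to \<open>teq\<close>.
  The product \<open>*\<close> of formal tensors is concatenation, that is, \<open>\<otimes>\<close>.
\<close>

definition ftens :: "nat \<Rightarrow> ('r::comm_ring_1, 'a, 'm) module_scheme \<Rightarrow> ('a list \<Rightarrow>\<^sub>0 'r) set" where
  "ftens n M = {f. \<forall>xs\<in>supp f. length xs = n \<and> set xs \<subseteq> carrier M}"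

definition tensor_rels :: "('r::comm_ring_1, 'a, 'm) module_scheme \<Rightarrow> ('a list \<Rightarrow>\<^sub>0 'r) set" where
  "tensor_rels M =
     {basis (u @ (x \<oplus>\<^bsub>M\<^esub> y) # v) - basis (u @ x # v) - basis (u @ y # v) | u x y v.
        set u \<subseteq> carrier M \<and> x \<in> carrier M \<and> y \<in> carrier M \<and> set v \<subseteq> carrier M} \<union>
     {basis (u @ (c \<odot>\<^bsub>M\<^esub> x) # v) - scale c (basis (u @ x # v)) | u c x v.
        set u \<subseteq> carrier M \<and> x \<in> carrier M \<and> set v \<subseteq> carrier M}"

definition teq :: "('r::comm_ring_1, 'a, 'm) module_scheme \<Rightarrow> ('a list \<Rightarrow>\<^sub>0 'r) \<Rightarrow> ('a list \<Rightarrow>\<^sub>0 'r) \<Rightarrow> bool"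
  where "teq M f g \<longleftrightarrow> f - g \<in> mspan (free_alg UNIV) (tensor_rels M)"

text \<open>\<open>h \<otimes> \<cdots> \<otimes> h\<close>, with a change of scalars \<open>\<rho>\<close>.\<close>
definition push :: "('r::comm_ring_1 \<Rightarrow> 's::comm_ring_1) \<Rightarrow> ('a \<Rightarrow> 'b) \<Rightarrow> ('a list \<Rightarrow>\<^sub>0 'r) \<Rightarrow> 'b list \<Rightarrow>\<^sub>0 's"
  where "push \<rho> h f = (\<Sum>xs\<in>supp f. Poly_Mapping.single (map h xs) (\<rho> (coef f xs)))"

text \<open>The product of the algebra \<open>A\<^sup>\<otimes>\<^sup>n\<close>.\<close>
definition tmult :: "('r::comm_ring_1, 'a, 'm) module_scheme \<Rightarrow> ('a list \<Rightarrow>\<^sub>0 'r) \<Rightarrow> ('a list \<Rightarrow>\<^sub>0 'r) \<Rightarrow>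
    'a list \<Rightarrow>\<^sub>0 'r" where
  "tmult A f g = (\<Sum>xs\<in>supp f. \<Sum>ys\<in>supp g.
     Poly_Mapping.single (map2 (monoid.mult A) xs ys) (coef f xs * coef g ys))"

definition contract :: "('r::comm_ring_1, 'a, 'm) module_scheme \<Rightarrow> ('a list \<Rightarrow> 'a) \<Rightarrow> ('a list \<Rightarrow>\<^sub>0 'r) \<Rightarrow> 'a"
  where "contract A h f = (\<Oplus>\<^bsub>A\<^esub>xs\<in>supp f. coef f xs \<odot>\<^bsub>A\<^esub> h xs)"

text \<open>For \<open>d\<close> with values in 2-tensors: \<open>d \<otimes> id\<close> and \<open>id \<otimes> d\<close> on 2-tensors.\<close>
definition on_left :: "('a \<Rightarrow> 'a list \<Rightarrow>\<^sub>0 'r::comm_ring_1) \<Rightarrow> ('a list \<Rightarrow>\<^sub>0 'r) \<Rightarrow> 'a list \<Rightarrow>\<^sub>0 'r" where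
  "on_left d = lin (\<lambda>xs. d (xs ! 0) * basis [xs ! 1])"

definition on_right :: "('a \<Rightarrow> 'a list \<Rightarrow>\<^sub>0 'r::comm_ring_1) \<Rightarrow> ('a list \<Rightarrow>\<^sub>0 'r) \<Rightarrow> 'a list \<Rightarrow>\<^sub>0 'r" where
  "on_right d = lin (\<lambda>xs. basis [xs ! 0] * d (xs ! 1))"

definition flip :: "('a list \<Rightarrow>\<^sub>0 'r::comm_ring_1) \<Rightarrow> 'a list \<Rightarrow>\<^sub>0 'r" where
  "flip = lin (\<lambda>xs. basis (rev xs))"

definition cyc :: "('a list \<Rightarrow>\<^sub>0 'r::comm_ring_1) \<Rightarrow> 'a list \<Rightarrow>\<^sub>0 'r" where
  "cyc = lin (\<lambda>xs. basis (rotate1 xs))"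

definition swap23 :: "('a list \<Rightarrow>\<^sub>0 'r::comm_ring_1) \<Rightarrow> 'a list \<Rightarrow>\<^sub>0 'r" where
  "swap23 = lin (\<lambda>xs. basis [xs ! 0, xs ! 2, xs ! 1])"

definition wedge :: "'a \<Rightarrow> 'a \<Rightarrow> 'a list \<Rightarrow>\<^sub>0 'r::comm_ring_1" where
  "wedge x y = basis [x, y] - basis [y, x]"

definition tensor_linear :: "nat \<Rightarrow> ('r::comm_ring_1, 'a, 'm) module_scheme \<Rightarrow> ('a \<Rightarrow> 'a list \<Rightarrow>\<^sub>0 'r) \<Rightarrow> bool"
  where "tensor_linear n M d \<longleftrightarrow> (\<forall>x\<in>carrier M. d x \<in> ftens n M) \<and>
    (\<forall>x\<in>carrier M. \<forall>y\<in>carrier M. teq M (d (x \<oplus>\<^bsub>M\<^esub> y)) (d x + d y)) \<and>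
    (\<forall>c. \<forall>x\<in>carrier M. teq M (d (c \<odot>\<^bsub>M\<^esub> x)) (scale c (d x)))"


section \<open>Hopf algebras\<close>

record (overloaded) ('r, 'a) hopf = "('r, 'a) module" +
  comult :: "'a \<Rightarrow> 'a list \<Rightarrow>\<^sub>0 'r"
  counit :: "'a \<Rightarrow> 'r"
  antipode :: "'a \<Rightarrow> 'a"

definition hopf_algebra :: "('r::comm_ring_1, 'a) hopf \<Rightarrow> bool" where
  "hopf_algebra A \<longleftrightarrow> assoc_algebra A \<and>
    tensor_linear 2 A (comult A) \<and>
    (\<forall>x\<in>carrier A. \<forall>y\<in>carrier A. teq A (comult A (x \<otimes>\<^bsub>A\<^esub> y)) (tmult A (comult A x) (comult A y))) \<and>
    teq A (comult A \<one>\<^bsub>A\<^esub>) (basis [\<one>\<^bsub>A\<^esub>, \<one>\<^bsub>A\<^esub>]) \<and>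
    (\<forall>x\<in>carrier A. \<forall>y\<in>carrier A. counit A (x \<oplus>\<^bsub>A\<^esub> y) = counit A x + counit A y) \<and>
    (\<forall>c. \<forall>x\<in>carrier A. counit A (c \<odot>\<^bsub>A\<^esub> x) = c * counit A x) \<and>
    (\<forall>x\<in>carrier A. \<forall>y\<in>carrier A. counit A (x \<otimes>\<^bsub>A\<^esub> y) = counit A x * counit A y) \<and>
    counit A \<one>\<^bsub>A\<^esub> = 1 \<and>
    linear_on A A (antipode A) \<and>
    (\<forall>x\<in>carrier A.
       teq A (on_left (comult A) (comult A x)) (on_right (comult A) (comult A x)) \<and>
       contract A (\<lambda>xs. counit A (xs ! 0) \<odot>\<^bsub>A\<^esub> (xs ! 1)) (comult A x) = x \<and>
       contract A (\<lambda>xs. counit A (xs ! 1) \<odot>\<^bsub>A\<^esub> (xs ! 0)) (comult A x) = x \<and>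
       contract A (\<lambda>xs. antipode A (xs ! 0) \<otimes>\<^bsub>A\<^esub> (xs ! 1)) (comult A x) = counit A x \<odot>\<^bsub>A\<^esub> \<one>\<^bsub>A\<^esub> \<and>
       contract A (\<lambda>xs. (xs ! 0) \<otimes>\<^bsub>A\<^esub> antipode A (xs ! 1)) (comult A x) = counit A x \<odot>\<^bsub>A\<^esub> \<one>\<^bsub>A\<^esub>)"

definition algebra_hom :: "('r::comm_ring_1, 'a, 'm) module_scheme \<Rightarrow> ('r, 'b, 'n) module_scheme \<Rightarrow>
    ('a \<Rightarrow> 'b) \<Rightarrow> bool" where
  "algebra_hom A B h \<longleftrightarrow> h \<in> ring_hom A B \<and> linear_on A B h"

definition hopf_iso :: "('r::comm_ring_1, 'a) hopf \<Rightarrow> ('r, 'b) hopf \<Rightarrow> ('a \<Rightarrow> 'b) \<Rightarrow> bool" where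
  "hopf_iso A B h \<longleftrightarrow> algebra_hom A B h \<and> bij_betw h (carrier A) (carrier B) \<and>
    (\<forall>x\<in>carrier A. teq B (push id h (comult A x)) (comult B (h x)) \<and>
       counit B (h x) = counit A x \<and> h (antipode A x) = antipode B (h x))"

text \<open>
  The Hopf structure on the free algebra on \<open>V\<close> with \<open>\<Delta>\<close> multiplicative and given by \<open>D\<close> on the
  generators, the generators in the kernel of the counit, and the antipode antimultiplicative and
  given by \<open>s\<close> on the generators.
\<close>
definition free_hopf :: "'x set \<Rightarrow> ('x \<Rightarrow> ('x list \<Rightarrow>\<^sub>0 'r) list \<Rightarrow>\<^sub>0 'r) \<Rightarrow> ('x \<Rightarrow> 'x list \<Rightarrow>\<^sub>0 'r) \<Rightarrow>
    ('r::comm_ring_1, 'x list \<Rightarrow>\<^sub>0 'r) hopf" where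
  "free_hopf V D s = module.extend (free_alg V)
     (hopf.fields
        (lin (\<lambda>w. foldr (tmult (free_alg V)) (map D w) (basis [1, 1])))
        (\<lambda>f. coef f [])
        (lin (\<lambda>w. prod_list (map s (rev w)))))"

definition prim_tensor :: "('r, 'a, 'm) module_scheme \<Rightarrow> 'a \<Rightarrow> 'a list \<Rightarrow>\<^sub>0 'r::comm_ring_1" where
  "prim_tensor A x = basis [x, \<one>\<^bsub>A\<^esub>] + basis [\<one>\<^bsub>A\<^esub>, x]"

text \<open>
  Quotients by an ideal \<open>I\<close>, with a change of scalars: \<open>\<rho>\<close> is a surjective ring homomorphism with
  section \<open>\<sigma>\<close>, whose kernel is absorbed by \<open>I\<close>.  Both are the identity for an ordinary quotient.
  \<^const>\<open>FactRing\<close> does not need the product of \<open>A\<close> to be associative; below it is also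
  applied to a nonassociative algebra.
\<close>
definition quot_module :: "('s \<Rightarrow> 'r) \<Rightarrow> ('r, 'a, 'm) module_scheme \<Rightarrow> 'a set \<Rightarrow> ('s, 'a set) module" where
  "quot_module \<sigma> A I = ring.extend (A Quot I)
     (module.fields (\<lambda>c Y. \<Union>y\<in>Y. I +>\<^bsub>A\<^esub> (\<sigma> c \<odot>\<^bsub>A\<^esub> y)))"

definition quot_hopf :: "('s \<Rightarrow> 'r) \<Rightarrow> ('r \<Rightarrow> 's) \<Rightarrow> ('r::comm_ring_1, 'a) hopf \<Rightarrow> 'a set \<Rightarrow>
    ('s::comm_ring_1, 'a set) hopf" where
  "quot_hopf \<sigma> \<rho> A I = module.extend (quot_module \<sigma> A I)
     (hopf.fields
        (\<lambda>Y. push \<rho> (\<lambda>y. I +>\<^bsub>A\<^esub> y) (comult A (SOME y. y \<in> Y)))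
        (\<lambda>Y. \<rho> (counit A (SOME y. y \<in> Y)))
        (\<lambda>Y. I +>\<^bsub>A\<^esub> antipode A (SOME y. y \<in> Y)))"


section \<open>Lie algebras and enveloping algebras\<close>

text \<open>
  A Lie algebra is carried by the library's module record, with \<^const>\<open>monoid.mult\<close> as the bracket
  (\<^const>\<open>one\<close> is irrelevant).
\<close>
definition lie_algebra :: "('k::field, 'l, 'm) module_scheme \<Rightarrow> bool" where
  "lie_algebra L \<longleftrightarrow> module (ring_of_type_algebra :: 'k ring) L \<and>
    (\<forall>x\<in>carrier L. linear_on L L (\<lambda>y. x \<otimes>\<^bsub>L\<^esub> y) \<and> linear_on L L (\<lambda>y. y \<otimes>\<^bsub>L\<^esub> x) \<and>
       x \<otimes>\<^bsub>L\<^esub> x = \<zero>\<^bsub>L\<^esub>) \<and>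
    (\<forall>x\<in>carrier L. \<forall>y\<in>carrier L. \<forall>z\<in>carrier L.
       (x \<otimes>\<^bsub>L\<^esub> (y \<otimes>\<^bsub>L\<^esub> z)) \<oplus>\<^bsub>L\<^esub> (y \<otimes>\<^bsub>L\<^esub> (z \<otimes>\<^bsub>L\<^esub> x)) \<oplus>\<^bsub>L\<^esub> (z \<otimes>\<^bsub>L\<^esub> (x \<otimes>\<^bsub>L\<^esub> y)) = \<zero>\<^bsub>L\<^esub>)"

definition lie_iso :: "('k::field, 'l, 'm) module_scheme \<Rightarrow> ('k, 'l2, 'n) module_scheme \<Rightarrow> ('l \<Rightarrow> 'l2) \<Rightarrow> bool"
  where "lie_iso L M h \<longleftrightarrow> linear_on L M h \<and> bij_betw h (carrier L) (carrier M) \<and>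
    (\<forall>x\<in>carrier L. \<forall>y\<in>carrier L. h (x \<otimes>\<^bsub>L\<^esub> y) = h x \<otimes>\<^bsub>M\<^esub> h y)"

text \<open>The Lie algebra of primitive elements of a Hopf algebra, under the commutator.\<close>
definition primitive_lie :: "('k::field, 'a) hopf \<Rightarrow> ('k, 'a) module" where
  "primitive_lie A = \<lparr>carrier = {x \<in> carrier A. teq A (comult A x) (prim_tensor A x)},
     monoid.mult = (\<lambda>x y. (x \<otimes>\<^bsub>A\<^esub> y) \<ominus>\<^bsub>A\<^esub> (y \<otimes>\<^bsub>A\<^esub> x)), one = \<one>\<^bsub>A\<^esub>,
     ring.zero = \<zero>\<^bsub>A\<^esub>, add = add A,
     module.smult = module.smult A\<rparr>"

text \<open>The enveloping algebra is the tensor algebra modulo the relations \<open>xy - yx - [x, y]\<close>; the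
  tensor algebra in turn is the free algebra on the set of elements of \<open>L\<close> modulo linearity.\<close>
definition env_rels :: "('k::field, 'l, 'm) module_scheme \<Rightarrow> ('l list \<Rightarrow>\<^sub>0 'k) set" where
  "env_rels L =
     {gen (x \<oplus>\<^bsub>L\<^esub> y) - gen x - gen y | x y. x \<in> carrier L \<and> y \<in> carrier L} \<union>
     {gen (c \<odot>\<^bsub>L\<^esub> x) - scale c (gen x) | c x. x \<in> carrier L} \<union>
     {gen x * gen y - gen y * gen x - gen (x \<otimes>\<^bsub>L\<^esub> y) | x y. x \<in> carrier L \<and> y \<in> carrier L}"

definition env_ideal :: "('k::field, 'l, 'm) module_scheme \<Rightarrow> ('l list \<Rightarrow>\<^sub>0 'k) set" where
  "env_ideal L = Idl\<^bsub>(free_alg (carrier L) :: ('k, _) module)\<^esub> (env_rels L)"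

definition env :: "('k::field, 'l, 'm) module_scheme \<Rightarrow> ('k, ('l list \<Rightarrow>\<^sub>0 'k) set) hopf" where
  "env L = quot_hopf id id
     (free_hopf (carrier L) (\<lambda>x. prim_tensor (free_alg (carrier L)) (gen x)) (\<lambda>x. - gen x))
     (env_ideal L)"

definition env_incl :: "('k::field, 'l, 'm) module_scheme \<Rightarrow> 'l \<Rightarrow> ('l list \<Rightarrow>\<^sub>0 'k) set" where
  "env_incl L x = env_ideal L +>\<^bsub>(free_alg (carrier L) :: ('k, _) module)\<^esub> gen x"

text \<open>The free Lie algebra is the free nonassociative algebra modulo the Lie axioms.\<close>

datatype 'x mag = Leaf 'x | Br "'x mag" "'x mag"

definition free_mag :: "'x set \<Rightarrow> ('k::field, 'x mag \<Rightarrow>\<^sub>0 'k) module" where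
  "free_mag V = \<lparr>carrier = {f. \<forall>t\<in>supp f. set_mag t \<subseteq> V},
     monoid.mult = (\<lambda>f g. lin (\<lambda>s. lin (\<lambda>t. basis (Br s t)) g) f), one = 0,
     ring.zero = 0, add = (+), module.smult = scale\<rparr>"

inductive_set lie_ideal :: "('k::field, 'a, 'm) module_scheme \<Rightarrow> 'a set"
  for A :: "('k, 'a, 'm) module_scheme" where
  zero: "\<zero>\<^bsub>A\<^esub> \<in> lie_ideal A"
| add: "f \<in> lie_ideal A \<Longrightarrow> g \<in> lie_ideal A \<Longrightarrow> f \<oplus>\<^bsub>A\<^esub> g \<in> lie_ideal A"
| smult: "f \<in> lie_ideal A \<Longrightarrow> c \<odot>\<^bsub>A\<^esub> f \<in> lie_ideal A"
| left: "f \<in> carrier A \<Longrightarrow> g \<in> lie_ideal A \<Longrightarrow> f \<otimes>\<^bsub>A\<^esub> g \<in> lie_ideal A"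
| right: "f \<in> lie_ideal A \<Longrightarrow> g \<in> carrier A \<Longrightarrow> f \<otimes>\<^bsub>A\<^esub> g \<in> lie_ideal A"
| alt: "f \<in> carrier A \<Longrightarrow> f \<otimes>\<^bsub>A\<^esub> f \<in> lie_ideal A"
| jacobi: "f \<in> carrier A \<Longrightarrow> g \<in> carrier A \<Longrightarrow> h \<in> carrier A \<Longrightarrow>
    (f \<otimes>\<^bsub>A\<^esub> (g \<otimes>\<^bsub>A\<^esub> h)) \<oplus>\<^bsub>A\<^esub> (g \<otimes>\<^bsub>A\<^esub> (h \<otimes>\<^bsub>A\<^esub> f)) \<oplus>\<^bsub>A\<^esub> (h \<otimes>\<^bsub>A\<^esub> (f \<otimes>\<^bsub>A\<^esub> g)) \<in> lie_ideal A"

definition free_lie :: "'x set \<Rightarrow> ('k::field, ('x mag \<Rightarrow>\<^sub>0 'k) set) module" where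
  "free_lie V = quot_module id (free_mag V) (lie_ideal (free_mag V))"

definition lie_gen :: "'x set \<Rightarrow> 'x \<Rightarrow> ('x mag \<Rightarrow>\<^sub>0 'k::field) set" where
  "lie_gen V x = lie_ideal (free_mag V) +>\<^bsub>(free_mag V :: ('k, _) module)\<^esub> basis (Leaf x)"


section \<open>Lie bialgebras and co-Poisson Hopf algebras\<close>

definition co_jacobi :: "('k::field, 'a, 'm) module_scheme \<Rightarrow> ('a \<Rightarrow> 'a list \<Rightarrow>\<^sub>0 'k) \<Rightarrow> 'a \<Rightarrow> bool" where
  "co_jacobi M \<delta> x \<longleftrightarrow> (let j = on_left \<delta> (\<delta> x) in teq M (j + cyc j + cyc (cyc j)) 0)"

definition cobracket :: "('k::field, 'a, 'm) module_scheme \<Rightarrow> ('a \<Rightarrow> 'a list \<Rightarrow>\<^sub>0 'k) \<Rightarrow> bool" where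
  "cobracket M \<delta> \<longleftrightarrow> tensor_linear 2 M \<delta> \<and>
     (\<forall>x\<in>carrier M. teq M (flip (\<delta> x)) (- \<delta> x) \<and> co_jacobi M \<delta> x)"

definition ad2 :: "('k::field, 'l, 'm) module_scheme \<Rightarrow> 'l \<Rightarrow> ('l list \<Rightarrow>\<^sub>0 'k) \<Rightarrow> 'l list \<Rightarrow>\<^sub>0 'k" where
  "ad2 L x = lin (\<lambda>ys. basis [x \<otimes>\<^bsub>L\<^esub> (ys ! 0), ys ! 1] + basis [ys ! 0, x \<otimes>\<^bsub>L\<^esub> (ys ! 1)])"

definition lie_bialgebra :: "('k::field, 'l, 'm) module_scheme \<Rightarrow> ('l \<Rightarrow> 'l list \<Rightarrow>\<^sub>0 'k) \<Rightarrow> bool" where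
  "lie_bialgebra L \<delta> \<longleftrightarrow> lie_algebra L \<and> cobracket L \<delta> \<and>
     (\<forall>x\<in>carrier L. \<forall>y\<in>carrier L. teq L (\<delta> (x \<otimes>\<^bsub>L\<^esub> y)) (ad2 L x (\<delta> y) - ad2 L y (\<delta> x)))"

definition copoisson_hopf :: "('k::field, 'a) hopf \<Rightarrow> ('a \<Rightarrow> 'a list \<Rightarrow>\<^sub>0 'k) \<Rightarrow> bool" where
  "copoisson_hopf A \<delta> \<longleftrightarrow> hopf_algebra A \<and>
     (\<forall>x\<in>carrier A. teq A (flip (comult A x)) (comult A x)) \<and>
     cobracket A \<delta> \<and>
     (\<forall>x\<in>carrier A. teq A (on_left (comult A) (\<delta> x))
        (on_right \<delta> (comult A x) + swap23 (on_left \<delta> (comult A x)))) \<and>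
     (\<forall>x\<in>carrier A. \<forall>y\<in>carrier A. teq A (\<delta> (x \<otimes>\<^bsub>A\<^esub> y))
        (tmult A (\<delta> x) (comult A y) + tmult A (comult A x) (\<delta> y)))"

definition same_tensors :: "('k::comm_ring_1, 'b, 'm) module_scheme \<Rightarrow> 'a set \<Rightarrow> ('a \<Rightarrow> 'b list \<Rightarrow>\<^sub>0 'k) \<Rightarrow>
    ('a \<Rightarrow> 'b list \<Rightarrow>\<^sub>0 'k) \<Rightarrow> bool" where
  "same_tensors M V d e \<longleftrightarrow> (\<forall>x\<in>V. teq M (d x) (e x))"


section \<open>Gradings\<close>

definition graded_module :: "('k::field, 'a, 'm) module_scheme \<Rightarrow> (nat \<Rightarrow> 'a set) \<Rightarrow> bool" where
  "graded_module A G \<longleftrightarrow> (\<forall>i. G i \<subseteq> carrier A \<and> mspan A (G i) = G i) \<and>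
     (\<forall>x\<in>carrier A. \<exists>!c. (\<forall>i. c i \<in> G i) \<and> finite {i. c i \<noteq> \<zero>\<^bsub>A\<^esub>} \<and>
        x = (\<Oplus>\<^bsub>A\<^esub>i\<in>{i. c i \<noteq> \<zero>\<^bsub>A\<^esub>}. c i))"

text \<open>A tensor of total degree \<open>m\<close>.\<close>
definition tensor_degree :: "('k::field, 'a, 'm) module_scheme \<Rightarrow> (nat \<Rightarrow> 'a set) \<Rightarrow> int \<Rightarrow> ('a list \<Rightarrow>\<^sub>0 'k) \<Rightarrow> bool"
  where "tensor_degree A G m f \<longleftrightarrow> (\<exists>g. teq A f g \<and>
     (\<forall>xs\<in>supp g. \<exists>ds. list_all2 (\<lambda>x d. x \<in> G d) xs ds \<and> int (sum_list ds) = m))"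

definition homogeneous :: "('k::field, 'a, 'm) module_scheme \<Rightarrow> (nat \<Rightarrow> 'a set) \<Rightarrow> int \<Rightarrow>
    ('a \<Rightarrow> 'a list \<Rightarrow>\<^sub>0 'k) \<Rightarrow> bool" where
  "homogeneous A G s d \<longleftrightarrow> (\<forall>i. \<forall>x\<in>G i. tensor_degree A G (int i + s) (d x))"

definition graded_hopf :: "('k::field, 'a) hopf \<Rightarrow> (nat \<Rightarrow> 'a set) \<Rightarrow> bool" where
  "graded_hopf A G \<longleftrightarrow> hopf_algebra A \<and> graded_module A G \<and>
     (\<forall>i j. \<forall>x\<in>G i. \<forall>y\<in>G j. x \<otimes>\<^bsub>A\<^esub> y \<in> G (i + j)) \<and> \<one>\<^bsub>A\<^esub> \<in> G 0 \<and>
     homogeneous A G 0 (comult A) \<and>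
     (\<forall>i. \<forall>x\<in>G i. (i \<noteq> 0 \<longrightarrow> counit A x = 0) \<and> antipode A x \<in> G i)"

definition graded_copoisson_hopf :: "('k::field, 'a) hopf \<Rightarrow> ('a \<Rightarrow> 'a list \<Rightarrow>\<^sub>0 'k) \<Rightarrow> (nat \<Rightarrow> 'a set) \<Rightarrow>
    int \<Rightarrow> bool" where
  "graded_copoisson_hopf A \<delta> G s \<longleftrightarrow> copoisson_hopf A \<delta> \<and> graded_hopf A G \<and> homogeneous A G s \<delta>"

definition graded_lie_bialgebra :: "('k::field, 'l, 'm) module_scheme \<Rightarrow> ('l \<Rightarrow> 'l list \<Rightarrow>\<^sub>0 'k) \<Rightarrow>
    (nat \<Rightarrow> 'l set) \<Rightarrow> bool" where
  "graded_lie_bialgebra L \<delta> G \<longleftrightarrow> lie_bialgebra L \<delta> \<and> graded_module L G \<and>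
     (\<forall>i j. \<forall>x\<in>G i. \<forall>y\<in>G j. x \<otimes>\<^bsub>L\<^esub> y \<in> G (i + j)) \<and> homogeneous L G 0 \<delta>"

text \<open>Gradings of an algebra, respectively of a Lie algebra, determined by the degrees \<open>wt\<close> of
  generators \<open>x n\<close>, for \<open>n \<in> N\<close>.\<close>
definition alg_grading :: "('k::field, 'a, 'm) module_scheme \<Rightarrow> 'n set \<Rightarrow> ('n \<Rightarrow> 'a) \<Rightarrow> ('n \<Rightarrow> nat) \<Rightarrow>
    nat \<Rightarrow> 'a set" where
  "alg_grading A N x wt i =
     mspan A {foldr (monoid.mult A) (map x w) \<one>\<^bsub>A\<^esub> | w. set w \<subseteq> N \<and> sum_list (map wt w) = i}"

primrec mag_eval :: "('a \<Rightarrow> 'a \<Rightarrow> 'a) \<Rightarrow> ('x \<Rightarrow> 'a) \<Rightarrow> 'x mag \<Rightarrow> 'a" where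
  "mag_eval br x (Leaf n) = x n"
| "mag_eval br x (Br s t) = br (mag_eval br x s) (mag_eval br x t)"

definition lie_grading :: "('k::field, 'l, 'm) module_scheme \<Rightarrow> 'n set \<Rightarrow> ('n \<Rightarrow> 'l) \<Rightarrow> ('n \<Rightarrow> nat) \<Rightarrow>
    nat \<Rightarrow> 'l set" where
  "lie_grading L N x wt i =
     mspan L {mag_eval (monoid.mult L) x t | t. set_mag t \<subseteq> N \<and> mag_eval (+) wt t = i}"


section \<open>Quantization\<close>

definition hbar :: "'k::field poly" where "hbar = [:0, 1:]"

definition hbar_ideal :: "('k::field poly, 'a, 'm) module_scheme \<Rightarrow> 'a set" where
  "hbar_ideal A = (\<lambda>y. hbar \<odot>\<^bsub>A\<^esub> y) ` carrier A"

abbreviation mod_hbar :: "('k::field poly, 'a, 'm) module_scheme \<Rightarrow> 'a \<Rightarrow> 'a set" where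
  "mod_hbar A y \<equiv> hbar_ideal A +>\<^bsub>A\<^esub> y"

definition specialize :: "('k::field poly, 'a) hopf \<Rightarrow> ('k, 'a set) hopf" where
  "specialize A = quot_hopf (\<lambda>c. [:c:]) (\<lambda>p. poly p 0) A (hbar_ideal A)"

definition quantized_env :: "('k::field poly, 'a) hopf \<Rightarrow> ('k, 'l) module \<Rightarrow>
    ('a set \<Rightarrow> ('l list \<Rightarrow>\<^sub>0 'k) set) \<Rightarrow> bool" where
  "quantized_env A L \<phi> \<longleftrightarrow> hopf_algebra A \<and> lie_algebra L \<and> hopf_iso (specialize A) (env L) \<phi>"

text \<open>\<open>\<delta> (y mod \<hbar>) = \<hbar>\<^sup>-\<^sup>1 (\<Delta> y - \<Delta>\<^sup>o\<^sup>p y) mod \<hbar>\<close>, including that \<open>\<Delta> y - \<Delta>\<^sup>o\<^sup>p y\<close> is divisible by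
  \<open>\<hbar>\<close> and that the choice of the quotient \<open>g\<close> does not matter.\<close>
definition semiclassical_cobracket :: "('k::field poly, 'a) hopf \<Rightarrow> ('a set \<Rightarrow> 'a set list \<Rightarrow>\<^sub>0 'k) \<Rightarrow> bool"
  where "semiclassical_cobracket A \<delta> \<longleftrightarrow> (\<forall>y\<in>carrier A.
     (\<exists>g\<in>ftens 2 A. teq A (scale hbar g) (comult A y - flip (comult A y))) \<and>
     (\<forall>g\<in>ftens 2 A. teq A (scale hbar g) (comult A y - flip (comult A y)) \<longrightarrow>
        teq (specialize A) (\<delta> (mod_hbar A y)) (push (\<lambda>p. poly p 0) (mod_hbar A) g)))"

text \<open>\<open>A\<close> is a Hopf algebra over \<open>k[\<hbar>]\<close> whose structure is the restriction of that of the Hopf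
  algebra \<open>B\<close> over \<open>k(\<hbar>)\<close>.\<close>
definition restricts :: "('k::field poly, 'a) hopf \<Rightarrow> ('k poly fract, 'a) hopf \<Rightarrow> bool" where
  "restricts A B \<longleftrightarrow> carrier A \<subseteq> carrier B \<and> monoid.mult A = monoid.mult B \<and> one A = one B \<and> ring.zero A = ring.zero B \<and>
     add A = add B \<and> (\<forall>p y. p \<odot>\<^bsub>A\<^esub> y = to_fract p \<odot>\<^bsub>B\<^esub> y) \<and>
     (\<forall>y\<in>carrier A. comult A y \<in> ftens 2 A \<and> teq B (push to_fract id (comult A y)) (comult B y) \<and>
        to_fract (counit A y) = counit B y \<and> antipode A y = antipode B y)"


section \<open>The Hopf algebra \<open>H\<close> and its Rees algebra\<close>

definition index_set :: "enat \<Rightarrow> nat set" where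
  "index_set \<nu> = {n. 1 \<le> n \<and> enat n \<le> \<nu>}"

definition P_poly :: "nat \<Rightarrow> nat \<Rightarrow> nat list \<Rightarrow>\<^sub>0 'r::comm_ring_1" where
  "P_poly k t = (\<Sum>js\<in>{js. length js = k \<and> (\<forall>j\<in>set js. 0 < j) \<and> sum_list js = t}. prod_list (map gen js))"

definition Q_poly :: "nat \<Rightarrow> nat \<Rightarrow> nat list \<Rightarrow>\<^sub>0 'r::comm_ring_1" where
  "Q_poly l t = (\<Sum>k=1..t. of_nat ((l + 1) choose k) * P_poly k t)"

definition H_comult_gen :: "nat \<Rightarrow> (nat list \<Rightarrow>\<^sub>0 'r) list \<Rightarrow>\<^sub>0 'r::comm_ring_1" where
  "H_comult_gen n = basis [gen n, 1] + basis [1, gen n] +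
     (\<Sum>m\<in>{1..<n}. basis [gen m, Q_poly m (n - m)])"

fun H_antipode_gen :: "nat \<Rightarrow> nat list \<Rightarrow>\<^sub>0 'r::comm_ring_1" where
  "H_antipode_gen n = - gen n - (\<Sum>m\<in>{1..<n}. H_antipode_gen m * Q_poly m (n - m))"

declare H_antipode_gen.simps [simp del]

text \<open>As the structure constants are integers, the scalar extension to \<open>k(\<hbar>)\<close> of the Hopf
  algebra over \<open>k\<close> is the same definition with \<open>'r = 'k poly fract\<close>.\<close>
definition H_alg :: "enat \<Rightarrow> ('r::comm_ring_1, nat list \<Rightarrow>\<^sub>0 'r) hopf" where
  "H_alg \<nu> = free_hopf (index_set \<nu>) H_comult_gen H_antipode_gen"

definition aug_ideal :: "enat \<Rightarrow> (nat list \<Rightarrow>\<^sub>0 'k::field) set" where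
  "aug_ideal \<nu> = {f \<in> carrier (H_alg \<nu>). counit (H_alg \<nu>) f = 0}"

primrec aug_power :: "enat \<Rightarrow> nat \<Rightarrow> (nat list \<Rightarrow>\<^sub>0 'k::field) set" where
  "aug_power \<nu> 0 = carrier (H_alg \<nu>)"
| "aug_power \<nu> (Suc n) = ideal_prod (H_alg \<nu> :: ('k, _) hopf) (aug_ideal \<nu>) (aug_power \<nu> n)"

definition extend_scalars :: "('x \<Rightarrow>\<^sub>0 'k::field) \<Rightarrow> 'x \<Rightarrow>\<^sub>0 'k poly fract" where
  "extend_scalars f = Poly_Mapping.map (\<lambda>c. to_fract [:c:]) f"

definition hbar_inv_scale :: "nat \<Rightarrow> ('x \<Rightarrow>\<^sub>0 'k::field poly fract) \<Rightarrow> 'x \<Rightarrow>\<^sub>0 'k poly fract" where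
  "hbar_inv_scale n f = scale (inverse (to_fract hbar) ^ n) f"

definition H_poly_module :: "enat \<Rightarrow> ('k::field poly, nat list \<Rightarrow>\<^sub>0 'k poly fract) module" where
  "H_poly_module \<nu> = ring.extend (ring.truncate (H_alg \<nu> :: ('k poly fract, _) hopf))
     (module.fields (\<lambda>p. scale (to_fract p)))"

definition rees_set :: "enat \<Rightarrow> (nat list \<Rightarrow>\<^sub>0 'k::field poly fract) set" where
  "rees_set \<nu> = mspan (H_poly_module \<nu>) (\<Union>n. (\<lambda>j. hbar_inv_scale n (extend_scalars j)) ` aug_power \<nu> n)"

text \<open>The comultiplication takes values in 2-tensors over \<open>k[\<hbar>]\<close>, and is determined by its image
  in 2-tensors over \<open>k(\<hbar>)\<close>; similarly for the counit.\<close>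
definition rees :: "enat \<Rightarrow> ('k::field poly, nat list \<Rightarrow>\<^sub>0 'k poly fract) hopf" where
  "rees \<nu> = (let B = H_alg \<nu>; M = (H_poly_module \<nu>)\<lparr>carrier := rees_set \<nu>\<rparr> in
     module.extend M
       (hopf.fields
          (\<lambda>y. SOME f. f \<in> ftens 2 M \<and> teq B (push to_fract id f) (comult B y))
          (\<lambda>y. SOME p. to_fract p = counit B y)
          (antipode B)))"

definition rees_gen :: "nat \<Rightarrow> nat list \<Rightarrow>\<^sub>0 'k::field poly fract" where
  "rees_gen n = hbar_inv_scale 1 (gen n)"

end

(*
  For a scalar h let D_h be the coproduct on the free algebra on the x_n obtained from that of H by the
  substitution a_n = h x_n, divided by h.  It is polynomial in h: with E = 1 + h sum_u x_u, the second
  tensor factor next to x_m is the degree n - m part of E^(m+1), and coassociativity follows from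
  E^k E^l = E^(k+l).  Then h = 1 gives H, h = hbar gives its Rees algebra, whose elements are uniquely
  k[hbar]-combinations of words in hbar^(-1) a_n, and h = 0 makes the x_n primitive, that is, gives
  U(L_nu).  The cobracket is the linear term (D_hbar - D_hbar^op) / hbar modulo hbar; its co-Leibniz and
  co-Jacobi identities come from multiplicativity and coassociativity of D_hbar, cancelling powers of hbar.

  The free Lie algebra embeds in the free algebra by the theorem of Dynkin, Specht and Wever: right-normed
  bracketing of words is, up to the length, a left inverse of the canonical map.  Friedrichs' criterion
  identifies its image with the primitive elements for h = 0; by the co-Leibniz rule the
  cobracket maps it to its tensor square, since this holds for the generators x_n.

  H, its Rees algebra, the specialization, the free Lie algebra and its enveloping algebra all have
  injective coordinate maps into free modules, and identities between formal tensors are decided there.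
*)
theory Submission
  imports Defs "HOL-Library.Product_Plus" "HOL-Computational_Algebra.Formal_Power_Series"
begin

section \<open>Semilinear maps on free modules\<close>

text \<open>The binomial sums come from composing formal diffeomorphisms: with a(z) = z + sum a_n
  z^(n+1) and E = a(z)/z, the factor next to a_m is a coefficient of E^(m+1). Here the a_n do not
  commute, so coassociativity cannot be read off from composition over a commutative ring.

  The obstacle that shapes the proof is that coproducts and cobrackets are known only up to
  \<open>teq\<close>, and some are picked by \<open>SOME\<close>. To decide \<open>teq\<close>, a
  coordinate map must stay injective on tensor powers; therefore it comes with a linear retraction.
  For the free Lie algebra the retraction is right-normed bracketing divided by the length of the
  word, and this division calls for characteristic zero.

  The Hopf axioms are checked once, in a locale with the parameter h. The specialization and the
  enveloping algebra are both quotients by the kernel of a map onto the same free algebra, so their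
  isomorphism is the identity in coordinates.\<close>

lemma coef_scale [simp]: "coef (scale c f) w = c * coef f w"
  unfolding scale_def by (simp add: Poly_Mapping.map.rep_eq when_def)

lemma scale_simps [simp]:
  "scale 0 f = 0" "scale 1 f = f" "scale c 0 = 0" "scale c (scale d f) = scale (c * d) f"
  "scale c (Poly_Mapping.single w d) = Poly_Mapping.single w (c * d)"
  by (auto intro!: poly_mapping_eqI simp: algebra_simps lookup_single when_def)

lemma scale_linear:
  "scale c (f + g) = scale c f + scale c g" "scale (c + d) f = scale c f + scale d f"
  "scale c (- f) = - scale c f" "scale c (f - g) = scale c f - scale c g"
  "scale (- c) f = - scale c f" "scale (c - d) f = scale c f - scale d f"
  by (auto intro!: poly_mapping_eqI simp: algebra_simps lookup_add lookup_minus)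

lemma scale_sum: "scale c (sum h I) = (\<Sum>i\<in>I. scale c (h i))"
  by (induction I rule: infinite_finite_induct) (auto simp: scale_linear)

lemma scale_conv_mult: "scale c f = Poly_Mapping.single 0 c * f"
  by (simp add: scale_def mult_map_scale_conv_mult)

lemma pm_sum: "f = (\<Sum>w\<in>supp f. scale (coef f w) (basis w))"
  by (rule poly_mapping_eqI) (simp add: lookup_sum lookup_single when_def in_keys_iff)

text \<open>The changes of scalars in use are k to k[hbar], evaluation at 0 from k[hbar] to k, and
  k[hbar] to k(hbar). Linear maps are treated together with such a change, so that one set of lemmas
  serves lifting, reduction and the embedding of the Rees algebra.\<close>

definition rhom :: "('r::comm_ring_1 \<Rightarrow> 's::comm_ring_1) \<Rightarrow> bool" where
  "rhom \<rho> \<longleftrightarrow> \<rho> 0 = 0 \<and> \<rho> 1 = 1 \<and> (\<forall>a b. \<rho> (a + b) = \<rho> a + \<rho> b) \<and> (\<forall>a b. \<rho> (a * b) = \<rho> a * \<rho> b)"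

lemma rhom_id [simp]: "rhom id" "rhom (\<lambda>x. x)" by (simp_all add: rhom_def)

definition slin :: "('r::comm_ring_1 \<Rightarrow> 's::comm_ring_1) \<Rightarrow> ('x \<Rightarrow> 'y \<Rightarrow>\<^sub>0 's) \<Rightarrow> ('x \<Rightarrow>\<^sub>0 'r) \<Rightarrow> 'y \<Rightarrow>\<^sub>0 's" where
  "slin \<rho> h f = (\<Sum>w\<in>supp f. scale (\<rho> (coef f w)) (h w))"

definition semilin :: "('r::comm_ring_1 \<Rightarrow> 's::comm_ring_1) \<Rightarrow> (('x \<Rightarrow>\<^sub>0 'r) \<Rightarrow> 'y \<Rightarrow>\<^sub>0 's) \<Rightarrow> bool" where
  "semilin \<rho> F \<longleftrightarrow> (\<forall>f g. F (f + g) = F f + F g) \<and> (\<forall>c f. F (scale c f) = scale (\<rho> c) (F f))"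

lemma semilinD:
  assumes "semilin \<rho> F"
  shows semilin_add: "F (f + g) = F f + F g" and semilin_scale: "F (scale c f) = scale (\<rho> c) (F f)"
    and semilin_zero: "F 0 = 0" and semilin_minus: "F (- f) = - F f"
    and semilin_diff: "F (f - g) = F f - F g" and semilin_sum: "F (sum k I) = (\<Sum>i\<in>I. F (k i))"
proof -
  have a: "F (f + g) = F f + F g" for f g using assms by (auto simp: semilin_def)
  then show "F (f + g) = F f + F g" .
  show "F (scale c f) = scale (\<rho> c) (F f)" using assms by (auto simp: semilin_def)
  show z: "F 0 = 0" using a[of 0 0] by simp
  have m: "F (- f) = - F f" for f
    using a[of f "- f"] z by (simp add: eq_neg_iff_add_eq_0 add.commute)
  then show "F (- f) = - F f" .
  show "F (f - g) = F f - F g"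
    using a[of f "- g"] m by simp
  show "F (sum k I) = (\<Sum>i\<in>I. F (k i))"
    by (induction I rule: infinite_finite_induct) (auto simp: a z)
qed

lemma semilin_expand:
  assumes "semilin \<rho> F"
  shows "F f = (\<Sum>w\<in>supp f. scale (\<rho> (coef f w)) (F (basis w)))"
  by (subst pm_sum) (simp only: semilin_sum[OF assms] semilin_scale[OF assms])

lemma semilin_ext_on:
  assumes "semilin \<rho> F" "semilin \<rho> G" "\<And>w. w \<in> supp f \<Longrightarrow> F (basis w) = G (basis w)"
  shows "F f = G f"
  using assms(3) unfolding semilin_expand[OF assms(1), of f] semilin_expand[OF assms(2), of f]
  by (intro sum.cong) auto

lemma semilin_ext:
  assumes "semilin \<rho> F" "semilin \<rho> G" "\<And>w. F (basis w) = G (basis w)"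
  shows "F f = G f"
  by (rule semilin_ext_on[OF assms])

lemma slin_superset:
  assumes "\<rho> 0 = 0" "finite S" "supp f \<subseteq> S"
  shows "slin \<rho> h f = (\<Sum>w\<in>S. scale (\<rho> (coef f w)) (h w))"
  unfolding slin_def using assms by (intro sum.mono_neutral_left) (auto simp: in_keys_iff)

lemma semilin_slin [simp, intro]: assumes "rhom \<rho>" shows "semilin \<rho> (slin \<rho> h)"
proof -
  have z: "\<rho> 0 = 0" using assms by (simp add: rhom_def)
  have "slin \<rho> h (f + g) = slin \<rho> h f + slin \<rho> h g" for f g
    using assms slin_superset[where \<rho> = \<rho>, OF z, of "supp f \<union> supp g" f h] slin_superset[where \<rho> = \<rho>, OF z, of "supp f \<union> supp g" g h]
      slin_superset[where \<rho> = \<rho>, OF z, of "supp f \<union> supp g" "f + g" h] keys_add[of f g]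
    by (simp add: lookup_add rhom_def scale_linear sum.distrib)
  moreover have "slin \<rho> h (scale c f) = scale (\<rho> c) (slin \<rho> h f)" for c f
    using assms slin_superset[where \<rho> = \<rho>, OF z, of "supp f" f h] slin_superset[where \<rho> = \<rho>, OF z, of "supp f" "scale c f" h]
    by (force simp: rhom_def scale_sum in_keys_iff)
  ultimately show ?thesis by (simp add: semilin_def)
qed

lemma slin_single: "rhom \<rho> \<Longrightarrow> slin \<rho> h (Poly_Mapping.single w c) = scale (\<rho> c) (h w)"
  by (cases "c = 0") (auto simp: slin_def rhom_def)

lemma slin_basis [simp]: "rhom \<rho> \<Longrightarrow> slin \<rho> h (basis w) = h w"
  by (simp add: slin_single) (simp add: rhom_def)

lemma slin_cong: "(\<And>w. w \<in> supp f \<Longrightarrow> h w = k w) \<Longrightarrow> slin \<rho> h f = slin \<rho> k f"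
  unfolding slin_def by (intro sum.cong) auto

lemma lin_slin: "lin = slin id"
  by (auto simp: lin_def slin_def fun_eq_iff)

lemma lin_basis [simp]: "lin h (basis w) = h w"
  and semilin_lin [simp, intro]: "semilin id (lin h)"
  by (simp_all add: lin_slin)

lemma push_slin: "rhom \<rho> \<Longrightarrow> push \<rho> h = slin \<rho> (\<lambda>xs. basis (map h xs))"
  by (auto simp: push_def slin_def fun_eq_iff)

lemma semilin_id [simp, intro]: "semilin id (\<lambda>f. f)" "semilin id id"
  by (auto simp: semilin_def)

lemma semilin_lincomb [intro]:
  "semilin \<rho> F \<Longrightarrow> semilin \<rho> G \<Longrightarrow> semilin \<rho> (\<lambda>f. F f + G f)"
  "semilin \<rho> F \<Longrightarrow> semilin \<rho> G \<Longrightarrow> semilin \<rho> (\<lambda>f. F f - G f)"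
  "semilin \<rho> F \<Longrightarrow> semilin \<rho> (\<lambda>f. - F f)"
  "semilin \<rho> F \<Longrightarrow> semilin \<rho> (\<lambda>f. scale c (F f))"
  "semilin \<rho> (\<lambda>f. 0)"
  by (auto simp: semilin_def scale_linear algebra_simps)

lemma semilin_comp1: "semilin \<rho> F \<Longrightarrow> semilin id G \<Longrightarrow> semilin \<rho> (\<lambda>f. G (F f))"
  by (auto simp: semilin_def)

lemma semilin_comp2: "semilin id F \<Longrightarrow> semilin \<rho> G \<Longrightarrow> semilin \<rho> (\<lambda>f. G (F f))"
  by (auto simp: semilin_def)

text \<open>Scaling is left convolution with a multiple of the unit, so the first identity is
  associativity. The second says that scalars are central although the monoid need not be
  commutative; by linearity it is checked on basis elements.\<close>

lemma scale_mult [simp]: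
  fixes f g :: "'x::monoid_add \<Rightarrow>\<^sub>0 'r::comm_ring_1"
  shows "scale c f * g = scale c (f * g)" "f * scale c g = scale c (f * g)"
proof -
  show "scale c f * g = scale c (f * g)"
    by (simp add: scale_conv_mult mult.assoc)
  have "semilin id (\<lambda>f. f * scale c g)" "semilin id (\<lambda>f. scale c (f * g))"
    by (auto simp: semilin_def scale_conv_mult algebra_simps mult_single simp flip: mult.assoc)
  then show "f * scale c g = scale c (f * g)"
  proof (rule semilin_ext)
    fix w
    have "semilin id (\<lambda>g. basis w * scale c g)" "semilin id (\<lambda>g. scale c (basis w * g :: 'x \<Rightarrow>\<^sub>0 'r))"
      by (auto simp: semilin_def scale_conv_mult algebra_simps mult_single simp flip: mult.assoc)
    then show "basis w * scale c g = scale c (basis w * g)"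
      by (rule semilin_ext) (simp add: mult_single)
  qed
qed

lemma semilin_mult [intro]:
  fixes a :: "'x::monoid_add \<Rightarrow>\<^sub>0 'r::comm_ring_1"
  shows "semilin \<rho> F \<Longrightarrow> semilin \<rho> (\<lambda>f. a * F f)" "semilin \<rho> F \<Longrightarrow> semilin \<rho> (\<lambda>f. F f * a)"
  by (auto simp: semilin_def algebra_simps)

lemma basis_mult: "basis v * basis w = (basis (v + w) :: 'x::monoid_add \<Rightarrow>\<^sub>0 'r::comm_ring_1)"
  by (simp add: mult_single)

lemma basis_zero: "basis 0 = (1 :: 'x::monoid_add \<Rightarrow>\<^sub>0 'r::comm_ring_1)"
  by simp

lemma one_list: "(1 :: 'x list \<Rightarrow>\<^sub>0 'r::comm_ring_1) = basis []"
  by (simp flip: basis_zero add: zero_list_def)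

lemma basis_Cons: "(basis (x # w) :: 'x list \<Rightarrow>\<^sub>0 'r::comm_ring_1) = gen x * basis w"
  by (simp add: gen_def basis_mult plus_list_def)

lemma basis_append: "(basis (v @ w) :: 'x list \<Rightarrow>\<^sub>0 'r::comm_ring_1) = basis v * basis w"
  by (simp add: basis_mult plus_list_def)

subsection \<open>Ring homomorphisms\<close>

definition ringmap :: "('r::comm_ring_1 \<Rightarrow> 's::comm_ring_1) \<Rightarrow> (('x::monoid_add \<Rightarrow>\<^sub>0 'r) \<Rightarrow> 'y::monoid_add \<Rightarrow>\<^sub>0 's) \<Rightarrow> bool" where
  "ringmap \<rho> F \<longleftrightarrow> semilin \<rho> F \<and> F 1 = 1 \<and> (\<forall>f g. F (f * g) = F f * F g)"

lemma ringmapD: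
  assumes "ringmap \<rho> F"
  shows "semilin \<rho> F" "F 1 = 1" "F (f * g) = F f * F g"
  using assms by (auto simp: ringmap_def)

lemma ringmap_id [simp]: "ringmap id (\<lambda>f. f)" "ringmap id id" by (auto simp: ringmap_def)

lemma ringmap_comp1: "ringmap \<rho> F \<Longrightarrow> ringmap id G \<Longrightarrow> ringmap \<rho> (\<lambda>f. G (F f))"
  by (auto simp: ringmap_def intro: semilin_comp1)

lemma ringmap_comp2: "ringmap id F \<Longrightarrow> ringmap \<rho> G \<Longrightarrow> ringmap \<rho> (\<lambda>f. G (F f))"
  by (auto simp: ringmap_def intro: semilin_comp2)

lemma ringmap_ext_on:
  assumes F: "ringmap \<rho> F" and G: "ringmap \<rho> G"
    and V: "\<And>w. w \<in> supp f \<Longrightarrow> set w \<subseteq> V" and eq: "\<And>x. x \<in> V \<Longrightarrow> F (gen x) = G (gen x)"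
  shows "F f = G f"
proof (rule semilin_ext_on[OF ringmapD(1)[OF F] ringmapD(1)[OF G]])
  fix w assume "w \<in> supp f"
  then have "set w \<subseteq> V" by (rule V)
  then show "F (basis w) = G (basis w)"
    by (induction w) (auto simp: basis_Cons eq ringmapD[OF F] ringmapD[OF G] simp flip: one_list)
qed

lemma ringmap_ext:
  assumes "ringmap \<rho> F" "ringmap \<rho> G" "\<And>x. F (gen x) = G (gen x)"
  shows "F f = G f"
  by (rule ringmap_ext_on[OF assms(1,2), where V = UNIV]) (auto simp: assms(3))

lemma ringmap_by_basis:
  assumes "semilin \<rho> F" "F 1 = 1" "\<And>v w. F (basis (v + w)) = F (basis v) * F (basis w)"
  shows "ringmap \<rho> F"
proof -
  have "F (f * g) = F f * F g" for f g
  proof (rule semilin_ext[of \<rho> "\<lambda>f. F (f * g)" "\<lambda>f. F f * F g"])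
    fix v show "F (basis v * g) = F (basis v) * F g"
      by (rule semilin_ext[of \<rho> "\<lambda>g. F (basis v * g)" "\<lambda>g. F (basis v) * F g"])
        (auto intro!: semilin_comp2[OF _ assms(1)] assms(1) simp: basis_mult assms(3) simp del: mult_single)
  qed (auto intro!: semilin_comp2[OF _ assms(1)] assms(1))
  then show ?thesis using assms by (simp add: ringmap_def)
qed

text \<open>The universal property of the free algebra. The target is the algebra of any monoid,
  because a tensor product of free algebras is the algebra of a product of word monoids and has to
  be an admissible target for coproducts.\<close>

definition alg :: "('r::comm_ring_1 \<Rightarrow> 's::comm_ring_1) \<Rightarrow> ('x \<Rightarrow> 'y::monoid_add \<Rightarrow>\<^sub>0 's) \<Rightarrow> ('x list \<Rightarrow>\<^sub>0 'r) \<Rightarrow> 'y \<Rightarrow>\<^sub>0 's" where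
  "alg \<rho> s = slin \<rho> (\<lambda>w. prod_list (map s w))"

lemma alg_basis [simp]: "rhom \<rho> \<Longrightarrow> alg \<rho> s (basis w) = prod_list (map s w)"
  by (simp add: alg_def)

lemma ringmap_alg [simp, intro]: "rhom \<rho> \<Longrightarrow> ringmap \<rho> (alg \<rho> s)"
  by (rule ringmap_by_basis) (auto simp: plus_list_def one_list alg_def)

lemma alg_gen [simp]: "rhom \<rho> \<Longrightarrow> alg \<rho> s (gen x) = s x"
  by (simp add: gen_def)

definition antialg :: "('x \<Rightarrow> 'x list \<Rightarrow>\<^sub>0 'r) \<Rightarrow> ('x list \<Rightarrow>\<^sub>0 'r::comm_ring_1) \<Rightarrow> 'x list \<Rightarrow>\<^sub>0 'r" where
  "antialg s = lin (\<lambda>w. prod_list (map s (rev w)))"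

lemma semilin_antialg [simp, intro]: "semilin id (antialg s)"
  by (simp add: antialg_def)

lemma antialg_gen [simp]: "antialg s (gen x) = s x" and antialg_one [simp]: "antialg s 1 = 1"
  by (simp_all add: antialg_def gen_def) (simp add: one_list)

lemma antialg_mult: "antialg s (f * g) = antialg s g * antialg s f"
proof (rule semilin_ext[of id "\<lambda>f. antialg s (f * g)" "\<lambda>f. antialg s g * antialg s f"])
  fix v show "antialg s (basis v * g) = antialg s g * antialg s (basis v)"
  proof (rule semilin_ext[of id "\<lambda>g. antialg s (basis v * g)" "\<lambda>g. antialg s g * antialg s (basis v)"])
    show "antialg s (basis v * basis w) = antialg s (basis w) * antialg s (basis v)" for w
      by (simp add: antialg_def flip: basis_append)
  qed (auto intro!: semilin_comp2[OF _ semilin_antialg])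
qed (auto intro!: semilin_comp2[OF _ semilin_antialg])

subsection \<open>Tensor products of free modules\<close>

text \<open>The tensor product of two free modules is the free module on pairs. For monoids,
  componentwise addition of pairs makes the convolution product the usual product of a tensor
  product of algebras; this is \<open>ten_mult\<close>.\<close>

definition ten :: "('a \<Rightarrow>\<^sub>0 'r) \<Rightarrow> ('b \<Rightarrow>\<^sub>0 'r) \<Rightarrow> 'a \<times> 'b \<Rightarrow>\<^sub>0 'r::comm_ring_1" where
  "ten f g = lin (\<lambda>v. lin (\<lambda>w. basis (v, w)) g) f"

lemma ten_basis [simp]: "ten (basis v) (basis w) = basis (v, w)"
  by (simp add: ten_def)

lemma semilin_ten1: "semilin id (\<lambda>f. ten f g)"
  by (simp add: ten_def)

lemma ten_add1: "ten (f + f') g = ten f g + ten f' g"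
  and ten_scale1: "ten (scale c f) g = scale c (ten f g)"
  and ten_diff1: "ten (f - f') g = ten f g - ten f' g"
  and ten_minus1: "ten (- f) g = - ten f g" and ten_zero1: "ten 0 g = 0"
  and ten_sum1: "ten (sum k I) g = (\<Sum>i\<in>I. ten (k i) g)"
  using semilinD[OF semilin_ten1] by auto

lemma ten_add2: "ten f (g + g') = ten f g + ten f g'"
  and ten_scale2: "ten f (scale c g) = scale c (ten f g)"
proof -
  show "ten f (g + g') = ten f g + ten f g'"
    by (rule semilin_ext[of id "\<lambda>f. ten f (g + g')" "\<lambda>f. ten f g + ten f g'"])
      (auto intro!: semilin_ten1 semilin_lincomb simp: ten_def semilinD[OF semilin_lin])
  show "ten f (scale c g) = scale c (ten f g)"
    by (rule semilin_ext[of id "\<lambda>f. ten f (scale c g)" "\<lambda>f. scale c (ten f g)"])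
      (auto intro!: semilin_ten1 semilin_lincomb simp: ten_def semilinD[OF semilin_lin])
qed

lemma semilin_ten2: "semilin id (ten f)"
  by (simp add: semilin_def ten_add2 ten_scale2)

lemma ten_diff2: "ten f (g - g') = ten f g - ten f g'"
  and ten_minus2: "ten f (- g) = - ten f g" and ten_zero2: "ten f 0 = 0"
  and ten_sum2: "ten f (sum k I) = (\<Sum>i\<in>I. ten f (k i))"
  using semilinD[OF semilin_ten2] by auto

lemmas ten_linear = ten_add1 ten_add2 ten_scale1 ten_scale2 ten_diff1 ten_diff2 ten_minus1 ten_minus2
  ten_zero1 ten_zero2 ten_sum1 ten_sum2

lemma semilin_ten [intro]:
  "semilin \<rho> F \<Longrightarrow> semilin \<rho> (\<lambda>f. ten (F f) g)" "semilin \<rho> F \<Longrightarrow> semilin \<rho> (\<lambda>f. ten h (F f))"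
  by (auto simp: semilin_def ten_linear)

lemma ten_ext:
  assumes "semilin \<rho> F" "semilin \<rho> G" "\<And>v w. F (ten (basis v) (basis w)) = G (ten (basis v) (basis w))"
  shows "F f = G f"
proof (rule semilin_ext[OF assms(1,2)])
  fix p show "F (basis p) = G (basis p)"
    using assms(3)[of "fst p" "snd p"] by simp
qed

lemma bilin_ext:
  assumes "\<And>g. semilin \<rho> (\<lambda>f. F f g)" "\<And>g. semilin \<rho> (\<lambda>f. G f g)"
    "\<And>f. semilin \<rho> (F f)" "\<And>f. semilin \<rho> (G f)"
    "\<And>v w. F (basis v) (basis w) = G (basis v) (basis w)"
  shows "F f g = G f g"
  by (rule semilin_ext[of \<rho> "\<lambda>f. F f g" "\<lambda>f. G f g"], rule assms, rule assms, rule semilin_ext[of \<rho>])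
    (auto simp: assms)

lemma ten_mult:
  fixes f f' :: "'a::monoid_add \<Rightarrow>\<^sub>0 'r::comm_ring_1" and g g' :: "'b::monoid_add \<Rightarrow>\<^sub>0 'r"
  shows "ten f g * ten f' g' = ten (f * f') (g * g')"
proof (rule bilin_ext[of id "\<lambda>f g. ten f g * ten f' g'" "\<lambda>f g. ten (f * f') (g * g')"])
  fix v w
  show "ten (basis v) (basis w) * ten f' g' = ten (basis v * f') (basis w * g')"
    by (rule bilin_ext[of id "\<lambda>f' g'. ten (basis v) (basis w) * ten f' g'"
          "\<lambda>f' g'. ten (basis v * f') (basis w * g')"])
      (auto intro!: semilin_ten semilin_mult simp: basis_mult plus_prod_def simp del: mult_single)
qed (auto intro!: semilin_ten semilin_mult)

lemma ten_one [simp]: "ten 1 1 = (1 :: 'a::monoid_add \<times> 'b::monoid_add \<Rightarrow>\<^sub>0 'r::comm_ring_1)"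
  using ten_basis[of "0::'a" "0::'b", where ?'c = 'r] by (simp flip: zero_prod_def)

definition tmap :: "('r \<Rightarrow> 's) \<Rightarrow> (('a \<Rightarrow>\<^sub>0 'r::comm_ring_1) \<Rightarrow> 'c \<Rightarrow>\<^sub>0 's::comm_ring_1) \<Rightarrow>
    (('b \<Rightarrow>\<^sub>0 'r) \<Rightarrow> 'd \<Rightarrow>\<^sub>0 's) \<Rightarrow> ('a \<times> 'b \<Rightarrow>\<^sub>0 'r) \<Rightarrow> 'c \<times> 'd \<Rightarrow>\<^sub>0 's" where
  "tmap \<rho> F G = slin \<rho> (\<lambda>p. ten (F (basis (fst p))) (G (basis (snd p))))"

lemma semilin_tmap [simp, intro]: "rhom \<rho> \<Longrightarrow> semilin \<rho> (tmap \<rho> F G)"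
  by (simp add: tmap_def)

lemma tmap_ten:
  assumes "rhom \<rho>" "semilin \<rho> F" "semilin \<rho> G"
  shows "tmap \<rho> F G (ten f g) = ten (F f) (G g)"
  by (rule bilin_ext[of \<rho> "\<lambda>f g. tmap \<rho> F G (ten f g)" "\<lambda>f g. ten (F f) (G g)"])
    (use assms in \<open>auto simp: tmap_def intro!: semilin_ten semilin_ten1 semilin_ten2 semilin_comp2[OF _ semilin_slin]\<close>)

lemma ringmap_tmap:
  assumes "rhom \<rho>" "ringmap \<rho> F" "ringmap \<rho> G"
  shows "ringmap \<rho> (tmap \<rho> F G)"
proof (rule ringmap_by_basis)
  note [simp] = tmap_ten[OF assms(1) ringmapD(1)[OF assms(2)] ringmapD(1)[OF assms(3)]]
  show "tmap \<rho> F G 1 = 1"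
    unfolding ten_one[symmetric] by (simp only: tmap_ten[OF assms(1) ringmapD(1)[OF assms(2)] ringmapD(1)[OF assms(3)]]
        ringmapD[OF assms(2)] ringmapD[OF assms(3)])
  fix v w
  show "tmap \<rho> F G (basis (v + w)) = tmap \<rho> F G (basis v) * tmap \<rho> F G (basis w)"
    by (cases v; cases w)
      (simp add: plus_prod_def ten_mult ringmapD[OF assms(2)] ringmapD[OF assms(3)] flip: ten_basis basis_mult)
qed (use assms in auto)

definition tswap :: "('a \<times> 'b \<Rightarrow>\<^sub>0 'r) \<Rightarrow> 'b \<times> 'a \<Rightarrow>\<^sub>0 'r::comm_ring_1" where
  "tswap = lin (\<lambda>p. basis (prod.swap p))"

text \<open>Iterated tensor products are nested pairs, so the two bracketings of a threefold tensor
  have different types; right-nested triples are the normal form.\<close>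

definition tassoc :: "(('a \<times> 'b) \<times> 'c \<Rightarrow>\<^sub>0 'r) \<Rightarrow> 'a \<times> 'b \<times> 'c \<Rightarrow>\<^sub>0 'r::comm_ring_1" where
  "tassoc = lin (\<lambda>p. basis (fst (fst p), snd (fst p), snd p))"

lemma semilin_tswap [simp, intro]: "semilin id tswap" and semilin_tassoc [simp, intro]: "semilin id tassoc"
  by (simp_all add: tswap_def tassoc_def)

lemma tswap_ten [simp]: "tswap (ten f g) = ten g f"
  by (rule bilin_ext[of id "\<lambda>f g. tswap (ten f g)" "\<lambda>f g. ten g f"])
    (auto simp: tswap_def intro!: semilin_ten semilin_comp2[OF _ semilin_lin])

lemma tassoc_ten [simp]: "tassoc (ten (ten f g) h) = ten f (ten g h)"
proof (rule semilin_ext[of id "\<lambda>h. tassoc (ten (ten f g) h)" "\<lambda>h. ten f (ten g h)"])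
  fix u
  show "tassoc (ten (ten f g) (basis u)) = ten f (ten g (basis u))"
    by (rule bilin_ext[of id "\<lambda>f g. tassoc (ten (ten f g) (basis u))" "\<lambda>f g. ten f (ten g (basis u))"])
      (auto simp: tassoc_def intro!: semilin_ten semilin_comp2[OF _ semilin_lin])
qed (auto simp: tassoc_def intro!: semilin_ten semilin_comp2[OF _ semilin_lin])

lemma ringmap_tswap [simp]: "ringmap id (tswap :: ('a::monoid_add \<times> 'b::monoid_add \<Rightarrow>\<^sub>0 'r::comm_ring_1) \<Rightarrow> _)"
  by (rule ringmap_by_basis) (auto simp: tswap_def plus_prod_def zero_prod_def basis_mult simp flip: basis_zero simp del: mult_single)

lemma ringmap_tassoc [simp]:
  "ringmap id (tassoc :: (('a::monoid_add \<times> 'b::monoid_add) \<times> 'c::monoid_add \<Rightarrow>\<^sub>0 'r::comm_ring_1) \<Rightarrow> _)"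
  by (rule ringmap_by_basis) (auto simp: tassoc_def plus_prod_def zero_prod_def basis_mult simp flip: basis_zero simp del: mult_single)

subsection \<open>Supports\<close>

text \<open>The types admit all natural numbers as letters. That an element lies in the algebra on
  \<open>V\<close>, or is homogeneous of a given degree, is a condition on its support, and both are
  handled by this predicate.\<close>

definition supin :: "'x set \<Rightarrow> ('x \<Rightarrow>\<^sub>0 'r::comm_ring_1) \<Rightarrow> bool" where
  "supin W f \<longleftrightarrow> supp f \<subseteq> W"

lemma supin_coef: "supin W f \<longleftrightarrow> (\<forall>w. w \<notin> W \<longrightarrow> coef f w = 0)"
  by (auto simp: supin_def in_keys_iff)

lemma supin_basic [simp]:
  "supin W 0" "supin W f \<Longrightarrow> supin W g \<Longrightarrow> supin W (f + g)"
  "supin W f \<Longrightarrow> supin W g \<Longrightarrow> supin W (f - g)" "supin W f \<Longrightarrow> supin W (- f)"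
  "supin W f \<Longrightarrow> supin W (scale c f)" "w \<in> W \<Longrightarrow> supin W (Poly_Mapping.single w c)" "supin UNIV f"
  by (auto simp: supin_coef lookup_add lookup_minus lookup_single when_def)

lemma supin_mono: "supin A f \<Longrightarrow> A \<subseteq> B \<Longrightarrow> supin B f"
  by (auto simp: supin_def)

lemma supin_sum: "(\<And>i. i \<in> I \<Longrightarrow> supin W (k i)) \<Longrightarrow> supin W (sum k I)"
  by (induction I rule: infinite_finite_induct) auto

lemma supin_semilin:
  assumes "semilin \<rho> F" "supin A f" "\<And>w. w \<in> A \<Longrightarrow> supin B (F (basis w))"
  shows "supin B (F f)"
  unfolding semilin_expand[OF assms(1), of f] using assms(2,3) unfolding supin_def[of A]
  by (intro supin_sum supin_basic) auto

lemma supin_mult: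
  fixes f g :: "'x::monoid_add \<Rightarrow>\<^sub>0 'r::comm_ring_1"
  assumes "supin A f" "supin B g" "\<And>v w. v \<in> A \<Longrightarrow> w \<in> B \<Longrightarrow> v + w \<in> C"
  shows "supin C (f * g)"
proof -
  have "supin C (basis v * g)" if "v \<in> A" for v
    by (rule supin_semilin[OF semilin_mult(1)[OF semilin_id(1)] assms(2)])
      (use assms(3) that in \<open>auto simp: basis_mult simp del: mult_single\<close>)
  then show ?thesis
    by (rule supin_semilin[OF semilin_mult(2)[OF semilin_id(1)] assms(1)])
qed

lemma supin_ten:
  assumes "supin A f" "supin B g"
  shows "supin (A \<times> B) (ten f g)"
proof -
  have "supin (A \<times> B) (ten (basis v) g)" if "v \<in> A" for v
    by (rule supin_semilin[OF semilin_ten2 assms(2)]) (use that in auto)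
  then show ?thesis
    by (rule supin_semilin[OF semilin_ten1 assms(1)])
qed

lemma supin_lists_mult [simp]: "supin (lists V) f \<Longrightarrow> supin (lists V) g \<Longrightarrow> supin (lists V) (f * g)"
  by (erule supin_mult) (auto simp: plus_list_def)

lemma supin_lists_one [simp]: "[] \<in> W \<Longrightarrow> supin W 1" "[x] \<in> W \<Longrightarrow> supin W (gen x)"
  by (auto simp: one_list gen_def)

section \<open>The noncommutative Faa di Bruno bialgebra\<close>

text \<open>The parameter \<open>h\<close> rescales the generators: \<open>h = 1\<close> gives \<open>H\<close>, \<open>h = \<hbar>\<close> its Rees algebra,
  \<open>h = 0\<close> the enveloping algebra.  \<open>FB h k t\<close> is the degree \<open>t\<close> part of \<open>(1 + h \<Sum>\<^sub>u x\<^sub>u)\<^sup>k\<close>.\<close>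

definition FB_gf :: "'r \<Rightarrow> (nat list \<Rightarrow>\<^sub>0 'r::comm_ring_1) fps" where
  "FB_gf h = Abs_fps (\<lambda>u. if u = 0 then 1 else scale h (gen u))"

definition FB :: "'r \<Rightarrow> nat \<Rightarrow> nat \<Rightarrow> nat list \<Rightarrow>\<^sub>0 'r::comm_ring_1" where
  "FB h k t = fps_nth (FB_gf h ^ k) t"

lemma FB_simps [simp]:
  "FB h 0 t = (if t = 0 then 1 else 0)" "FB h (Suc 0) t = (if t = 0 then 1 else scale h (gen t))"
  "FB h k 0 = 1"
  by (simp_all add: FB_def FB_gf_def fps_nth_power_0)

lemma FB_add: "FB h (k + l) t = (\<Sum>u\<le>t. FB h k u * FB h l (t - u))"
  by (simp add: FB_def power_add fps_mult_nth atLeast0AtMost)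

lemma FB_zero: "FB 0 k t = (if t = 0 then 1 else 0)"
proof -
  have "FB_gf 0 = (1 :: (nat list \<Rightarrow>\<^sub>0 'a) fps)" by (rule fps_ext) (simp add: FB_gf_def)
  then show ?thesis by (simp add: FB_def)
qed

text \<open>A part of degree t has no letter beyond t. Hence the coproducts and antipodes of the
  generators with index at most nu stay within these letters.\<close>

lemma supin_FB: "supin (lists {1..t}) (FB h k t)"
proof (induction k arbitrary: t)
  case (Suc k)
  have "supin (lists {1..t}) (FB h 1 u * FB h k (t - u))" if "u \<le> t" for u
    using that by (intro supin_lists_mult supin_mono[OF Suc] lists_mono) auto
  then show ?case using FB_add[of h 1 k t] by (auto intro!: supin_sum)
qed simp

text \<open>The first two summands are the terms m = n and m = 0 of the sum over all m, where a_0 =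
  1. The term m = 0 is written separately because it has no factor x_m to absorb the division by h;
  in this form h = 0 is allowed.\<close>

definition dgen :: "'r \<Rightarrow> nat \<Rightarrow> nat list \<times> nat list \<Rightarrow>\<^sub>0 'r::comm_ring_1" where
  "dgen h n = ten (gen n) 1 + ten 1 (gen n) + (\<Sum>m\<in>{1..<n}. ten (gen m) (FB h (m + 1) (n - m)))"

definition Dl :: "'r \<Rightarrow> (nat list \<Rightarrow>\<^sub>0 'r::comm_ring_1) \<Rightarrow> nat list \<times> nat list \<Rightarrow>\<^sub>0 'r" where
  "Dl h = alg id (dgen h)"

lemma Dl_gen [simp]: "Dl h (gen n) = dgen h n" by (simp add: Dl_def)

lemma ringmap_Dl [simp, intro]: "ringmap id (Dl h)" and semilin_Dl [simp, intro]: "semilin id (Dl h)"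
  by (simp_all add: Dl_def ringmapD)

lemmas Dl_simps = ringmapD(2,3)[OF ringmap_Dl] semilinD[OF semilin_Dl]

text \<open>Multiplied by h, the two extra terms of \<open>dgen\<close> become the terms s = u and s
  = 0 of a uniform sum; this is the form with which \<open>Dl_FB\<close> can induct.\<close>

lemma Dl_FB1: "Dl h (FB h 1 u) = (\<Sum>s\<le>u. ten (FB h 1 s) (FB h (1 + s) (u - s)))"
proof (cases "u = 0")
  case False
  then have "{..u} = insert 0 (insert u {1..<u})" by auto
  moreover have "(\<Sum>s\<in>{1..<u}. ten (FB h 1 s) (FB h (1 + s) (u - s))) =
      (\<Sum>s\<in>{1..<u}. scale h (ten (gen s) (FB h (s + 1) (u - s))))"
    by (intro sum.cong) (auto simp: ten_linear)
  ultimately show ?thesis using False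
    by (simp add: Dl_simps dgen_def scale_linear scale_sum ten_linear)
qed (simp add: Dl_simps)

lemma Dl_FB: "Dl h (FB h k t) = (\<Sum>s\<le>t. ten (FB h k s) (FB h (k + s) (t - s)))"
proof (induction k arbitrary: t)
  case 0
  have "(\<Sum>s\<le>t. ten (FB h 0 s) (FB h (0 + s) (t - s))) = (\<Sum>s\<le>t. if s = 0 then ten 1 (FB h 0 t) else 0)"
    by (intro sum.cong) (auto simp: ten_linear)
  also have "\<dots> = ten 1 (FB h 0 t)" by simp
  finally show ?case by (simp add: Dl_simps ten_linear)
next
  case (Suc k)
  let ?g = "\<lambda>s s' v w. ten (FB h 1 s * FB h k s') (FB h (1 + s) v * FB h (k + s') w)"
  have "Dl h (FB h (1 + k) t) = (\<Sum>u\<le>t. \<Sum>s\<le>u. \<Sum>s'\<le>t-u. ?g s s' (u - s) (t - u - s'))"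
    unfolding FB_add Dl_simps Dl_FB1 Suc sum_product ten_mult ..
  also have "\<dots> = (\<Sum>(u,s,s')\<in>(SIGMA u:{..t}. {..u} \<times> {..t-u}). ?g s s' (u - s) (t - u - s'))"
    by (simp only: sum.cartesian_product, subst sum.Sigma, simp, simp, rule refl)
  \<comment> \<open>The substitution r = s + s', v = u - s makes r the degree of the first tensor
    factor. For fixed r and s the sum over v is then \<open>FB_add\<close> for the exponents 1 + s
    and k + (r - s), whose sum depends on r alone.\<close>
  also have "\<dots> = (\<Sum>(r,s,v)\<in>(SIGMA r:{..t}. {..r} \<times> {..t-r}). ?g s (r - s) v (t - r - v))"
    by (rule sum.reindex_bij_witness[of _ "\<lambda>(r,s,v). (s + v, s, r - s)" "\<lambda>(u,s,s'). (s + s', s, u - s)"])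
      (auto simp: algebra_simps)
  also have "\<dots> = (\<Sum>r\<le>t. \<Sum>s\<le>r. \<Sum>v\<le>t-r. ?g s (r - s) v (t - r - v))"
    by (simp only: sum.cartesian_product, subst sum.Sigma, simp, simp, rule refl)
  also have "\<dots> = (\<Sum>r\<le>t. ten (FB h (1 + k) r) (FB h (1 + k + r) (t - r)))"
  proof (rule sum.cong[OF refl])
    fix r
    have "ten (FB h 1 s * FB h k (r - s)) (FB h (1 + k + r) (t - r)) = (\<Sum>v\<le>t-r. ?g s (r - s) v (t - r - v))"
      if "s \<le> r" for s
    proof -
      have "1 + k + r = (1 + s) + (k + (r - s))" using that by simp
      then show ?thesis by (simp only: FB_add ten_sum2)
    qed
    then show "(\<Sum>s\<le>r. \<Sum>v\<le>t-r. ?g s (r - s) v (t - r - v)) = ten (FB h (1 + k) r) (FB h (1 + k + r) (t - r))"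
      by (simp only: FB_add[of h 1 k] ten_sum1) (auto intro!: sum.cong)
  qed
  finally show ?case by simp
qed

definition DlL :: "'r \<Rightarrow> (nat list \<times> nat list \<Rightarrow>\<^sub>0 'r::comm_ring_1) \<Rightarrow> nat list \<times> nat list \<times> nat list \<Rightarrow>\<^sub>0 'r" where
  "DlL h Z = tassoc (tmap id (Dl h) (\<lambda>x. x) Z)"

definition DlR :: "'r \<Rightarrow> (nat list \<times> nat list \<Rightarrow>\<^sub>0 'r::comm_ring_1) \<Rightarrow> nat list \<times> nat list \<times> nat list \<Rightarrow>\<^sub>0 'r" where
  "DlR h = tmap id (\<lambda>x. x) (Dl h)"

lemma ringmap_DlLR: "ringmap id (DlL h)" "ringmap id (DlR h)"
  unfolding DlL_def[abs_def] DlR_def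
  by (rule ringmap_comp1[OF ringmap_tmap ringmap_tassoc], auto)
    (rule ringmap_tmap, auto)

lemma DlLR_ten [simp]: "DlL h (ten f g) = tassoc (ten (Dl h f) g)" "DlR h (ten f g) = ten f (Dl h g)"
  by (simp_all add: DlL_def DlR_def tmap_ten)

lemmas DlLR_simps = semilinD[OF ringmapD(1)[OF ringmap_DlLR(1)]] semilinD[OF ringmapD(1)[OF ringmap_DlLR(2)]]

text \<open>On the right, \<open>Dl_FB\<close> with k = m + 1 expands the second factor. Its end
  terms s = 0 and s = n - m are the terms of L with a unit in the second or the third factor, and
  the remaining sum over (m, s) becomes the double sum of L when (m + s, m) is taken as its pair of
  indices.\<close>

lemma coassoc_gen: "DlL h (dgen h n) = DlR h (dgen h n)"
proof -
  let ?x = "\<lambda>m. gen m :: nat list \<Rightarrow>\<^sub>0 'a" and ?F = "\<lambda>m s. FB h (m + 1) s"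
  have L: "DlL h (dgen h n) = ten (?x n) 1 + ten 1 (ten (?x n) 1) + (\<Sum>m\<in>{1..<n}. ten (?x m) (ten (?F m (n - m)) 1))
     + ten 1 (ten 1 (?x n)) + (\<Sum>m\<in>{1..<n}. ten (?x m) (ten 1 (?F m (n - m)))) +
     (\<Sum>m\<in>{1..<n}. ten 1 (ten (?x m) (?F m (n - m)))) +
     (\<Sum>m\<in>{1..<n}. \<Sum>l\<in>{1..<m}. ten (?x l) (ten (?F l (m - l)) (?F m (n - m))))"
    by (simp add: dgen_def DlLR_simps ten_linear semilinD[OF semilin_tassoc] sum.distrib Dl_simps) (simp flip: ten_one)
  have R: "DlR h (dgen h n) = ten (?x n) 1 + ten 1 (ten (?x n) 1) + ten 1 (ten 1 (?x n)) +
     (\<Sum>m\<in>{1..<n}. ten 1 (ten (?x m) (?F m (n - m)))) +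
     (\<Sum>m\<in>{1..<n}. \<Sum>s\<le>n-m. ten (?x m) (ten (?F m s) (?F (m + s) (n - m - s))))"
    by (simp add: dgen_def DlLR_simps ten_linear Dl_FB Dl_simps add.commute add.left_commute)
  have "(\<Sum>m\<in>{1..<n}. \<Sum>s\<le>n-m. ten (?x m) (ten (?F m s) (?F (m + s) (n - m - s)))) =
    (\<Sum>m\<in>{1..<n}. ten (?x m) (ten 1 (?F m (n - m))) + ten (?x m) (ten (?F m (n - m)) 1) +
       (\<Sum>s\<in>{1..<n-m}. ten (?x m) (ten (?F m s) (?F (m + s) (n - m - s)))))"
  proof (rule sum.cong[OF refl])
    fix m assume "m \<in> {1..<n}"
    then have "{..n-m} = insert 0 (insert (n-m) {1..<n-m})" "n - m \<noteq> 0" by auto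
    then show "(\<Sum>s\<le>n-m. ten (?x m) (ten (?F m s) (?F (m + s) (n - m - s)))) =
      ten (?x m) (ten 1 (?F m (n - m))) + ten (?x m) (ten (?F m (n - m)) 1) +
       (\<Sum>s\<in>{1..<n-m}. ten (?x m) (ten (?F m s) (?F (m + s) (n - m - s))))"
      by simp
  qed
  moreover have "(\<Sum>m\<in>{1..<n}. \<Sum>s\<in>{1..<n-m}. ten (?x m) (ten (?F m s) (?F (m + s) (n - m - s)))) =
     (\<Sum>m\<in>{1..<n}. \<Sum>l\<in>{1..<m}. ten (?x l) (ten (?F l (m - l)) (?F m (n - m))))"
    unfolding sum.Sigma[OF finite_atLeastLessThan ballI[OF finite_atLeastLessThan]]
    by (rule sum.reindex_bij_witness[of _ "\<lambda>(m,l). (l, m - l)" "\<lambda>(m,s). (m + s, m)"]) auto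
  ultimately show ?thesis unfolding L R by (simp add: sum.distrib algebra_simps)
qed

lemma coassoc: "DlL h (Dl h f) = DlR h (Dl h f)"
  by (rule ringmap_ext[of id "\<lambda>f. DlL h (Dl h f)" "\<lambda>f. DlR h (Dl h f)"])
    (auto intro!: ringmap_comp1[OF ringmap_Dl] ringmap_DlLR simp: coassoc_gen)

subsection \<open>Counit and antipode\<close>

abbreviation eps :: "('x list \<Rightarrow>\<^sub>0 'r::comm_ring_1) \<Rightarrow> 'r" where "eps f \<equiv> coef f []"

text \<open>The counit with values in a free algebra instead of the scalars, so that it is an
  instance of \<open>alg\<close> and can be a factor of a convolution.\<close>

definition epsT :: "('x list \<Rightarrow>\<^sub>0 'r) \<Rightarrow> 'y list \<Rightarrow>\<^sub>0 'r::comm_ring_1" where "epsT f = scale (eps f) 1"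

lemma epsT_alg: "epsT = (alg id (\<lambda>_. 0) :: ('x list \<Rightarrow>\<^sub>0 'r::comm_ring_1) \<Rightarrow> 'y list \<Rightarrow>\<^sub>0 'r)"
proof
  fix f :: "'x list \<Rightarrow>\<^sub>0 'r"
  show "epsT f = (alg id (\<lambda>_. 0) f :: 'y list \<Rightarrow>\<^sub>0 'r)"
    unfolding epsT_def
  proof (rule semilin_ext[of id "\<lambda>f. scale (eps f) 1" "alg id (\<lambda>_. 0)"])
    show "scale (eps (basis w)) (1 :: 'y list \<Rightarrow>\<^sub>0 'r) = alg id (\<lambda>_. 0) (basis w)" for w :: "'x list"
      by (cases w) (auto simp: lookup_single when_def)
  qed (simp_all add: ringmapD, simp add: semilin_def lookup_add scale_linear)
qed

lemma eps_mult:
  fixes f g :: "'a list \<Rightarrow>\<^sub>0 'b::comm_ring_1"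
  shows "eps (f * g) = eps f * eps g"
proof -
  have "epsT (f * g) = (epsT f * epsT g :: 'a list \<Rightarrow>\<^sub>0 'b)"
    by (simp add: epsT_alg ringmapD(3)[OF ringmap_alg])
  then have "coef (epsT (f * g) :: 'a list \<Rightarrow>\<^sub>0 'b) [] = coef (epsT f * epsT g :: 'a list \<Rightarrow>\<^sub>0 'b) []"
    by simp
  then show ?thesis by (simp add: epsT_def) (simp add: one_list)
qed

lemma eps_simps [simp]: "eps 1 = (1 :: 'r::comm_ring_1)" "eps (gen x) = (0 :: 'r)"
  by (simp_all add: one_list gen_def lookup_single)

text \<open>The product map after A tensor B; applied to a coproduct it is the convolution of A and
  B.\<close>

definition conv2 :: "(('a \<Rightarrow>\<^sub>0 'r) \<Rightarrow> 'c::monoid_add \<Rightarrow>\<^sub>0 'r) \<Rightarrow> (('b \<Rightarrow>\<^sub>0 'r) \<Rightarrow> 'c \<Rightarrow>\<^sub>0 'r) \<Rightarrow>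
    ('a \<times> 'b \<Rightarrow>\<^sub>0 'r::comm_ring_1) \<Rightarrow> 'c \<Rightarrow>\<^sub>0 'r" where
  "conv2 A B = lin (\<lambda>p. A (basis (fst p)) * B (basis (snd p)))"

lemma semilin_conv2 [simp, intro]: "semilin id (conv2 A B)" by (simp add: conv2_def)

lemma semilin_conv2_Dl [simp, intro]: "semilin id (\<lambda>b. conv2 A B (Dl h b))"
  by (rule semilin_comp2[OF semilin_Dl semilin_conv2])

lemma conv2_ten: "semilin id A \<Longrightarrow> semilin id B \<Longrightarrow> conv2 A B (ten f g) = A f * B g"
  by (rule bilin_ext[of id "\<lambda>f g. conv2 A B (ten f g)" "\<lambda>f g. A f * B g"])
    (auto simp: conv2_def intro!: semilin_mult semilin_ten1 semilin_ten2 semilin_comp2[OF _ semilin_lin])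

lemma ringmap_epsT [simp]: "ringmap id epsT" and semilin_epsT [simp, intro]: "semilin id epsT"
  by (simp_all add: epsT_alg ringmapD)

lemma epsT_simps [simp]: "epsT 1 = 1" "epsT (gen x) = 0"
  by (auto simp: epsT_def)

text \<open>Multiplicativity rests on the images of A and B commuting. This covers the counit
  axioms, where one factor has scalar values, but not those of the antipode, which is
  antimultiplicative; these are proved by induction on words.\<close>

lemma ringmap_conv2:
  assumes A: "ringmap id A" and B: "ringmap id B" and c: "\<And>a b. A a * B b = B b * A a"
  shows "ringmap id (conv2 A B)"
proof (rule ringmap_by_basis)
  note t = conv2_ten[OF ringmapD(1)[OF A] ringmapD(1)[OF B]]
  show "conv2 A B 1 = 1" unfolding ten_one[symmetric] by (simp only: t ringmapD(2)[OF A] ringmapD(2)[OF B] mult_1)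
  fix v w
  have "A (a * a') * B (b * b') = A a * B b * (A a' * B b')" for a a' b b'
    using c[of a' b] by (simp add: ringmapD(3)[OF A] ringmapD(3)[OF B]) (metis mult.assoc)
  then show "conv2 A B (basis (v + w)) = conv2 A B (basis v) * conv2 A B (basis w)"
    by (cases v; cases w) (simp add: plus_prod_def ten_mult t flip: ten_basis basis_mult)
qed auto

lemma epsT_comm: "epsT a * b = b * epsT a"
  by (simp add: epsT_def)

lemma epsT_FB: "0 < t \<Longrightarrow> epsT (FB h k t) = (0 :: 'y list \<Rightarrow>\<^sub>0 'r::comm_ring_1)"
proof (induction k arbitrary: t)
  case (Suc k)
  have "epsT (FB h 1 u * FB h k (t - u)) = (0 :: 'y list \<Rightarrow>\<^sub>0 'r)" if "u \<le> t" for u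
    using that Suc.prems Suc.IH[of "t - u"]
    by (cases "u = 0") (auto simp: ringmapD(3)[OF ringmap_epsT] semilinD[OF semilin_epsT])
  then show ?case using FB_add[of h 1 k t] by (simp add: semilinD[OF semilin_epsT])
qed (simp add: semilinD[OF semilin_epsT])

lemma counit_left: "conv2 epsT (\<lambda>x. x) (Dl h f) = f" and counit_right: "conv2 (\<lambda>x. x) epsT (Dl h f) = f"
proof -
  have rm: "ringmap id (conv2 epsT (\<lambda>x. x))" "ringmap id (conv2 (\<lambda>x. x) epsT)"
    by (auto intro!: ringmap_conv2 simp: epsT_comm)
  show "conv2 epsT (\<lambda>x. x) (Dl h f) = f"
    by (rule ringmap_ext[of id "\<lambda>f. conv2 epsT (\<lambda>x. x) (Dl h f)" "\<lambda>f. f"])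
      (auto intro!: ringmap_comp1[OF ringmap_Dl] rm simp: dgen_def semilinD[OF semilin_conv2] conv2_ten)
  show "conv2 (\<lambda>x. x) epsT (Dl h f) = f"
    by (rule ringmap_ext[of id "\<lambda>f. conv2 (\<lambda>x. x) epsT (Dl h f)" "\<lambda>f. f"])
      (auto intro!: ringmap_comp1[OF ringmap_Dl] rm sum.neutral simp: dgen_def semilinD[OF semilin_conv2] conv2_ten epsT_FB)
qed

fun sgen :: "'r \<Rightarrow> nat \<Rightarrow> nat list \<Rightarrow>\<^sub>0 'r::comm_ring_1" where
  "sgen h n = - gen n - (\<Sum>m\<in>{1..<n}. sgen h m * FB h (m + 1) (n - m))"

declare sgen.simps [simp del]

definition Sl :: "'r \<Rightarrow> (nat list \<Rightarrow>\<^sub>0 'r::comm_ring_1) \<Rightarrow> nat list \<Rightarrow>\<^sub>0 'r" where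
  "Sl h = antialg (sgen h)"

lemma semilin_Sl [simp, intro]: "semilin id (Sl h)" by (simp add: Sl_def)

lemma Sl_simps: "Sl h 1 = 1" "Sl h (gen n) = sgen h n" "Sl h (f * g) = Sl h g * Sl h f"
  by (simp_all add: Sl_def antialg_mult)

lemma antipode_left: "conv2 (Sl h) (\<lambda>x. x) (Dl h f) = epsT f"
proof (rule semilin_ext[of id "\<lambda>f. conv2 (Sl h) (\<lambda>x. x) (Dl h f)" epsT])
  let ?M = "conv2 (Sl h) (\<lambda>x. x)"
  \<comment> \<open>Antimultiplicativity of S puts the contribution of Y in the middle: the value on
    Y times v tensor w is S(v) M(Y) w. For Y the coproduct of a letter, M(Y) is zero by the
    recursion defining \<open>sgen\<close>, so the whole product vanishes.\<close>
  have pull: "?M (Y * Z) = conv2 (Sl h) (\<lambda>d. ?M Y * d) Z" if "?M Y * 1 = ?M Y" "\<And>c. ?M Y * c = c * ?M Y" for Z Y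
  proof (rule ten_ext[of id "\<lambda>Z. ?M (Y * Z)"])
    fix v w :: "nat list"
    have "?M (Y * ten (basis v) (basis w)) = Sl h (basis v) * ?M Y * basis w" for Y
    proof (rule ten_ext[of id "\<lambda>Y. ?M (Y * ten (basis v) (basis w))"])
      fix v' w' :: "nat list"
      show "?M (ten (basis v') (basis w') * ten (basis v) (basis w)) =
        Sl h (basis v) * ?M (ten (basis v') (basis w')) * basis w"
        by (simp only: ten_mult conv2_ten[OF semilin_Sl semilin_id(1)] Sl_simps id_apply mult.assoc)
    qed (auto intro!: semilin_mult semilin_comp2[OF _ semilin_conv2])
    then show "?M (Y * ten (basis v) (basis w)) = conv2 (Sl h) (\<lambda>d. ?M Y * d) (ten (basis v) (basis w))"
      by (subst conv2_ten) (auto simp: mult.assoc)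
  qed (auto intro!: semilin_mult semilin_comp2[OF _ semilin_conv2])
  fix w
  show "?M (Dl h (basis w)) = epsT (basis w)"
  proof (induction w)
    case Nil
    have "?M (Dl h 1) = 1" unfolding Dl_simps ten_one[symmetric] by (simp only: conv2_ten[OF semilin_Sl semilin_id(1)] Sl_simps id_apply mult_1)
    then show ?case by (simp flip: one_list)
  next
    case (Cons n w)
    have "?M (dgen h n) = sgen h n + gen n + (\<Sum>m\<in>{1..<n}. sgen h m * FB h (m + 1) (n - m))"
      by (simp add: dgen_def semilinD[OF semilin_conv2] conv2_ten Sl_simps)
    then have z: "?M (dgen h n) = 0" by (simp add: sgen.simps[of h n])
    have "conv2 (Sl h) (\<lambda>d. 0) Z = 0" for Z by (simp add: conv2_def lin_def)
    then show ?case
      by (simp add: basis_Cons Dl_simps pull z ringmapD(3)[OF ringmap_epsT])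
  qed
qed (auto intro!: semilin_mult semilin_comp2[OF _ semilin_conv2])

text \<open>The left inverse \<open>S\<close> is also a right inverse on generators, by induction on the degree, because
  \<open>S * (id * S) = (S * id) * S = S\<close>.\<close>

lemma conv_assoc: "conv2 (Sl h) (\<lambda>b. conv2 (\<lambda>x. x) (Sl h) (Dl h b)) (Dl h f) = Sl h f"
proof -
  let ?T = "conv2 (Sl h) (conv2 (\<lambda>x. x) (Sl h))"
  have "conv2 (Sl h) (\<lambda>b. conv2 (\<lambda>x. x) (Sl h) (Dl h b)) Z = ?T (DlR h Z)" for Z
    by (rule ten_ext[of id "conv2 (Sl h) (\<lambda>b. conv2 (\<lambda>x. x) (Sl h) (Dl h b))" "\<lambda>Z. ?T (DlR h Z)"])
      (auto intro!: semilin_comp2[OF _ semilin_conv2] semilin_comp2[OF semilin_Dl semilin_conv2]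
        ringmapD(1)[OF ringmap_DlLR(2)] simp: conv2_ten simp del: ten_basis)
  moreover have "?T (DlL h Z) = conv2 (\<lambda>b. conv2 (Sl h) (\<lambda>x. x) (Dl h b)) (Sl h) Z" for Z
  proof (rule ten_ext[of id "\<lambda>Z. ?T (DlL h Z)"])
    fix v w :: "nat list"
    have "?T (tassoc (ten Y (basis w))) = conv2 (Sl h) (\<lambda>x. x) Y * Sl h (basis w)" for Y
      by (rule ten_ext[of id "\<lambda>Y. ?T (tassoc (ten Y (basis w)))"])
        (auto intro!: semilin_comp2[OF _ semilin_conv2] semilin_comp2[OF _ semilin_tassoc] semilin_ten
          simp: conv2_ten mult.assoc simp del: ten_basis)
    then show "?T (DlL h (ten (basis v) (basis w))) =
        conv2 (\<lambda>b. conv2 (Sl h) (\<lambda>x. x) (Dl h b)) (Sl h) (ten (basis v) (basis w))"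
      by (subst conv2_ten) (auto intro!: semilin_comp2[OF semilin_Dl semilin_conv2] simp del: ten_basis)
  qed (auto intro!: semilin_comp2[OF _ semilin_conv2] ringmapD(1)[OF ringmap_DlLR(1)])
  moreover have "conv2 epsT (Sl h) (Dl h f) = Sl h f"
  proof -
    have "epsT a * Sl h b = Sl h (epsT a * b)" for a b :: "nat list \<Rightarrow>\<^sub>0 _"
      by (simp add: epsT_def semilinD[OF semilin_Sl])
    note * = this
    have "conv2 epsT (Sl h) Z = Sl h (conv2 epsT (\<lambda>x. x) Z)" for Z :: "nat list \<times> nat list \<Rightarrow>\<^sub>0 _"
      by (rule ten_ext[of id "conv2 epsT (Sl h)"])
        (auto intro!: semilin_comp2[OF _ semilin_Sl] simp: * conv2_ten simp del: ten_basis)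
    then show ?thesis by (simp add: counit_left)
  qed
  ultimately show ?thesis by (simp add: coassoc[symmetric] antipode_left epsT_def[symmetric])
qed

text \<open>The contribution of g is enclosed by that of f, as in f' g' S(g'') S(f''). By assumption
  the inner part is the counit of g, a scalar, which can be moved out.\<close>

lemma antipode_right_mult:
  assumes "conv2 (\<lambda>x. x) (Sl h) (Dl h g) = epsT g"
  shows "conv2 (\<lambda>x. x) (Sl h) (Dl h (f * g)) = conv2 (\<lambda>x. x) (Sl h) (Dl h f) * epsT g"
proof -
  let ?M = "conv2 (\<lambda>x. x) (Sl h)"
  have "?M (Z * Dl h g) = ?M Z * epsT g" for Z
  proof (rule ten_ext[of id "\<lambda>Z. ?M (Z * Dl h g)"])
    fix v w :: "nat list"
    have "?M (ten (basis v) (basis w) * Y) = basis v * ?M Y * Sl h (basis w)" for Y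
    proof (rule ten_ext[of id "\<lambda>Y. ?M (ten (basis v) (basis w) * Y)"])
      fix v' w' :: "nat list"
      show "?M (ten (basis v) (basis w) * ten (basis v') (basis w')) =
        basis v * ?M (ten (basis v') (basis w')) * Sl h (basis w)"
        by (simp only: ten_mult conv2_ten[OF semilin_id(1) semilin_Sl] Sl_simps id_apply mult.assoc)
    qed (auto intro!: semilin_mult semilin_comp2[OF _ semilin_conv2])
    then have "?M (ten (basis v) (basis w) * Dl h g) = basis v * epsT g * Sl h (basis w)"
      by (simp add: assms)
    also have "\<dots> = basis v * Sl h (basis w) * epsT g" by (metis epsT_comm mult.assoc)
    finally show "?M (ten (basis v) (basis w) * Dl h g) = ?M (ten (basis v) (basis w)) * epsT g"
      by (simp add: conv2_ten del: ten_basis)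
  qed (auto intro!: semilin_mult semilin_comp2[OF _ semilin_conv2])
  then show ?thesis by (simp add: Dl_simps)
qed

text \<open>Restricting the letters to \<open>V\<close> makes this usable inside the induction on n:
  the polynomials \<open>FB\<close> next to x_m have only letters smaller than n.\<close>

lemma antipode_right_step:
  assumes "\<And>x. x \<in> V \<Longrightarrow> conv2 (\<lambda>x. x) (Sl h) (dgen h x) = 0" "supin (lists V) f"
  shows "conv2 (\<lambda>x. x) (Sl h) (Dl h f) = epsT f"
proof (rule semilin_ext_on[of id "\<lambda>f. conv2 (\<lambda>x. x) (Sl h) (Dl h f)" epsT])
  fix w assume "w \<in> supp f"
  then have "set w \<subseteq> V" using assms(2) by (auto simp: supin_def)
  then show "conv2 (\<lambda>x. x) (Sl h) (Dl h (basis w)) = epsT (basis w)"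
  proof (induction w)
    case Nil
    have "conv2 (\<lambda>x. x) (Sl h) (Dl h 1) = 1" unfolding Dl_simps ten_one[symmetric]
      by (simp only: conv2_ten[OF semilin_id(1) semilin_Sl] Sl_simps id_apply mult_1)
    then show ?case by (simp flip: one_list)
  next
    case (Cons x w)
    then show ?case
      by (simp add: basis_Cons antipode_right_mult assms(1) ringmapD(3)[OF ringmap_epsT])
  qed
qed (auto intro!: semilin_mult semilin_comp2[OF _ semilin_conv2])

lemma antipode_right_gen: "conv2 (\<lambda>x. x) (Sl h) (dgen h n) = 0"
proof (induction n rule: less_induct)
  case (less n)
  let ?g = "\<lambda>b. conv2 (\<lambda>x. x) (Sl h) (Dl h b)"
  have g1: "?g 1 = 1"
    using antipode_right_step[of "{}" h 1] by simp
  have "?g (FB h (m + 1) (n - m)) = 0" if "m \<in> {1..<n}" for m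
  proof -
    have "conv2 (\<lambda>x. x) (Sl h) (Dl h (FB h (m + 1) (n - m))) = epsT (FB h (m + 1) (n - m))"
      by (rule antipode_right_step[of "{1..n-m}", OF less supin_FB]) (use that in auto)
    then show ?thesis using that by (simp add: epsT_FB)
  qed
  moreover have "semilin id ?g" by (auto intro!: semilin_mult semilin_comp2[OF _ semilin_conv2])
  ultimately have "conv2 (Sl h) ?g (dgen h n) = sgen h n + ?g (gen n)"
    by (simp add: dgen_def semilinD[OF semilin_conv2] conv2_ten Sl_simps g1)
  moreover have "conv2 (Sl h) ?g (dgen h n) = sgen h n"
    using conv_assoc[of h "gen n"] by (simp add: Sl_simps)
  ultimately show ?case by simp
qed

lemma antipode_right: "conv2 (\<lambda>x. x) (Sl h) (Dl h f) = epsT f"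
  by (rule antipode_right_step[where V = UNIV]) (simp_all add: antipode_right_gen)

subsection \<open>Rescaling, supports and the formulas for \<open>H\<close>\<close>

text \<open>It carries the structure with parameter h to that with parameter h' = \<rho> h * q. Two
  cases are used: \<rho> the embedding in k(hbar) and q = 1/hbar, leading from hbar to 1, and \<rho>
  evaluation at 0 with q = 1, leading from hbar to 0.\<close>

definition rescale :: "('r::comm_ring_1 \<Rightarrow> 's::comm_ring_1) \<Rightarrow> 's \<Rightarrow> (nat list \<Rightarrow>\<^sub>0 'r) \<Rightarrow> nat list \<Rightarrow>\<^sub>0 's" where
  "rescale \<rho> q = alg \<rho> (\<lambda>n. scale q (gen n))"

lemma ringmap_rescale [simp, intro]: "rhom \<rho> \<Longrightarrow> ringmap \<rho> (rescale \<rho> q)"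
  and semilin_rescale [simp, intro]: "rhom \<rho> \<Longrightarrow> semilin \<rho> (rescale \<rho> q)"
  and rescale_gen [simp]: "rhom \<rho> \<Longrightarrow> rescale \<rho> q (gen n) = scale q (gen n)"
  by (simp_all add: rescale_def ringmapD)

lemma rescale_basis: "rhom \<rho> \<Longrightarrow> rescale \<rho> q (basis w) = scale (q ^ length w) (basis w)"
proof -
  assume "rhom \<rho>"
  have "prod_list (map (\<lambda>n. scale q (gen n)) w) = scale (q ^ length w) (basis w)"
    by (induction w) (simp_all add: basis_Cons one_list[symmetric] mult.commute del: scale_simps(5))
  then show ?thesis using \<open>rhom \<rho>\<close> by (simp add: rescale_def)
qed

lemma coef_rescale: assumes "rhom \<rho>" shows "coef (rescale \<rho> q f) w = \<rho> (coef f w) * q ^ length w"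
proof -
  have "rescale \<rho> q f = (\<Sum>v\<in>supp f. Poly_Mapping.single v (\<rho> (coef f v) * q ^ length v))"
    unfolding semilin_expand[OF semilin_rescale[OF assms], of q f] by (simp add: rescale_basis assms)
  then have "coef (rescale \<rho> q f) w = (\<Sum>v\<in>supp f. if v = w then \<rho> (coef f v) * q ^ length v else 0)"
    by (simp add: lookup_sum lookup_single when_def)
  then show ?thesis using assms by (auto simp: in_keys_iff rhom_def)
qed

context
  fixes \<rho> :: "'r::comm_ring_1 \<Rightarrow> 's::comm_ring_1" and q h h'
  assumes \<rho>: "rhom \<rho>" and h': "h' = \<rho> h * q"
begin

lemma rescale_FB: "rescale \<rho> q (FB h k t) = FB h' k t"
proof (induction k arbitrary: t)
  case 0
  then show ?case using \<rho> by (simp add: ringmapD(2)[OF ringmap_rescale] semilinD[OF semilin_rescale])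
next
  case (Suc k)
  have "rescale \<rho> q (FB h 1 u) = FB h' 1 u" for u
    using \<rho> h' by (simp add: ringmapD(2)[OF ringmap_rescale] semilinD[OF semilin_rescale])
  then show ?case
    using FB_add[of h 1 k t] FB_add[of h' 1 k t] \<rho> Suc
    by (simp add: semilinD[OF semilin_rescale] ringmapD(3)[OF ringmap_rescale])
qed

lemma rescale_Dl: "Dl h' (rescale \<rho> q f) = tmap \<rho> (rescale \<rho> q) (rescale \<rho> q) (Dl h f)"
proof (rule ringmap_ext[of \<rho> "\<lambda>f. Dl h' (rescale \<rho> q f)"])
  fix n
  show "Dl h' (rescale \<rho> q (gen n)) = tmap \<rho> (rescale \<rho> q) (rescale \<rho> q) (Dl h (gen n))"
    using \<rho> rescale_FB by (simp add: dgen_def semilinD[OF semilin_tmap] tmap_ten Dl_simps scale_linear scale_sum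
        ten_linear ringmapD(2)[OF ringmap_rescale])
next
  show "ringmap \<rho> (\<lambda>f. Dl h' (rescale \<rho> q f))"
    by (rule ringmap_comp1[OF ringmap_rescale[OF \<rho>] ringmap_Dl])
  show "ringmap \<rho> (\<lambda>f. tmap \<rho> (rescale \<rho> q) (rescale \<rho> q) (Dl h f))"
    by (rule ringmap_comp2[OF ringmap_Dl ringmap_tmap]) (use \<rho> in auto)
qed

lemma rescale_Sl: "Sl h' (rescale \<rho> q f) = rescale \<rho> q (Sl h f)"
proof (rule semilin_ext[of \<rho> "\<lambda>f. Sl h' (rescale \<rho> q f)"])
  have g: "rescale \<rho> q (sgen h n) = scale q (sgen h' n)" for n
  proof (induction n rule: less_induct)
    case (less n)
    then show ?case unfolding sgen.simps[of _ n] using \<rho>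
      by (simp add: semilinD[OF semilin_rescale] ringmapD(3)[OF ringmap_rescale] rescale_FB scale_linear scale_sum)
  qed
  show "Sl h' (rescale \<rho> q (basis w)) = rescale \<rho> q (Sl h (basis w))" for w
  proof (induction w)
    case (Cons n w)
    then show ?case using \<rho>
      by (simp add: basis_Cons ringmapD(3)[OF ringmap_rescale] Sl_simps semilinD[OF semilin_Sl] g)
  qed (simp add: ringmapD(2)[OF ringmap_rescale] \<rho> Sl_simps flip: one_list)
qed (use \<rho> in \<open>auto intro!: semilin_comp1[OF semilin_rescale] semilin_comp2[OF semilin_Sl]\<close>)

end

text \<open>The index sets enter the bialgebra computations through this closure property, which
  keeps coproduct, antipode and cobracket within the words over \<open>V\<close>.\<close>

definition down :: "nat set \<Rightarrow> bool" where "down V \<longleftrightarrow> (\<forall>n\<in>V. {1..n} \<subseteq> V)"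

lemma supin_alg:
  assumes "rhom \<rho>" "supin (lists V) f" "0 \<in> W" "\<And>a b. a \<in> W \<Longrightarrow> b \<in> W \<Longrightarrow> a + b \<in> W" "\<And>x. x \<in> V \<Longrightarrow> supin W (s x)"
  shows "supin W (alg \<rho> s f)"
proof (rule supin_semilin[OF ringmapD(1)[OF ringmap_alg[OF assms(1)]] assms(2)])
  have 1: "supin W 1" using supin_basic(6)[of 0 W 1] assms(3) by simp
  show "w \<in> lists V \<Longrightarrow> supin W (alg \<rho> s (basis w))" for w
    by (induction w) (use assms in \<open>auto simp: 1 intro!: supin_mult[of W _ W _ W]\<close>)
qed

lemma supin_Dl:
  assumes "down V" "supin (lists V) f"
  shows "supin (lists V \<times> lists V) (Dl h f)"
  unfolding Dl_def
proof (rule supin_alg[OF rhom_id(1) assms(2)])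
  fix n assume n: "n \<in> V"
  have "m \<in> V \<and> supin (lists V) (FB h (m + 1) (n - m))" if "m \<in> {1..<n}" for m
    using that n assms(1) unfolding down_def
    by (intro conjI supin_mono[OF supin_FB] lists_mono) force+
  note * = this
  show "supin (lists V \<times> lists V) (dgen h n)"
    unfolding dgen_def by (intro supin_basic(2) supin_sum) (use n * in \<open>auto intro!: supin_ten\<close>)
qed (auto simp: plus_prod_def zero_prod_def plus_list_def zero_list_def)

lemma supin_Sl:
  assumes "down V" "supin (lists V) f"
  shows "supin (lists V) (Sl h f)"
proof (rule supin_semilin[OF semilin_Sl assms(2)])
  have g: "n \<in> V \<Longrightarrow> supin (lists V) (sgen h n)" for n
  proof (induction n rule: less_induct)
    case (less n)
    have "supin (lists V) (sgen h m * FB h (m + 1) (n - m))" if "m \<in> {1..<n}" for m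
      using that less assms(1) unfolding down_def
      by (intro supin_lists_mult supin_mono[OF supin_FB] lists_mono less.IH) force+
    then show ?case
      unfolding sgen.simps[of _ n] using less by (intro supin_basic supin_sum) auto
  qed
  show "w \<in> lists V \<Longrightarrow> supin (lists V) (Sl h (basis w))" for w
    by (induction w) (auto simp: basis_Cons Sl_simps g, auto simp: Sl_simps simp flip: one_list)
qed

section \<open>The polynomials P and Q as coefficients of powers of a series\<close>

lemma P_poly_conv_fps: "P_poly k t = fps_nth ((FB_gf 1 - 1) ^ k) t"
proof (induction k arbitrary: t)
  case 0
  have "{js. length js = 0 \<and> (\<forall>j\<in>set js. 0 < j) \<and> sum_list js = t} = (if t = 0 then {[]} else {})" by auto
  then show ?case by (simp add: P_poly_def)
next
  case (Suc k)
  let ?J = "\<lambda>k t. {js. length js = k \<and> (\<forall>j\<in>set js. 0 < j) \<and> sum_list js = (t::nat)}"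
  have "finite (?J k t)" for k t
  proof (rule finite_subset)
    show "?J k t \<subseteq> {js. set js \<subseteq> {..t} \<and> length js = k}" using member_le_sum_list by auto
  qed (simp add: finite_lists_length_eq)
  then have "(\<Sum>j=1..t. \<Sum>js\<in>?J k (t - j). prod_list (map gen (j # js)) :: nat list \<Rightarrow>\<^sub>0 'a) =
      (\<Sum>(j,js)\<in>(SIGMA j:{1..t}. ?J k (t - j)). prod_list (map gen (j # js)))"
    by (subst sum.Sigma) auto
  also have "\<dots> = (\<Sum>js\<in>?J (Suc k) t. prod_list (map gen js))"
    by (rule sum.reindex_bij_witness[of _ "\<lambda>js. (hd js, tl js)" "\<lambda>(j,js). j # js"])
      (auto simp: length_Suc_conv)
  finally have "P_poly (Suc k) t = (\<Sum>j=1..t. gen j * P_poly k (t - j) :: nat list \<Rightarrow>\<^sub>0 'a)"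
    by (simp add: P_poly_def sum_distrib_left)
  \<comment> \<open>The sum over the first index j may start at 0, because the series
    \<open>FB_gf 1 - 1\<close> has no constant term.\<close>
  also have "\<dots> = (\<Sum>j=0..t. fps_nth (FB_gf 1 - 1) j * P_poly k (t - j))"
    by (rule sum.mono_neutral_cong_left) (auto simp: FB_gf_def Suc_le_eq)
  finally show ?case by (simp add: Suc fps_mult_nth)
qed

lemma P_poly_eq_0: "t < k \<Longrightarrow> P_poly k t = 0"
proof -
  assume "t < k"
  have "length js \<le> sum_list js" if "\<forall>j\<in>set js. 0 < j" for js :: "nat list"
    using that by (induction js) auto
  then have "{js. length js = k \<and> (\<forall>j\<in>set js. 0 < j) \<and> sum_list js = t} = {}" using \<open>t < k\<close> by fastforce
  then show ?thesis unfolding P_poly_def by (simp only: sum.empty)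
qed

text \<open>Applied to power series over the free algebra, which do not commute; 1 and e do. The
  induction is Pascal's rule.\<close>

lemma one_plus_power:
  fixes e :: "'a::ring_1"
  shows "(1 + e) ^ n = (\<Sum>k\<le>n. of_nat (n choose k) * e ^ k)"
proof (induction n)
  case (Suc n)
  have "(1 + e) ^ Suc n = (\<Sum>k\<le>n. of_nat (n choose k) * e ^ k) + (\<Sum>k\<le>n. of_nat (n choose k) * e ^ Suc k)"
    by (simp add: power_Suc2 Suc distrib_left sum_distrib_right mult.assoc del: power_Suc)
  also have "(\<Sum>k\<le>n. of_nat (n choose k) * e ^ k) = 1 + (\<Sum>k\<le>n. of_nat (n choose Suc k) * e ^ Suc k)"
    using sum.atMost_Suc_shift[of "\<lambda>k. of_nat (n choose k) * e ^ k" n] by (simp add: binomial_eq_0)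
  finally show ?case
    unfolding sum.atMost_Suc_shift by (simp add: sum.distrib distrib_right algebra_simps)
qed simp

text \<open>The binomial theorem for E = 1 + (E - 1), read off in degree t. Both ranges of k extend
  to 0..max t (l + 1): the term k = 0 vanishes as t > 0, those with k > t because a sum of k
  positive integers is at least k, and those with k > l + 1 because the binomial coefficient is
  zero.\<close>

lemma Q_poly_conv_FB: "0 < t \<Longrightarrow> Q_poly l t = FB 1 (l + 1) t"
proof -
  assume t: "0 < t"
  have c: "fps_nth (of_nat n * F) t = of_nat n * fps_nth F t" for n and F :: "(nat list \<Rightarrow>\<^sub>0 'a) fps"
    by (induction n) (auto simp: algebra_simps)
  let ?f = "\<lambda>k. of_nat (l + 1 choose k) * P_poly k t :: nat list \<Rightarrow>\<^sub>0 'a"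
  have "P_poly 0 t = (0 :: nat list \<Rightarrow>\<^sub>0 'a)" using t by (simp add: P_poly_conv_fps)
  then have "sum ?f {1..t} = sum ?f {..max t (l + 1)}"
    by (intro sum.mono_neutral_left) (auto simp: P_poly_eq_0 not_le Suc_le_eq)
  also have "\<dots> = sum ?f {..l + 1}"
    by (intro sum.mono_neutral_right) (auto simp: binomial_eq_0)
  also have "\<dots> = fps_nth ((1 + (FB_gf 1 - 1)) ^ (l + 1)) t"
    unfolding one_plus_power fps_sum_nth c P_poly_conv_fps ..
  finally show ?thesis by (simp add: Q_poly_def FB_def)
qed

lemma H_antipode_gen_conv: "H_antipode_gen n = sgen 1 n"
proof (induction n rule: less_induct)
  case (less n)
  then show ?case unfolding H_antipode_gen.simps[of n] sgen.simps[of _ n]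
    by (intro arg_cong2[of _ _ _ _ "(-)"] sum.cong refl) (auto simp: Q_poly_conv_FB)
qed

section \<open>The semiclassical limit\<close>

definition ev0 :: "'k::field poly \<Rightarrow> 'k" where "ev0 p = poly p 0"

lemma rhom_ev0 [simp]: "rhom ev0" and rhom_const [simp]: "rhom (\<lambda>c. [:c::'k::field:])"
  by (auto simp: rhom_def ev0_def one_pCons)

lemma ev0_simps [simp]: "ev0 hbar = 0" "ev0 [:c:] = c" "ev0 0 = 0" "ev0 (a + b) = ev0 a + ev0 b"
   "ev0 (a - b) = ev0 a - ev0 b" "ev0 (a * b) = ev0 a * ev0 b"
  by (simp_all add: ev0_def hbar_def)

lemma hbar_nz [simp]: "hbar \<noteq> 0" by (simp add: hbar_def)

lemma ev0_eq_0: "ev0 p = 0 \<longleftrightarrow> hbar dvd p"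
  by (auto simp: ev0_def hbar_def poly_eq_0_iff_dvd)

definition red :: "('x \<Rightarrow>\<^sub>0 'k::field poly) \<Rightarrow> 'x \<Rightarrow>\<^sub>0 'k" where "red = slin ev0 basis"
definition lift :: "('x \<Rightarrow>\<^sub>0 'k::field) \<Rightarrow> 'x \<Rightarrow>\<^sub>0 'k poly" where "lift = slin (\<lambda>c. [:c:]) basis"

lemma coef_slin_basis: "\<rho> 0 = 0 \<Longrightarrow> coef (slin \<rho> basis f) w = \<rho> (coef f w)"
proof -
  assume z: "\<rho> 0 = 0"
  have "coef (slin \<rho> basis f) w = (\<Sum>v\<in>supp f. if v = w then \<rho> (coef f v) else 0)"
    by (simp add: slin_def lookup_sum lookup_single when_def)
  then show ?thesis using z by (auto simp: in_keys_iff)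
qed

lemma coef_red [simp]: "coef (red f) w = ev0 (coef f w)" and coef_lift [simp]: "coef (lift g) w = [:coef g w:]"
  by (simp_all add: red_def lift_def coef_slin_basis)

lemma semilin_red [simp, intro]: "semilin ev0 red" and semilin_lift [simp, intro]: "semilin (\<lambda>c. [:c:]) lift"
  and red_basis [simp]: "red (basis w) = basis w" and lift_basis [simp]: "lift (basis w) = basis w"
  and red_lift [simp]: "red (lift f) = f"
  by (auto simp: red_def lift_def coef_slin_basis intro!: poly_mapping_eqI)

lemmas red_simps = semilinD[OF semilin_red]

lemma ringmap_red [simp, intro]: "ringmap ev0 (red :: ('x::monoid_add \<Rightarrow>\<^sub>0 'k::field poly) \<Rightarrow> _)"
proof (rule ringmap_by_basis)
  show "red (1 :: 'x \<Rightarrow>\<^sub>0 'k poly) = 1" unfolding single_one[symmetric] by (rule red_basis)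
  show "red (basis (v + w)) = red (basis v) * red (basis w)" for v w :: 'x
    by (simp only: red_basis basis_mult)
qed auto

text \<open>This brings reduction modulo hbar under the rescaling lemmas, with the parameter going
  from hbar to 0.\<close>

lemma red_rescale: "red = rescale ev0 1"
  by (rule ext, rule poly_mapping_eqI) (simp add: coef_rescale)

lemma red_ten: "red (ten f g) = ten (red f) (red g)"
  by (rule bilin_ext[of ev0 "\<lambda>f g. red (ten f g)" "\<lambda>f g. ten (red f) (red g)"])
    (auto intro!: semilin_ten semilin_comp2[OF _ semilin_red] semilin_ten1 semilin_ten2)

lemma tmap_red: "tmap ev0 red red f = red f"
  by (rule ten_ext[of ev0 "tmap ev0 red red"]) (auto simp: tmap_ten red_ten simp del: ten_basis)

lemma Dl_red: "Dl 0 (red f) = red (Dl hbar f)"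
  using rescale_Dl[OF rhom_ev0, of 0 hbar 1 f] by (simp add: tmap_red flip: red_rescale)

lemma Sl_red: "Sl 0 (red f) = red (Sl hbar f)"
  using rescale_Sl[OF rhom_ev0, of 0 hbar 1 f] by (simp flip: red_rescale)

lemma red_tassoc: "red (tassoc f) = tassoc (red f)" and red_tswap: "red (tswap g) = tswap (red g)"
  by (rule semilin_ext[OF semilin_comp2[OF semilin_tassoc semilin_red] semilin_comp1[OF semilin_red semilin_tassoc]],
      simp add: tassoc_def)
    (rule semilin_ext[OF semilin_comp2[OF semilin_tswap semilin_red] semilin_comp1[OF semilin_red semilin_tswap]],
      simp add: tswap_def)

lemma scale_hbar_inj: "scale hbar f = scale hbar g \<Longrightarrow> f = g"
  by (metis coef_scale hbar_nz mult_left_cancel poly_mapping_eqI)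

text \<open>The bound on the support keeps the quotient by hbar within the same letters, so that it
  still belongs to the algebra on the given index set.\<close>

lemma red_eq_0E:
  assumes "red f = 0" obtains g where "f = scale hbar g" "supp g \<subseteq> supp f"
proof
  have d: "hbar dvd coef f w" for w
    using arg_cong[OF assms, of "\<lambda>f. coef f w"] by (simp add: ev0_eq_0)
  let ?g = "Poly_Mapping.map (\<lambda>p. p div hbar) f"
  have c: "coef ?g w = coef f w div hbar" for w
    by (simp add: Poly_Mapping.map.rep_eq when_def)
  show "f = scale hbar ?g" by (rule poly_mapping_eqI) (simp add: c d)
  show "supp ?g \<subseteq> supp f" by (auto simp: in_keys_iff c)
qed

lemma cocommutative: "tswap (Dl 0 f) = Dl 0 f"
  by (rule ringmap_ext[of id "\<lambda>f. tswap (Dl 0 f)"])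
    (auto intro!: ringmap_comp1[OF ringmap_Dl] ringmap_tswap
      simp: dgen_def FB_zero semilinD[OF semilin_tswap] ten_linear intro!: sum.neutral)

lemma dgen_0: "dgen 0 n = ten (gen n) 1 + ten 1 (gen n)"
  by (auto simp: dgen_def FB_zero ten_linear intro!: sum.neutral)

section \<open>The cobracket as the first-order part of the coproduct\<close>

definition dh :: "(nat list \<Rightarrow>\<^sub>0 'k::field poly) \<Rightarrow> nat list \<times> nat list \<Rightarrow>\<^sub>0 'k poly" where
  "dh f = (THE g. scale hbar g = Dl hbar f - tswap (Dl hbar f))"

text \<open>The quotient exists because the coproduct is cocommutative modulo hbar, and it is unique
  because hbar is not a zero divisor.\<close>

lemma scale_dh: "scale hbar (dh f) = Dl hbar f - tswap (Dl hbar f)"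
proof -
  have "red (Dl hbar f - tswap (Dl hbar f)) = 0"
    by (simp add: red_simps red_tswap cocommutative flip: Dl_red)
  then obtain g where "scale hbar g = Dl hbar f - tswap (Dl hbar f)" by (metis red_eq_0E)
  then have "\<exists>!g. scale hbar g = Dl hbar f - tswap (Dl hbar f)" by (metis scale_hbar_inj)
  then show ?thesis unfolding dh_def by (rule theI')
qed

lemma dh_eqI: "scale hbar g = Dl hbar f - tswap (Dl hbar f) \<Longrightarrow> dh f = g"
  using scale_dh scale_hbar_inj by metis

lemma semilin_dh [simp, intro]: "semilin id dh"
  unfolding semilin_def
proof (intro conjI allI dh_eqI)
  show "scale hbar (dh f + dh g) = Dl hbar (f + g) - tswap (Dl hbar (f + g))" for f g :: "nat list \<Rightarrow>\<^sub>0 'a poly"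
    by (simp add: scale_linear scale_dh Dl_simps semilinD[OF semilin_tswap])
  have "scale hbar (scale (id c) (dh f)) = scale c (scale hbar (dh f))" for c and f :: "nat list \<Rightarrow>\<^sub>0 'a poly"
    by (simp add: mult.commute)
  then show "scale hbar (scale (id c) (dh f)) = Dl hbar (scale c f) - tswap (Dl hbar (scale c f))" for c and f :: "nat list \<Rightarrow>\<^sub>0 'a poly"
    by (simp only: scale_dh Dl_simps semilinD[OF semilin_tswap] scale_linear id_apply)
qed

definition db :: "(nat list \<Rightarrow>\<^sub>0 'k::field) \<Rightarrow> nat list \<times> nat list \<Rightarrow>\<^sub>0 'k" where
  "db f = red (dh (lift f))"

text \<open>Independence of the lift: two lifts differ by hbar times some g, and \<open>dh\<close>
  is linear over k[hbar], so its values differ by a multiple of hbar.\<close>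

lemma db_red: "db (red f) = red (dh f)"
proof -
  have "red (f - lift (red f)) = 0" by (simp add: red_simps)
  then obtain g where "f - lift (red f) = scale hbar g" by (rule red_eq_0E)
  then have "f = lift (red f) + scale hbar g" by (simp add: algebra_simps)
  then have "dh f = dh (lift (red f)) + scale hbar (dh g)" using semilin_add[OF semilin_dh] semilin_scale[OF semilin_dh, of hbar g] by (metis id_apply)
  then show ?thesis by (simp add: db_def red_simps)
qed

lemma semilin_db [simp, intro]: "semilin id db"
  unfolding semilin_def db_def by (simp add: semilinD[OF semilin_dh] semilinD[OF semilin_lift] red_simps)

lemma db_tswap: "tswap (db f) = - db f"
proof -
  have i: "tswap (tswap g) = g" for g :: "nat list \<times> nat list \<Rightarrow>\<^sub>0 'a poly"
    by (rule semilin_ext[OF semilin_comp2[OF semilin_tswap semilin_tswap] semilin_id(1)]) (simp add: tswap_def)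
  have "scale hbar (tswap (dh g)) = scale hbar (- dh g)" for g :: "nat list \<Rightarrow>\<^sub>0 'a poly"
    unfolding semilin_scale[OF semilin_tswap, of hbar "dh g", unfolded id_apply, symmetric]
    by (simp only: scale_dh scale_linear(3)) (simp add: semilinD[OF semilin_tswap] i)
  then have "tswap (dh g) = - dh g" for g :: "nat list \<Rightarrow>\<^sub>0 'a poly" by (rule scale_hbar_inj)
  then show ?thesis by (simp add: db_def red_simps flip: red_tswap)
qed

text \<open>With Delta' the opposite coproduct, Delta(fg) - Delta'(fg) is (Delta f - Delta' f) Delta
  g + Delta' f (Delta g - Delta' g). Divide by hbar and reduce; modulo hbar, Delta' f becomes Delta
  f.\<close>

lemma db_mult: "db (f * g) = db f * Dl 0 g + Dl 0 f * db g"
proof -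
  have "scale hbar (dh (f * g)) = scale hbar (dh f * Dl hbar g + tswap (Dl hbar f) * dh g)" for f g :: "nat list \<Rightarrow>\<^sub>0 'a poly"
  proof -
    have "scale hbar (dh f * Dl hbar g + tswap (Dl hbar f) * dh g) =
        scale hbar (dh f) * Dl hbar g + tswap (Dl hbar f) * scale hbar (dh g)"
      by (simp add: scale_linear)
    then show ?thesis
      by (simp only: scale_dh) (simp add: Dl_simps ringmapD(3)[OF ringmap_tswap] algebra_simps)
  qed
  then have *: "dh (f * g) = dh f * Dl hbar g + tswap (Dl hbar f) * dh g" for f g :: "nat list \<Rightarrow>\<^sub>0 'a poly"
    by (rule scale_hbar_inj)
  have "db (red (lift f * lift g)) = red (dh (lift f)) * Dl 0 g + Dl 0 f * red (dh (lift g))"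
    unfolding db_red * by (simp add: red_simps ringmapD(3)[OF ringmap_red] red_tswap cocommutative flip: Dl_red)
  then show ?thesis unfolding db_def[of f] db_def[of g] by (simp add: ringmapD(3)[OF ringmap_red])
qed

text \<open>To first order in hbar, E^k is 1 + k hbar sum x_u, so the tensor factor next to x_m
  contributes (m + 1) x_(n-m). This is the origin of the coefficient l + 1 of the cobracket.\<close>

lemma db_gen: "db (gen n :: nat list \<Rightarrow>\<^sub>0 'k::field) = (\<Sum>l\<in>{1..<n}. scale (of_nat (l + 1)) (ten (gen l) (gen (n - l)) - ten (gen (n - l)) (gen l)))"
proof -
  have 1: "\<exists>G :: nat list \<Rightarrow>\<^sub>0 'k poly. FB hbar k t = scale hbar G \<and> red G = scale (of_nat k) (gen t)" if "0 < t" for k t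
    using that
  proof (induction k arbitrary: t)
    case (Suc k)
    have "\<exists>G :: nat list \<Rightarrow>\<^sub>0 'k poly. FB hbar k (t - u) = scale hbar G" if "u \<in> {1..<t}" for u using Suc.IH[of "t - u"] that by auto
    then obtain G :: "nat \<Rightarrow> nat list \<Rightarrow>\<^sub>0 'k poly" where G: "\<And>u. u \<in> {1..<t} \<Longrightarrow> FB hbar k (t - u) = scale hbar (G u)" by metis
    obtain G0 :: "nat list \<Rightarrow>\<^sub>0 'k poly" where G0: "FB hbar k t = scale hbar G0" "red G0 = scale (of_nat k) (gen t)" using Suc by blast
    have t: "{..t} = insert 0 (insert t {1..<t})" using Suc.prems by auto
    have "(\<Sum>u\<in>{1..<t}. FB hbar 1 u * FB hbar k (t - u)) = (\<Sum>u\<in>{1..<t}. scale hbar (gen u * scale hbar (G u)))"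
      by (intro sum.cong refl) (auto simp: G)
    \<comment> \<open>Of the product of E and E^k only the end terms u = 0 and u = t are of first
      order; for 0 < u < t both factors are divisible by hbar.\<close>
    then have "FB hbar (1 + k) t = scale hbar (G0 + gen t + (\<Sum>u\<in>{1..<t}. scale hbar (gen u * G u)))"
      unfolding FB_add t using Suc.prems by (simp add: G0 scale_linear scale_sum)
    moreover have "red (G0 + gen t + (\<Sum>u\<in>{1..<t}. scale hbar (gen u * G u))) = scale (of_nat (1 + k)) (gen t)"
      by (simp add: red_simps G0 scale_linear) (simp add: gen_def)
    ultimately show ?case by auto
  qed (auto intro!: exI[of _ 0] simp: red_simps)
  have "\<exists>G :: nat \<Rightarrow> nat list \<Rightarrow>\<^sub>0 'k poly. \<forall>m\<in>{1..<n}. FB hbar (m + 1) (n - m) = scale hbar (G m) \<and> red (G m) = scale (of_nat (m + 1)) (gen (n - m))"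
  proof (intro bchoice ballI)
    fix m assume "m \<in> {1..<n}"
    then show "\<exists>G :: nat list \<Rightarrow>\<^sub>0 'k poly. FB hbar (m + 1) (n - m) = scale hbar G \<and> red G = scale (of_nat (m + 1)) (gen (n - m))"
      using 1[of "n - m" "m + 1"] by auto
  qed
  then obtain G :: "nat \<Rightarrow> nat list \<Rightarrow>\<^sub>0 'k poly" where G: "\<And>m. m \<in> {1..<n} \<Longrightarrow> FB hbar (m + 1) (n - m) = scale hbar (G m)"
    "\<And>m. m \<in> {1..<n} \<Longrightarrow> red (G m) = scale (of_nat (m + 1)) (gen (n - m))" by blast
  have "dh (gen n) = (\<Sum>m\<in>{1..<n}. ten (gen m) (G m) - ten (G m) (gen m))"
  proof (rule dh_eqI)
    have "dgen hbar n = ten (gen n) 1 + ten 1 (gen n) + (\<Sum>m\<in>{1..<n}. scale hbar (ten (gen m) (G m)))"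
      unfolding dgen_def by (intro arg_cong2[of _ _ _ _ "(+)"] sum.cong refl) (simp only: G ten_linear)
    then show "scale hbar (\<Sum>m\<in>{1..<n}. ten (gen m) (G m) - ten (G m) (gen m)) = Dl hbar (gen n) - tswap (Dl hbar (gen n))"
      by (simp add: semilinD[OF semilin_tswap] scale_sum scale_linear sum_subtractf)
  qed
  then have "db (red (gen n)) = (\<Sum>m\<in>{1..<n}. ten (red (gen m)) (red (G m)) - ten (red (G m)) (red (gen m)))"
    unfolding db_red by (simp add: red_simps red_ten)
  also have "\<dots> = (\<Sum>m\<in>{1..<n}. scale (of_nat (m + 1)) (ten (gen m) (gen (n - m)) - ten (gen (n - m)) (gen m)))"
    by (intro sum.cong refl) (simp add: G ten_linear scale_linear, simp add: gen_def)
  finally show ?thesis by (simp add: gen_def)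
qed

lemma supin_red: "supin W f \<Longrightarrow> supin W (red f)" and supin_lift: "supin W g \<Longrightarrow> supin W (lift g)"
  by (auto simp: supin_coef)

lemma supin_dh:
  assumes "down V" "supin (lists V) f"
  shows "supin (lists V \<times> lists V) (dh f)"
proof -
  have "supin (lists V \<times> lists V) (scale hbar (dh f))"
    unfolding scale_dh
  proof (rule supin_basic(3)[OF supin_Dl[OF assms]], rule supin_semilin[OF semilin_tswap supin_Dl[OF assms]])
    show "p \<in> lists V \<times> lists V \<Longrightarrow> supin (lists V \<times> lists V) (tswap (basis p))" for p :: "nat list \<times> nat list"
      by (cases p) (auto simp: tswap_def)
  qed
  then show ?thesis by (auto simp: supin_coef)
qed

lemma supin_db: "down V \<Longrightarrow> supin (lists V) f \<Longrightarrow> supin (lists V \<times> lists V) (db f)"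
  unfolding db_def by (intro supin_red supin_dh supin_lift)

section \<open>Threefold tensors: co-Jacobi and co-Leibniz\<close>

definition EL :: "(('a \<Rightarrow>\<^sub>0 'r) \<Rightarrow> 'b \<times> 'c \<Rightarrow>\<^sub>0 'r) \<Rightarrow> ('a \<times> 'd \<Rightarrow>\<^sub>0 'r::comm_ring_1) \<Rightarrow> 'b \<times> 'c \<times> 'd \<Rightarrow>\<^sub>0 'r" where
  "EL A Z = tassoc (tmap id A (\<lambda>x. x) Z)"

definition ER :: "(('a \<Rightarrow>\<^sub>0 'r) \<Rightarrow> 'b \<times> 'c \<Rightarrow>\<^sub>0 'r) \<Rightarrow> ('d \<times> 'a \<Rightarrow>\<^sub>0 'r::comm_ring_1) \<Rightarrow> 'd \<times> 'b \<times> 'c \<Rightarrow>\<^sub>0 'r" where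
  "ER A Z = tmap id (\<lambda>x. x) A Z"

definition cyc3 :: "('a \<times> 'a \<times> 'a \<Rightarrow>\<^sub>0 'r::comm_ring_1) \<Rightarrow> 'a \<times> 'a \<times> 'a \<Rightarrow>\<^sub>0 'r" where
  "cyc3 = lin (\<lambda>(u, v, w). basis (v, w, u))"

definition sw12 :: "('a \<times> 'a \<times> 'a \<Rightarrow>\<^sub>0 'r::comm_ring_1) \<Rightarrow> 'a \<times> 'a \<times> 'a \<Rightarrow>\<^sub>0 'r" where
  "sw12 = lin (\<lambda>(u, v, w). basis (v, u, w))"

definition sw23 :: "('a \<times> 'a \<times> 'a \<Rightarrow>\<^sub>0 'r::comm_ring_1) \<Rightarrow> 'a \<times> 'a \<times> 'a \<Rightarrow>\<^sub>0 'r" where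
  "sw23 = lin (\<lambda>(u, v, w). basis (u, w, v))"

lemma semilin_EL [simp, intro]: "semilin id (EL A)" and semilin_ER [simp, intro]: "semilin id (ER A)"
  and semilin_perm [simp, intro]: "semilin id cyc3" "semilin id sw12" "semilin id sw23"
  unfolding EL_def[abs_def] ER_def[abs_def] cyc3_def sw12_def sw23_def
  by (auto intro!: semilin_comp1[OF _ semilin_tassoc])

lemma EL_ten: "semilin id A \<Longrightarrow> EL A (ten f g) = tassoc (ten (A f) g)"
  by (simp add: EL_def tmap_ten)

lemma ER_ten: "semilin id A \<Longrightarrow> ER A (ten f g) = ten f (A g)"
  by (simp add: ER_def tmap_ten)

lemma sw12_tassoc: "sw12 (tassoc (ten Y g)) = tassoc (ten (tswap Y) g)"
  and cyc3_ten: "cyc3 (ten g Y) = tassoc (ten Y g)"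
  and sw23_ten: "sw23 (ten g Y) = ten g (tswap Y)"
proof -
  show "sw12 (tassoc (ten Y g)) = tassoc (ten (tswap Y) g)"
    by (rule bilin_ext[of id "\<lambda>Y g. sw12 (tassoc (ten Y g))" "\<lambda>Y g. tassoc (ten (tswap Y) g)"])
     (auto simp: sw12_def tassoc_def tswap_def intro!: semilin_comp2[OF _ semilin_lin] semilin_ten1 semilin_ten2 semilin_ten)
  show "cyc3 (ten g Y) = tassoc (ten Y g)"
    by (rule bilin_ext[of id "\<lambda>g Y. cyc3 (ten g Y)" "\<lambda>g Y. tassoc (ten Y g)"])
     (auto simp: cyc3_def tassoc_def intro!: semilin_comp2[OF _ semilin_lin] semilin_ten1 semilin_ten2 semilin_ten)
  show "sw23 (ten g Y) = ten g (tswap Y)"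
    by (rule bilin_ext[of id "\<lambda>g Y. sw23 (ten g Y)" "\<lambda>g Y. ten g (tswap Y)"])
     (auto simp: sw23_def tswap_def intro!: semilin_comp2[OF _ semilin_lin] semilin_ten1 semilin_ten2 semilin_ten)
qed

text \<open>Passing to the opposite coproduct, in the outer or in the inner position, becomes a
  permutation of the three factors. Together with coassociativity this makes every double coproduct
  a permutation of a single tensor.\<close>

lemma EL_tswap: "semilin id A \<Longrightarrow> EL (\<lambda>a. tswap (A a)) Z = sw12 (EL A Z)"
  and ER_tswap: "semilin id A \<Longrightarrow> ER (\<lambda>a. tswap (A a)) Y = sw23 (ER A Y)"
  and EL_arg_tswap: "semilin id A \<Longrightarrow> EL A (tswap Y) = cyc3 (ER A Y)"
proof -
  assume A: "semilin id A"
  then have s: "semilin id (\<lambda>a. tswap (A a))" by (rule semilin_comp1[OF _ semilin_tswap])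
  show "EL (\<lambda>a. tswap (A a)) Z = sw12 (EL A Z)"
    by (rule ten_ext[OF semilin_EL semilin_comp2[OF semilin_EL semilin_perm(2)]])
      (simp add: EL_ten[OF A] EL_ten[OF s] sw12_tassoc del: ten_basis)
  show "ER (\<lambda>a. tswap (A a)) Y = sw23 (ER A Y)"
    by (rule ten_ext[OF semilin_ER semilin_comp2[OF semilin_ER semilin_perm(3)]])
      (simp add: ER_ten[OF A] ER_ten[OF s] sw23_ten del: ten_basis)
  show "EL A (tswap Y) = cyc3 (ER A Y)"
    by (rule ten_ext[OF semilin_comp2[OF semilin_tswap semilin_EL] semilin_comp2[OF semilin_ER semilin_perm(1)]])
      (simp add: ER_ten[OF A] EL_ten[OF A] cyc3_ten del: ten_basis)
qed

lemma EL_fun: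
  assumes "semilin id A" "semilin id B"
  shows "EL (\<lambda>a. A a - B a) Z = EL A Z - EL B Z" "EL (\<lambda>a. scale c (A a)) Z = scale c (EL A Z)"
  by (rule ten_ext[OF semilin_EL semilin_lincomb(2)[OF semilin_EL semilin_EL]],
      simp add: EL_ten semilin_lincomb assms ten_linear semilinD[OF semilin_tassoc] del: ten_basis)
    (rule ten_ext[OF semilin_EL semilin_lincomb(4)[OF semilin_EL]],
      simp add: EL_ten semilin_lincomb assms ten_linear semilinD[OF semilin_tassoc] del: ten_basis)

lemma ER_fun:
  assumes "semilin id A" "semilin id B"
  shows "ER (\<lambda>a. A a - B a) Z = ER A Z - ER B Z" "ER (\<lambda>a. scale c (A a)) Z = scale c (ER A Z)"
  by (rule ten_ext[OF semilin_ER semilin_lincomb(2)[OF semilin_ER semilin_ER]],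
      simp add: ER_ten semilin_lincomb assms ten_linear del: ten_basis)
    (rule ten_ext[OF semilin_ER semilin_lincomb(4)[OF semilin_ER]],
      simp add: ER_ten semilin_lincomb assms ten_linear del: ten_basis)

context
  fixes f :: "nat list \<Rightarrow>\<^sub>0 'k::field poly"
begin

private abbreviation "Z \<equiv> EL (Dl hbar) (Dl hbar f)"

lemma DlLR_E: "DlL h = EL (Dl h)" "DlR h = ER (Dl h)"
  by (auto simp: DlL_def EL_def DlR_def ER_def)

private lemma ER_Z: "ER (Dl hbar) (Dl hbar f) = Z"
  using coassoc[of hbar f] by (simp add: DlLR_E)

private lemma tsw: "semilin id (\<lambda>a. tswap (Dl hbar a))"
  by (rule semilin_comp1[OF semilin_Dl semilin_tswap])

private lemma EL_dh: "scale hbar (EL dh Y) = EL (Dl hbar) Y - sw12 (EL (Dl hbar) Y)"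
  and ER_dh: "scale hbar (ER dh Y') = ER (Dl hbar) Y' - sw23 (ER (Dl hbar) Y')"
  using EL_fun(1)[OF semilin_Dl tsw, of hbar Y] EL_fun(2)[OF semilin_dh semilin_dh, of hbar Y]
    ER_fun(1)[OF semilin_Dl tsw, of hbar Y'] ER_fun(2)[OF semilin_dh semilin_dh, of hbar Y']
  by (simp_all add: scale_dh EL_tswap ER_tswap)

text \<open>Multiplied by hbar^2, the first summand is (1 - \<open>sw12\<close>) (1 -
  \<open>cyc3\<close>) Z, with Z the double coproduct of f, by coassociativity. The sum over the
  cyclic rotations telescopes, as conjugation by \<open>sw12\<close> inverts \<open>cyc3\<close>;
  finally hbar^2 is cancelled.\<close>

lemma dh_jacobi: "EL dh (dh f) + cyc3 (EL dh (dh f)) + cyc3 (cyc3 (EL dh (dh f))) = 0"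
proof -
  have "scale hbar (scale hbar (EL dh (dh f))) = scale hbar (EL dh (scale hbar (dh f)))"
    by (simp add: semilinD[OF semilin_EL] del: scale_simps(4))
  also have "\<dots> = Z - sw12 Z - (cyc3 Z - sw12 (cyc3 Z))"
    unfolding EL_dh unfolding scale_dh
    by (simp add: semilinD[OF semilin_EL] semilinD[OF semilin_perm(2)] EL_arg_tswap ER_Z)
  finally have J: "scale hbar (scale hbar (EL dh (dh f))) = Z - sw12 Z - (cyc3 Z - sw12 (cyc3 Z))" .
  define j where "j = (\<lambda>Z :: nat list \<times> nat list \<times> nat list \<Rightarrow>\<^sub>0 'k poly. Z - sw12 Z - (cyc3 Z - sw12 (cyc3 Z)))"
  have sj: "semilin id j" unfolding j_def
    by (intro semilin_lincomb semilin_id semilin_perm semilin_comp2[OF semilin_perm(1)])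
  have "j Y + cyc3 (j Y) + cyc3 (cyc3 (j Y)) = 0" for Y
  proof (rule semilin_ext[of id "\<lambda>Y. j Y + cyc3 (j Y) + cyc3 (cyc3 (j Y))" "\<lambda>_. 0"])
    show "semilin id (\<lambda>Y. j Y + cyc3 (j Y) + cyc3 (cyc3 (j Y)))"
      by (intro semilin_lincomb sj semilin_comp2[OF sj semilin_perm(1)]
          semilin_comp2[OF semilin_comp2[OF sj semilin_perm(1)] semilin_perm(1)])
    fix p :: "nat list \<times> nat list \<times> nat list"
    show "j (basis p) + cyc3 (j (basis p)) + cyc3 (cyc3 (j (basis p))) = 0"
      unfolding j_def semilinD[OF semilin_perm(1)] by (cases p) (simp add: cyc3_def sw12_def)
  qed (rule semilin_lincomb)
  from this[of Z] have "scale hbar (scale hbar (EL dh (dh f) + cyc3 (EL dh (dh f)) + cyc3 (cyc3 (EL dh (dh f))))) = 0"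
    unfolding j_def J[symmetric] by (simp add: semilinD[OF semilin_perm(1)] scale_linear)
  then show ?thesis using scale_hbar_inj[of _ 0] by (metis scale_simps(3))
qed

text \<open>Multiplied by hbar, the left side is Z - \<open>cyc3\<close> Z and the right side is (Z
  - \<open>sw23\<close> Z) + (\<open>sw23\<close> Z - \<open>sw23\<close> (\<open>sw12\<close> Z));
  they agree since \<open>sw23\<close> after \<open>sw12\<close> is \<open>cyc3\<close>.\<close>

lemma dh_leibniz: "EL (Dl hbar) (dh f) = ER dh (Dl hbar f) + sw23 (EL dh (Dl hbar f))"
proof (rule scale_hbar_inj)
  have "sw23 (sw12 Y) = cyc3 Y" for Y :: "nat list \<times> nat list \<times> nat list \<Rightarrow>\<^sub>0 'k poly"
    by (rule semilin_ext[OF semilin_comp2[OF semilin_perm(2) semilin_perm(3)] semilin_perm(1)])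
      (simp add: cyc3_def sw12_def sw23_def split: prod.splits)
  moreover have "scale hbar (EL (Dl hbar) (dh f)) = EL (Dl hbar) (scale hbar (dh f))"
    by (simp add: semilinD[OF semilin_EL])
  ultimately show "scale hbar (EL (Dl hbar) (dh f)) = scale hbar (ER dh (Dl hbar f) + sw23 (EL dh (Dl hbar f)))"
    using semilin_scale[OF semilin_perm(3), of hbar "EL dh (Dl hbar f)", symmetric]
    by (simp add: scale_linear EL_dh ER_dh ER_Z scale_dh semilinD[OF semilin_EL] EL_arg_tswap semilinD[OF semilin_perm(3)])
qed

end

lemma red_E:
  assumes "semilin id A" "semilin id B" "\<And>a. red (A a) = B (red a)"
  shows "red (EL A Z) = EL B (red Z)" "red (ER A Y) = ER B (red Y)"
proof -
  show "red (EL A Z) = EL B (red Z)"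
    by (rule ten_ext[OF semilin_comp2[OF semilin_EL semilin_red] semilin_comp1[OF semilin_red semilin_EL]])
      (simp add: EL_ten assms red_ten red_tassoc del: ten_basis)
  show "red (ER A Y) = ER B (red Y)"
    by (rule ten_ext[OF semilin_comp2[OF semilin_ER semilin_red] semilin_comp1[OF semilin_red semilin_ER]])
      (simp add: ER_ten assms red_ten del: ten_basis)
qed

lemma red_perm: "red (cyc3 Z) = cyc3 (red Z)" "red (sw23 Z) = sw23 (red Z)"
  by (rule semilin_ext[OF semilin_comp2[OF semilin_perm(1) semilin_red] semilin_comp1[OF semilin_red semilin_perm(1)]],
      simp add: cyc3_def split: prod.splits)
    (rule semilin_ext[OF semilin_comp2[OF semilin_perm(3) semilin_red] semilin_comp1[OF semilin_red semilin_perm(3)]],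
      simp add: sw23_def split: prod.splits)

lemma db_jacobi: "EL db (db f) + cyc3 (EL db (db f)) + cyc3 (cyc3 (EL db (db f))) = 0"
proof -
  have "red (EL dh (dh (lift f))) = EL db (db f)"
    by (simp add: red_E(1)[OF semilin_dh semilin_db] flip: db_red)
  then show ?thesis using arg_cong[OF dh_jacobi[of "lift f"], of red] by (simp add: red_simps red_perm)
qed

lemma db_leibniz: "EL (Dl 0) (db f) = ER db (Dl 0 f) + sw23 (EL db (Dl 0 f))"
  using arg_cong[OF dh_leibniz[of "lift f"], of red]
  by (simp add: red_simps red_perm red_E[OF semilin_dh semilin_db] red_E[OF semilin_Dl semilin_Dl]
      flip: db_red Dl_red)

section \<open>Modules with coordinates\<close>

text \<open>All modules that occur embed into free modules; a coordinate map \<open>c\<close> turns identities between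
  formal tensors into identities in a tensor product of free modules.\<close>

lemma free_alg_simps [simp]:
  "carrier (free_alg V) = {f. \<forall>w\<in>supp f. set w \<subseteq> V}" "monoid.mult (free_alg V) = (*)" "one (free_alg V) = 1"
  "ring.zero (free_alg V) = 0" "add (free_alg V) = (+)" "module.smult (free_alg V) = scale"
  by (simp_all add: free_alg_def)

lemma free_alg_carrier: "f \<in> carrier (free_alg V) \<longleftrightarrow> supin (lists V) f"
  by (auto simp: supin_def)

locale coord =
  fixes M :: "('r::comm_ring_1, 'a, 'm) module_scheme" and c :: "'a \<Rightarrow> 'b \<Rightarrow>\<^sub>0 'r"
  assumes zero_closed [simp]: "\<zero>\<^bsub>M\<^esub> \<in> carrier M"
    and add_closed [simp]: "x \<in> carrier M \<Longrightarrow> y \<in> carrier M \<Longrightarrow> x \<oplus>\<^bsub>M\<^esub> y \<in> carrier M"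
    and smult_closed [simp]: "x \<in> carrier M \<Longrightarrow> a \<odot>\<^bsub>M\<^esub> x \<in> carrier M"
    and c_zero [simp]: "c \<zero>\<^bsub>M\<^esub> = 0"
    and c_add [simp]: "x \<in> carrier M \<Longrightarrow> y \<in> carrier M \<Longrightarrow> c (x \<oplus>\<^bsub>M\<^esub> y) = c x + c y"
    and c_smult [simp]: "x \<in> carrier M \<Longrightarrow> c (a \<odot>\<^bsub>M\<^esub> x) = scale a (c x)"
    and c_inj: "inj_on c (carrier M)"
begin

lemma c_eqI: "x \<in> carrier M \<Longrightarrow> y \<in> carrier M \<Longrightarrow> c x = c y \<Longrightarrow> x = y"
  using c_inj by (auto dest: inj_onD)

lemma is_abelian_group: "abelian_group M"
proof (rule abelian_groupI)
  fix x assume x: "x \<in> carrier M"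
  have "((- 1) \<odot>\<^bsub>M\<^esub> x) \<oplus>\<^bsub>M\<^esub> x = \<zero>\<^bsub>M\<^esub>" using x by (intro c_eqI) (auto simp: scale_linear)
  then show "\<exists>y\<in>carrier M. y \<oplus>\<^bsub>M\<^esub> x = \<zero>\<^bsub>M\<^esub>" using x smult_closed by blast
qed (auto intro!: c_eqI simp: algebra_simps)

sublocale abelian_group M by (rule is_abelian_group)

lemma is_module: "module (ring_of_type_algebra :: 'r ring) M"
proof (rule moduleI)
  show "cring (ring_of_type_algebra :: 'r ring)" by (rule cring_from_type_algebra)
qed (auto intro!: c_eqI is_abelian_group simp: ring_of_type_algebra_def scale_linear)

lemma c_a_inv: "x \<in> carrier M \<Longrightarrow> c (\<ominus>\<^bsub>M\<^esub> x) = - c x"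
  using c_add[of "\<ominus>\<^bsub>M\<^esub> x" x] by (simp add: l_neg eq_neg_iff_add_eq_0)

lemma c_minus: "x \<in> carrier M \<Longrightarrow> y \<in> carrier M \<Longrightarrow> c (x \<ominus>\<^bsub>M\<^esub> y) = c x - c y"
  by (simp add: a_minus_def c_a_inv)

lemma c_finsum: "finite I \<Longrightarrow> (\<And>i. i \<in> I \<Longrightarrow> f i \<in> carrier M) \<Longrightarrow> c (\<Oplus>\<^bsub>M\<^esub>i\<in>I. f i) = (\<Sum>i\<in>I. c (f i))"
  by (induction I rule: finite_induct) (auto simp: finsum_insert Pi_def)

lemma finsum_in: "(\<And>i. i \<in> I \<Longrightarrow> f i \<in> carrier M) \<Longrightarrow> (\<Oplus>\<^bsub>M\<^esub>i\<in>I. f i) \<in> carrier M"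
  by (intro finsum_closed) auto

lemma mspan_carrier: "S \<subseteq> carrier M \<Longrightarrow> x \<in> mspan M S \<Longrightarrow> x \<in> carrier M"
  by (rotate_tac, induction rule: mspan.induct) auto

end

subsection \<open>Formal tensors\<close>

text \<open>The target is the tensor algebra of a free module, that is, a free algebra; each entry
  of a list is replaced by its coordinates. No length has to be fixed at this stage;
  \<open>pr2\<close> and \<open>pr3\<close> then extract the tensors of order two and three as pairs
  and triples.\<close>

definition tl :: "('a \<Rightarrow> 'b \<Rightarrow>\<^sub>0 'r::comm_ring_1) \<Rightarrow> ('a list \<Rightarrow>\<^sub>0 'r) \<Rightarrow> 'b list \<Rightarrow>\<^sub>0 'r" where
  "tl c = alg id (\<lambda>x. lin (\<lambda>w. gen w) (c x))"

definition pr2 :: "('b list \<Rightarrow>\<^sub>0 'r::comm_ring_1) \<Rightarrow> 'b \<times> 'b \<Rightarrow>\<^sub>0 'r" where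
  "pr2 = lin (\<lambda>ws. if length ws = 2 then basis (ws ! 0, ws ! 1) else 0)"

definition pr3 :: "('b list \<Rightarrow>\<^sub>0 'r::comm_ring_1) \<Rightarrow> 'b \<times> 'b \<times> 'b \<Rightarrow>\<^sub>0 'r" where
  "pr3 = lin (\<lambda>ws. if length ws = 3 then basis (ws ! 0, ws ! 1, ws ! 2) else 0)"

definition tev2 :: "('a \<Rightarrow> 'b \<Rightarrow>\<^sub>0 'r::comm_ring_1) \<Rightarrow> ('a list \<Rightarrow>\<^sub>0 'r) \<Rightarrow> 'b \<times> 'b \<Rightarrow>\<^sub>0 'r" where
  "tev2 c f = pr2 (tl c f)"

definition tev3 :: "('a \<Rightarrow> 'b \<Rightarrow>\<^sub>0 'r::comm_ring_1) \<Rightarrow> ('a list \<Rightarrow>\<^sub>0 'r) \<Rightarrow> 'b \<times> 'b \<times> 'b \<Rightarrow>\<^sub>0 'r" where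
  "tev3 c f = pr3 (tl c f)"

lemma ringmap_tl [simp]: "ringmap id (tl c)" and semilin_tl [simp, intro]: "semilin id (tl c)"
  by (simp_all add: tl_def ringmapD)

lemma semilin_tev [simp, intro]: "semilin id (tev2 c)" "semilin id (tev3 c)"
  unfolding tev2_def[abs_def] tev3_def[abs_def] pr2_def pr3_def
  by (rule semilin_comp1[OF semilin_tl semilin_lin])+

lemmas tev_simps = semilinD[OF semilin_tev(1), unfolded id_apply] semilinD[OF semilin_tev(2), unfolded id_apply]

lemma tev2_basis: "tev2 c (basis [x, y]) = ten (c x) (c y)"
proof -
  have "pr2 (lin gen p * lin gen q) = ten p q" for p q :: "'a \<Rightarrow>\<^sub>0 'b"
    by (rule bilin_ext[of id "\<lambda>p q. pr2 (lin gen p * lin gen q)" ten])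
      (auto simp: pr2_def gen_def basis_mult plus_list_def intro!: semilin_ten1 semilin_ten2
        semilin_comp2[OF semilin_mult(1)[OF semilin_lin] semilin_lin] semilin_comp2[OF semilin_mult(2)[OF semilin_lin] semilin_lin]
        simp del: mult_single)
  then show ?thesis by (simp add: tev2_def tl_def)
qed

lemma semilin_pr3: "semilin id pr3"
  by (simp add: pr3_def)

lemma tev3_basis: "tev3 c (basis [x, y, z]) = ten (c x) (ten (c y) (c z))"
proof -
  have 1: "pr3 (basis [v] * (lin gen p * lin gen q)) = ten (basis v) (ten p q)" for p q :: "'a \<Rightarrow>\<^sub>0 'b" and v
    by (rule bilin_ext[of id "\<lambda>p q. pr3 (basis [v] * (lin gen p * lin gen q))" "\<lambda>p q. ten (basis v) (ten p q)"])
      (auto simp: pr3_def gen_def basis_mult plus_list_def intro!: semilin_ten semilin_ten1 semilin_ten2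
        semilin_comp2[OF semilin_mult(1)[OF semilin_mult(1)[OF semilin_lin]] semilin_lin] semilin_comp2[OF semilin_mult(1)[OF semilin_mult(2)[OF semilin_lin]] semilin_lin]
        simp del: mult_single)
  have "pr3 (lin gen o' * (lin gen p * lin gen q)) = ten o' (ten p q)" for o' p q :: "'a \<Rightarrow>\<^sub>0 'b"
    by (rule semilin_ext[OF semilin_comp2[OF semilin_mult(2)[OF semilin_lin] semilin_pr3] semilin_ten1])
      (simp add: gen_def 1)
  then show ?thesis by (simp add: tev3_def tl_def)
qed

definition tlists :: "nat \<Rightarrow> ('r::comm_ring_1, 'a, 'm) module_scheme \<Rightarrow> 'a list set" where
  "tlists n M = {xs. length xs = n \<and> set xs \<subseteq> carrier M}"

lemma ftens_supin: "f \<in> ftens n M \<longleftrightarrow> supin (tlists n M) f"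
  by (auto simp: ftens_def tlists_def supin_def)

lemma tlists2E:
  assumes "xs \<in> tlists 2 M" obtains x y where "xs = [x, y]" "x \<in> carrier M" "y \<in> carrier M"
  using assms by (auto simp: tlists_def length_Suc_conv numeral_2_eq_2)

lemma tlists3E:
  assumes "xs \<in> tlists 3 M" obtains x y z where "xs = [x, y, z]" "x \<in> carrier M" "y \<in> carrier M" "z \<in> carrier M"
  using assms by (auto simp: tlists_def length_Suc_conv numeral_3_eq_3)

lemma tlistsI [simp]:
  "x \<in> carrier M \<Longrightarrow> y \<in> carrier M \<Longrightarrow> [x, y] \<in> tlists 2 M"
  "x \<in> carrier M \<Longrightarrow> y \<in> carrier M \<Longrightarrow> z \<in> carrier M \<Longrightarrow> [x, y, z] \<in> tlists 3 M"
  by (auto simp: tlists_def)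

lemma ftens_closed [simp]:
  "0 \<in> ftens n M" "f \<in> ftens n M \<Longrightarrow> g \<in> ftens n M \<Longrightarrow> f + g \<in> ftens n M"
  "f \<in> ftens n M \<Longrightarrow> g \<in> ftens n M \<Longrightarrow> f - g \<in> ftens n M" "f \<in> ftens n M \<Longrightarrow> - f \<in> ftens n M"
  "f \<in> ftens n M \<Longrightarrow> scale a f \<in> ftens n M" "xs \<in> tlists n M \<Longrightarrow> basis xs \<in> ftens n M"
  by (simp_all add: ftens_supin)

lemma ftens_sum: "(\<And>i. i \<in> I \<Longrightarrow> k i \<in> ftens n M) \<Longrightarrow> sum k I \<in> ftens n M"
  unfolding ftens_supin by (rule supin_sum)

lemma ftens_slin:
  assumes "rhom \<rho>" "f \<in> ftens m M" "\<And>xs. xs \<in> tlists m M \<Longrightarrow> h xs \<in> ftens n M'"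
  shows "slin \<rho> h f \<in> ftens n M'"
proof -
  have "supin (tlists m M) f" using assms(2) by (simp add: ftens_supin)
  then show ?thesis
    unfolding ftens_supin by (rule supin_semilin[OF semilin_slin[OF assms(1)]]) (use assms in \<open>simp add: ftens_supin\<close>)
qed

lemma ftens_wedge [simp]: "x \<in> carrier M \<Longrightarrow> y \<in> carrier M \<Longrightarrow> wedge x y \<in> ftens 2 M"
  by (simp add: wedge_def)

lemma ftens_mult: "f \<in> ftens m M \<Longrightarrow> g \<in> ftens n M \<Longrightarrow> f * g \<in> ftens (m + n) M"
  unfolding ftens_supin by (erule supin_mult) (auto simp: tlists_def plus_list_def)

lemma tensor_semilin_eq:
  assumes "f \<in> ftens n M" "semilin \<rho> F" "semilin \<rho> G" "\<And>xs. xs \<in> tlists n M \<Longrightarrow> F (basis xs) = G (basis xs)"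
  shows "F f = G f"
  by (rule semilin_ext_on[OF assms(2,3)], rule assms(4)) (use assms(1) in \<open>auto simp: ftens_supin supin_def\<close>)

lemma tmult_lin: "tmult A f g = lin (\<lambda>xs. lin (\<lambda>ys. basis (map2 (monoid.mult A) xs ys)) g) f"
  by (simp add: tmult_def lin_def scale_sum)

lemma semilin_tmult: "semilin id (\<lambda>f. tmult A f g)" "semilin id (tmult A f)"
proof -
  show "semilin id (\<lambda>f. tmult A f g)" by (simp add: tmult_lin)
  have 1: "(\<lambda>f. tmult A f g) = lin (\<lambda>xs. lin (\<lambda>ys. basis (map2 (monoid.mult A) xs ys)) g)" for g
    by (simp add: tmult_lin fun_eq_iff)
  show "semilin id (tmult A f)"
    unfolding semilin_def
  proof (intro conjI allI)
    fix g h :: "'b list \<Rightarrow>\<^sub>0 'a" and a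
    show "tmult A f (g + h) = tmult A f g + tmult A f h"
      by (rule semilin_ext[of id "\<lambda>f. tmult A f (g + h)" "\<lambda>f. tmult A f g + tmult A f h"])
        (auto simp: tmult_lin semilinD[OF semilin_lin] intro!: semilin_lincomb(1))
    show "tmult A f (scale a g) = scale (id a) (tmult A f g)"
      by (rule semilin_ext[of id "\<lambda>f. tmult A f (scale a g)" "\<lambda>f. scale (id a) (tmult A f g)"])
        (auto simp: tmult_lin semilinD[OF semilin_lin] intro!: semilin_lincomb(4))
  qed
qed

lemma tmult_basis [simp]: "tmult A (basis [x, y]) (basis [x', y']) = basis [x \<otimes>\<^bsub>A\<^esub> x', y \<otimes>\<^bsub>A\<^esub> y']"
  by (simp add: tmult_lin)

lemma ftens_tmult:
  assumes "f \<in> ftens 2 A" "g \<in> ftens 2 A" "\<And>x y. x \<in> carrier A \<Longrightarrow> y \<in> carrier A \<Longrightarrow> x \<otimes>\<^bsub>A\<^esub> y \<in> carrier A"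
  shows "tmult A f g \<in> ftens 2 A"
  unfolding tmult_lin lin_slin
proof (rule ftens_slin[OF rhom_id(1) assms(1)], rule ftens_slin[OF rhom_id(1) assms(2)])
  fix xs ys assume "xs \<in> tlists 2 A" "ys \<in> tlists 2 A"
  then show "basis (map2 (monoid.mult A) xs ys) \<in> ftens 2 A"
    by (elim tlists2E) (simp add: assms(3))
qed

lemma tev2_tmult:
  assumes f: "f \<in> ftens 2 A" and g: "g \<in> ftens 2 A"
    and m: "\<And>x y. x \<in> carrier A \<Longrightarrow> y \<in> carrier A \<Longrightarrow> c (x \<otimes>\<^bsub>A\<^esub> y) = c x * c y"
  shows "tev2 c (tmult A f g) = tev2 c f * tev2 c g"
proof (rule tensor_semilin_eq[OF f, of id "\<lambda>f. tev2 c (tmult A f g)" "\<lambda>f. tev2 c f * tev2 c g"])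
  fix xs assume xs: "xs \<in> tlists 2 A"
  show "tev2 c (tmult A (basis xs) g) = tev2 c (basis xs) * tev2 c g"
  proof (rule tensor_semilin_eq[OF g, of id "\<lambda>g. tev2 c (tmult A (basis xs) g)" "\<lambda>g. tev2 c (basis xs) * tev2 c g"])
    show "ys \<in> tlists 2 A \<Longrightarrow> tev2 c (tmult A (basis xs) (basis ys)) = tev2 c (basis xs) * tev2 c (basis ys)" for ys
      using xs by (elim tlists2E) (simp add: m tev2_basis ten_mult)
  qed (auto intro!: semilin_mult semilin_comp2[OF semilin_tmult(2)])
qed (auto intro!: semilin_mult semilin_comp2[OF semilin_tmult(1)])

lemma ftens_push:
  assumes "rhom \<rho>" "f \<in> ftens 2 M" "\<And>x. x \<in> carrier M \<Longrightarrow> h x \<in> carrier M'"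
  shows "push \<rho> h f \<in> ftens 2 M'"
  unfolding push_slin[OF assms(1)] by (rule ftens_slin[OF assms(1,2)]) (auto elim!: tlists2E simp: assms)

lemma tev2_push:
  assumes "rhom \<rho>" "f \<in> ftens 2 M" "semilin \<rho> F" "\<And>x. x \<in> carrier M \<Longrightarrow> c' (h x) = F (c x)"
  shows "tev2 c' (push \<rho> h f) = tmap \<rho> F F (tev2 c f)"
  unfolding push_slin[OF assms(1)]
  by (rule tensor_semilin_eq[OF assms(2) semilin_comp1[OF semilin_slin[OF assms(1)] semilin_tev(1)]
      semilin_comp2[OF semilin_tev(1) semilin_tmap[OF assms(1)]]])
    (auto elim!: tlists2E simp: assms tev2_basis tmap_ten)

lemma tmap_id [simp]: "tmap id (\<lambda>x. x) (\<lambda>x. x) f = f"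
  by (rule ten_ext[OF semilin_tmap[OF rhom_id(1)] semilin_id(1)]) (simp add: tmap_ten del: ten_basis)

lemma tev2_push_id:
  assumes "f \<in> ftens 2 M" "\<And>x. x \<in> carrier M \<Longrightarrow> c' (h x) = c x"
  shows "tev2 c' (push id h f) = tev2 c f"
  using tev2_push[OF rhom_id(1) assms(1) semilin_id(1), where c = c and c' = c' and h = h] assms(2) by simp

lemma ftens_flip: "f \<in> ftens 2 M \<Longrightarrow> flip f \<in> ftens 2 M"
  unfolding flip_def lin_slin by (erule ftens_slin[OF rhom_id(1)]) (auto elim!: tlists2E)

lemma tev2_flip: "f \<in> ftens 2 M \<Longrightarrow> tev2 c (flip f) = tswap (tev2 c f)"
  unfolding flip_def
  by (erule tensor_semilin_eq[OF _ semilin_comp2[OF semilin_lin semilin_tev(1)] semilin_comp2[OF semilin_tev(1) semilin_tswap]])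
    (auto elim!: tlists2E simp: tev2_basis)

lemma tev3_mult:
  assumes "f \<in> ftens 2 M"
  shows "tev3 c (f * basis [y]) = tassoc (ten (tev2 c f) (c y))" "tev3 c (basis [y] * f) = ten (c y) (tev2 c f)"
proof -
  show "tev3 c (f * basis [y]) = tassoc (ten (tev2 c f) (c y))"
    by (rule tensor_semilin_eq[OF assms semilin_comp2[OF semilin_mult(2)[OF semilin_id(1)] semilin_tev(2)]
      semilin_comp2[OF semilin_comp2[OF semilin_tev(1) semilin_ten1] semilin_tassoc]])
     (auto elim!: tlists2E simp: tev2_basis tev3_basis basis_mult plus_list_def simp del: mult_single)
  show "tev3 c (basis [y] * f) = ten (c y) (tev2 c f)"
    by (rule tensor_semilin_eq[OF assms semilin_comp2[OF semilin_mult(1)[OF semilin_id(1)] semilin_tev(2)]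
      semilin_comp2[OF semilin_tev(1) semilin_ten2]])
     (auto elim!: tlists2E simp: tev2_basis tev3_basis basis_mult plus_list_def simp del: mult_single)
qed

lemma ftens_on_left: "f \<in> ftens 2 M \<Longrightarrow> (\<And>x. x \<in> carrier M \<Longrightarrow> d x \<in> ftens 2 M) \<Longrightarrow> on_left d f \<in> ftens 3 M"
  and ftens_on_right: "f \<in> ftens 2 M \<Longrightarrow> (\<And>x. x \<in> carrier M \<Longrightarrow> d x \<in> ftens 2 M) \<Longrightarrow> on_right d f \<in> ftens 3 M"
proof -
  assume f: "f \<in> ftens 2 M" and d: "\<And>x. x \<in> carrier M \<Longrightarrow> d x \<in> ftens 2 M"
  have 1: "basis [y] \<in> ftens (Suc 0) M" if "y \<in> carrier M" for y using that by (simp add: tlists_def)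
  show "on_left d f \<in> ftens 3 M" unfolding on_left_def lin_slin
    by (rule ftens_slin[OF rhom_id(1) f]) (auto elim!: tlists2E simp: numeral_3_eq_3 intro!: ftens_mult[of _ 2 _ _ 1, simplified] d 1)
  show "on_right d f \<in> ftens 3 M" unfolding on_right_def lin_slin
    by (rule ftens_slin[OF rhom_id(1) f]) (auto elim!: tlists2E simp: numeral_3_eq_3 intro!: ftens_mult[of _ 1 _ _ 2, simplified] d 1)
qed

lemma tev3_on:
  assumes "f \<in> ftens 2 M" "semilin id D" "\<And>x. x \<in> carrier M \<Longrightarrow> d x \<in> ftens 2 M" "\<And>x. x \<in> carrier M \<Longrightarrow> tev2 c (d x) = D (c x)"
  shows "tev3 c (on_left d f) = EL D (tev2 c f)" "tev3 c (on_right d f) = ER D (tev2 c f)"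
proof -
  show "tev3 c (on_left d f) = EL D (tev2 c f)" unfolding on_left_def
    by (rule tensor_semilin_eq[OF assms(1) semilin_comp2[OF semilin_lin semilin_tev(2)] semilin_comp2[OF semilin_tev(1) semilin_EL]])
      (auto elim!: tlists2E simp: tev3_mult[OF assms(3)] EL_ten[OF assms(2)] tev2_basis assms(4))
  show "tev3 c (on_right d f) = ER D (tev2 c f)" unfolding on_right_def
    by (rule tensor_semilin_eq[OF assms(1) semilin_comp2[OF semilin_lin semilin_tev(2)] semilin_comp2[OF semilin_tev(1) semilin_ER]])
      (auto elim!: tlists2E simp: tev3_mult[OF assms(3)] ER_ten[OF assms(2)] tev2_basis assms(4))
qed

lemma cyc3_ten3: "cyc3 (ten f (ten g h)) = ten g (ten h f)" and sw23_ten3: "sw23 (ten f (ten g h)) = ten f (ten h g)"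
  by (simp_all add: cyc3_ten sw23_ten)

lemma ftens_cyc: "f \<in> ftens 3 M \<Longrightarrow> cyc f \<in> ftens 3 M" and ftens_swap23: "f \<in> ftens 3 M \<Longrightarrow> swap23 f \<in> ftens 3 M"
  unfolding cyc_def swap23_def lin_slin by (erule ftens_slin[OF rhom_id(1)]; auto elim!: tlists3E)+

lemma tev3_cyc: "f \<in> ftens 3 M \<Longrightarrow> tev3 c (cyc f) = cyc3 (tev3 c f)"
  unfolding cyc_def
  by (erule tensor_semilin_eq[OF _ semilin_comp2[OF semilin_lin semilin_tev(2)] semilin_comp2[OF semilin_tev(2) semilin_perm(1)]])
    (auto elim!: tlists3E simp: tev3_basis cyc3_ten3)

lemma tev3_swap23: "f \<in> ftens 3 M \<Longrightarrow> tev3 c (swap23 f) = sw23 (tev3 c f)"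
  unfolding swap23_def
  by (erule tensor_semilin_eq[OF _ semilin_comp2[OF semilin_lin semilin_tev(2)] semilin_comp2[OF semilin_tev(2) semilin_perm(3)]])
    (auto elim!: tlists3E simp: tev3_basis sw23_ten3)

subsection \<open>Equality of formal tensors\<close>

lemma mspan_free_simps:
  fixes S :: "('a list \<Rightarrow>\<^sub>0 'r::comm_ring_1) set"
  shows "0 \<in> mspan (free_alg UNIV) S" "f \<in> mspan (free_alg UNIV) S \<Longrightarrow> g \<in> mspan (free_alg UNIV) S \<Longrightarrow> f + g \<in> mspan (free_alg UNIV) S"
   "f \<in> mspan (free_alg UNIV) S \<Longrightarrow> scale a f \<in> mspan (free_alg UNIV) S"
  using mspan.zero[of "free_alg UNIV"] mspan.add[of f "free_alg UNIV" S g] mspan.smult[of f "free_alg UNIV" S a] by auto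

lemma teq_refl [simp]: "teq M f f"
  by (simp add: teq_def mspan_free_simps)

lemma teq_add: "teq M f g \<Longrightarrow> teq M f' g' \<Longrightarrow> teq M (f + f') (g + g')"
  unfolding teq_def by (drule (1) mspan_free_simps(2)) (simp add: algebra_simps)

lemma teq_scale: "teq M f g \<Longrightarrow> teq M (scale a f) (scale a g)"
  unfolding teq_def by (drule mspan_free_simps(3)[of _ _ a]) (simp add: scale_linear)

lemma teq_sym: "teq M f g \<Longrightarrow> teq M g f"
  unfolding teq_def by (drule mspan_free_simps(3)[of _ _ "-1"]) (simp add: scale_linear)

lemma teq_trans [trans]: "teq M f g \<Longrightarrow> teq M g h \<Longrightarrow> teq M f h"
  unfolding teq_def by (drule (1) mspan_free_simps(2)) simp

lemma teq_sum: "(\<And>i. i \<in> I \<Longrightarrow> teq M (h i) (k i)) \<Longrightarrow> teq M (sum h I) (sum k I)"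
  by (induction I rule: infinite_finite_induct) (auto intro: teq_add)

text \<open>A multilinearity relation with further factors on both sides is again one, with longer
  neighbours u and v. The factors are taken over the carrier because the relations are imposed only
  there.\<close>

lemma teq_mult:
  fixes M :: "('r::comm_ring_1, 'a, 'm) module_scheme"
  assumes "teq M f f'" "supin (lists (carrier M)) g" "supin (lists (carrier M)) h"
  shows "teq M (g * f * h) (g * f' * h)"
proof -
  let ?S = "mspan (free_alg UNIV) (tensor_rels M)"
  have sem: "F q \<in> ?S" if "semilin id F" "\<And>w. w \<in> lists (carrier M) \<Longrightarrow> F (basis w) \<in> ?S" "supin (lists (carrier M)) q" for F q
  proof -
    have "(\<Sum>w\<in>I. scale (coef q w) (F (basis w))) \<in> ?S" if "I \<subseteq> lists (carrier M)" for I
      using that \<open>\<And>w. w \<in> lists (carrier M) \<Longrightarrow> F (basis w) \<in> ?S\<close>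
      by (induction I rule: infinite_finite_induct) (auto intro!: mspan_free_simps)
    then show ?thesis unfolding semilin_expand[OF that(1), of q] id_apply using that(3) by (simp add: supin_def)
  qed
  have "basis u * q * basis v \<in> ?S" if u: "u \<in> lists (carrier M)" and v: "v \<in> lists (carrier M)" and q: "q \<in> ?S" for u v q
    using q
  proof (induction rule: mspan.induct)
    case (base x)
    have b: "basis u * basis (a @ b # d) * basis v = (basis ((u @ a) @ b # (d @ v)) :: _ \<Rightarrow>\<^sub>0 'r)" for a b d
      by (simp add: basis_append basis_Cons mult.assoc)
    have r: "p \<in> tensor_rels M \<Longrightarrow> p \<in> ?S" for p by (rule mspan.base)
    have "basis u * x * basis v \<in> tensor_rels M"
      using base unfolding tensor_rels_def
    proof (elim UnE CollectE exE conjE)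
      fix a y z d assume *: "x = basis (a @ (y \<oplus>\<^bsub>M\<^esub> z) # d) - basis (a @ y # d) - basis (a @ z # d)"
        "set a \<subseteq> carrier M" "y \<in> carrier M" "z \<in> carrier M" "set d \<subseteq> carrier M"
      then show "basis u * x * basis v \<in> {basis (u @ (x \<oplus>\<^bsub>M\<^esub> y) # v) - basis (u @ x # v) - basis (u @ y # v) | u x y v.
        set u \<subseteq> carrier M \<and> x \<in> carrier M \<and> y \<in> carrier M \<and> set v \<subseteq> carrier M} \<union>
     {basis (u @ (c \<odot>\<^bsub>M\<^esub> x) # v) - scale c (basis (u @ x # v)) | u c x v.
        set u \<subseteq> carrier M \<and> x \<in> carrier M \<and> set v \<subseteq> carrier M}"
        using u v by (intro UnI1 CollectI exI[of _ "u @ a"] exI[of _ y] exI[of _ z] exI[of _ "d @ v"])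
          (simp only: *(1) right_diff_distrib left_diff_distrib b, auto)
    next
      fix a y z d assume *: "x = basis (a @ (y \<odot>\<^bsub>M\<^esub> z) # d) - scale y (basis (a @ z # d))"
        "set a \<subseteq> carrier M" "z \<in> carrier M" "set d \<subseteq> carrier M"
      then show "basis u * x * basis v \<in> {basis (u @ (x \<oplus>\<^bsub>M\<^esub> y) # v) - basis (u @ x # v) - basis (u @ y # v) | u x y v.
        set u \<subseteq> carrier M \<and> x \<in> carrier M \<and> y \<in> carrier M \<and> set v \<subseteq> carrier M} \<union>
     {basis (u @ (c \<odot>\<^bsub>M\<^esub> x) # v) - scale c (basis (u @ x # v)) | u c x v.
        set u \<subseteq> carrier M \<and> x \<in> carrier M \<and> set v \<subseteq> carrier M}"
        using u v by (intro UnI2 CollectI exI[of _ "u @ a"] exI[of _ y] exI[of _ z] exI[of _ "d @ v"])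
          (simp only: *(1) right_diff_distrib left_diff_distrib scale_mult b, auto)
    qed
    then show ?case by (rule r)
  qed (auto simp: algebra_simps intro: mspan_free_simps)
  then have "basis u * (f - f') * h \<in> ?S" if "u \<in> lists (carrier M)" for u
    using that assms(1) by (intro sem[OF semilin_mult(1)[OF semilin_id(1)] _ assms(3)]) (auto simp: teq_def)
  then have "g * (f - f') * h \<in> ?S"
    by (intro sem[of "\<lambda>g. g * (f - f') * h", OF semilin_mult(2)[OF semilin_mult(2)[OF semilin_id(1)]] _ assms(2)])
  then show ?thesis by (simp add: teq_def algebra_simps)
qed

context coord
begin

text \<open>The easy direction: coordinates respect multilinearity. The converse is obtained from
  the retraction in \<open>coord_r\<close>.\<close>

lemma teq_tl:
  assumes "teq M f g" shows "tl c f = tl c g"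
proof -
  have "tl c p = 0" if "p \<in> mspan (free_alg UNIV) (tensor_rels M)" for p
    using that
  proof (induction rule: mspan.induct)
    case (base p)
    have t: "tl c (basis (u @ x # v)) = tl c (basis u) * (lin gen (c x) * tl c (basis v))" for u x v
      by (simp add: basis_append basis_Cons ringmapD(3)[OF ringmap_tl]) (simp add: tl_def)
    show ?case using base unfolding tensor_rels_def
      by (elim UnE CollectE exE conjE; hypsubst)
        (simp_all add: t semilinD[OF semilin_tl] semilinD[OF semilin_lin] algebra_simps del: scale_simps(5))
  qed (auto simp: semilinD[OF semilin_tl])
  then have "tl c (f - g) = 0" using assms by (simp add: teq_def)
  then show ?thesis by (simp add: semilinD[OF semilin_tl])
qed

lemma teq_tev: "teq M f g \<Longrightarrow> tev2 c f = tev2 c g" "teq M f g \<Longrightarrow> tev3 c f = tev3 c g"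
  by (auto simp: tev2_def tev3_def dest: teq_tl)

end

text \<open>The retraction r makes M a direct summand of the free module on W, so tensor powers of c
  remain injective; over k[hbar], injectivity of c alone would not give this. Surjectivity is not
  imposed, since the coordinates of the free Lie algebra form a proper subspace of the free
  algebra.\<close>

locale coord_r = coord M c for M :: "('r::comm_ring_1, 'a, 'm) module_scheme" and c :: "'a \<Rightarrow> 'b \<Rightarrow>\<^sub>0 'r" +
  fixes r :: "('b \<Rightarrow>\<^sub>0 'r) \<Rightarrow> 'a" and W :: "'b set"
  assumes r_closed [simp]: "supin W p \<Longrightarrow> r p \<in> carrier M"
    and r_add: "supin W p \<Longrightarrow> supin W q \<Longrightarrow> r (p + q) = r p \<oplus>\<^bsub>M\<^esub> r q"
    and r_scale: "supin W p \<Longrightarrow> r (scale a p) = a \<odot>\<^bsub>M\<^esub> r p"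
    and rc [simp]: "x \<in> carrier M \<Longrightarrow> r (c x) = x"
    and c_W [simp]: "x \<in> carrier M \<Longrightarrow> supin W (c x)"
begin

text \<open>Linearity of r turns into multilinearity relations with a single slot, two for each
  summand. The empty sum has its own argument: the formal tensor of r 0 vanishes because r 0 is 0
  times itself.\<close>

lemma r_ftens:
  assumes "supin W p"
  shows "teq M (lin (\<lambda>w. basis [r (basis w)]) p) (basis [r p])"
proof -
  have z: "teq M 0 (basis [r 0])"
  proof -
    have "basis [0 \<odot>\<^bsub>M\<^esub> r 0] - scale 0 (basis [r 0]) \<in> tensor_rels M"
      unfolding tensor_rels_def by (rule UnI2, rule CollectI, intro exI[of _ "[]"] exI[of _ 0] exI[of _ "r 0"]) auto
    then have "teq M (basis [0 \<odot>\<^bsub>M\<^esub> r 0]) 0" by (simp add: teq_def mspan.base)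
    moreover have "0 \<odot>\<^bsub>M\<^esub> r 0 = r 0" using r_scale[of 0 0] by simp
    ultimately show ?thesis by (simp add: teq_sym)
  qed
  have "teq M (\<Sum>w\<in>I. scale (coef p w) (basis [r (basis w)])) (basis [r (\<Sum>w\<in>I. scale (coef p w) (basis w))])"
    if "finite I" "I \<subseteq> W" for I
    using that
  proof (induction I rule: finite_induct)
    case (insert w I)
    let ?q = "\<Sum>w\<in>I. scale (coef p w) (basis w)" and ?w = "scale (coef p w) (basis w :: 'b \<Rightarrow>\<^sub>0 'r)"
    have W: "supin W ?q" "supin W (basis w :: 'b \<Rightarrow>\<^sub>0 'r)" "supin W ?w" using insert by (auto intro!: supin_sum supin_basic(5))
    have "basis [r ?w \<oplus>\<^bsub>M\<^esub> r ?q] - basis [r ?w] - basis [r ?q] \<in> tensor_rels M"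
      unfolding tensor_rels_def
      by (rule UnI1, rule CollectI, intro exI[of _ "[]"] exI[of _ "r ?w"] exI[of _ "r ?q"]) (auto simp: W simp del: scale_simps)
    then have 1: "teq M (basis [r ?w] + basis [r ?q]) (basis [r (?w + ?q)])"
      unfolding r_add[OF W(3,1)] by (rule_tac teq_sym) (simp add: teq_def mspan.base diff_diff_eq del: scale_simps)
    have "basis [coef p w \<odot>\<^bsub>M\<^esub> r (basis w)] - scale (coef p w) (basis [r (basis w)]) \<in> tensor_rels M"
      unfolding tensor_rels_def
      by (rule UnI2, rule CollectI, intro exI[of _ "[]"] exI[of _ "coef p w"] exI[of _ "r (basis w)"]) (use W(2) in auto)
    then have 2: "teq M (scale (coef p w) (basis [r (basis w)])) (basis [r ?w])"
      unfolding r_scale[OF W(2)] by (rule_tac teq_sym) (simp add: teq_def mspan.base del: scale_simps)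
    have "teq M (scale (coef p w) (basis [r (basis w)]) + (\<Sum>w\<in>I. scale (coef p w) (basis [r (basis w)])))
        (basis [r ?w] + basis [r ?q])"
      using insert 2 by (intro teq_add) auto
    also note 1
    finally show ?case using insert by (simp del: scale_simps)
  qed (simp add: z)
  from this[of "supp p"] show ?thesis
    using assms pm_sum[of p] by (simp add: lin_def supin_def del: scale_simps)
qed

text \<open>Applying r in every slot undoes the coordinates, slot by slot with
  \<open>r_ftens\<close> and \<open>teq_mult\<close>. Hence \<open>tl c f\<close> determines f up to
  \<open>teq\<close>, the missing half of \<open>teq_iff_tl\<close>.\<close>

lemma teq_of_tl:
  assumes "supin (lists (carrier M)) f"
  shows "teq M (alg id (\<lambda>w. basis [r (basis w)]) (tl c f)) f"
proof -
  define R :: "('b list \<Rightarrow>\<^sub>0 'r) \<Rightarrow> 'a list \<Rightarrow>\<^sub>0 'r" where "R = alg id (\<lambda>w. basis [r (basis w)])"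
  have rR: "ringmap id R" and sR: "semilin id R" by (simp_all add: R_def ringmapD)
  have R_gen: "R (lin gen p) = lin (\<lambda>w. basis [r (basis w)]) p" for p
    by (rule semilin_ext[OF semilin_comp2[OF semilin_lin sR] semilin_lin]) (simp add: R_def)
  have supR: "supin (lists (carrier M)) (lin (\<lambda>w. basis [r (basis w)]) p)" if "supin W p" for p
    by (rule supin_semilin[OF semilin_lin that]) auto
  have b: "teq M (R (tl c (basis xs))) (basis xs) \<and> supin (lists (carrier M)) (R (tl c (basis xs)))"
    if "xs \<in> lists (carrier M)" for xs
    using that
  proof (induction rule: lists.induct)
    case Nil
    then show ?case by (simp add: R_def tl_def one_list)
  next
    case (Cons x xs)
    have e: "R (tl c (basis (x # xs))) = lin (\<lambda>w. basis [r (basis w)]) (c x) * R (tl c (basis xs))"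
    proof -
      have "tl c (basis (x # xs)) = lin gen (c x) * tl c (basis xs)"
        by (simp add: basis_Cons ringmapD(3)[OF ringmap_tl]) (simp add: tl_def)
      then show ?thesis by (simp only: ringmapD(3)[OF rR] R_gen)
    qed
    have xs: "xs \<in> lists (carrier M)" "x \<in> carrier M" by (rule Cons.hyps)+
    note IH = Cons.IH[THEN conjunct1] Cons.IH[THEN conjunct2]
    have 1: "supin (lists (carrier M)) 1" by simp
    have x: "supin (lists (carrier M)) (basis [x])" using xs by simp
    have "teq M (1 * lin (\<lambda>w. basis [r (basis w)]) (c x) * R (tl c (basis xs))) (1 * basis [r (c x)] * R (tl c (basis xs)))"
      by (rule teq_mult[OF r_ftens[OF c_W[OF xs(2)]] 1 IH(2)])
    also have "teq M (1 * basis [r (c x)] * R (tl c (basis xs))) (1 * basis [r (c x)] * basis xs)"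
      using teq_mult[OF IH(1) x 1] by (simp only: rc[OF xs(2)] mult_1_left mult_1_right)
    also have "1 * basis [r (c x)] * basis xs = (basis (x # xs) :: 'a list \<Rightarrow>\<^sub>0 'r)" using xs by (simp add: basis_mult plus_list_def del: mult_single)
    finally have "teq M (lin (\<lambda>w. basis [r (basis w)]) (c x) * R (tl c (basis xs))) (basis (x # xs))"
      by (simp only: mult_1_left)
    then show ?case unfolding e by (intro conjI supin_lists_mult supR[OF c_W[OF xs(2)]] IH(2))
  qed
  have F: "semilin id (\<lambda>f. R (tl c f))" by (rule semilin_comp2[OF semilin_tl sR])
  have "teq M (\<Sum>w\<in>supp f. scale (id (coef f w)) (R (tl c (basis w)))) (\<Sum>w\<in>supp f. scale (coef f w) (basis w))"
    unfolding id_apply by (rule teq_sum, rule teq_scale, rule b[THEN conjunct1]) (use assms in \<open>auto simp: supin_def\<close>)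
  then show ?thesis
    unfolding semilin_expand[OF F, of f, symmetric] pm_sum[symmetric] unfolding R_def .
qed

lemma teq_iff_tl:
  assumes "supin (lists (carrier M)) f" "supin (lists (carrier M)) g"
  shows "teq M f g \<longleftrightarrow> tl c f = tl c g"
  using teq_tl teq_of_tl[OF assms(1)] teq_of_tl[OF assms(2)] teq_sym teq_trans by metis

lemma supin_tl: "f \<in> ftens n M \<Longrightarrow> supin {ws. length ws = n} (tl c f)"
proof (rule supin_semilin[OF semilin_tl])
  assume "f \<in> ftens n M" then show "supin (tlists n M) f" by (simp add: ftens_supin)
  have "supin {ws. length ws = length xs} (tl c (basis xs))" for xs
  proof (induction xs)
    case (Cons x xs)
    have "supin {ws. length ws = 1} (lin gen (c x) :: 'b list \<Rightarrow>\<^sub>0 'r)"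
      by (rule supin_semilin[OF semilin_lin, of UNIV]) (auto simp: gen_def)
    then show ?case using Cons
      by (simp add: basis_Cons ringmapD(3)[OF ringmap_tl]) (simp add: tl_def, erule supin_mult, auto simp: plus_list_def)
  qed (simp add: tl_def)
  then show "xs \<in> tlists n M \<Longrightarrow> supin {ws. length ws = n} (tl c (basis xs))" for xs by (auto simp: tlists_def)
qed

lemma teq2: "f \<in> ftens 2 M \<Longrightarrow> g \<in> ftens 2 M \<Longrightarrow> teq M f g \<longleftrightarrow> tev2 c f = tev2 c g"
  and teq3: "f \<in> ftens 3 M \<Longrightarrow> g \<in> ftens 3 M \<Longrightarrow> teq M f g \<longleftrightarrow> tev3 c f = tev3 c g"
proof -
  have s: "f \<in> ftens n M \<Longrightarrow> supin (lists (carrier M)) f" for f n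
    unfolding ftens_supin by (erule supin_mono) (auto simp: tlists_def)
  have inv2: "lin (\<lambda>(v, w). basis [v, w]) (pr2 F) = F" if "supin {ws. length ws = 2} F" for F :: "'b list \<Rightarrow>\<^sub>0 'r"
    unfolding pr2_def
    by (rule semilin_ext_on[OF semilin_comp2[OF semilin_lin semilin_lin] semilin_id(1)])
      (use that in \<open>auto simp: length_Suc_conv numeral_2_eq_2 subset_iff supin_def\<close>)
  have inv3: "lin (\<lambda>(v, w, u). basis [v, w, u]) (pr3 F) = F" if "supin {ws. length ws = 3} F" for F :: "'b list \<Rightarrow>\<^sub>0 'r"
    unfolding pr3_def
    by (rule semilin_ext_on[OF semilin_comp2[OF semilin_lin semilin_lin] semilin_id(1)])
      (use that in \<open>auto simp: length_Suc_conv numeral_3_eq_3 subset_iff supin_def\<close>)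
  show "teq M f g \<longleftrightarrow> tev2 c f = tev2 c g" if "f \<in> ftens 2 M" "g \<in> ftens 2 M"
    unfolding teq_iff_tl[OF s[OF that(1)] s[OF that(2)]] tev2_def
    using arg_cong[of _ _ "lin (\<lambda>(v, w). basis [v, w])"] inv2[OF supin_tl[OF that(1)]] inv2[OF supin_tl[OF that(2)]] by metis
  show "teq M f g \<longleftrightarrow> tev3 c f = tev3 c g" if "f \<in> ftens 3 M" "g \<in> ftens 3 M"
    unfolding teq_iff_tl[OF s[OF that(1)] s[OF that(2)]] tev3_def
    using arg_cong[of _ _ "lin (\<lambda>(v, w, u). basis [v, w, u])"] inv3[OF supin_tl[OF that(1)]] inv3[OF supin_tl[OF that(2)]] by metis
qed

text \<open>Produces formal tensors with prescribed coordinates, among them the values of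
  \<open>cobr\<close> and the witness for the coproduct of the Rees algebra.\<close>

definition untev :: "('b \<times> 'b \<Rightarrow>\<^sub>0 'r) \<Rightarrow> 'a list \<Rightarrow>\<^sub>0 'r" where
  "untev = lin (\<lambda>p. basis [r (basis (fst p)), r (basis (snd p))])"

lemma untev_ftens: "supin (W \<times> W) Z \<Longrightarrow> untev Z \<in> ftens 2 M"
  unfolding untev_def ftens_supin
  by (rule supin_semilin[OF semilin_lin]) (auto intro!: supin_basic(6))

lemma tev2_untev:
  assumes "supin (W \<times> W) Z" "\<And>w. w \<in> W \<Longrightarrow> c (r (basis w)) = basis w"
  shows "tev2 c (untev Z) = Z"
  unfolding untev_def
  by (rule semilin_ext_on[OF semilin_comp2[OF semilin_lin semilin_tev(1)] semilin_id(1)])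
   (use assms in \<open>auto simp: tev2_basis supin_def\<close>)

end

locale coord_b = coord M c for M :: "('r::comm_ring_1, 'a, 'm) module_scheme" and c :: "'a \<Rightarrow> 'b \<Rightarrow>\<^sub>0 'r" +
  fixes W :: "'b set"
  assumes c_W: "x \<in> carrier M \<Longrightarrow> supin W (c x)"
    and c_surj: "supin W p \<Longrightarrow> \<exists>x\<in>carrier M. c x = p"
begin

definition r :: "('b \<Rightarrow>\<^sub>0 'r) \<Rightarrow> 'a" where "r = inv_into (carrier M) c"

lemma r_in: "supin W p \<Longrightarrow> r p \<in> carrier M" and cr [simp]: "supin W p \<Longrightarrow> c (r p) = p"
proof -
  assume "supin W p"
  then obtain x where "x \<in> carrier M" "c x = p" using c_surj by blast
  then show "r p \<in> carrier M" "c (r p) = p"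
    unfolding r_def using inv_into_f_f[OF c_inj, of x] by auto
qed

sublocale coord_r M c r W
  by unfold_locales (auto intro!: c_eqI simp: r_in c_W)

end

section \<open>Gradings in coordinates\<close>

context coord_r
begin

lemma r_zero: "r 0 = \<zero>\<^bsub>M\<^esub>"
  using rc[of "\<zero>\<^bsub>M\<^esub>"] by simp

lemma r_sum:
  assumes "finite I" "I \<subseteq> W"
  shows "r (\<Sum>w\<in>I. scale (a w) (basis w)) = (\<Oplus>\<^bsub>M\<^esub>w\<in>I. a w \<odot>\<^bsub>M\<^esub> r (basis w))"
  using assms
proof (induction I rule: finite_induct)
  case (insert w I)
  have "supin W (\<Sum>w\<in>I. scale (a w) (basis w :: 'b \<Rightarrow>\<^sub>0 'r))" "supin W (basis w :: 'b \<Rightarrow>\<^sub>0 'r)"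
    "supin W (scale (a w) (basis w :: 'b \<Rightarrow>\<^sub>0 'r))"
    using insert by (auto intro!: supin_sum supin_basic(5))
  moreover have "(\<lambda>w. a w \<odot>\<^bsub>M\<^esub> r (basis w)) \<in> I \<rightarrow> carrier M" using insert by auto
  ultimately show ?case using insert by (simp add: r_add r_scale finsum_insert del: scale_simps)
qed (simp add: r_zero)

lemma r_expand: "supin W p \<Longrightarrow> r p = (\<Oplus>\<^bsub>M\<^esub>w\<in>supp p. coef p w \<odot>\<^bsub>M\<^esub> r (basis w))"
  using r_sum[of "supp p" "coef p"] pm_sum[of p] by (simp add: supin_def del: scale_simps)

text \<open>The linear extension of c after r, which fixes all coordinates of elements of M. It is
  the identity over W if c reaches everything there, and Dynkin's idempotent for the free Lie
  algebra.\<close>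

definition PP :: "('b \<Rightarrow>\<^sub>0 'r) \<Rightarrow> 'b \<Rightarrow>\<^sub>0 'r" where "PP = lin (\<lambda>w. c (r (basis w)))"

lemma c_r: "supin W p \<Longrightarrow> c (r p) = PP p"
proof -
  assume p: "supin W p"
  then have "r (basis w) \<in> carrier M" if "w \<in> supp p" for w
    using that by (auto simp: supin_def[of W p])
  then show ?thesis using p by (simp add: r_expand c_finsum PP_def lin_def)
qed

lemma PP_c [simp]: "x \<in> carrier M \<Longrightarrow> PP (c x) = c x"
  using c_r[OF c_W, of x] by simp

lemma mspan_finsum:
  assumes "finite I" "S \<subseteq> carrier M" "\<And>i. i \<in> I \<Longrightarrow> f i \<in> mspan M S"
  shows "(\<Oplus>\<^bsub>M\<^esub>i\<in>I. f i) \<in> mspan M S"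
  using assms(1,3)
proof (induction I rule: finite_induct)
  case (insert i I)
  then have "f \<in> I \<rightarrow> carrier M" "f i \<in> carrier M" using mspan_carrier[OF assms(2)] by auto
  then show ?case using insert by (simp add: finsum_insert mspan.add)
qed (simp add: mspan.zero)

lemma r_mspan:
  assumes "supin W p" "S \<subseteq> carrier M" "\<And>w. w \<in> supp p \<Longrightarrow> r (basis w) \<in> mspan M S"
  shows "r p \<in> mspan M S"
  unfolding r_expand[OF assms(1)] using assms(3) by (intro mspan_finsum assms(2)) (auto intro: mspan.smult)

definition Gr :: "('b \<Rightarrow> nat) \<Rightarrow> nat \<Rightarrow> 'a set" where
  "Gr wt i = {x \<in> carrier M. supin {w. wt w = i} (c x)}"

text \<open>Compatibility of a weight with the retraction: it makes \<open>PP\<close> commute with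
  the projections to the homogeneous parts.\<close>

definition homog :: "('b \<Rightarrow> nat) \<Rightarrow> bool" where
  "homog wt \<longleftrightarrow> (\<forall>w\<in>W. supin {v. wt v = wt w} (c (r (basis w))))"

lemma Gr_mspan: "mspan M (Gr wt i) = Gr wt i"
proof -
  have "x \<in> mspan M (Gr wt i) \<Longrightarrow> x \<in> Gr wt i" for x
    by (induction rule: mspan.induct) (auto simp: Gr_def)
  then show ?thesis by (auto intro: mspan.base)
qed

text \<open>The gradings of the theorem are spans of monomials or of brackets in the generators;
  this criterion identifies them with the parts \<open>Gr\<close> cut out by coordinates.\<close>

lemma mspan_eq_Gr:
  assumes "\<And>i. B i \<subseteq> Gr wt i" "\<And>w. w \<in> W \<Longrightarrow> r (basis w) \<in> mspan M (B (wt w))"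
  shows "mspan M (B i) = Gr wt i"
proof -
  have "x \<in> mspan M (B i) \<Longrightarrow> x \<in> Gr wt i" for x
    by (induction rule: mspan.induct) (use assms(1) in \<open>auto simp: Gr_def\<close>)
  moreover have "x \<in> mspan M (B i)" if x: "x \<in> Gr wt i" for x
  proof -
    have "B i \<subseteq> carrier M" using assms(1)[of i] by (auto simp: Gr_def)
    then have "r (c x) \<in> mspan M (B i)"
    proof (rule r_mspan[rotated])
      show "supin W (c x)" using x by (simp add: Gr_def)
      fix w assume "w \<in> supp (c x)"
      then have "w \<in> W" "wt w = i" using x c_W[of x] by (auto simp: Gr_def supin_def)
      then show "r (basis w) \<in> mspan M (B i)" using assms(2) by blast
    qed
    then show ?thesis using x by (simp add: Gr_def)
  qed
  ultimately show ?thesis by blast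
qed

definition proj :: "('b \<Rightarrow> nat) \<Rightarrow> nat \<Rightarrow> ('b \<Rightarrow>\<^sub>0 'r) \<Rightarrow> 'b \<Rightarrow>\<^sub>0 'r" where
  "proj wt i = lin (\<lambda>w. if wt w = i then basis w else 0)"

lemma semilin_proj [simp]: "semilin id (proj wt i)" by (simp add: proj_def)

lemma supin_proj: "supin A p \<Longrightarrow> supin (A \<inter> {w. wt w = i}) (proj wt i p)"
  unfolding proj_def by (rule supin_semilin[OF semilin_lin]) auto

lemma proj_eq: "supin {w. wt w = j} p \<Longrightarrow> proj wt i p = (if i = j then p else 0)"
proof (cases "i = j")
  case True
  assume "supin {w. wt w = j} p"
  then have "proj wt i p = p"
    by (rule_tac semilin_ext_on[OF semilin_proj semilin_id(1)]) (use True in \<open>auto simp: proj_def supin_def\<close>)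
  then show ?thesis using True by simp
next
  case False
  assume "supin {w. wt w = j} p"
  then have "proj wt i p = 0"
    by (rule_tac semilin_ext_on[OF semilin_proj semilin_lincomb(5)]) (use False in \<open>auto simp: proj_def supin_def\<close>)
  then show ?thesis using False by simp
qed

lemma sum_proj:
  assumes "finite I" "\<And>i. i \<notin> I \<Longrightarrow> proj wt i p = 0"
  shows "(\<Sum>i\<in>I. proj wt i p) = p"
proof -
  have "finite (I \<union> wt ` supp p)" using assms by simp
  then have "(\<Sum>i\<in>I. proj wt i p) = (\<Sum>i\<in>I \<union> wt ` supp p. proj wt i p)"
    by (intro sum.mono_neutral_left) (auto simp: assms)
  also have "\<dots> = p"
  proof -
    have "semilin id (\<lambda>p. \<Sum>i\<in>J. proj wt i p)" for J
      by (auto simp: semilin_def semilinD[OF semilin_proj] sum.distrib scale_sum)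
    then show ?thesis
      by (rule semilin_ext_on[of id "\<lambda>q. \<Sum>i\<in>I \<union> wt ` supp p. proj wt i q" "\<lambda>q. q"]) (use assms(1) in \<open>auto simp: proj_def\<close>)
  qed
  finally show ?thesis .
qed

end

text \<open>The component of x in degree i is r of the degree i part of c x. As \<open>PP\<close>
  commutes with \<open>proj\<close>, its coordinates are exactly that part; applying
  \<open>proj\<close> to the coordinates of any other decomposition gives uniqueness.\<close>

lemma graded_module_Gr:
  fixes M :: "('k::field, 'a, 'm) module_scheme"
  assumes "coord_r M c r W" and hom: "coord_r.homog c r W wt"
  shows "graded_module M (coord_r.Gr M c wt)"
proof -
  interpret coord_r M c r W by fact
  have PPp: "PP (proj wt i p) = proj wt i (PP p)" if "supin W p" for i p
  proof (rule semilin_ext_on[of id "\<lambda>p. PP (proj wt i p)" "\<lambda>p. proj wt i (PP p)"])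
    fix w assume "w \<in> supp p"
    with that have "w \<in> W" by (auto simp: supin_def)
    then show "PP (proj wt i (basis w)) = proj wt i (PP (basis w))"
      using proj_eq[of wt "wt w" "c (r (basis w))" i] hom by (auto simp: homog_def PP_def proj_def semilinD[OF semilin_lin])
  qed (auto simp: PP_def intro!: semilin_comp2[OF semilin_proj semilin_lin] semilin_comp2[OF semilin_lin semilin_proj])
  have pW: "supin W (proj wt i (c x))" if "x \<in> carrier M" for x i
    using supin_proj[OF c_W[OF that]] by (rule supin_mono) auto
  define comp where "comp x i = r (proj wt i (c x))" for x i
  have cc: "c (comp x i) = proj wt i (c x)" "comp x i \<in> carrier M" "comp x i \<in> Gr wt i" if "x \<in> carrier M" for x i
  proof -
    show 1: "c (comp x i) = proj wt i (c x)" using that pW[OF that] by (simp add: comp_def c_r PPp)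
    show "comp x i \<in> carrier M" using pW[OF that] by (simp add: comp_def)
    then show "comp x i \<in> Gr wt i" using 1 supin_proj[of UNIV "c x" wt i] by (simp add: Gr_def)
  qed
  have z: "comp x i = \<zero>\<^bsub>M\<^esub> \<longleftrightarrow> proj wt i (c x) = 0" if "x \<in> carrier M" for x i
    using cc[OF that, of i] c_eqI[of "comp x i" "\<zero>\<^bsub>M\<^esub>"] by auto
  show ?thesis
    unfolding graded_module_def
  proof (intro conjI allI ballI)
    fix i show "Gr wt i \<subseteq> carrier M" by (auto simp: Gr_def)
    show "mspan M (Gr wt i) = Gr wt i" by (rule Gr_mspan)
  next
    fix x assume x: "x \<in> carrier M"
    have fin: "finite {i. comp x i \<noteq> \<zero>\<^bsub>M\<^esub>}"
    proof (rule finite_subset[of _ "wt ` supp (c x)"])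
      have "proj wt i (c x) = 0" if "i \<notin> wt ` supp (c x)" for i
        by (rule semilin_ext_on[of id "proj wt i" "\<lambda>_. 0"]) (use that in \<open>auto simp: proj_def semilin_def semilinD[OF semilin_lin]\<close>)
      then show "{i. comp x i \<noteq> \<zero>\<^bsub>M\<^esub>} \<subseteq> wt ` supp (c x)" using z[OF x] by blast
    qed simp
    show "\<exists>!k. (\<forall>i. k i \<in> Gr wt i) \<and> finite {i. k i \<noteq> \<zero>\<^bsub>M\<^esub>} \<and> x = (\<Oplus>\<^bsub>M\<^esub>i\<in>{i. k i \<noteq> \<zero>\<^bsub>M\<^esub>}. k i)"
    proof (intro ex1I[of _ "comp x"] conjI allI)
      show "x = (\<Oplus>\<^bsub>M\<^esub>i\<in>{i. comp x i \<noteq> \<zero>\<^bsub>M\<^esub>}. comp x i)"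
      proof (rule c_eqI[OF x finsum_in])
        have "(\<Sum>i\<in>{i. comp x i \<noteq> \<zero>\<^bsub>M\<^esub>}. proj wt i (c x)) = c x"
          by (rule sum_proj[OF fin]) (simp add: z[OF x])
        then show "c x = c (\<Oplus>\<^bsub>M\<^esub>i\<in>{i. comp x i \<noteq> \<zero>\<^bsub>M\<^esub>}. comp x i)"
          by (simp only: c_finsum[OF fin cc(2)[OF x]] cc(1)[OF x])
      qed (rule cc(2)[OF x])
    next
      fix k assume k: "(\<forall>i. k i \<in> Gr wt i) \<and> finite {i. k i \<noteq> \<zero>\<^bsub>M\<^esub>} \<and> x = (\<Oplus>\<^bsub>M\<^esub>i\<in>{i. k i \<noteq> \<zero>\<^bsub>M\<^esub>}. k i)"
      have kc: "k i \<in> carrier M" "supin {w. wt w = i} (c (k i))" for i using k by (auto simp: Gr_def)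
      have "c x = (\<Sum>i\<in>{i. k i \<noteq> \<zero>\<^bsub>M\<^esub>}. c (k i))"
        using k kc c_finsum[of "{i. k i \<noteq> \<zero>\<^bsub>M\<^esub>}" k] by simp
      then have "proj wt j (c x) = (\<Sum>i\<in>{i. k i \<noteq> \<zero>\<^bsub>M\<^esub>}. if i = j then c (k j) else 0)" for j
        by (auto simp: semilin_sum[OF semilin_proj] proj_eq[OF kc(2)] intro!: sum.cong)
      then have "proj wt j (c x) = c (k j)" for j using k by auto
      then show "k = comp x" using kc cc[OF x] by (intro ext c_eqI) auto
    qed (use x fin cc in auto)
  qed
qed

text \<open>The witness for \<open>tensor_degree\<close> is \<open>untev\<close> of the coordinates
  of d x: its entries are the elements \<open>r (basis w)\<close>, homogeneous of the weight of w.
  It represents d x because \<open>PP\<close> in both slots fixes the coordinates of a tensor over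
  M.\<close>

lemma homogeneous_Gr:
  fixes M :: "('k::field, 'a, 'm) module_scheme"
  assumes "coord_r M c r W" and hom: "coord_r.homog c r W wt"
    and d: "\<And>x. x \<in> carrier M \<Longrightarrow> d x \<in> ftens 2 M"
    and deg: "\<And>i x. x \<in> coord_r.Gr M c wt i \<Longrightarrow> supin {(v, w). wt v + wt w = i + s} (tev2 c (d x))"
  shows "homogeneous M (coord_r.Gr M c wt) (int s) d"
proof -
  interpret coord_r M c r W by fact
  have u: "tev2 c (untev (tev2 c f)) = tev2 c f \<and> supin (W \<times> W) (tev2 c f)" if "f \<in> ftens 2 M" for f
  proof
    have t: "tev2 c (untev Z) = tmap id PP PP Z" for Z
      by (rule ten_ext[OF semilin_comp2[OF _ semilin_tev(1)] semilin_tmap[OF rhom_id(1)]])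
        (auto simp: untev_def tev2_basis PP_def tmap_def)
    show "tev2 c (untev (tev2 c f)) = tev2 c f" unfolding t
      by (rule tensor_semilin_eq[OF that semilin_comp2[OF semilin_tev(1) semilin_tmap[OF rhom_id(1)]] semilin_tev(1)])
        (auto elim!: tlists2E simp: tev2_basis, subst tmap_ten, auto simp: PP_def[symmetric] PP_c, auto simp: PP_def)
    show "supin (W \<times> W) (tev2 c f)"
      using that unfolding ftens_supin
      by (rule supin_semilin[OF semilin_tev(1)]) (auto elim!: tlists2E simp: tev2_basis intro!: supin_ten)
  qed
  show ?thesis
    unfolding homogeneous_def tensor_degree_def
  proof (intro allI ballI)
    fix i x assume x: "x \<in> Gr wt i"
    then have xc: "x \<in> carrier M" by (simp add: Gr_def)
    let ?Z = "tev2 c (d x)"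
    have Z: "supin ((W \<times> W) \<inter> {(v, w). wt v + wt w = i + s}) ?Z"
      using u[OF d[OF xc]] deg[OF x] by (auto simp: supin_def)
    have g: "untev ?Z \<in> ftens 2 M" by (intro untev_ftens) (use u[OF d[OF xc]] in simp)
    have "supin {[a, b] | a b. \<exists>m n. a \<in> Gr wt m \<and> b \<in> Gr wt n \<and> m + n = i + s} (untev ?Z)"
      unfolding untev_def
    proof (rule supin_semilin[OF semilin_lin Z])
      fix p assume p: "p \<in> (W \<times> W) \<inter> {(v, w). wt v + wt w = i + s}"
      have "r (basis w) \<in> Gr wt (wt w)" if "w \<in> W" for w using that hom by (auto simp: Gr_def homog_def)
      then have "[r (basis (fst p)), r (basis (snd p))] \<in> {[a, b] | a b. \<exists>m n. a \<in> Gr wt m \<and> b \<in> Gr wt n \<and> m + n = i + s}"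
        using p by (cases p) (simp, blast)
      then show "supin {[a, b] | a b. \<exists>m n. a \<in> Gr wt m \<and> b \<in> Gr wt n \<and> m + n = i + s}
          (lin (\<lambda>p. basis [r (basis (fst p)), r (basis (snd p))]) (basis p))"
        unfolding lin_basis by (rule supin_basic(6))
    qed
    then have "\<forall>xs\<in>supp (untev ?Z). \<exists>ds. list_all2 (\<lambda>x d. x \<in> Gr wt d) xs ds \<and> int (sum_list ds) = int i + int s"
      unfolding supin_def
    proof (intro ballI)
      fix xs assume "xs \<in> supp (untev ?Z)" "supp (untev ?Z) \<subseteq> {[a, b] | a b. \<exists>m n. a \<in> Gr wt m \<and> b \<in> Gr wt n \<and> m + n = i + s}"
      then obtain a b m n where "xs = [a, b]" "a \<in> Gr wt m" "b \<in> Gr wt n" "m + n = i + s" by blast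
      then show "\<exists>ds. list_all2 (\<lambda>x d. x \<in> Gr wt d) xs ds \<and> int (sum_list ds) = int i + int s"
        by (intro exI[of _ "[m, n]"]) auto
    qed
    moreover have "teq M (d x) (untev ?Z)" using u[OF d[OF xc]] by (simp add: teq2 d xc g)
    ultimately show "\<exists>g. teq M (d x) g \<and> (\<forall>xs\<in>supp g. \<exists>ds. list_all2 (\<lambda>x d. x \<in> Gr wt d) xs ds \<and> int (sum_list ds) = int i + int s)"
      by blast
  qed
qed

section \<open>Hopf algebras in coordinates\<close>

text \<open>H, its Rees algebra and the two classical algebras differ here only in h and in the ring
  of scalars. The operations are prescribed through their coordinates, since coproducts are known
  only up to \<open>teq\<close>.\<close>

locale FB_hopf = coord_b A c "lists V"
  for A :: "('r::comm_ring_1, 'a) hopf" and c :: "'a \<Rightarrow> nat list \<Rightarrow>\<^sub>0 'r" and V :: "nat set" +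
  fixes h :: 'r
  assumes down_V: "down V"
    and mult_closed [simp]: "x \<in> carrier A \<Longrightarrow> y \<in> carrier A \<Longrightarrow> x \<otimes>\<^bsub>A\<^esub> y \<in> carrier A"
    and one_closed [simp]: "\<one>\<^bsub>A\<^esub> \<in> carrier A"
    and c_mult [simp]: "x \<in> carrier A \<Longrightarrow> y \<in> carrier A \<Longrightarrow> c (x \<otimes>\<^bsub>A\<^esub> y) = c x * c y"
    and c_one [simp]: "c \<one>\<^bsub>A\<^esub> = 1"
    and comult_ftens [simp]: "x \<in> carrier A \<Longrightarrow> comult A x \<in> ftens 2 A"
    and comult_tev [simp]: "x \<in> carrier A \<Longrightarrow> tev2 c (comult A x) = Dl h (c x)"
    and counit_c [simp]: "x \<in> carrier A \<Longrightarrow> counit A x = eps (c x)"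
    and antipode_closed [simp]: "x \<in> carrier A \<Longrightarrow> antipode A x \<in> carrier A"
    and antipode_c [simp]: "x \<in> carrier A \<Longrightarrow> c (antipode A x) = Sl h (c x)"
begin

lemma is_ring: "ring A"
  by (rule ringI[OF is_abelian_group])
    (auto intro!: monoidI c_eqI simp: algebra_simps)

lemma is_assoc_algebra: "assoc_algebra A"
  unfolding assoc_algebra_def by (auto intro!: is_ring is_module c_eqI)

text \<open>Translates the counit and antipode axioms, which are contractions of formal tensors,
  into identities for \<open>conv2\<close>.\<close>

lemma contract_conv2:
  assumes f: "f \<in> ftens 2 A" and H: "\<And>x y. x \<in> carrier A \<Longrightarrow> y \<in> carrier A \<Longrightarrow> H [x, y] \<in> carrier A"
    and c: "\<And>x y. x \<in> carrier A \<Longrightarrow> y \<in> carrier A \<Longrightarrow> c (H [x, y]) = F (c x) * G (c y)" and sl: "semilin id F" "semilin id G"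
  shows "contract A H f \<in> carrier A" "c (contract A H f) = conv2 F G (tev2 c f)"
proof -
  have Hc: "H xs \<in> carrier A" if "xs \<in> supp f" for xs
    using that f H unfolding ftens_supin supin_def by (auto elim!: tlists2E dest!: subsetD)
  then show "contract A H f \<in> carrier A" unfolding contract_def by (intro finsum_in) auto
  have "c (contract A H f) = lin (\<lambda>xs. c (H xs)) f"
    unfolding contract_def lin_def using Hc by (subst c_finsum) auto
  also have "\<dots> = conv2 F G (tev2 c f)"
    by (rule tensor_semilin_eq[OF f semilin_lin semilin_comp2[OF semilin_tev(1) semilin_conv2]])
      (auto elim!: tlists2E simp: tev2_basis c conv2_ten[OF sl])
  finally show "c (contract A H f) = conv2 F G (tev2 c f)" .
qed

theorem is_hopf_algebra: "hopf_algebra A"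
  unfolding hopf_algebra_def
proof (intro conjI ballI allI)
  show "assoc_algebra A" by (rule is_assoc_algebra)
  show "tensor_linear 2 A (comult A)"
    unfolding tensor_linear_def by (auto simp: teq2 tev_simps Dl_simps)
  show "linear_on A A (antipode A)"
    unfolding linear_on_def by (auto intro!: c_eqI simp: semilinD[OF semilin_Sl])
  have [simp]: "basis [\<one>\<^bsub>A\<^esub>, \<one>\<^bsub>A\<^esub>] \<in> ftens 2 A" by simp
  show "teq A (comult A \<one>\<^bsub>A\<^esub>) (basis [\<one>\<^bsub>A\<^esub>, \<one>\<^bsub>A\<^esub>])" by (simp add: teq2 Dl_simps tev2_basis)
  show "counit A \<one>\<^bsub>A\<^esub> = 1" by simp
  fix x assume x: "x \<in> carrier A"
  note cf = comult_ftens[OF x]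
  show "teq A (on_left (comult A) (comult A x)) (on_right (comult A) (comult A x))"
    using x coassoc[of h "c x"] unfolding DlLR_E
    by (simp add: teq3 ftens_on_left ftens_on_right tev3_on[of _ A "Dl h"])
  note rule = contract_conv2[OF cf]
  show "contract A (\<lambda>xs. counit A (xs ! 0) \<odot>\<^bsub>A\<^esub> (xs ! 1)) (comult A x) = x"
    using rule[of "\<lambda>xs. counit A (xs ! 0) \<odot>\<^bsub>A\<^esub> (xs ! 1)" epsT "\<lambda>x. x"] x
    by (intro c_eqI) (auto simp: counit_left epsT_def[where 'y = nat])
  show "contract A (\<lambda>xs. counit A (xs ! 1) \<odot>\<^bsub>A\<^esub> (xs ! 0)) (comult A x) = x"
    using rule[of "\<lambda>xs. counit A (xs ! 1) \<odot>\<^bsub>A\<^esub> (xs ! 0)" "\<lambda>x. x" epsT] x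
    by (intro c_eqI) (auto simp: counit_right epsT_def[where 'y = nat])
  show "contract A (\<lambda>xs. antipode A (xs ! 0) \<otimes>\<^bsub>A\<^esub> (xs ! 1)) (comult A x) = counit A x \<odot>\<^bsub>A\<^esub> \<one>\<^bsub>A\<^esub>"
    using rule[of "\<lambda>xs. antipode A (xs ! 0) \<otimes>\<^bsub>A\<^esub> (xs ! 1)" "Sl h" "\<lambda>x. x"] x
    by (intro c_eqI) (auto simp: antipode_left epsT_def)
  show "contract A (\<lambda>xs. (xs ! 0) \<otimes>\<^bsub>A\<^esub> antipode A (xs ! 1)) (comult A x) = counit A x \<odot>\<^bsub>A\<^esub> \<one>\<^bsub>A\<^esub>"
    using rule[of "\<lambda>xs. (xs ! 0) \<otimes>\<^bsub>A\<^esub> antipode A (xs ! 1)" "\<lambda>x. x" "Sl h"] x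
    by (intro c_eqI) (auto simp: antipode_right epsT_def)
  show "counit A (a \<odot>\<^bsub>A\<^esub> x) = a * counit A x" for a using x by simp
  fix y assume y: "y \<in> carrier A"
  show "teq A (comult A (x \<otimes>\<^bsub>A\<^esub> y)) (tmult A (comult A x) (comult A y))"
    using x y by (simp add: teq2 ftens_tmult tev2_tmult Dl_simps)
  show "counit A (x \<oplus>\<^bsub>A\<^esub> y) = counit A x + counit A y" using x y by (simp add: lookup_add)
  show "counit A (x \<otimes>\<^bsub>A\<^esub> y) = counit A x * counit A y" using x y by (simp add: eps_mult)
qed

lemma c_r_basis: "w \<in> lists V \<Longrightarrow> c (r (basis w)) = basis w"
  by (rule cr) (rule supin_basic(6))

lemma r_gen_foldr:
  assumes "\<And>n. n \<in> V \<Longrightarrow> x n \<in> carrier A \<and> c (x n) = gen n" "set w \<subseteq> V"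
  shows "foldr (monoid.mult A) (map x w) \<one>\<^bsub>A\<^esub> \<in> carrier A \<and> foldr (monoid.mult A) (map x w) \<one>\<^bsub>A\<^esub> = r (basis w)"
proof -
  have "foldr (monoid.mult A) (map x w) \<one>\<^bsub>A\<^esub> \<in> carrier A \<and> c (foldr (monoid.mult A) (map x w) \<one>\<^bsub>A\<^esub>) = basis w"
    using assms(2) by (induction w) (simp_all add: assms(1) basis_Cons flip: one_list)
  then show ?thesis using assms(2) rc[of "foldr (monoid.mult A) (map x w) \<one>\<^bsub>A\<^esub>"] by simp
qed

text \<open>Generation by the x n as an induction rule; it yields the uniqueness of the isomorphism
  and of the co-Poisson structure.\<close>

lemma carrier_induct:
  assumes "\<And>n. n \<in> V \<Longrightarrow> x n \<in> carrier A \<and> c (x n) = gen n" "y \<in> carrier A"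
    and "P \<zero>\<^bsub>A\<^esub>" "P \<one>\<^bsub>A\<^esub>" "\<And>n. n \<in> V \<Longrightarrow> P (x n)"
    and "\<And>y z. y \<in> carrier A \<Longrightarrow> z \<in> carrier A \<Longrightarrow> P y \<Longrightarrow> P z \<Longrightarrow> P (y \<oplus>\<^bsub>A\<^esub> z)"
    and "\<And>a y. y \<in> carrier A \<Longrightarrow> P y \<Longrightarrow> P (a \<odot>\<^bsub>A\<^esub> y)"
    and "\<And>y z. y \<in> carrier A \<Longrightarrow> z \<in> carrier A \<Longrightarrow> P y \<Longrightarrow> P z \<Longrightarrow> P (y \<otimes>\<^bsub>A\<^esub> z)"
  shows "P y"
proof -
  let ?S = "{y \<in> carrier A. P y}"
  have w: "foldr (monoid.mult A) (map x w) \<one>\<^bsub>A\<^esub> \<in> ?S" if "set w \<subseteq> V" for w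
    using that assms by (induction w) auto
  have "r (c y) \<in> mspan A ?S"
  proof (rule r_mspan)
    fix w assume "w \<in> supp (c y)"
    then have "set w \<subseteq> V" using c_W[OF assms(2)] by (auto simp: supin_def)
    then show "r (basis w) \<in> mspan A ?S" using w r_gen_foldr[OF assms(1)] by (metis (no_types, lifting) mspan.base)
  qed (use assms(2) c_W in auto)
  moreover have "z \<in> mspan A ?S \<Longrightarrow> z \<in> ?S" for z
    by (induction rule: mspan.induct) (use assms in auto)
  ultimately have "r (c y) \<in> ?S" by blast
  then show ?thesis using rc[OF assms(2)] by simp
qed

end

section \<open>Weights of words for h = 0\<close>

lemma Sl_0_basis: "Sl 0 (basis w) = scale ((- 1) ^ length w) (basis (rev w) :: nat list \<Rightarrow>\<^sub>0 'r::comm_ring_1)"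
proof (induction w)
  case (Cons n w)
  have "sgen 0 n = (- gen n :: nat list \<Rightarrow>\<^sub>0 'r)" by (subst sgen.simps) (auto simp: FB_zero intro!: sum.neutral)
  then show ?case using Cons by (simp add: basis_Cons Sl_simps basis_append scale_linear del: scale_simps(5)) (simp add: gen_def one_list[symmetric])
qed (simp add: Sl_simps flip: one_list)

abbreviation wtw :: "(nat \<Rightarrow> nat) \<Rightarrow> nat list \<Rightarrow> nat" where "wtw wt w \<equiv> sum_list (map wt w)"

lemma Dl_0_weight: "supin {(v, u). wtw wt v + wtw wt u = wtw wt w} (Dl 0 (basis w))"
proof (induction w)
  case Nil
  have "Dl 0 (basis []) = (basis ([], []) :: nat list \<times> nat list \<Rightarrow>\<^sub>0 'a)"
    by (simp add: Dl_simps flip: one_list ten_one) (simp only: one_list ten_basis)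
  then show ?case by simp
next
  case (Cons n w)
  have "supin {(v, u). wtw wt v + wtw wt u = wt n} (dgen 0 n)"
    by (simp add: dgen_0 gen_def one_list)
  then show ?case using Cons by (simp add: basis_Cons Dl_simps) (erule supin_mult, auto simp: plus_prod_def plus_list_def)
qed

text \<open>The shift s is the defect of additivity of wt: wt n = n has s = 0, and wt n = 1, which
  counts letters, has s = 1, because the cobracket of a letter has two letters in each term.\<close>

lemma db_weight:
  assumes wt: "\<And>l n. 1 \<le> l \<Longrightarrow> l < n \<Longrightarrow> wt l + wt (n - l) = wt n + s"
  shows "supin {(v, u). wtw wt v + wtw wt u = wtw wt w + s} (db (basis w :: nat list \<Rightarrow>\<^sub>0 'k::field))"
proof (induction w)
  case Nil
  have "db 1 = db (1 :: nat list \<Rightarrow>\<^sub>0 'k) + db 1" using db_mult[of "1 :: nat list \<Rightarrow>\<^sub>0 'k" 1] by (simp add: Dl_simps)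
  then show ?case by (simp flip: one_list)
next
  case (Cons n w)
  have g: "supin {(v, u). wtw wt v + wtw wt u = wt n + s} (db (gen n :: nat list \<Rightarrow>\<^sub>0 'k))"
    unfolding db_gen unfolding gen_def ten_basis
    by (intro supin_sum supin_basic(3,5,6)) (use wt in \<open>auto simp: add.commute\<close>)
  have d: "supin {(v, u). wtw wt v + wtw wt u = wt n} (Dl 0 (gen n :: nat list \<Rightarrow>\<^sub>0 'k))"
    unfolding Dl_gen dgen_0 by (simp add: gen_def one_list)
  have 1: "supin {(v, u). wtw wt v + wtw wt u = wtw wt (n # w) + s} (db (gen n) * Dl 0 (basis w :: nat list \<Rightarrow>\<^sub>0 'k))"
    by (rule supin_mult[OF g Dl_0_weight[of wt]]) (auto simp: plus_prod_def plus_list_def)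
  have 2: "supin {(v, u). wtw wt v + wtw wt u = wtw wt (n # w) + s} (Dl 0 (gen n) * db (basis w :: nat list \<Rightarrow>\<^sub>0 'k))"
    by (rule supin_mult[OF d Cons]) (auto simp: plus_prod_def plus_list_def)
  show ?case unfolding basis_Cons db_mult by (rule supin_basic(2)[OF 1 2])
qed

section \<open>Co-Poisson structure and gradings for h = 0\<close>

locale FB_classical = FB_hopf A c V 0
  for A :: "('k::field, 'a) hopf" and c :: "'a \<Rightarrow> nat list \<Rightarrow>\<^sub>0 'k" and V :: "nat set"
begin

definition cobr :: "'a \<Rightarrow> 'a list \<Rightarrow>\<^sub>0 'k" where "cobr x = untev (db (c x))"

lemma cobr [simp]: "x \<in> carrier A \<Longrightarrow> cobr x \<in> ftens 2 A" "x \<in> carrier A \<Longrightarrow> tev2 c (cobr x) = db (c x)"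
  unfolding cobr_def
  by (rule untev_ftens[OF supin_db[OF down_V c_W]], assumption)
    (rule tev2_untev[OF supin_db[OF down_V c_W]], simp_all add: c_r_basis)

theorem is_copoisson: "copoisson_hopf A cobr"
  unfolding copoisson_hopf_def cobracket_def
proof (intro conjI ballI)
  show "hopf_algebra A" by (rule is_hopf_algebra)
  show "tensor_linear 2 A cobr"
    unfolding tensor_linear_def by (auto simp: teq2 tev_simps semilinD[OF semilin_db])
  fix x assume x: "x \<in> carrier A"
  show "teq A (flip (comult A x)) (comult A x)"
    using x by (simp add: teq2 ftens_flip tev2_flip[OF comult_ftens[OF x]] cocommutative)
  show "teq A (flip (cobr x)) (- cobr x)"
    using x by (simp add: teq2 ftens_flip tev2_flip[OF cobr(1)[OF x]] db_tswap tev_simps)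
  have t: "tev3 c (on_left cobr (cobr x)) = EL db (db (c x))" "on_left cobr (cobr x) \<in> ftens 3 A"
    using x by (simp_all add: tev3_on(1)[of _ A db] ftens_on_left)
  then show "co_jacobi A cobr x"
    unfolding co_jacobi_def Let_def by (simp add: teq3 ftens_cyc tev_simps tev3_cyc[OF t(2)] tev3_cyc[OF ftens_cyc[OF t(2)]] db_jacobi)
  have l: "on_left cobr (comult A x) \<in> ftens 3 A" using x by (simp add: ftens_on_left)
  then show "teq A (on_left (comult A) (cobr x)) (on_right cobr (comult A x) + swap23 (on_left cobr (comult A x)))"
    using x db_leibniz[of "c x"]
    by (simp add: teq3 ftens_on_left ftens_on_right ftens_swap23 tev_simps tev3_swap23[OF l] tev3_on[of _ A db] tev3_on[of _ A "Dl 0"])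
  fix y assume y: "y \<in> carrier A"
  show "teq A (cobr (x \<otimes>\<^bsub>A\<^esub> y)) (tmult A (cobr x) (comult A y) + tmult A (comult A x) (cobr y))"
    using x y by (simp add: teq2 ftens_tmult tev2_tmult tev_simps db_mult)
qed

lemma homog_wtw: "homog (wtw wt)"
  by (simp add: homog_def)

lemma alg_grading_eq:
  assumes "\<And>n. n \<in> V \<Longrightarrow> x n \<in> carrier A \<and> c (x n) = gen n"
  shows "alg_grading A V x wt = Gr (wtw wt)"
proof
  fix i
  have f: "foldr (monoid.mult A) (map x w) \<one>\<^bsub>A\<^esub> \<in> carrier A \<and> foldr (monoid.mult A) (map x w) \<one>\<^bsub>A\<^esub> = r (basis w)"
    if "set w \<subseteq> V" for w
    by (rule r_gen_foldr[OF assms that])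
  show "alg_grading A V x wt i = Gr (wtw wt) i"
    unfolding alg_grading_def
  proof (rule mspan_eq_Gr)
    fix i
    show "{foldr (monoid.mult A) (map x w) \<one>\<^bsub>A\<^esub> | w. set w \<subseteq> V \<and> wtw wt w = i} \<subseteq> Gr (wtw wt) i"
    proof (intro subsetI, elim CollectE exE conjE)
      fix y w assume y: "y = foldr (monoid.mult A) (map x w) \<one>\<^bsub>A\<^esub>" and w: "set w \<subseteq> V" "wtw wt w = i"
      have "w \<in> lists V" using w by auto
      then have "c (r (basis w)) = basis w" by (rule c_r_basis)
      moreover have "y = r (basis w)" "y \<in> carrier A" using f[OF w(1)] y by auto
      ultimately show "y \<in> Gr (wtw wt) i" using w(2) by (simp add: Gr_def)
    qed
  next
    fix w assume "w \<in> lists V"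
    then have "set w \<subseteq> V" by auto
    then have "r (basis w) \<in> {foldr (monoid.mult A) (map x v) \<one>\<^bsub>A\<^esub> | v. set v \<subseteq> V \<and> wtw wt v = wtw wt w}"
      using f[of w] by (intro CollectI exI[of _ w]) simp
    then show "r (basis w) \<in> mspan A {foldr (monoid.mult A) (map x v) \<one>\<^bsub>A\<^esub> | v. set v \<subseteq> V \<and> wtw wt v = wtw wt w}"
      by (rule mspan.base)
  qed
qed

lemma graded_hopf_Gr: "graded_hopf A (Gr (wtw wt))"
  unfolding graded_hopf_def
proof (intro conjI allI ballI impI)
  show "hopf_algebra A" by (rule is_hopf_algebra)
  show "graded_module A (Gr (wtw wt))" by (rule graded_module_Gr[OF coord_r_axioms homog_wtw])
  show "\<one>\<^bsub>A\<^esub> \<in> Gr (wtw wt) 0" by (simp add: Gr_def)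
  have "supin {(v, w). wtw wt v + wtw wt w = i + 0} (tev2 c (comult A x))" if "x \<in> Gr (wtw wt) i" for x i
  proof -
    have "supin {(v, w). wtw wt v + wtw wt w = i} (Dl 0 (c x))"
    proof (rule supin_semilin[OF semilin_Dl, of "{w. wtw wt w = i}"])
      show "w \<in> {w. wtw wt w = i} \<Longrightarrow> supin {(v, w). wtw wt v + wtw wt w = i} (Dl 0 (basis w))" for w
        using Dl_0_weight[of wt w] by auto
    qed (use that in \<open>auto simp: Gr_def\<close>)
    then show ?thesis using that by (simp add: Gr_def)
  qed
  then have "homogeneous A (Gr (wtw wt)) (int 0) (comult A)"
    by (intro homogeneous_Gr[OF coord_r_axioms homog_wtw]) auto
  then show "homogeneous A (Gr (wtw wt)) 0 (comult A)" by simp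
  fix i x assume x: "x \<in> Gr (wtw wt) i"
  then have xc: "x \<in> carrier A" "supin {w. wtw wt w = i} (c x)" by (auto simp: Gr_def)
  then show "i \<noteq> 0 \<Longrightarrow> counit A x = 0" by (simp add: supin_coef)
  have "supin {w. wtw wt w = i} (Sl 0 (c x))"
    by (rule supin_semilin[OF semilin_Sl xc(2)]) (auto simp: Sl_0_basis rev_map[symmetric])
  then show "antipode A x \<in> Gr (wtw wt) i" using xc by (simp add: Gr_def)
  fix j y assume y: "y \<in> Gr (wtw wt) j"
  then have "supin {w. wtw wt w = i + j} (c x * c y)" using xc
    by (rule_tac supin_mult[of "{w. wtw wt w = i}" _ "{w. wtw wt w = j}"]) (auto simp: Gr_def plus_list_def)
  then show "x \<otimes>\<^bsub>A\<^esub> y \<in> Gr (wtw wt) (i + j)" using xc y by (simp add: Gr_def)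
qed

lemma graded_copoisson_Gr:
  assumes "\<And>l n. 1 \<le> l \<Longrightarrow> l < n \<Longrightarrow> wt l + wt (n - l) = wt n + s"
  shows "graded_copoisson_hopf A cobr (Gr (wtw wt)) (int s)"
  unfolding graded_copoisson_hopf_def
proof (intro conjI is_copoisson graded_hopf_Gr homogeneous_Gr[OF coord_r_axioms homog_wtw] cobr(1))
  fix i x assume "x \<in> Gr (wtw wt) i"
  then have x: "x \<in> carrier A" "supin {w. wtw wt w = i} (c x)" by (auto simp: Gr_def)
  have "supin {(v, w). wtw wt v + wtw wt w = i + s} (db (c x))"
    by (rule supin_semilin[OF semilin_db x(2)]) (use db_weight[OF assms] in auto)
  then show "supin {(v, w). wtw wt v + wtw wt w = i + s} (tev2 c (cobr x))" using x by simp
qed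

end

section \<open>Quotients\<close>

text \<open>The ideal is given as the kernel of a map \<kappa> into a free module, so cosets are
  fibres of \<kappa>, and \<kappa> descends to coordinates on the quotient. The product mul on
  coordinates is a parameter, since for the free Lie algebra it is the commutator; \<sigma> chooses
  representatives of scalars, for the passage from k[hbar] to k.\<close>

locale quot =
  fixes B :: "('r, 'a::ab_group_add, 'm) module_scheme" and \<kappa> :: "'a \<Rightarrow> 'b \<Rightarrow>\<^sub>0 's::comm_ring_1"
    and \<sigma> :: "'s \<Rightarrow> 'r" and I :: "'a set" and mul :: "('b \<Rightarrow>\<^sub>0 's) \<Rightarrow> ('b \<Rightarrow>\<^sub>0 's) \<Rightarrow> 'b \<Rightarrow>\<^sub>0 's"
  assumes B_add: "add B = (+)" and B_zero: "ring.zero B = 0"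
    and C_zero: "0 \<in> carrier B" and C_add: "x \<in> carrier B \<Longrightarrow> y \<in> carrier B \<Longrightarrow> x + y \<in> carrier B"
    and C_uminus: "x \<in> carrier B \<Longrightarrow> - x \<in> carrier B"
    and C_smult: "x \<in> carrier B \<Longrightarrow> \<sigma> a \<odot>\<^bsub>B\<^esub> x \<in> carrier B"
    and C_mult: "x \<in> carrier B \<Longrightarrow> y \<in> carrier B \<Longrightarrow> x \<otimes>\<^bsub>B\<^esub> y \<in> carrier B"
    and k_add: "x \<in> carrier B \<Longrightarrow> y \<in> carrier B \<Longrightarrow> \<kappa> (x + y) = \<kappa> x + \<kappa> y"
    and k_smult: "x \<in> carrier B \<Longrightarrow> \<kappa> (\<sigma> a \<odot>\<^bsub>B\<^esub> x) = scale a (\<kappa> x)"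
    and k_mult: "x \<in> carrier B \<Longrightarrow> y \<in> carrier B \<Longrightarrow> \<kappa> (x \<otimes>\<^bsub>B\<^esub> y) = mul (\<kappa> x) (\<kappa> y)"
    and I_eq: "I = {x \<in> carrier B. \<kappa> x = 0}"
begin

abbreviation coset :: "'a \<Rightarrow> 'a set" where "coset x \<equiv> I +>\<^bsub>B\<^esub> x"

definition kq :: "'a set \<Rightarrow> 'b \<Rightarrow>\<^sub>0 's" where "kq Y = \<kappa> (SOME y. y \<in> Y)"

abbreviation "Q \<equiv> quot_module \<sigma> B I"

lemma k_zero: "\<kappa> 0 = 0" using k_add[of 0 0] C_zero by simp

lemma k_diff: assumes "x \<in> carrier B" "y \<in> carrier B" shows "x - y \<in> carrier B" "\<kappa> (x - y) = \<kappa> x - \<kappa> y"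
proof -
  show 1: "x - y \<in> carrier B" using C_add[OF assms(1) C_uminus[OF assms(2)]] by simp
  show "\<kappa> (x - y) = \<kappa> x - \<kappa> y" using k_add[OF 1 assms(2)] by simp
qed

lemma coset_eq: assumes x: "x \<in> carrier B" shows "coset x = {y \<in> carrier B. \<kappa> y = \<kappa> x}"
proof -
  have c: "coset x = (\<lambda>i. i + x) ` I" by (auto simp: a_r_coset_def' B_add)
  have "y \<in> (\<lambda>i. i + x) ` I" if "y \<in> carrier B" "\<kappa> y = \<kappa> x" for y
    using k_diff[OF that(1) x] that(2) by (intro image_eqI[of _ _ "y - x"]) (auto simp: I_eq)
  then show ?thesis unfolding c by (auto simp: I_eq x C_add k_add)
qed

text \<open>The quotient Hopf structure is defined with \<open>SOME\<close>; every representative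
  serves equally well, because only its value under \<kappa> counts.\<close>

lemma coset_some: assumes "x \<in> carrier B"
  shows "(SOME y. y \<in> coset x) \<in> carrier B" "\<kappa> (SOME y. y \<in> coset x) = \<kappa> x"
  using someI[of "\<lambda>y. y \<in> coset x" x] by (auto simp: coset_eq[OF assms] assms)

lemma kq_coset: "x \<in> carrier B \<Longrightarrow> kq (coset x) = \<kappa> x"
  unfolding kq_def by (rule coset_some)

lemma coset_cong: "x \<in> carrier B \<Longrightarrow> y \<in> carrier B \<Longrightarrow> coset x = coset y \<longleftrightarrow> \<kappa> x = \<kappa> y"
  using kq_coset[of x] kq_coset[of y] by (auto simp: coset_eq)

lemma I_coset: "I = coset 0"
  unfolding coset_eq[OF C_zero] k_zero by (rule I_eq)

lemma Q_simps:
  "carrier Q = coset ` carrier B" "ring.zero Q = coset 0" "one Q = coset \<one>\<^bsub>B\<^esub>"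
  "x \<in> carrier B \<Longrightarrow> y \<in> carrier B \<Longrightarrow> coset x \<oplus>\<^bsub>Q\<^esub> coset y = coset (x + y)"
  "x \<in> carrier B \<Longrightarrow> y \<in> carrier B \<Longrightarrow> coset x \<otimes>\<^bsub>Q\<^esub> coset y = coset (x \<otimes>\<^bsub>B\<^esub> y)"
  "x \<in> carrier B \<Longrightarrow> a \<odot>\<^bsub>Q\<^esub> coset x = coset (\<sigma> a \<odot>\<^bsub>B\<^esub> x)"
proof -
  show "carrier Q = coset ` carrier B" "ring.zero Q = coset 0" "one Q = coset \<one>\<^bsub>B\<^esub>"
    using I_coset by (auto simp: quot_module_def ring.extend_def module.fields_def FactRing_def A_RCOSETS_def')
  fix x assume x: "x \<in> carrier B"
  show "a \<odot>\<^bsub>Q\<^esub> coset x = coset (\<sigma> a \<odot>\<^bsub>B\<^esub> x)"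
    using x by (auto simp: quot_module_def ring.extend_def module.fields_def coset_eq C_smult k_smult)
  fix y assume y: "y \<in> carrier B"
  have "z \<in> (\<Union>h\<in>coset x. \<Union>k\<in>coset y. {h + k})" if "z \<in> coset (x + y)" for z
  proof -
    have z: "z \<in> carrier B" "\<kappa> z = \<kappa> x + \<kappa> y" using that x y by (auto simp: coset_eq C_add k_add)
    have "z - x \<in> coset y" "x \<in> coset x" using x y z by (auto simp: coset_eq k_diff)
    then show ?thesis by (intro UN_I[of x] UN_I[of "z - x"]) simp_all
  qed
  moreover have "(\<Union>h\<in>coset x. \<Union>k\<in>coset y. {h + k}) \<subseteq> coset (x + y)"
    using x y by (auto simp: coset_eq C_add k_add)
  ultimately show "coset x \<oplus>\<^bsub>Q\<^esub> coset y = coset (x + y)"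
    by (auto simp: quot_module_def ring.extend_def module.fields_def FactRing_def set_add_def' B_add)
  have "coset (a \<otimes>\<^bsub>B\<^esub> b) = coset (x \<otimes>\<^bsub>B\<^esub> y)" if "a \<in> coset x" "b \<in> coset y" for a b
    using that x y by (subst coset_cong) (auto simp: coset_eq C_mult k_mult)
  then have "(\<Union>a\<in>coset x. \<Union>b\<in>coset y. coset (a \<otimes>\<^bsub>B\<^esub> b)) = (\<Union>a\<in>coset x. \<Union>b\<in>coset y. coset (x \<otimes>\<^bsub>B\<^esub> y))" by auto
  moreover have "x \<in> coset x" "y \<in> coset y" using x y by (auto simp: coset_eq)
  ultimately show "coset x \<otimes>\<^bsub>Q\<^esub> coset y = coset (x \<otimes>\<^bsub>B\<^esub> y)"
    by (auto simp: quot_module_def ring.extend_def module.fields_def FactRing_def rcoset_mult_def)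
qed

lemma coord_Q: "coord Q kq"
proof
  show "inj_on kq (carrier Q)" by (auto simp: Q_simps inj_on_def kq_coset coset_cong)
qed (auto simp: Q_simps kq_coset C_zero C_add C_smult k_zero k_add k_smult B_zero)

lemma kq_mult: "Y \<in> carrier Q \<Longrightarrow> Z \<in> carrier Q \<Longrightarrow> Y \<otimes>\<^bsub>Q\<^esub> Z \<in> carrier Q \<and> kq (Y \<otimes>\<^bsub>Q\<^esub> Z) = mul (kq Y) (kq Z)"
  by (auto simp: Q_simps kq_coset C_mult k_mult)

end

lemma coord_cong:
  assumes "coord M c" "carrier M' = carrier M" "ring.zero M' = ring.zero M" "add M' = add M" "module.smult M' = module.smult M"
  shows "coord M' c"
  using assms unfolding coord_def by simp

lemma hopf_extend_simps [simp]:
  "carrier (module.extend M (hopf.fields d e s)) = carrier M" "monoid.mult (module.extend M (hopf.fields d e s)) = monoid.mult M"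
  "one (module.extend M (hopf.fields d e s)) = one M" "ring.zero (module.extend M (hopf.fields d e s)) = ring.zero M"
  "add (module.extend M (hopf.fields d e s)) = add M" "module.smult (module.extend M (hopf.fields d e s)) = module.smult M"
  "comult (module.extend M (hopf.fields d e s)) = d" "counit (module.extend M (hopf.fields d e s)) = e"
  "antipode (module.extend M (hopf.fields d e s)) = s"
  by (simp_all add: module.extend_def hopf.fields_def)

text \<open>Common frame for the specialization of the Rees algebra and the enveloping algebra. Both
  become instances of \<open>FB_classical\<close> over the same words, whence their
  isomorphism.\<close>

locale quot_to_classical = quot B \<kappa> \<sigma> I "(*)"
  for B :: "('r::comm_ring_1, 'a::ab_group_add) hopf" and \<kappa> :: "'a \<Rightarrow> nat list \<Rightarrow>\<^sub>0 'k::field" and \<sigma> I +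
  fixes \<rho> :: "'r \<Rightarrow> 'k" and V :: "nat set"
  assumes rhom_rho: "rhom \<rho>" and V_down: "down V"
    and C_one: "\<one>\<^bsub>B\<^esub> \<in> carrier B" and k_one: "\<kappa> \<one>\<^bsub>B\<^esub> = 1"
    and k_W: "x \<in> carrier B \<Longrightarrow> supin (lists V) (\<kappa> x)"
    and k_surj: "supin (lists V) p \<Longrightarrow> \<exists>x\<in>carrier B. \<kappa> x = p"
    and B_comult: "x \<in> carrier B \<Longrightarrow> comult B x \<in> ftens 2 B"
    and k_comult: "x \<in> carrier B \<Longrightarrow> tev2 kq (push \<rho> coset (comult B x)) = Dl 0 (\<kappa> x)"
    and k_counit: "x \<in> carrier B \<Longrightarrow> \<rho> (counit B x) = eps (\<kappa> x)"
    and C_antipode: "x \<in> carrier B \<Longrightarrow> antipode B x \<in> carrier B"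
    and k_antipode: "x \<in> carrier B \<Longrightarrow> \<kappa> (antipode B x) = Sl 0 (\<kappa> x)"
begin

abbreviation "QH \<equiv> quot_hopf \<sigma> \<rho> B I"

lemma QH_simps:
  "carrier QH = carrier Q" "monoid.mult QH = monoid.mult Q" "one QH = one Q" "ring.zero QH = ring.zero Q"
  "add QH = add Q" "module.smult QH = module.smult Q"
  by (simp_all add: quot_hopf_def)

lemma FB_classical_QH: "FB_classical QH kq V"
proof -
  interpret coord QH kq by (rule coord_cong[OF coord_Q]) (simp_all add: QH_simps)
  show ?thesis
  proof
    show "down V" by (rule V_down)
    show "Y \<in> carrier QH \<Longrightarrow> supin (lists V) (kq Y)" for Y
      by (auto simp: QH_simps Q_simps kq_coset k_W)
    show "\<exists>Y\<in>carrier QH. kq Y = p" if p: "supin (lists V) p" for p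
    proof -
      obtain x where "x \<in> carrier B" "\<kappa> x = p" using k_surj[OF p] by blast
      then show ?thesis by (auto simp: QH_simps Q_simps kq_coset intro!: bexI[of _ "coset x"])
    qed
    show "\<one>\<^bsub>QH\<^esub> \<in> carrier QH" "kq \<one>\<^bsub>QH\<^esub> = 1"
      using C_one by (auto simp: QH_simps Q_simps kq_coset k_one)
    fix Y assume "Y \<in> carrier QH"
    then obtain x where Y: "Y = coset x" "x \<in> carrier B" by (auto simp: QH_simps Q_simps)
    note s = coset_some[OF Y(2)]
    have "push \<rho> coset (comult B y) \<in> ftens 2 QH" if "y \<in> carrier B" for y
      by (rule ftens_push[OF rhom_rho B_comult[OF that]]) (auto simp: QH_simps Q_simps)
    then show "comult QH Y \<in> ftens 2 QH" using s by (simp add: quot_hopf_def Y)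
    show "tev2 kq (comult QH Y) = Dl 0 (kq Y)" using s by (simp add: quot_hopf_def Y k_comult kq_coset)
    show "counit QH Y = eps (kq Y)" using s by (simp add: quot_hopf_def Y k_counit kq_coset)
    show "antipode QH Y \<in> carrier QH" "kq (antipode QH Y) = Sl 0 (kq Y)"
      using s by (auto simp: quot_hopf_def Y kq_coset Q_simps C_antipode k_antipode)
  qed (use kq_mult in \<open>auto simp: QH_simps\<close>)
qed

end

section \<open>Free Hopf algebras\<close>

lemma free_hopf_simps [simp]:
  "carrier (free_hopf V D s) = carrier (free_alg V)" "monoid.mult (free_hopf V D s) = (*)" "one (free_hopf V D s) = 1"
  "ring.zero (free_hopf V D s) = 0" "add (free_hopf V D s) = (+)" "module.smult (free_hopf V D s) = scale"
  "counit (free_hopf V D s) = eps" "antipode (free_hopf V D s) = antialg s"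
  by (simp_all add: free_hopf_def antialg_def)

lemma ftens_carrier_cong: "carrier M = carrier M' \<Longrightarrow> ftens n M = ftens n M'"
  by (simp add: ftens_def)

text \<open>The second part evaluates the coproduct in the coordinates of a multiplicative map
  \<kappa>: the fold over the letters becomes an algebra map, determined by its values on
  generators. It is used with the identity for H and with \<open>sub\<close> for the enveloping
  algebra.\<close>

lemma free_comult:
  fixes D :: "'x \<Rightarrow> ('x list \<Rightarrow>\<^sub>0 'r::comm_ring_1) list \<Rightarrow>\<^sub>0 'r"
  assumes D: "\<And>x. x \<in> V \<Longrightarrow> D x \<in> ftens 2 (free_alg V)" and y: "supin (lists V) y"
  shows "comult (free_hopf V D s) y \<in> ftens 2 (free_hopf V D s)"
    and "\<And>\<kappa> :: ('x list \<Rightarrow>\<^sub>0 'r) \<Rightarrow> 'm::monoid_add \<Rightarrow>\<^sub>0 'r.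
       (\<And>f g. f \<in> carrier (free_alg V) \<Longrightarrow> g \<in> carrier (free_alg V) \<Longrightarrow> \<kappa> (f * g) = \<kappa> f * \<kappa> g) \<Longrightarrow> \<kappa> 1 = 1 \<Longrightarrow>
       tev2 \<kappa> (comult (free_hopf V D s) y) = alg id (\<lambda>x. tev2 \<kappa> (D x)) y"
proof -
  let ?F = "\<lambda>w. foldr (tmult (free_alg V)) (map D w) (basis [1, 1]) :: ('x list \<Rightarrow>\<^sub>0 'r) list \<Rightarrow>\<^sub>0 'r"
  have c: "comult (free_hopf V D s) = lin ?F" by (simp add: free_hopf_def)
  have m: "f \<in> carrier (free_alg V) \<Longrightarrow> g \<in> carrier (free_alg V) \<Longrightarrow> f \<otimes>\<^bsub>free_alg V\<^esub> g \<in> carrier (free_alg V)"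
    for f g :: "'x list \<Rightarrow>\<^sub>0 'r"
    unfolding free_alg_carrier by simp
  have one: "(1 :: 'x list \<Rightarrow>\<^sub>0 'r) \<in> carrier (free_alg V)" unfolding free_alg_carrier by simp
  have F: "?F w \<in> ftens 2 (free_alg V)" if "w \<in> lists V" for w
    using that
  proof (induction w)
    case Nil
    have "basis [1, 1] \<in> ftens 2 (free_alg V :: ('r, 'x list \<Rightarrow>\<^sub>0 'r) module)" using one by (intro ftens_closed tlistsI)
    then show ?case by simp
  next
    case (Cons x w)
    then show ?case using ftens_tmult[OF D _ m] by simp
  qed
  have "lin ?F y \<in> ftens 2 (free_alg V)"
    unfolding ftens_supin by (rule supin_semilin[OF semilin_lin y]) (use F in \<open>simp add: ftens_supin\<close>)
  then show "comult (free_hopf V D s) y \<in> ftens 2 (free_hopf V D s)"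
    unfolding c using ftens_carrier_cong[of "free_hopf V D s" "free_alg V" 2] by simp
  fix \<kappa> :: "('x list \<Rightarrow>\<^sub>0 'r) \<Rightarrow> 'm \<Rightarrow>\<^sub>0 'r"
  assume k: "\<And>f g. f \<in> carrier (free_alg V) \<Longrightarrow> g \<in> carrier (free_alg V) \<Longrightarrow> \<kappa> (f * g) = \<kappa> f * \<kappa> g" "\<kappa> 1 = 1"
  have "tev2 \<kappa> (?F w) = prod_list (map (\<lambda>x. tev2 \<kappa> (D x)) w)" if "w \<in> lists V" for w
    using that
  proof (induction w)
    case Nil
    then show ?case by (simp add: tev2_basis k)
  next
    case (Cons x w)
    then show ?case using tev2_tmult[OF D F, of x w \<kappa>] k(1) by simp
  qed
  note F' = this
  show "tev2 \<kappa> (comult (free_hopf V D s) y) = alg id (\<lambda>x. tev2 \<kappa> (D x)) y"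
    unfolding c
  proof (rule semilin_ext_on[OF semilin_comp2[OF semilin_lin semilin_tev(1)] ringmapD(1)[OF ringmap_alg[OF rhom_id(1)]]])
    fix w assume "w \<in> supp y"
    then have "w \<in> lists V" using y by (auto simp: supin_def)
    then show "tev2 \<kappa> (lin ?F (basis w)) = alg id (\<lambda>x. tev2 \<kappa> (D x)) (basis w)" by (simp add: F')
  qed
qed

lemma coord_free_alg: "coord (free_alg V) (\<lambda>f. f)"
  by unfold_locales (use free_alg_carrier supin_basic in \<open>auto simp: free_alg_carrier simp del: free_alg_simps(1)\<close>)

lemma FB_hopf_H_alg:
  assumes "down V"
  shows "FB_hopf (free_hopf V H_comult_gen H_antipode_gen) (\<lambda>f. f) V (1 :: 'r::comm_ring_1)"
proof -
  let ?H = "free_hopf V H_comult_gen H_antipode_gen :: ('r, nat list \<Rightarrow>\<^sub>0 'r) hopf"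
  interpret coord ?H "\<lambda>f. f" by (rule coord_cong[OF coord_free_alg[of V]]) simp_all
  have Hc: "f \<in> carrier ?H \<longleftrightarrow> supin (lists V) f" for f by (simp only: free_hopf_simps free_alg_carrier)
  have D: "H_comult_gen n \<in> ftens 2 (free_alg V :: ('r, nat list \<Rightarrow>\<^sub>0 'r) module)" if "n \<in> V" for n
  proof -
    have q: "(Q_poly m (n - m) :: nat list \<Rightarrow>\<^sub>0 'r) \<in> carrier (free_alg V)" "(gen m :: nat list \<Rightarrow>\<^sub>0 'r) \<in> carrier (free_alg V)"
      if "m \<in> {1..<n}" for m
    proof -
      have "{1..n} \<subseteq> V" using assms \<open>n \<in> V\<close> by (auto simp: down_def)
      then have "{1..n - m} \<subseteq> V" "m \<in> V" using that by (auto simp: subset_iff)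
      then show "(Q_poly m (n - m) :: nat list \<Rightarrow>\<^sub>0 'r) \<in> carrier (free_alg V)" "(gen m :: nat list \<Rightarrow>\<^sub>0 'r) \<in> carrier (free_alg V)"
        using that supin_mono[OF supin_FB[of "n - m" 1 "m + 1"] lists_mono, of V]
        unfolding free_alg_carrier by (auto simp: Q_poly_conv_FB)
    qed
    have g: "(gen n :: nat list \<Rightarrow>\<^sub>0 'r) \<in> carrier (free_alg V)" "(1 :: nat list \<Rightarrow>\<^sub>0 'r) \<in> carrier (free_alg V)"
      unfolding free_alg_carrier using that by auto
    show ?thesis unfolding H_comult_gen_def
      by (intro ftens_closed(2) ftens_sum ftens_closed(6) tlistsI q g)
  qed
  have t: "tev2 (\<lambda>f. f) (H_comult_gen n) = (dgen 1 n :: nat list \<times> nat list \<Rightarrow>\<^sub>0 'r)" for n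
    by (auto simp: H_comult_gen_def dgen_def tev_simps tev2_basis Q_poly_conv_FB intro!: sum.cong)
  show ?thesis
  proof
    fix x assume "x \<in> carrier ?H"
    then have x: "supin (lists V) x" by (simp only: Hc)
    show "comult ?H x \<in> ftens 2 ?H" by (rule free_comult(1)[OF D x])
    show "tev2 (\<lambda>f. f) (comult ?H x) = Dl 1 x"
      by (subst free_comult(2)[OF D x]) (simp_all add: t Dl_def)
    show "antipode ?H x \<in> carrier ?H" "antipode ?H x = Sl 1 x"
      using supin_Sl[OF assms x, of 1] unfolding Hc by (simp_all add: Sl_def H_antipode_gen_conv[abs_def])
  qed (simp_all add: Hc assms del: free_hopf_simps(1))
qed

section \<open>The Rees algebra\<close>

lemma coef_slin_diag:
  assumes "\<rho> 0 = 0"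
  shows "coef (slin \<rho> (\<lambda>w. scale (a w) (basis w)) f) w = \<rho> (coef f w) * a w"
proof -
  have "coef (slin \<rho> (\<lambda>w. scale (a w) (basis w)) f) w = (\<Sum>v\<in>supp f. if v = w then \<rho> (coef f v) * a v else 0)"
    by (simp add: slin_def lookup_sum lookup_single when_def)
  then show ?thesis using assms by (auto simp: in_keys_iff)
qed

lemma rhom_to_fract [simp]: "rhom (to_fract :: 'k::field poly \<Rightarrow> _)"
  by (simp add: rhom_def)

abbreviation qh :: "'k::field poly fract" where "qh \<equiv> inverse (to_fract hbar)"

lemma qh_nz [simp]: "to_fract hbar * qh = 1" "qh \<noteq> 0"
  by simp_all

text \<open>\<open>\<Phi>\<close> identifies \<open>k[\<hbar>]\<langle>x\<^sub>n\<rangle>\<close> with the Rees algebra, \<open>x\<^sub>n \<mapsto> \<hbar>\<^sup>-\<^sup>1 a\<^sub>n\<close>.\<close>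
definition Phi :: "(nat list \<Rightarrow>\<^sub>0 'k::field poly) \<Rightarrow> nat list \<Rightarrow>\<^sub>0 'k poly fract" where
  "Phi = rescale to_fract qh"

lemma ringmap_Phi [simp]: "ringmap to_fract Phi" and semilin_Phi [simp]: "semilin to_fract Phi"
  by (simp_all add: Phi_def)

lemmas Phi_simps = semilinD[OF semilin_Phi] ringmapD(2,3)[OF ringmap_Phi]

lemma coef_Phi: "coef (Phi f) w = to_fract (coef f w) * qh ^ length w"
  by (simp add: Phi_def coef_rescale)

lemma Phi_inj: "Phi f = Phi g \<longleftrightarrow> f = g"
proof
  assume "Phi f = Phi g"
  then have "coef (Phi f) w = coef (Phi g) w" for w by simp
  then show "f = g" by (intro poly_mapping_eqI) (simp add: coef_Phi)
qed simp

lemma supp_Phi: "supp (Phi f) = supp f"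
  by (auto simp: in_keys_iff coef_Phi)

text \<open>On pairs of words the map is diagonal with powers of 1/hbar as entries. It follows that
  2-tensors over k[hbar] are determined by their images over k(hbar), so the choice made in
  \<open>rees\<close> fixes the coproduct up to \<open>teq\<close>.\<close>

lemma tmap_Phi_inj: "tmap to_fract Phi Phi f = tmap to_fract Phi Phi g \<Longrightarrow> f = g"
proof -
  have "coef (tmap to_fract Phi Phi f) p = to_fract (coef f p) * (qh ^ length (fst p) * qh ^ length (snd p))" for f p
  proof -
    have "tmap to_fract Phi Phi f = slin to_fract (\<lambda>p. scale (qh ^ length (fst p) * qh ^ length (snd p)) (basis p)) f"
      unfolding tmap_def
      by (rule slin_cong) (simp add: Phi_def rescale_basis ten_linear mult.commute del: scale_simps(5))
    then show ?thesis by (simp only: coef_slin_diag to_fract_0)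
  qed
  note c = this
  assume e: "tmap to_fract Phi Phi f = tmap to_fract Phi Phi g"
  show "f = g"
  proof (rule poly_mapping_eqI)
    fix p
    have "to_fract (coef f p) * (qh ^ length (fst p) * qh ^ length (snd p)) =
        to_fract (coef g p) * (qh ^ length (fst p) * qh ^ length (snd p))"
      unfolding c[symmetric] e ..
    then show "coef f p = coef g p" by simp
  qed
qed

lemma Dl_Phi: "Dl 1 (Phi f) = tmap to_fract Phi Phi (Dl hbar f)"
  and Sl_Phi: "Sl 1 (Phi f) = Phi (Sl hbar f)"
  unfolding Phi_def by (rule rescale_Dl rescale_Sl; simp)+

abbreviation H_rees :: "enat \<Rightarrow> ('k::field poly, nat list \<Rightarrow>\<^sub>0 'k poly fract) module" where
  "H_rees \<nu> \<equiv> (H_poly_module \<nu>)\<lparr>carrier := rees_set \<nu>\<rparr>"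

lemma H_poly_simps [simp]:
  "ring.zero (H_poly_module \<nu>) = 0" "add (H_poly_module \<nu>) = (+)" "module.smult (H_poly_module \<nu>) = (\<lambda>p. scale (to_fract p))"
  "monoid.mult (H_poly_module \<nu>) = (*)" "one (H_poly_module \<nu>) = 1"
  by (simp_all add: H_poly_module_def ring.extend_def module.fields_def ring.truncate_def H_alg_def)

lemma aug_ideal_eq: "aug_ideal \<nu> = {f. supin (lists (index_set \<nu>)) f \<and> eps f = 0}"
  unfolding aug_ideal_def H_alg_def free_hopf_simps free_alg_carrier[abs_def] using free_alg_carrier by blast

text \<open>Elements of J have no constant term, so products of n of them, and sums of such
  products, involve only words of length at least n.\<close>

lemma aug_power_supin:
  "f \<in> aug_power \<nu> n \<Longrightarrow> supin {w \<in> lists (index_set \<nu>). n \<le> length w} f"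
proof (induction n arbitrary: f)
  case 0
  then have "f \<in> carrier (free_alg (index_set \<nu>))" by (simp add: H_alg_def)
  then show ?case unfolding free_alg_carrier by simp
next
  case (Suc n)
  let ?W = "{w \<in> lists (index_set \<nu>). 1 \<le> length w}"
  from Suc.prems have "f \<in> ideal_prod (H_alg \<nu> :: ('a, _) hopf) (aug_ideal \<nu>) (aug_power \<nu> n)" by simp
  then show ?case
  proof (induction rule: ideal_prod.induct)
    case (prod i j)
    have "supin ?W i" using prod(1) unfolding aug_ideal_eq by (auto simp: supin_coef Suc_le_eq)
    then have "supin {w \<in> lists (index_set \<nu>). Suc n \<le> length w} (i * j)"
      by (rule supin_mult[OF _ Suc.IH[OF prod(2)]]) (auto simp: plus_list_def)
    then show ?case by (simp add: H_alg_def)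
  qed (simp add: H_alg_def)
qed

lemma basis_aug_power: "set w \<subseteq> index_set \<nu> \<Longrightarrow> (basis w :: nat list \<Rightarrow>\<^sub>0 'k::field) \<in> aug_power \<nu> (length w)"
proof (induction w)
  case Nil
  have "(basis [] :: nat list \<Rightarrow>\<^sub>0 'k) \<in> carrier (free_alg (index_set \<nu>))" unfolding free_alg_carrier by simp
  then show ?case by (simp add: H_alg_def)
next
  case (Cons n w)
  have "(gen n :: nat list \<Rightarrow>\<^sub>0 'k) \<in> aug_ideal \<nu>" using Cons.prems unfolding aug_ideal_eq by simp
  then have "gen n \<otimes>\<^bsub>H_alg \<nu>\<^esub> basis w \<in> ideal_prod (H_alg \<nu> :: ('k, _) hopf) (aug_ideal \<nu>) (aug_power \<nu> (length w))"
    using Cons by (intro ideal_prod.prod) auto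
  then show ?case by (simp add: H_alg_def basis_Cons)
qed

text \<open>hbar^(-n) w is hbar^(length w - n) times \<open>Phi\<close> of w, and the exponent is
  not negative when w occurs in an element of J^n. Conversely, \<open>Phi\<close> of w is
  hbar^(-length w) w, and w lies in J^(length w).\<close>

lemma rees_set_eq: "rees_set \<nu> = Phi ` {p :: nat list \<Rightarrow>\<^sub>0 'a::field poly. supin (lists (index_set \<nu>)) p}"
proof
  let ?V = "index_set \<nu>"
  let ?S = "(\<Union>n. (\<lambda>j. hbar_inv_scale n (extend_scalars j)) ` aug_power \<nu> n) :: (nat list \<Rightarrow>\<^sub>0 'a poly fract) set"
  have sub: "y \<in> Phi ` {p. supin (lists ?V) p}" if "y \<in> mspan (H_poly_module \<nu>) ?S" for y
    using that
  proof (induction rule: mspan.induct)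
    case zero
    then show ?case by (auto simp: Phi_simps intro!: image_eqI[of _ _ 0])
  next
    case (base y)
    then obtain n j where j: "j \<in> aug_power \<nu> n" "y = hbar_inv_scale n (extend_scalars j)" by auto
    define p where "p = slin (\<lambda>c. [:c:]) (\<lambda>w. scale (hbar ^ (length w - n)) (basis w)) j"
    have p: "coef p w = [:coef j w:] * hbar ^ (length w - n)" for w
      unfolding p_def by (rule coef_slin_diag) simp
    have s: "w \<notin> lists ?V \<or> length w < n \<Longrightarrow> coef j w = 0" for w
      using aug_power_supin[OF j(1)] by (auto simp: supin_coef)
    have "y = Phi p"
    proof (rule poly_mapping_eqI)
      fix w
      have e: "coef y w = qh ^ n * to_fract [:coef j w:]"
        by (auto simp: j(2) hbar_inv_scale_def extend_scalars_def Poly_Mapping.map.rep_eq when_def)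
      show "coef y w = coef (Phi p) w"
      proof (cases "length w < n")
        case True
        then show ?thesis using s[of w] by (simp add: e coef_Phi p)
      next
        case False
        let ?m = "length w - n"
        have q: "qh ^ length w = (qh ^ ?m * qh ^ n :: 'a poly fract)" using False by (simp only: power_add[symmetric]) simp
        have "to_fract hbar ^ ?m * qh ^ ?m = (to_fract hbar * qh :: 'a poly fract) ^ ?m" by (simp only: power_mult_distrib)
        then have 1: "to_fract hbar ^ ?m * qh ^ ?m = (1 :: 'a poly fract)" by (simp only: qh_nz power_one)
        have pw: "to_fract (hbar ^ m) = (to_fract hbar ^ m :: 'a poly fract)" for m by (induction m) simp_all
        have "coef (Phi p) w = to_fract [:coef j w:] * ((to_fract hbar ^ ?m * qh ^ ?m) * qh ^ n)"
          by (simp only: coef_Phi p to_fract_mult pw q mult.assoc)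
        then show ?thesis by (simp only: 1 e mult.commute mult_1_left)
      qed
    qed
    moreover have "supin (lists ?V) p" using s by (auto simp: supin_coef p)
    ultimately show ?case by auto
  next
    case (add x y)
    then show ?case by (auto simp: simp flip: semilin_add[OF semilin_Phi])
  next
    case (smult x c)
    then show ?case by (auto simp flip: semilin_scale[OF semilin_Phi])
  qed
  show "rees_set \<nu> \<subseteq> Phi ` {p :: nat list \<Rightarrow>\<^sub>0 'a poly. supin (lists ?V) p}"
    unfolding rees_set_def by (rule subsetI, erule sub)
  show "Phi ` {p :: nat list \<Rightarrow>\<^sub>0 'a poly. supin (lists ?V) p} \<subseteq> rees_set \<nu>"
  proof safe
    fix p :: "nat list \<Rightarrow>\<^sub>0 'a poly" assume p: "supin (lists ?V) p"
    have b: "Phi (basis w :: nat list \<Rightarrow>\<^sub>0 'a poly) \<in> rees_set \<nu>" if "w \<in> lists ?V" for w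
    proof -
      have "Phi (basis w :: nat list \<Rightarrow>\<^sub>0 'a poly) = hbar_inv_scale (length w) (extend_scalars (basis w))"
        by (rule poly_mapping_eqI) (auto simp: coef_Phi hbar_inv_scale_def extend_scalars_def Poly_Mapping.map.rep_eq when_def lookup_single one_pCons[symmetric])
      moreover have "(basis w :: nat list \<Rightarrow>\<^sub>0 'a) \<in> aug_power \<nu> (length w)" using that by (intro basis_aug_power) auto
      ultimately show ?thesis unfolding rees_set_def
        by (intro mspan.base UN_I[of "length w" UNIV] UNIV_I image_eqI)
    qed
    have "(\<Sum>w\<in>I. scale (to_fract (coef p w)) (Phi (basis w))) \<in> rees_set \<nu>" if "I \<subseteq> lists ?V" for I
      using that
    proof (induction I rule: infinite_finite_induct)
      case (insert w I)
      have "scale (to_fract (coef p w)) (Phi (basis w)) \<in> rees_set \<nu>"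
        using mspan.smult[of "Phi (basis w)" "H_poly_module \<nu>" ?S "coef p w"] b[of w] insert by (simp add: rees_set_def)
      then show ?case using insert mspan.add[of _ "H_poly_module \<nu>" ?S] by (simp add: rees_set_def)
    qed (use mspan.zero[of "H_poly_module \<nu>" ?S] in \<open>simp_all add: rees_set_def\<close>)
    then show "Phi p \<in> rees_set \<nu>"
      unfolding semilin_expand[OF semilin_Phi, of p] using p by (simp add: supin_def)
  qed
qed

lemma down_index_set: "down (index_set \<nu>)"
  by (auto simp: down_def index_set_def) (metis enat_ord_simps(1) order.trans)

definition cR :: "(nat list \<Rightarrow>\<^sub>0 'k::field poly fract) \<Rightarrow> nat list \<Rightarrow>\<^sub>0 'k poly" where
  "cR y = (THE p. Phi p = y)"

lemma cR_Phi [simp]: "cR (Phi p) = p"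
  unfolding cR_def by (rule the_equality) (simp_all add: Phi_inj)

text \<open>The auxiliary parameter fixes the field.\<close>
context
  fixes \<nu> :: enat and TK :: "'k::field itself"
begin

abbreviation (input) "VN \<equiv> index_set \<nu>"
abbreviation (input) "RA \<equiv> (rees \<nu> :: ('k poly, _) hopf)"

lemma rees_simps:
  "carrier RA = rees_set \<nu>" "monoid.mult RA = (*)" "one RA = 1"
  "ring.zero RA = 0" "add RA = (+)" "module.smult RA = (\<lambda>p. scale (to_fract p))" "antipode RA = antipode (H_alg \<nu>)"
  by (simp_all add: rees_def Let_def)

lemma H_rees_simps:
  "carrier (H_rees \<nu>) = rees_set \<nu>" "ring.zero (H_rees \<nu>) = 0" "add (H_rees \<nu>) = (+)"
  "module.smult (H_rees \<nu>) = (\<lambda>p. scale (to_fract p))"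
  using H_poly_simps[of \<nu>] by simp_all

lemma rees_setE: assumes "y \<in> rees_set \<nu>" obtains p where "y = Phi p" "supin (lists VN) p"
  using assms unfolding rees_set_eq by blast

lemma rees_supin: assumes "y \<in> rees_set \<nu>" shows "supin (lists VN) y"
proof -
  obtain p where "y = Phi p" "supin (lists VN) p" using assms by (rule rees_setE)
  then show ?thesis by (simp add: supin_def[of _ "Phi p"] supin_def[of _ p] supp_Phi)
qed

lemma Phi_rees: "supin (lists VN) p \<Longrightarrow> Phi p \<in> rees_set \<nu>"
  unfolding rees_set_eq by blast

lemma Phi_cR: "y \<in> rees_set \<nu> \<Longrightarrow> Phi (cR y) = y" and supin_cR: "y \<in> rees_set \<nu> \<Longrightarrow> supin (lists VN) (cR y)"
  by (auto elim: rees_setE)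

lemma coord_b_rees: "coord_b (H_rees \<nu> :: ('k poly, _) module) cR (lists VN)"
proof
  show "\<zero>\<^bsub>H_rees \<nu>\<^esub> \<in> carrier (H_rees \<nu>)" "cR \<zero>\<^bsub>H_rees \<nu>\<^esub> = (0 :: _ \<Rightarrow>\<^sub>0 'k poly)"
    using Phi_rees[of 0] cR_Phi[of 0] by (simp_all add: Phi_simps)
  fix x y :: "nat list \<Rightarrow>\<^sub>0 'k poly fract" and a
  assume "x \<in> carrier (H_rees \<nu>)"
  then obtain p where p: "x = Phi p" "supin (lists VN) p" by (auto elim: rees_setE)
  show "a \<odot>\<^bsub>H_rees \<nu>\<^esub> x \<in> carrier (H_rees \<nu>)" "cR (a \<odot>\<^bsub>H_rees \<nu>\<^esub> x) = scale a (cR x)"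
    using p Phi_rees[of "scale a p"] cR_Phi[of "scale a p"] by (simp_all add: Phi_simps del: cR_Phi) (simp)
  show "supin (lists VN) (cR x)" using p by simp
  assume "y \<in> carrier (H_rees \<nu>)"
  then obtain q where q: "y = Phi q" "supin (lists VN) q" by (auto elim: rees_setE)
  show "x \<oplus>\<^bsub>H_rees \<nu>\<^esub> y \<in> carrier (H_rees \<nu>)" "cR (x \<oplus>\<^bsub>H_rees \<nu>\<^esub> y) = cR x + cR y"
    using p q Phi_rees[of "p + q"] cR_Phi[of "p + q"] by (simp_all add: Phi_simps del: cR_Phi) (simp)
next
  show "inj_on cR (carrier (H_rees \<nu> :: ('k poly, _) module))"
    by (auto simp: inj_on_def elim!: rees_setE)
  show "\<exists>x\<in>carrier (H_rees \<nu>). cR x = p" if "supin (lists VN) p" for p :: "_ \<Rightarrow>\<^sub>0 'k poly"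
    using Phi_rees[OF that] by (intro bexI[of _ "Phi p"]) auto
qed

lemma coord_b_RA: "coord_b RA cR (lists VN)"
proof -
  interpret coord_b "H_rees \<nu> :: ('k poly, _) module" cR "lists VN" by (rule coord_b_rees)
  have "coord RA cR" by (rule coord_cong[OF coord_axioms]) (simp_all add: rees_simps)
  then show ?thesis
    unfolding coord_b_def coord_b_axioms_def using c_W c_surj by (simp add: rees_simps H_rees_simps)
qed

text \<open>The choice in \<open>rees\<close> has a candidate, \<open>untev\<close> of the coproduct
  with parameter hbar, whose coefficients lie in k[hbar]. Every candidate has these coordinates: by
  \<open>Dl_Phi\<close> the condition over k(hbar) compares images under \<open>Phi\<close> tensor
  \<open>Phi\<close>, which is injective.\<close>

lemma rees_comult:
  assumes y: "y \<in> rees_set \<nu>"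
  shows "comult RA y \<in> ftens 2 (H_rees \<nu>)" "teq (H_alg \<nu>) (push to_fract id (comult RA y)) (comult (H_alg \<nu>) y)"
    "tev2 cR (comult RA y) = Dl hbar (cR y)"
proof -
  interpret M: coord_b "H_rees \<nu> :: ('k poly, _) module" cR "lists VN" by (rule coord_b_rees)
  interpret H: FB_hopf "H_alg \<nu> :: ('k poly fract, _) hopf" "\<lambda>f. f" VN 1
    unfolding H_alg_def by (rule FB_hopf_H_alg[OF down_index_set])
  have sub: "y \<in> carrier (H_alg \<nu>)" if "y \<in> rees_set \<nu>" for y :: "_ \<Rightarrow>\<^sub>0 'k poly fract"
  proof -
    have "supin (lists VN) y" by (rule rees_supin[OF that])
    then show ?thesis unfolding H_alg_def free_hopf_simps free_alg_carrier .
  qed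
  have t: "tev2 (\<lambda>f. f) (push to_fract id f) = tmap to_fract Phi Phi (tev2 cR f)" "push to_fract id f \<in> ftens 2 (H_alg \<nu>)"
    if "f \<in> ftens 2 (H_rees \<nu> :: ('k poly, _) module)" for f
  proof -
    show "tev2 (\<lambda>f. f) (push to_fract id f) = tmap to_fract Phi Phi (tev2 cR f)"
      by (rule tev2_push[OF rhom_to_fract that semilin_Phi]) (simp add: Phi_cR)
    show "push to_fract id f \<in> ftens 2 (H_alg \<nu>)"
      by (rule ftens_push[OF rhom_to_fract that]) (simp add: sub)
  qed
  have e: "teq (H_alg \<nu>) (push to_fract id f) (comult (H_alg \<nu>) y) \<longleftrightarrow> tev2 cR f = Dl hbar (cR y)"
    if "f \<in> ftens 2 (H_rees \<nu> :: ('k poly, _) module)" for f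
  proof -
    have "tev2 (\<lambda>f. f) (comult (H_alg \<nu>) y) = tmap to_fract Phi Phi (Dl hbar (cR y))"
      using H.comult_tev[OF sub[OF y]] by (simp add: Dl_Phi[symmetric] Phi_cR y)
    then show ?thesis
      using tmap_Phi_inj by (auto simp: H.teq2[OF t(2)[OF that] H.comult_ftens[OF sub[OF y]]] t(1)[OF that])
  qed
  have u: "M.untev (Dl hbar (cR y)) \<in> ftens 2 (H_rees \<nu>)" "tev2 cR (M.untev (Dl hbar (cR y))) = Dl hbar (cR y)"
    by (rule M.untev_ftens[OF supin_Dl[OF down_index_set supin_cR[OF y]]])
      (rule M.tev2_untev[OF supin_Dl[OF down_index_set supin_cR[OF y]]], rule M.cr, rule supin_basic(6))
  have d: "comult RA y = (SOME f. f \<in> ftens 2 (H_rees \<nu>) \<and> teq (H_alg \<nu>) (push to_fract id f) (comult (H_alg \<nu>) y))"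
    by (simp add: rees_def Let_def)
  have "comult RA y \<in> ftens 2 (H_rees \<nu>) \<and> teq (H_alg \<nu>) (push to_fract id (comult RA y)) (comult (H_alg \<nu>) y)"
    unfolding d by (rule someI[of _ "M.untev (Dl hbar (cR y))"]) (use u e in blast)
  then show "comult RA y \<in> ftens 2 (H_rees \<nu>)" "teq (H_alg \<nu>) (push to_fract id (comult RA y)) (comult (H_alg \<nu>) y)"
    "tev2 cR (comult RA y) = Dl hbar (cR y)" using e by blast+
qed

lemma rees_counit: "y \<in> rees_set \<nu> \<Longrightarrow> to_fract (counit RA y) = counit (H_alg \<nu>) y"
  and rees_counit_c: "y \<in> rees_set \<nu> \<Longrightarrow> counit RA y = eps (cR y)"
proof -
  assume y: "y \<in> rees_set \<nu>"
  have d: "counit RA y = (SOME p. to_fract p = counit (H_alg \<nu>) y)" by (simp add: rees_def Let_def)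
  have e: "counit (H_alg \<nu>) y = to_fract (eps (cR y))"
    using y coef_Phi[of "cR y" "[]"] by (simp add: H_alg_def Phi_cR)
  show 1: "to_fract (counit RA y) = counit (H_alg \<nu>) y" unfolding d by (rule someI) (rule e[symmetric])
  show "counit RA y = eps (cR y)" using 1 unfolding e by simp
qed

lemma rees_antipode:
  assumes y: "y \<in> rees_set \<nu>"
  shows "antipode RA y \<in> rees_set \<nu>" "cR (antipode RA y) = Sl hbar (cR y)"
proof -
  have "antipode RA y = Sl 1 (Phi (cR y))"
    unfolding rees_simps using y by (simp add: H_alg_def Sl_def H_antipode_gen_conv[abs_def] Phi_cR)
  then have "antipode RA y = Phi (Sl hbar (cR y))" by (simp add: Sl_Phi)
  then show "antipode RA y \<in> rees_set \<nu>" "cR (antipode RA y) = Sl hbar (cR y)"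
    using Phi_rees[OF supin_Sl[OF down_index_set supin_cR[OF y]]] by simp_all
qed

lemma FB_hopf_rees: "FB_hopf RA cR VN hbar"
proof -
  interpret coord_b RA cR "lists VN" by (rule coord_b_RA)
  show ?thesis
  proof
    show "\<one>\<^bsub>RA\<^esub> \<in> carrier RA" "cR \<one>\<^bsub>RA\<^esub> = (1 :: _ \<Rightarrow>\<^sub>0 'k poly)"
      using Phi_rees[of 1] cR_Phi[of 1] by (simp_all add: rees_simps Phi_simps)
    fix x :: "nat list \<Rightarrow>\<^sub>0 'k poly fract" assume "x \<in> carrier RA"
    then have x: "x \<in> rees_set \<nu>" by (simp add: rees_simps)
    show "comult RA x \<in> ftens 2 RA" using rees_comult(1)[OF x] by (simp add: ftens_def rees_simps H_rees_simps)
    show "tev2 cR (comult RA x) = Dl hbar (cR x)" by (rule rees_comult(3)[OF x])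
    show "counit RA x = eps (cR x)" by (rule rees_counit_c[OF x])
    show "antipode RA x \<in> carrier RA" "cR (antipode RA x) = Sl hbar (cR x)" using rees_antipode[OF x] by (simp_all add: rees_simps)
    fix y :: "nat list \<Rightarrow>\<^sub>0 'k poly fract" assume "y \<in> carrier RA"
    then have y: "y \<in> rees_set \<nu>" by (simp add: rees_simps)
    have "x * y = Phi (cR x * cR y)" using x y by (simp add: Phi_simps Phi_cR)
    then show "x \<otimes>\<^bsub>RA\<^esub> y \<in> carrier RA" "cR (x \<otimes>\<^bsub>RA\<^esub> y) = cR x * cR y"
      using Phi_rees[OF supin_lists_mult[OF supin_cR[OF x] supin_cR[OF y]]] by (simp_all add: rees_simps)
  qed (rule down_index_set)
qed

theorem rees_restricts: "restricts RA (H_alg \<nu>)"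
  unfolding restricts_def
proof (intro conjI ballI allI)
  show "carrier RA \<subseteq> carrier (H_alg \<nu>)"
  proof
    fix y :: "nat list \<Rightarrow>\<^sub>0 'k poly fract" assume "y \<in> carrier RA"
    then have "supin (lists VN) y" by (simp add: rees_supin rees_simps)
    then show "y \<in> carrier (H_alg \<nu>)" unfolding H_alg_def free_hopf_simps free_alg_carrier .
  qed
  fix y :: "nat list \<Rightarrow>\<^sub>0 'k poly fract" assume "y \<in> carrier RA"
  then have y: "y \<in> rees_set \<nu>" by (simp add: rees_simps)
  show "comult RA y \<in> ftens 2 RA" using rees_comult(1)[OF y] by (simp add: ftens_def rees_simps H_rees_simps)
  show "teq (H_alg \<nu>) (push to_fract id (comult RA y)) (comult (H_alg \<nu>) y)" by (rule rees_comult(2)[OF y])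
  show "to_fract (counit RA y) = counit (H_alg \<nu>) y" by (rule rees_counit[OF y])
qed (simp_all add: rees_simps H_alg_def)

section \<open>The specialization at hbar = 0 and its cobracket\<close>

abbreviation "IH \<equiv> hbar_ideal RA"

lemma specialize_quot: "quot_to_classical RA (\<lambda>y. red (cR y)) (\<lambda>c. [:c::'k:]) IH ev0 VN"
proof -
  interpret FB_hopf RA cR VN hbar by (rule FB_hopf_rees)
  interpret Q: quot RA "\<lambda>y. red (cR y)" "\<lambda>c. [:c:]" IH "(*)"
  proof
    show "IH = {x \<in> carrier RA. red (cR x) = 0}"
    proof
      show "IH \<subseteq> {x \<in> carrier RA. red (cR x) = 0}" by (auto simp: hbar_ideal_def red_simps)
      show "{x \<in> carrier RA. red (cR x) = 0} \<subseteq> IH"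
      proof
        fix x assume "x \<in> {x \<in> carrier RA. red (cR x) = 0}"
        then have x: "x \<in> carrier RA" "red (cR x) = 0" by auto
        \<comment> \<open>The support bound places g over the letters of the index set, so that it
          is the coordinate vector of an element of the Rees algebra.\<close>
        obtain g where g: "cR x = scale hbar g" "supp g \<subseteq> supp (cR x)" by (rule red_eq_0E[OF x(2)])
        have "supin (lists VN) g" using g(2) c_W[OF x(1)] by (auto simp: supin_def)
        then have "x = hbar \<odot>\<^bsub>RA\<^esub> r g" "r g \<in> carrier RA" using x g by (auto intro!: c_eqI)
        then show "x \<in> IH" by (auto simp: hbar_ideal_def)
      qed
    qed
    fix x assume x: "x \<in> carrier RA"
    have m: "(- 1) \<odot>\<^bsub>RA\<^esub> x = - x" by (simp add: rees_simps scale_linear)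
    show "- x \<in> carrier RA" unfolding m[symmetric] using x by (rule smult_closed)
    show "red (cR ([:a:] \<odot>\<^bsub>RA\<^esub> x)) = scale a (red (cR x))" for a using x by (simp add: red_simps)
    fix y assume y: "y \<in> carrier RA"
    show "x + y \<in> carrier RA" "red (cR (x + y)) = red (cR x) + red (cR y)"
      using add_closed[OF x y] c_add[OF x y] by (simp_all add: rees_simps(5) red_simps)
  qed (use zero_closed in \<open>auto simp: ringmapD(3)[OF ringmap_red] rees_simps(4,5)\<close>)
  show ?thesis
  proof
    show "rhom ev0" by simp
    show "down VN" by (rule down_index_set)
    show "red (cR \<one>\<^bsub>RA\<^esub>) = 1" by (simp add: ringmapD(2)[OF ringmap_red])
    fix x assume x: "x \<in> carrier RA"
    show "supin (lists VN) (red (cR x))" using x by (simp add: supin_red c_W)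
    show "tev2 Q.kq (push ev0 Q.coset (comult RA x)) = Dl 0 (red (cR x))"
      using x by (subst tev2_push[OF rhom_ev0 comult_ftens[OF x] semilin_red, where c = cR])
        (simp_all add: Q.kq_coset tmap_red Dl_red)
    show "ev0 (counit RA x) = eps (red (cR x))" using x by simp
    show "red (cR (antipode RA x)) = Sl 0 (red (cR x))" using x by (simp add: Sl_red)
  next
    fix p :: "nat list \<Rightarrow>\<^sub>0 'k" assume p: "supin (lists VN) p"
    show "\<exists>x\<in>carrier RA. red (cR x) = p"
      using supin_lift[OF p] by (intro bexI[of _ "r (lift p)"]) auto
  qed auto
qed

abbreviation (input) "cA0 \<equiv> quot.kq (\<lambda>y. red (cR y) :: nat list \<Rightarrow>\<^sub>0 'k)"

lemma specialize_eq: "specialize RA = quot_hopf (\<lambda>c. [:c:]) ev0 RA IH"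
  by (simp add: specialize_def ev0_def[abs_def])

lemma A0_classical: "FB_classical (specialize RA) cA0 VN"
  unfolding specialize_eq by (rule quot_to_classical.FB_classical_QH[OF specialize_quot])

lemma cA0_mod_hbar: "y \<in> carrier RA \<Longrightarrow> cA0 (mod_hbar RA y) = red (cR y)"
  and mod_hbar_carrier: "y \<in> carrier RA \<Longrightarrow> mod_hbar RA y \<in> carrier (specialize RA)"
proof -
  interpret Q: quot_to_classical RA "\<lambda>y. red (cR y)" "\<lambda>c. [:c::'k:]" IH ev0 VN by (rule specialize_quot)
  show "y \<in> carrier RA \<Longrightarrow> cA0 (mod_hbar RA y) = red (cR y)" by (rule Q.kq_coset)
  show "y \<in> carrier RA \<Longrightarrow> mod_hbar RA y \<in> carrier (specialize RA)"
    unfolding specialize_eq Q.QH_simps Q.Q_simps by (rule imageI)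
qed

lemma rees_gen_props:
  assumes "n \<in> VN"
  shows "rees_gen n \<in> carrier RA" "cR (rees_gen n) = (gen n :: nat list \<Rightarrow>\<^sub>0 'k poly)"
proof -
  have "rees_gen n = Phi (gen n :: nat list \<Rightarrow>\<^sub>0 'k poly)" by (simp add: Phi_def rees_gen_def hbar_inv_scale_def)
  then show "rees_gen n \<in> carrier RA" "cR (rees_gen n) = (gen n :: nat list \<Rightarrow>\<^sub>0 'k poly)"
    using Phi_rees[of "gen n"] assms by (simp_all add: rees_simps)
qed

theorem A0_semiclassical: "semiclassical_cobracket RA (FB_classical.cobr (specialize RA) cA0)"
proof -
  interpret A: FB_hopf RA cR VN hbar by (rule FB_hopf_rees)
  interpret Cl: FB_classical "specialize RA" cA0 VN by (rule A0_classical)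
  show ?thesis unfolding semiclassical_cobracket_def
  proof (intro ballI conjI impI)
    fix y assume y: "y \<in> carrier RA"
    have fl: "comult RA y - flip (comult RA y) \<in> ftens 2 RA" using y by (simp add: ftens_flip)
    have ev: "tev2 cR (comult RA y - flip (comult RA y)) = scale hbar (dh (cR y))"
      using y by (simp add: tev_simps tev2_flip[OF A.comult_ftens[OF y]] scale_dh)
    have s: "supin (lists VN \<times> lists VN) (dh (cR y))"
      by (rule supin_dh[OF down_index_set A.c_W[OF y]])
    have g: "A.untev (dh (cR y)) \<in> ftens 2 RA" "tev2 cR (A.untev (dh (cR y))) = dh (cR y)"
      by (rule A.untev_ftens[OF s]) (rule A.tev2_untev[OF s A.c_r_basis])
    have "teq RA (scale hbar (A.untev (dh (cR y)))) (comult RA y - flip (comult RA y))"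
      using g fl ev by (simp add: A.teq2 tev_simps)
    then show "\<exists>g\<in>ftens 2 RA. teq RA (scale hbar g) (comult RA y - flip (comult RA y))" using g(1) by blast
    fix g :: "(nat list \<Rightarrow>\<^sub>0 'k poly fract) list \<Rightarrow>\<^sub>0 'k poly"
    assume g: "g \<in> ftens 2 RA" and t: "teq RA (scale hbar g) (comult RA y - flip (comult RA y))"
    \<comment> \<open>Two quotients g may differ as formal tensors, but not in coordinates, where
      hbar can be cancelled; hence the choice of g does not matter.\<close>
    have "scale hbar (tev2 cR g) = scale hbar (dh (cR y))"
      using A.teq_tev(1)[OF t] unfolding ev by (simp add: tev_simps)
    then have gd: "tev2 cR g = dh (cR y)" by (rule scale_hbar_inj)
    have p: "push ev0 (mod_hbar RA) g \<in> ftens 2 (specialize RA)"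
      by (rule ftens_push[OF rhom_ev0 g mod_hbar_carrier])
    have "tev2 cA0 (push ev0 (mod_hbar RA) g) = red (dh (cR y))"
      by (subst tev2_push[OF rhom_ev0 g semilin_red, where c = cR]) (simp_all add: cA0_mod_hbar gd tmap_red)
    then have "teq (specialize RA) (Cl.cobr (mod_hbar RA y)) (push ev0 (mod_hbar RA) g)"
      using mod_hbar_carrier[OF y] p by (simp add: Cl.teq2 cA0_mod_hbar[OF y] db_red)
    then show "teq (specialize RA) (Cl.cobr (mod_hbar RA y)) (push (\<lambda>p. poly p 0) (mod_hbar RA) g)"
      by (simp add: ev0_def[abs_def])
  qed
qed

end

section \<open>Free Lie algebras\<close>

definition br :: "('x mag \<Rightarrow>\<^sub>0 'k) \<Rightarrow> ('x mag \<Rightarrow>\<^sub>0 'k) \<Rightarrow> 'x mag \<Rightarrow>\<^sub>0 'k::field" where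
  "br f g = lin (\<lambda>s. lin (\<lambda>t. basis (Br s t)) g) f"

lemma br_basis [simp]: "br (basis s) (basis t) = basis (Br s t)"
  by (simp add: br_def)

lemma semilin_br1: "semilin id (\<lambda>f. br f g)"
  by (simp add: br_def)

lemma semilin_br2: "semilin id (br f)"
proof -
  have "br f (g + h) = br f g + br f h" for g h
    by (rule semilin_ext[OF semilin_br1 semilin_lincomb(1)[OF semilin_br1 semilin_br1]])
      (simp add: br_def semilinD[OF semilin_lin])
  moreover have "br f (scale a g) = scale a (br f g)" for a g
    by (rule semilin_ext[OF semilin_br1 semilin_lincomb(4)[OF semilin_br1]])
      (simp add: br_def semilinD[OF semilin_lin])
  ultimately show ?thesis by (simp add: semilin_def)
qed

lemmas br_simps = semilinD[OF semilin_br1, unfolded id_apply] semilinD[OF semilin_br2, unfolded id_apply]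

primrec itb :: "'x mag \<Rightarrow> 'x list \<Rightarrow>\<^sub>0 'k::field" where
  "itb (Leaf x) = gen x"
| "itb (Br s t) = itb s * itb t - itb t * itb s"

definition iota :: "('x mag \<Rightarrow>\<^sub>0 'k::field) \<Rightarrow> 'x list \<Rightarrow>\<^sub>0 'k" where "iota = lin itb"

lemma semilin_iota [simp, intro]: "semilin id iota" and iota_basis [simp]: "iota (basis t) = itb t"
  by (simp_all add: iota_def)

lemmas iota_simps = semilinD[OF semilin_iota, unfolded id_apply]

lemma iota_br: "iota (br f g) = iota f * iota g - iota g * iota f"
  by (rule bilin_ext[of id "\<lambda>f g. iota (br f g)" "\<lambda>f g. iota f * iota g - iota g * iota f"])
    (rule semilin_comp2[OF semilin_br1 semilin_iota] semilin_comp2[OF semilin_br2 semilin_iota]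
      semilin_lincomb(2)[OF semilin_mult(2)[OF semilin_iota] semilin_mult(1)[OF semilin_iota]]
      semilin_lincomb(2)[OF semilin_mult(1)[OF semilin_iota] semilin_mult(2)[OF semilin_iota]] | simp)+

abbreviation mwt :: "('x \<Rightarrow> nat) \<Rightarrow> 'x mag \<Rightarrow> nat" where "mwt wt t \<equiv> mag_eval (+) wt t"

lemma itb_weight: "supin {w. sum_list (map wt w) = mwt wt t} (itb t :: 'x list \<Rightarrow>\<^sub>0 'k::field)"
proof (induction t)
  case (Br s t)
  have "supin {w. sum_list (map wt w) = mwt wt (Br s t)} (itb s * itb t :: 'x list \<Rightarrow>\<^sub>0 'k)"
    by (rule supin_mult[OF Br]) (auto simp: plus_list_def)
  moreover have "supin {w. sum_list (map wt w) = mwt wt (Br s t)} (itb t * itb s :: 'x list \<Rightarrow>\<^sub>0 'k)"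
    by (rule supin_mult[OF Br(2,1)]) (auto simp: plus_list_def)
  ultimately show ?case by simp
qed (simp add: gen_def)

lemma itb_lists: "set_mag t \<subseteq> V \<Longrightarrow> supin (lists V) (itb t)"
  by (induction t) (auto intro!: supin_basic(3) supin_lists_mult)

abbreviation leaves :: "'x mag \<Rightarrow> nat" where "leaves t \<equiv> mwt (\<lambda>_. 1) t"

lemma itb_length: "supin {w. length w = leaves t} (itb t)"
  using itb_weight[of "\<lambda>_. 1" t] by (simp add: sum_list_triv)

lemma leaves_pos: "0 < leaves t" by (induction t) auto

fun rb :: "'x list \<Rightarrow> 'x mag" where
  "rb [x] = Leaf x"
| "rb (x # w) = Br (Leaf x) (rb w)"

text \<open>\<open>rb\<close> is unspecified on the empty word. The value 0 agrees with Dynkin's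
  operator, which kills constants.\<close>

definition bb :: "'x list \<Rightarrow> 'x mag \<Rightarrow>\<^sub>0 'k::field" where
  "bb w = (if w = [] then 0 else basis (rb w))"

lemma bb_simps [simp]: "bb [] = 0" "bb [x] = basis (Leaf x)" "w \<noteq> [] \<Longrightarrow> bb (x # w) = br (basis (Leaf x)) (bb w)"
  by (auto simp: bb_def neq_Nil_conv)

lemma rb_weight: "w \<noteq> [] \<Longrightarrow> mwt wt (rb w) = sum_list (map wt w)"
  by (induction w rule: rb.induct) auto

lemma rb_set: "w \<noteq> [] \<Longrightarrow> set_mag (rb w) = set w"
  by (induction w rule: rb.induct) auto

text \<open>\<open>beta\<close> sends a word to its right-normed bracket; \<open>betan\<close> is normalised so that it is a section
  of \<open>iota\<close> modulo the Lie relations (Dynkin--Specht--Wever).\<close>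
definition beta :: "('x list \<Rightarrow>\<^sub>0 'k::field) \<Rightarrow> 'x mag \<Rightarrow>\<^sub>0 'k" where "beta = lin bb"

definition betan :: "('x list \<Rightarrow>\<^sub>0 'k::field) \<Rightarrow> 'x mag \<Rightarrow>\<^sub>0 'k" where
  "betan = lin (\<lambda>w. scale (1 / of_nat (length w)) (bb w))"

lemma semilin_beta [simp, intro]: "semilin id beta" "semilin id betan"
  by (simp_all add: beta_def betan_def)

lemmas beta_simps = semilinD[OF semilin_beta(1), unfolded id_apply] semilinD[OF semilin_beta(2), unfolded id_apply]

text \<open>Left bracketing by letters makes the nonassociative algebra a module over the free
  algebra; \<open>adT\<close> is the action. Modulo the Lie relations it is the adjoint
  representation, extended to the enveloping algebra.\<close>

definition adw :: "'x list \<Rightarrow> ('x mag \<Rightarrow>\<^sub>0 'k) \<Rightarrow> 'x mag \<Rightarrow>\<^sub>0 'k::field" where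
  "adw w f = foldr (\<lambda>x. br (basis (Leaf x))) w f"

definition adT :: "('x list \<Rightarrow>\<^sub>0 'k) \<Rightarrow> ('x mag \<Rightarrow>\<^sub>0 'k) \<Rightarrow> 'x mag \<Rightarrow>\<^sub>0 'k::field" where
  "adT u f = lin (\<lambda>w. adw w f) u"

lemma adw_simps [simp]: "adw [] f = f" "adw (x # w) f = br (basis (Leaf x)) (adw w f)"
  by (simp_all add: adw_def)

lemma semilin_adT1: "semilin id (\<lambda>u. adT u f)" by (simp add: adT_def)

lemma adT_basis [simp]: "adT (basis w) f = adw w f" by (simp add: adT_def)

lemma semilin_adw: "semilin id (adw w)"
  by (induction w) (auto simp: semilin_def br_simps)

lemma semilin_adT2: "semilin id (adT u)"
proof -
  have "adT u (g + h) = adT u g + adT u h" for g h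
    by (rule semilin_ext[OF semilin_adT1 semilin_lincomb(1)[OF semilin_adT1 semilin_adT1]])
      (simp add: semilinD[OF semilin_adw])
  moreover have "adT u (scale a g) = scale a (adT u g)" for a g
    by (rule semilin_ext[OF semilin_adT1 semilin_lincomb(4)[OF semilin_adT1]])
      (simp add: semilinD[OF semilin_adw])
  ultimately show ?thesis by (simp add: semilin_def)
qed

lemmas adT_simps = semilinD[OF semilin_adT1, unfolded id_apply] semilinD[OF semilin_adT2, unfolded id_apply]

lemma adT_mult: "adT (u * v) f = adT u (adT v f)"
proof (rule bilin_ext[of id "\<lambda>u v. adT (u * v) f" "\<lambda>u v. adT u (adT v f)"])
  fix v w :: "'a list"
  show "adT (basis v * basis w) f = adT (basis v) (adT (basis w) f)"
    by (simp add: adw_def flip: basis_append)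
qed (rule semilin_comp2[OF semilin_mult(2)[OF semilin_id(1)] semilin_adT1] semilin_adT1
      semilin_comp2[OF semilin_mult(1)[OF semilin_id(1)] semilin_adT1] semilin_comp2[OF semilin_adT1 semilin_adT2])+

text \<open>Right-normed bracketing prepends letters just as \<open>adT\<close> does. The constant
  term of v has to vanish: a bracket of x with the value 0 of the empty word would give 0 instead of
  x.\<close>

lemma beta_mult:
  assumes "eps v = 0"
  shows "beta (u * v) = adT u (beta v)"
proof (rule semilin_ext[OF semilin_comp2[OF semilin_mult(2)[OF semilin_id(1)] semilin_beta(1)] semilin_adT1])
  fix w
  show "beta (basis w * v) = adT (basis w) (beta v)"
  proof (rule semilin_ext_on[OF semilin_comp2[OF semilin_mult(1)[OF semilin_id(1)] semilin_beta(1)]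
        semilin_comp2[OF semilin_beta(1) semilin_adT2]])
    fix u assume "u \<in> supp v"
    then have "u \<noteq> []" using assms by (auto simp: in_keys_iff)
    then have "bb (w @ u) = adw w (bb u)" by (induction w) auto
    then show "beta (basis w * basis u) = adT (basis w) (beta (basis u))"
      by (simp add: beta_def flip: basis_append)
  qed
qed

context
  fixes V :: "nat set" and TK :: "'k::field_char_0 itself"
begin

abbreviation "FM \<equiv> (free_mag V :: ('k, nat mag \<Rightarrow>\<^sub>0 'k) module)"
abbreviation "LI \<equiv> lie_ideal FM"
abbreviation (input) "FL \<equiv> (free_lie V :: ('k, (nat mag \<Rightarrow>\<^sub>0 'k) set) module)"

lemma FM_simps: "add FM = (+)" "ring.zero FM = 0" "module.smult FM = scale" "monoid.mult FM = br"
  by (simp_all add: free_mag_def br_def[abs_def])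

lemma FM_carrier: "f \<in> carrier FM \<longleftrightarrow> supin {t. set_mag t \<subseteq> V} f"
  by (auto simp: free_mag_def supin_def)

lemma br_carrier: "f \<in> carrier FM \<Longrightarrow> g \<in> carrier FM \<Longrightarrow> br f g \<in> carrier FM"
proof -
  assume "f \<in> carrier FM" "g \<in> carrier FM"
  then have f: "supin {t. set_mag t \<subseteq> V} f" and g: "supin {t. set_mag t \<subseteq> V} g" by (simp_all add: FM_carrier)
  have "supin {t. set_mag t \<subseteq> V} (br (basis s) g)" if "set_mag s \<subseteq> V" for s
    by (rule supin_semilin[OF semilin_br2 g]) (use that in auto)
  then have "supin {t. set_mag t \<subseteq> V} (br f g)"
    by (intro supin_semilin[OF semilin_br1 f]) auto
  then show ?thesis by (simp add: FM_carrier)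
qed

lemma FM_closed: "0 \<in> carrier FM" "f \<in> carrier FM \<Longrightarrow> g \<in> carrier FM \<Longrightarrow> f + g \<in> carrier FM"
  "f \<in> carrier FM \<Longrightarrow> - f \<in> carrier FM" "f \<in> carrier FM \<Longrightarrow> g \<in> carrier FM \<Longrightarrow> f - g \<in> carrier FM"
  "f \<in> carrier FM \<Longrightarrow> scale a f \<in> carrier FM" "set_mag t \<subseteq> V \<Longrightarrow> basis t \<in> carrier FM"
  by (simp_all add: FM_carrier)

lemma LI_carrier: "f \<in> LI \<Longrightarrow> f \<in> carrier FM"
  by (induction rule: lie_ideal.induct) (auto simp: FM_simps FM_closed br_carrier)

lemma LI_iota: "f \<in> LI \<Longrightarrow> iota f = 0"
  by (induction rule: lie_ideal.induct) (auto simp: FM_simps iota_simps iota_br algebra_simps)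

lemma LI_closed: "0 \<in> LI" "f \<in> LI \<Longrightarrow> g \<in> LI \<Longrightarrow> f + g \<in> LI" "f \<in> LI \<Longrightarrow> scale a f \<in> LI"
  "f \<in> carrier FM \<Longrightarrow> g \<in> LI \<Longrightarrow> br f g \<in> LI" "f \<in> LI \<Longrightarrow> g \<in> carrier FM \<Longrightarrow> br f g \<in> LI"
  "f \<in> carrier FM \<Longrightarrow> br f f \<in> LI"
  "f \<in> carrier FM \<Longrightarrow> g \<in> carrier FM \<Longrightarrow> h \<in> carrier FM \<Longrightarrow> br f (br g h) + br g (br h f) + br h (br f g) \<in> LI"
  using lie_ideal.zero[of FM] lie_ideal.add[of f FM g] lie_ideal.smult[of f FM a] lie_ideal.left[of f FM g]
    lie_ideal.right[of f FM g] lie_ideal.alt[of f FM] lie_ideal.jacobi[of f FM g h]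
  by (simp_all add: FM_simps)

lemma LI_minus: "f \<in> LI \<Longrightarrow> - f \<in> LI" and LI_diff: "f \<in> LI \<Longrightarrow> g \<in> LI \<Longrightarrow> f - g \<in> LI"
proof -
  show m: "f \<in> LI \<Longrightarrow> - f \<in> LI" for f using LI_closed(3)[of f "- 1"] by (simp add: scale_linear)
  show "f \<in> LI \<Longrightarrow> g \<in> LI \<Longrightarrow> f - g \<in> LI" using LI_closed(2)[OF _ m, of f g] by simp
qed

lemma br_antisym: assumes "f \<in> carrier FM" "g \<in> carrier FM" shows "br f g + br g f \<in> LI"
proof -
  have "br (f + g) (f + g) - br f f - br g g \<in> LI" using assms by (intro LI_diff LI_closed FM_closed)
  then show ?thesis by (simp add: br_simps algebra_simps)
qed

lemma adT_LI:
  assumes "supin (lists V) u" "f \<in> LI" shows "adT u f \<in> LI"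
proof -
  have "adw w f \<in> LI" if "w \<in> lists V" for w
    using that by (induction w) (use assms(2) in \<open>auto intro!: LI_closed(4) FM_closed\<close>)
  then have "(\<Sum>w\<in>I. scale (coef u w) (adw w f)) \<in> LI" if "I \<subseteq> lists V" for I
    using that by (induction I rule: infinite_finite_induct) (auto intro!: LI_closed(1,2,3))
  then show ?thesis using assms(1) by (simp add: adT_def lin_def supin_def)
qed

text \<open>The adjoint action is a Lie homomorphism: a commutator of actions acts as the bracket.
  The induction step is the Jacobi identity for s, t and f, all modulo the Lie relations.\<close>

lemma adT_itb:
  assumes "set_mag t \<subseteq> V" "f \<in> carrier FM"
  shows "adT (itb t) f - br (basis t) f \<in> LI"
  using assms
proof (induction t arbitrary: f)
  case (Leaf x)
  then show ?case by (simp add: gen_def LI_closed)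
next
  case (Br s t)
  have st: "set_mag s \<subseteq> V" "set_mag t \<subseteq> V" using Br.prems by auto
  note b = FM_closed(6)[OF st(1)] FM_closed(6)[OF st(2)] Br.prems(2)
  have 1: "adT (itb s') (adT (itb t') f) - br (basis s') (br (basis t') f) \<in> LI"
    if s: "set_mag s' \<subseteq> V" and t: "set_mag t' \<subseteq> V" "adT (itb t') f - br (basis t') f \<in> LI"
      "adT (itb s') (br (basis t') f) - br (basis s') (br (basis t') f) \<in> LI" for s' t'
  proof -
    have "adT (itb s') (adT (itb t') f - br (basis t') f) \<in> LI"
      by (rule adT_LI[OF itb_lists[OF s] t(2)])
    then have "adT (itb s') (adT (itb t') f - br (basis t') f) + (adT (itb s') (br (basis t') f) - br (basis s') (br (basis t') f)) \<in> LI"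
      using t(3) by (rule LI_closed(2))
    then show ?thesis by (simp add: adT_simps)
  qed
  have A: "adT (itb s) (adT (itb t) f) - br (basis s) (br (basis t) f) \<in> LI"
    using st b br_carrier by (intro 1 Br.IH) auto
  have B: "adT (itb t) (adT (itb s) f) - br (basis t) (br (basis s) f) \<in> LI"
    using st b br_carrier by (intro 1 Br.IH) auto
  have J: "br (basis s) (br (basis t) f) + br (basis t) (br f (basis s)) + br f (br (basis s) (basis t)) \<in> LI"
    using b by (intro LI_closed(7))
  have C: "br (basis t) (br f (basis s) + br (basis s) f) \<in> LI"
    using b by (intro LI_closed(4) br_antisym)
  have D: "br f (br (basis s) (basis t)) + br (br (basis s) (basis t)) f \<in> LI"
    using b by (intro br_antisym br_carrier)
  \<comment> \<open>The Jacobi relation has its terms in cyclic form; subtracting the antisymmetry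
    relations C and D turns it into [s,[t,f]] - [t,[s,f]] - [[s,t],f].\<close>
  have "(adT (itb s) (adT (itb t) f) - br (basis s) (br (basis t) f)) - (adT (itb t) (adT (itb s) f) - br (basis t) (br (basis s) f))
     + (br (basis s) (br (basis t) f) + br (basis t) (br f (basis s)) + br f (br (basis s) (basis t)))
     - br (basis t) (br f (basis s) + br (basis s) f) - (br f (br (basis s) (basis t)) + br (br (basis s) (basis t)) f) \<in> LI"
    by (intro LI_diff LI_closed(2) A B C D J)
  then show ?case by (simp add: adT_simps adT_mult br_simps)
qed

text \<open>The identity of Dynkin, Specht and Wever. For a bracket of s and t, with m and n leaves,
  \<open>beta\<close> of the commutator is congruent to ad s (n t) - ad t (m s), and by antisymmetry
  to (m + n) times the bracket.\<close>

lemma beta_itb: "set_mag t \<subseteq> V \<Longrightarrow> beta (itb t) - scale (of_nat (leaves t)) (basis t) \<in> LI"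
proof (induction t)
  case (Leaf x)
  then show ?case by (simp add: gen_def beta_def LI_closed del: scale_simps(5))
next
  case (Br s t)
  have e: "eps (itb t) = (0 :: 'k)" for t :: "nat mag"
  proof -
    have "supin {w. length w = leaves t} (itb t :: nat list \<Rightarrow>\<^sub>0 'k)" by (rule itb_length)
    then show ?thesis using leaves_pos[of t] by (simp add: supin_coef)
  qed
  have st: "set_mag s \<subseteq> V" "set_mag t \<subseteq> V" using Br.prems by auto
  note b = FM_closed(6)[OF st(1)] FM_closed(6)[OF st(2)]
  have 1: "adT (itb s') (beta (itb t')) - scale (of_nat (leaves t')) (basis (Br s' t')) \<in> LI"
    if s: "set_mag s' \<subseteq> V" "set_mag t' \<subseteq> V" and t: "beta (itb t') - scale (of_nat (leaves t')) (basis t') \<in> LI" for s' t'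
  proof -
    have "adT (itb s') (beta (itb t') - scale (of_nat (leaves t')) (basis t')) \<in> LI"
      by (rule adT_LI[OF itb_lists[OF s(1)] t])
    moreover have "scale (of_nat (leaves t')) (adT (itb s') (basis t') - br (basis s') (basis t')) \<in> LI"
      using s by (intro LI_closed(3) adT_itb FM_closed)
    ultimately have "adT (itb s') (beta (itb t') - scale (of_nat (leaves t')) (basis t')) +
        scale (of_nat (leaves t')) (adT (itb s') (basis t') - br (basis s') (basis t')) \<in> LI"
      by (rule LI_closed(2))
    then show ?thesis by (simp add: adT_simps scale_linear del: scale_simps(5))
  qed
  have "(adT (itb s) (beta (itb t)) - scale (of_nat (leaves t)) (basis (Br s t)))
     - (adT (itb t) (beta (itb s)) - scale (of_nat (leaves s)) (basis (Br t s)))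
     - scale (of_nat (leaves s)) (br (basis s) (basis t) + br (basis t) (basis s)) \<in> LI"
    by (rule LI_diff[OF LI_diff[OF 1[OF st Br.IH(2)[OF st(2)]] 1[OF st(2,1) Br.IH(1)[OF st(1)]]]
          LI_closed(3)[OF br_antisym[OF b]]])
  then show ?case by (simp add: beta_simps beta_mult e scale_linear algebra_simps del: scale_simps(5))
qed

lemma betan_iota:
  assumes "f \<in> carrier FM" shows "betan (iota f) - f \<in> LI"
proof -
  have b: "betan (itb t) - basis t \<in> LI" if "set_mag t \<subseteq> V" for t
  proof -
    \<comment> \<open>All words in \<open>itb t\<close> have the same length, the number of leaves,
      so the wordwise normalisation in \<open>betan\<close> is a single factor, and the number it
      divides by is nonzero in characteristic zero.\<close>
    have bt: "(betan (itb t) :: nat mag \<Rightarrow>\<^sub>0 'k) = scale (1 / of_nat (leaves t)) (beta (itb t))"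
      by (rule semilin_ext_on[OF semilin_beta(2) semilin_lincomb(4)[OF semilin_beta(1)]])
        (use itb_length[of t] in \<open>auto simp: beta_def betan_def supin_def simp del: scale_simps\<close>)
    have sc: "scale (1 / n) (u - scale n v) = scale (1 / n) u - v" if "n \<noteq> 0" for n :: 'k and u v :: "nat mag \<Rightarrow>\<^sub>0 'k"
      using that by (simp add: scale_linear)
    have ne: "(of_nat (leaves t) :: 'k) \<noteq> 0" using leaves_pos[of t] by simp
    have "(betan (itb t) :: nat mag \<Rightarrow>\<^sub>0 'k) - basis t = scale (1 / of_nat (leaves t)) (beta (itb t) - scale (of_nat (leaves t)) (basis t))"
      unfolding bt sc[OF ne] ..
    then show ?thesis using LI_closed(3)[OF beta_itb[OF that]] by simp
  qed
  have "(\<Sum>t\<in>I. scale (coef f t) (betan (itb t) - basis t)) \<in> LI" if "I \<subseteq> {t. set_mag t \<subseteq> V}" for I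
    using that by (induction I rule: infinite_finite_induct) (auto intro!: LI_closed(1,2,3) b simp del: scale_simps)
  then have "(\<Sum>t\<in>supp f. scale (coef f t) (betan (itb t) - basis t)) \<in> LI"
    using assms by (simp add: FM_carrier supin_def)
  moreover have "(\<Sum>t\<in>supp f. scale (coef f t) (betan (itb t) - basis t)) = betan (iota f) - f"
    unfolding semilin_expand[OF semilin_comp2[OF semilin_iota semilin_beta(2)], of f]
    using pm_sum[of f] by (simp add: scale_linear sum_subtractf del: scale_simps)
  ultimately show ?thesis by simp
qed

text \<open>If f is in the kernel of \<open>iota\<close>, then \<open>betan_iota\<close> says that -
  f lies in the ideal. This is the injectivity of the map from the free Lie algebra to the free
  algebra, in the form that \<open>quot\<close> asks for.\<close>

lemma LI_eq: "LI = {f \<in> carrier FM. iota f = 0}"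
proof
  show "LI \<subseteq> {f \<in> carrier FM. iota f = 0}" using LI_carrier LI_iota by blast
  show "{f \<in> carrier FM. iota f = 0} \<subseteq> LI"
  proof clarify
    fix f assume "f \<in> carrier FM" "iota f = 0"
    then have "- f \<in> LI" using betan_iota[of f] by (simp add: beta_simps)
    then show "f \<in> LI" using LI_minus[of "- f"] by simp
  qed
qed

definition comm :: "(nat list \<Rightarrow>\<^sub>0 'k) \<Rightarrow> (nat list \<Rightarrow>\<^sub>0 'k) \<Rightarrow> nat list \<Rightarrow>\<^sub>0 'k" where
  "comm a b = a * b - b * a"

lemma quot_L: "quot FM iota id LI comm"
  by standard (auto simp: FM_simps FM_closed br_carrier iota_simps iota_br LI_eq comm_def)

abbreviation cL :: "(nat mag \<Rightarrow>\<^sub>0 'k) set \<Rightarrow> nat list \<Rightarrow>\<^sub>0 'k" where "cL \<equiv> quot.kq iota"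
abbreviation cosL :: "(nat mag \<Rightarrow>\<^sub>0 'k) \<Rightarrow> (nat mag \<Rightarrow>\<^sub>0 'k) set" where "cosL f \<equiv> LI +>\<^bsub>FM\<^esub> f"

definition rL :: "(nat list \<Rightarrow>\<^sub>0 'k) \<Rightarrow> (nat mag \<Rightarrow>\<^sub>0 'k) set" where "rL p = cosL (betan p)"

interpretation QL: quot FM iota id LI comm by (rule quot_L)

lemma FL_simps:
  "carrier FL = cosL ` carrier FM" "ring.zero FL = cosL 0"
  "x \<in> carrier FM \<Longrightarrow> y \<in> carrier FM \<Longrightarrow> cosL x \<oplus>\<^bsub>FL\<^esub> cosL y = cosL (x + y)"
  "x \<in> carrier FM \<Longrightarrow> y \<in> carrier FM \<Longrightarrow> cosL x \<otimes>\<^bsub>FL\<^esub> cosL y = cosL (br x y)"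
  "x \<in> carrier FM \<Longrightarrow> a \<odot>\<^bsub>FL\<^esub> cosL x = cosL (scale a x)"
  unfolding free_lie_def using QL.Q_simps by (simp_all add: FM_simps)

lemma cL_cos: "f \<in> carrier FM \<Longrightarrow> cL (cosL f) = iota f"
  by (rule QL.kq_coset)

lemma betan_carrier: assumes "supin (lists V) p" shows "betan p \<in> carrier FM"
  unfolding FM_carrier
  by (rule supin_semilin[OF semilin_beta(2) assms]) (auto simp: betan_def bb_def rb_set intro!: supin_basic(6))

text \<open>By \<open>betan_iota\<close>, \<open>betan\<close> undoes \<open>iota\<close> modulo the
  Lie relations and so induces the retraction. The coordinates reach only the Lie polynomials, hence
  \<open>coord_r\<close> and not \<open>coord_b\<close>.\<close>

lemma coord_r_L: "coord_r FL cL rL (lists V)"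
proof -
  interpret coord FL cL unfolding free_lie_def by (rule QL.coord_Q)
  show ?thesis
  proof
    fix p :: "nat list \<Rightarrow>\<^sub>0 'k" assume p: "supin (lists V) p"
    show "rL p \<in> carrier FL" by (simp add: rL_def FL_simps betan_carrier p)
    show "rL (scale a p) = a \<odot>\<^bsub>FL\<^esub> rL p" for a by (simp add: rL_def FL_simps betan_carrier p beta_simps)
    fix q :: "nat list \<Rightarrow>\<^sub>0 'k" assume q: "supin (lists V) q"
    show "rL (p + q) = rL p \<oplus>\<^bsub>FL\<^esub> rL q" by (simp add: rL_def FL_simps betan_carrier p q beta_simps)
  next
    fix x assume "x \<in> carrier FL"
    then obtain f where f: "x = cosL f" "f \<in> carrier FM" by (auto simp: FL_simps)
    have s: "supin (lists V) (iota f)"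
      using f(2) unfolding FM_carrier by (rule supin_semilin[OF semilin_iota]) (auto intro: itb_lists)
    then show "supin (lists V) (cL x)" by (simp add: f cL_cos)
    have "iota (betan (iota f) - f) = 0" by (rule LI_iota[OF betan_iota[OF f(2)]])
    then show "rL (cL x) = x"
      using f(2) betan_carrier[OF s] by (simp add: f(1) cL_cos rL_def QL.coset_cong iota_simps)
  qed
qed

interpretation L: coord_r FL cL rL "lists V" by (rule coord_r_L)

lemma cL_mult: "x \<in> carrier FL \<Longrightarrow> y \<in> carrier FL \<Longrightarrow> x \<otimes>\<^bsub>FL\<^esub> y \<in> carrier FL"
  "x \<in> carrier FL \<Longrightarrow> y \<in> carrier FL \<Longrightarrow> cL (x \<otimes>\<^bsub>FL\<^esub> y) = cL x * cL y - cL y * cL x"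
  using QL.kq_mult[of x y] unfolding free_lie_def comm_def by auto

lemma lie_gen_eq: "lie_gen V n = cosL (basis (Leaf n))"
  by (simp add: lie_gen_def)

lemma lie_gen_props: "n \<in> V \<Longrightarrow> (lie_gen V n :: (nat mag \<Rightarrow>\<^sub>0 'k) set) \<in> carrier FL" "n \<in> V \<Longrightarrow> cL (lie_gen V n) = gen n"
  by (simp_all add: lie_gen_eq FL_simps FM_closed cL_cos)

theorem lie_algebra_L: "lie_algebra FL"
  unfolding lie_algebra_def linear_on_def
  by (intro conjI ballI allI Pi_I L.is_module L.c_eqI) (simp_all add: cL_mult algebra_simps scale_linear)

lemma mag_eval_L:
  assumes "set_mag t \<subseteq> V" shows "mag_eval (monoid.mult FL) (lie_gen V) t = cosL (basis t)"
  using assms by (induction t) (simp_all add: lie_gen_eq FL_simps FM_closed)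

lemma L_induct [consumes 1, case_names zero gen add smult mult]:
  assumes "x \<in> carrier FL" and "P \<zero>\<^bsub>FL\<^esub>" "\<And>n. n \<in> V \<Longrightarrow> P (lie_gen V n)"
    "\<And>x y. x \<in> carrier FL \<Longrightarrow> y \<in> carrier FL \<Longrightarrow> P x \<Longrightarrow> P y \<Longrightarrow> P (x \<oplus>\<^bsub>FL\<^esub> y)"
    "\<And>a x. x \<in> carrier FL \<Longrightarrow> P x \<Longrightarrow> P (a \<odot>\<^bsub>FL\<^esub> x)"
    "\<And>x y. x \<in> carrier FL \<Longrightarrow> y \<in> carrier FL \<Longrightarrow> P x \<Longrightarrow> P y \<Longrightarrow> P (x \<otimes>\<^bsub>FL\<^esub> y)"
  shows "P x"
proof -
  obtain f where f: "x = cosL f" "f \<in> carrier FM" using assms(1) by (auto simp: FL_simps)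
  have in_FL: "g \<in> carrier FM \<Longrightarrow> cosL g \<in> carrier FL" for g by (simp add: FL_simps)
  have b: "P (cosL (basis t))" if "set_mag t \<subseteq> V" for t
    using that
  proof (induction t)
    case (Br s t)
    then have "P (cosL (basis s) \<otimes>\<^bsub>FL\<^esub> cosL (basis t))"
      by (intro assms(6) in_FL FM_closed) auto
    then show ?case using Br.prems by (simp add: FL_simps FM_closed)
  qed (use assms(3) in \<open>simp add: lie_gen_eq\<close>)
  have "P (cosL (\<Sum>t\<in>I. scale (coef f t) (basis t))) \<and> (\<Sum>t\<in>I. scale (coef f t) (basis t)) \<in> carrier FM"
    if "I \<subseteq> {t. set_mag t \<subseteq> V}" for I
    using that
  proof (induction I rule: infinite_finite_induct)
    case (insert t I)
    let ?g = "\<Sum>t\<in>I. scale (coef f t) (basis t)" and ?t = "scale (coef f t) (basis t :: nat mag \<Rightarrow>\<^sub>0 'k)"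
    have t: "?t \<in> carrier FM" "basis t \<in> carrier FM" using insert by (auto intro!: FM_closed simp del: scale_simps)
    have "P (coef f t \<odot>\<^bsub>FL\<^esub> cosL (basis t))" using insert t by (intro assms(5) in_FL b) auto
    then have "P (cosL ?t)" using t by (simp add: FL_simps del: scale_simps)
    then have "P (cosL ?t \<oplus>\<^bsub>FL\<^esub> cosL ?g)" using insert t in_FL by (intro assms(4)) auto
    then have "P (cosL (?t + ?g))" using insert t by (simp add: FL_simps del: scale_simps)
    then show ?case using insert t FM_closed(2)[of ?t ?g] by (simp del: scale_simps)
  qed (use assms(2) in \<open>simp_all add: FL_simps FM_closed\<close>)
  from this[of "supp f"] show ?thesis
    using f pm_sum[of f] by (simp add: FM_carrier supin_def del: scale_simps)
qed

end

subsection \<open>Primitive elements\<close>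

definition Edeg :: "('x list \<Rightarrow>\<^sub>0 'k) \<Rightarrow> 'x list \<Rightarrow>\<^sub>0 'k::field" where
  "Edeg = lin (\<lambda>w. scale (of_nat (length w)) (basis w))"

lemma semilin_Edeg [simp, intro]: "semilin id Edeg" by (simp add: Edeg_def)

lemma coef_Edeg: "coef (Edeg f) w = of_nat (length w) * coef f w"
  unfolding Edeg_def lin_slin by (subst coef_slin_diag) simp_all

lemma Edeg_gen_mult: "Edeg (gen x * f) = gen x * f + gen x * Edeg f"
  by (rule semilin_ext[OF semilin_comp2[OF semilin_mult(1)[OF semilin_id(1)] semilin_Edeg]
        semilin_lincomb(1)[OF semilin_mult(1)[OF semilin_id(1)] semilin_mult(1)[OF semilin_Edeg]]])
    (simp add: Edeg_def scale_linear del: scale_simps(5) flip: basis_Cons)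

text \<open>Dynkin's operator as the convolution of the degree derivation with the antipode, a form
  that can be evaluated on words as well as through the coproduct of a primitive element.\<close>

definition Dyn :: "(nat list \<Rightarrow>\<^sub>0 'k::field) \<Rightarrow> nat list \<Rightarrow>\<^sub>0 'k" where
  "Dyn f = conv2 Edeg (Sl 0) (Dl 0 f)"

text \<open>The letter x is primitive. In the first factor it gives, by the derivation rule, x times
  the convolution of the identity with S, which is the counit, and x times \<open>Dyn f\<close>; in
  the second factor S moves it to the far right with a sign. On words the counit term is present
  only for a single letter, so this is the recursion of \<open>bb\<close>.\<close>

lemma Dyn_gen_mult:
  fixes f :: "nat list \<Rightarrow>\<^sub>0 'k::field"
  shows "Dyn (gen x * f) = gen x * epsT f + gen x * Dyn f - Dyn f * gen x"
proof -
  let ?E = "conv2 Edeg (Sl 0)"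
  have S: "Sl 0 (gen x) = (- gen x :: nat list \<Rightarrow>\<^sub>0 'k)"
    unfolding Sl_simps by (subst sgen.simps) (auto simp: FB_zero intro!: sum.neutral)
  have 1: "?E (ten (gen x) 1 * Z) = gen x * conv2 (\<lambda>x. x) (Sl 0) Z + gen x * ?E Z" for Z :: "nat list \<times> nat list \<Rightarrow>\<^sub>0 'k"
  proof (rule ten_ext[OF semilin_comp2[OF semilin_mult(1)[OF semilin_id(1)] semilin_conv2]
        semilin_lincomb(1)[OF semilin_mult(1)[OF semilin_conv2] semilin_mult(1)[OF semilin_conv2]]])
    fix v w :: "nat list"
    show "?E (ten (gen x) 1 * ten (basis v) (basis w :: nat list \<Rightarrow>\<^sub>0 'k)) =
      gen x * conv2 (\<lambda>x. x) (Sl 0) (ten (basis v) (basis w)) + gen x * ?E (ten (basis v) (basis w))"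
      by (simp only: ten_mult mult_1_left conv2_ten[OF semilin_Edeg semilin_Sl] conv2_ten[OF semilin_id(1) semilin_Sl]
          Edeg_gen_mult distrib_right mult.assoc)
  qed
  have 2: "?E (ten 1 (gen x) * Z) = - (?E Z * gen x)" for Z :: "nat list \<times> nat list \<Rightarrow>\<^sub>0 'k"
  proof (rule ten_ext[OF semilin_comp2[OF semilin_mult(1)[OF semilin_id(1)] semilin_conv2]
        semilin_lincomb(3)[OF semilin_mult(2)[OF semilin_conv2]]])
    fix v w :: "nat list"
    show "?E (ten 1 (gen x) * ten (basis v) (basis w :: nat list \<Rightarrow>\<^sub>0 'k)) = - (?E (ten (basis v) (basis w)) * gen x)"
      by (simp only: ten_mult mult_1_left conv2_ten[OF semilin_Edeg semilin_Sl] Sl_simps(3) S mult.assoc mult_minus_right)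
  qed
  show ?thesis
    unfolding Dyn_def Dl_simps Dl_gen dgen_0 distrib_right semilin_add[OF semilin_conv2] 1 2
    by (simp add: antipode_right)
qed

lemma semilin_Dyn: "semilin id Dyn"
  unfolding Dyn_def[abs_def] by (rule semilin_conv2_Dl)

lemma Edeg_one: "Edeg 1 = 0" by (simp add: one_list Edeg_def del: scale_simps(5))

lemma Dyn_one: "Dyn 1 = 0"
proof -
  have "Dyn 1 = conv2 Edeg (Sl 0) (ten 1 1)" by (simp add: Dyn_def Dl_simps)
  then show ?thesis by (simp only: conv2_ten[OF semilin_Edeg semilin_Sl] Edeg_one mult_zero_left)
qed

lemma iota_bb: "iota (bb w) = (Dyn (basis w) :: nat list \<Rightarrow>\<^sub>0 'k::field)"
proof (induction w)
  case Nil
  then show ?case using Dyn_one by (simp add: iota_simps one_list)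
next
  case (Cons x w)
  show ?case
  proof (cases "w = []")
    case True
    have "Dyn (gen x * 1) = (gen x :: nat list \<Rightarrow>\<^sub>0 'k)" unfolding Dyn_gen_mult by (simp add: Dyn_one)
    then show ?thesis using True by (simp add: basis_Cons one_list[symmetric])
  next
    case False
    then have "epsT (basis w) = (0 :: nat list \<Rightarrow>\<^sub>0 'k)" by (simp add: epsT_def lookup_single)
    then show ?thesis using False Cons by (simp add: iota_br basis_Cons Dyn_gen_mult)
  qed
qed

lemma iota_beta: "iota (beta f) = Dyn f"
  by (rule semilin_ext[OF semilin_comp2[OF semilin_beta(1) semilin_iota] semilin_Dyn]) (simp add: beta_def iota_bb)

text \<open>The bracket of a word is homogeneous of the length of the word, so the degree derivation
  cancels the normalisation in \<open>betan\<close>.\<close>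

lemma Edeg_iota_betan: "Edeg (iota (betan f)) = iota (beta (f :: nat list \<Rightarrow>\<^sub>0 'k::field_char_0))"
proof (rule semilin_ext[OF semilin_comp2[OF semilin_comp2[OF semilin_beta(2) semilin_iota] semilin_Edeg]
      semilin_comp2[OF semilin_beta(1) semilin_iota]])
  fix w :: "nat list"
  show "Edeg (iota (betan (basis w))) = iota (beta (basis w :: nat list \<Rightarrow>\<^sub>0 'k))"
  proof (cases "w = []")
    case False
    have "supin {v. length v = length w} (iota (bb w) :: nat list \<Rightarrow>\<^sub>0 'k)"
      using itb_length[of "rb w", where ?'b = 'k] False rb_weight[OF False, of "\<lambda>_. 1"]
      by (simp add: bb_def sum_list_triv)
    then have "Edeg (iota (bb w)) = scale (of_nat (length w)) (iota (bb w) :: nat list \<Rightarrow>\<^sub>0 'k)"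
      by (intro poly_mapping_eqI) (auto simp: coef_Edeg supin_coef)
    then show ?thesis using False
      by (simp add: betan_def beta_def iota_simps semilinD[OF semilin_Edeg])
  qed (simp add: betan_def beta_def iota_simps semilinD[OF semilin_Edeg])
qed

abbreviation primT :: "(nat list \<Rightarrow>\<^sub>0 'k::field) \<Rightarrow> bool" where
  "primT p \<equiv> Dl 0 p = ten p 1 + ten 1 p"

lemma primT_iota: "primT (iota f)"
proof -
  have b: "primT (itb t)" for t
  proof (induction t)
    case (Br s t)
    then show ?case by (simp add: Dl_simps algebra_simps ten_mult ten_linear)
  qed (simp add: dgen_0)
  show ?thesis
    by (rule semilin_ext[OF semilin_comp2[OF semilin_iota semilin_Dl]
        semilin_lincomb(1)[OF semilin_comp2[OF semilin_iota semilin_ten1] semilin_comp2[OF semilin_iota semilin_ten2]]])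
      (simp add: b)
qed

text \<open>Friedrichs' criterion, because on primitive elements Dynkin's operator \<open>Dyn\<close> is multiplication by the degree.\<close>

lemma primT_eq_iota:
  fixes p :: "nat list \<Rightarrow>\<^sub>0 'k::field_char_0"
  assumes "primT p" shows "p = iota (betan p)"
proof (rule poly_mapping_eqI)
  have "Dyn p = Edeg p"
    unfolding Dyn_def assms semilin_add[OF semilin_conv2] conv2_ten[OF semilin_Edeg semilin_Sl]
    by (simp add: Sl_simps Edeg_one)
  then have E: "Edeg (iota (betan p)) = Edeg p" by (simp add: Edeg_iota_betan iota_beta)
  have e: "eps (iota g) = 0" for g :: "nat mag \<Rightarrow>\<^sub>0 'k"
  proof -
    have "eps (itb t) = (0 :: 'k)" for t :: "nat mag"
    proof -
      have "supin {w. length w = leaves t} (itb t :: nat list \<Rightarrow>\<^sub>0 'k)" by (rule itb_length)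
      then show ?thesis using leaves_pos[of t] by (simp add: supin_coef)
    qed
    then have "supin {w. w \<noteq> []} (iota g)"
      by (rule_tac supin_semilin[OF semilin_iota, of UNIV]) (simp_all add: supin_coef)
    then show ?thesis by (simp add: supin_coef)
  qed
  \<comment> \<open>The degree derivation does not see constants; that p has none follows from the
    counit axiom applied to a primitive element.\<close>
  have "p = epsT p + p"
    using counit_left[of 0 p] unfolding assms semilin_add[OF semilin_conv2] conv2_ten[OF semilin_epsT semilin_id(1)] by simp
  then have "epsT p = (0 :: nat list \<Rightarrow>\<^sub>0 'k)" by simp
  then have p0: "eps p = 0" by (simp add: epsT_def one_list) (metis lookup_single_eq lookup_zero)
  fix w
  show "coef p w = coef (iota (betan p)) w"
  proof (cases "w = []")
    case False
    have "of_nat (length w) * coef (iota (betan p)) w = of_nat (length w) * coef p w"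
      using arg_cong[OF E, of "\<lambda>f. coef f w"] by (simp only: coef_Edeg)
    then show ?thesis using False by simp
  qed (simp add: p0 e)
qed

subsection \<open>The Lie bialgebra structure\<close>

text \<open>The coordinate form of \<open>ad2\<close>. For primitive a it is the commutator with the
  coproduct of a, which is how it arises from \<open>db_mult\<close>.\<close>

definition AD :: "(nat list \<Rightarrow>\<^sub>0 'k) \<Rightarrow> (nat list \<times> nat list \<Rightarrow>\<^sub>0 'k) \<Rightarrow> nat list \<times> nat list \<Rightarrow>\<^sub>0 'k::field" where
  "AD a Z = (ten a 1 + ten 1 a) * Z - Z * (ten a 1 + ten 1 a)"

lemma AD_ten: "AD a (ten u v) = ten (a * u - u * a) v + ten u (a * v - v * a)"
  by (simp add: AD_def algebra_simps ten_mult ten_linear)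

lemma semilin_AD: "semilin id (AD a)"
  unfolding AD_def[abs_def] by (rule semilin_lincomb(2)[OF semilin_mult(1)[OF semilin_id(1)] semilin_mult(2)[OF semilin_id(1)]])

context
  fixes V :: "nat set" and TK :: "'k::field_char_0 itself"
  assumes V: "down V"
begin

abbreviation (input) "FL1 \<equiv> (free_lie V :: ('k, (nat mag \<Rightarrow>\<^sub>0 'k) set) module)"
abbreviation (input) "cL1 \<equiv> (quot.kq iota :: (nat mag \<Rightarrow>\<^sub>0 'k) set \<Rightarrow> nat list \<Rightarrow>\<^sub>0 'k)"

interpretation L: coord_r FL1 cL1 "rL V" "lists V" by (rule coord_r_L)

lemma ftens_ad2: "x \<in> carrier FL1 \<Longrightarrow> f \<in> ftens 2 FL1 \<Longrightarrow> ad2 FL1 x f \<in> ftens 2 FL1"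
  unfolding ad2_def lin_slin by (rule ftens_slin[OF rhom_id(1)]) (auto elim!: tlists2E simp: cL_mult)

lemma tev2_ad2:
  assumes "x \<in> carrier FL1" "f \<in> ftens 2 FL1"
  shows "tev2 cL1 (ad2 FL1 x f) = AD (cL1 x) (tev2 cL1 f)"
  unfolding ad2_def
  by (rule tensor_semilin_eq[OF assms(2) semilin_comp2[OF semilin_lin semilin_tev(1)] semilin_comp2[OF semilin_tev(1) semilin_AD]])
    (auto elim!: tlists2E simp: tev_simps tev2_basis AD_ten cL_mult assms)

lemma cL_prim: assumes "x \<in> carrier FL1" shows "primT (cL1 x)"
  using assms primT_iota by (auto simp: FL_simps cL_cos)

text \<open>The cocycle condition: expanding both products by \<open>db_mult\<close> gives four
  terms, which pair up to commutators with the coproducts of a and b.\<close>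

lemma db_bracket:
  assumes "primT a" "primT b"
  shows "db (a * b - b * a) = AD a (db b) - AD b (db a)"
  by (simp add: semilinD[OF semilin_db] db_mult assms AD_def algebra_simps)

definition good :: "((nat mag \<Rightarrow>\<^sub>0 'k) set \<Rightarrow> (nat mag \<Rightarrow>\<^sub>0 'k) set list \<Rightarrow>\<^sub>0 'k) \<Rightarrow> bool" where
  "good \<delta> \<longleftrightarrow> (\<forall>x\<in>carrier FL1. \<delta> x \<in> ftens 2 FL1 \<and> tev2 cL1 (\<delta> x) = db (cL1 x))"

abbreviation (input) "dgenL n \<equiv> (\<Sum>l\<in>{1..<n}. scale (of_nat (l + 1)) (wedge (lie_gen V l) (lie_gen V (n - l)))) :: (nat mag \<Rightarrow>\<^sub>0 'k) set list \<Rightarrow>\<^sub>0 'k"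

lemma dgenL:
  assumes "n \<in> V" shows "dgenL n \<in> ftens 2 FL1" "tev2 cL1 (dgenL n) = db (gen n)"
proof -
  have V': "m \<in> V" if "1 \<le> m" "m < n" for m using V assms that by (auto simp: down_def subset_iff)
  show "dgenL n \<in> ftens 2 FL1"
    by (intro ftens_sum ftens_closed(5) ftens_wedge lie_gen_props V') auto
  show "tev2 cL1 (dgenL n) = db (gen n)"
    unfolding db_gen tev_simps wedge_def
  proof (intro sum.cong refl)
    fix l assume "l \<in> {1..<n}"
    then have "l \<in> V" "n - l \<in> V" using V'[of l] V'[of "n - l"] by auto
    then show "scale (of_nat (l + 1)) (tev2 cL1 (basis [lie_gen V l, lie_gen V (n - l)]) - tev2 cL1 (basis [lie_gen V (n - l), lie_gen V l])) =
        (scale (of_nat (l + 1)) (ten (gen l) (gen (n - l)) - ten (gen (n - l)) (gen l)) :: nat list \<times> nat list \<Rightarrow>\<^sub>0 'k)"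
      by (simp add: tev2_basis lie_gen_props)
  qed
qed

text \<open>There is no formula on cosets, so values are chosen pointwise. It suffices that
  \<open>db\<close> maps Lie polynomials into the image of the tensor square: this holds on
  generators and passes to brackets by the cocycle condition. Linearity up to \<open>teq\<close> is
  then inherited from \<open>db\<close>.\<close>

lemma good_exists: "\<exists>\<delta>. good \<delta>"
proof -
  have "\<exists>F\<in>ftens 2 FL1. tev2 cL1 F = db (cL1 x)" if "x \<in> carrier FL1" for x
    using that
  proof (induction rule: L_induct)
    case zero
    show ?case by (rule bexI[of _ 0]) (simp_all add: tev_simps semilinD[OF semilin_db])
  next
    case (gen n)
    then show ?case using dgenL[OF gen] by (intro bexI[of _ "dgenL n"]) (simp_all only: lie_gen_props)
  next
    case (add x y)
    then obtain F G where "F \<in> ftens 2 FL1" "tev2 cL1 F = db (cL1 x)" "G \<in> ftens 2 FL1" "tev2 cL1 G = db (cL1 y)" by blast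
    then show ?case using add by (intro bexI[of _ "F + G"]) (simp_all add: tev_simps semilinD[OF semilin_db])
  next
    case (smult a x)
    then obtain F where "F \<in> ftens 2 FL1" "tev2 cL1 F = db (cL1 x)" by blast
    then show ?case using smult by (intro bexI[of _ "scale a F"]) (simp_all add: tev_simps semilinD[OF semilin_db])
  next
    case (mult x y)
    then obtain F G where "F \<in> ftens 2 FL1" "tev2 cL1 F = db (cL1 x)" "G \<in> ftens 2 FL1" "tev2 cL1 G = db (cL1 y)" by blast
    then show ?case using mult
      by (intro bexI[of _ "ad2 FL1 x G - ad2 FL1 y F"])
        (simp_all add: tev_simps tev2_ad2 cL_mult db_bracket cL_prim ftens_ad2)
  qed
  then show ?thesis unfolding good_def by (intro bchoice) blast
qed

definition cobrL :: "(nat mag \<Rightarrow>\<^sub>0 'k) set \<Rightarrow> (nat mag \<Rightarrow>\<^sub>0 'k) set list \<Rightarrow>\<^sub>0 'k" where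
  "cobrL = (SOME \<delta>. good \<delta>)"

lemma cobrL: "x \<in> carrier FL1 \<Longrightarrow> cobrL x \<in> ftens 2 FL1" "x \<in> carrier FL1 \<Longrightarrow> tev2 cL1 (cobrL x) = db (cL1 x)"
proof -
  have "good cobrL" unfolding cobrL_def by (rule someI_ex[OF good_exists])
  then show "x \<in> carrier FL1 \<Longrightarrow> cobrL x \<in> ftens 2 FL1" "x \<in> carrier FL1 \<Longrightarrow> tev2 cL1 (cobrL x) = db (cL1 x)"
    by (simp_all add: good_def)
qed

theorem lie_bialgebra_L: "lie_bialgebra FL1 cobrL"
  unfolding lie_bialgebra_def cobracket_def
proof (intro conjI ballI)
  show "lie_algebra FL1" by (rule lie_algebra_L)
  show "tensor_linear 2 FL1 cobrL"
    unfolding tensor_linear_def by (auto simp: L.teq2 cobrL tev_simps semilinD[OF semilin_db])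
  fix x assume x: "x \<in> carrier FL1"
  show "teq FL1 (flip (cobrL x)) (- cobrL x)"
    using x by (simp add: L.teq2 cobrL ftens_flip tev2_flip[OF cobrL(1)[OF x]] db_tswap tev_simps)
  have t: "tev3 cL1 (on_left cobrL (cobrL x)) = EL db (db (cL1 x))" "on_left cobrL (cobrL x) \<in> ftens 3 FL1"
    using x by (simp_all add: tev3_on(1)[of _ FL1 db] ftens_on_left cobrL)
  then show "co_jacobi FL1 cobrL x"
    unfolding co_jacobi_def Let_def
    by (simp add: L.teq3 ftens_cyc tev_simps tev3_cyc[OF t(2)] tev3_cyc[OF ftens_cyc[OF t(2)]] db_jacobi)
  fix y assume y: "y \<in> carrier FL1"
  show "teq FL1 (cobrL (x \<otimes>\<^bsub>FL1\<^esub> y)) (ad2 FL1 x (cobrL y) - ad2 FL1 y (cobrL x))"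
    using x y by (simp add: L.teq2 cobrL cL_mult ftens_ad2 tev_simps tev2_ad2 db_bracket cL_prim)
qed

lemma cobrL_gen: "n \<in> V \<Longrightarrow> teq FL1 (cobrL (lie_gen V n)) (dgenL n)"
  by (subst L.teq2) (simp_all only: cobrL lie_gen_props dgenL)

text \<open>A cocycle is determined by its values on Lie generators. The comparison runs in
  coordinates, where the values of any such structure turn out to be those of
  \<open>db\<close>.\<close>

lemma lie_bialgebra_unique:
  assumes d: "lie_bialgebra FL1 \<delta>" "same_tensors FL1 (lie_gen V ` V) \<delta> cobrL"
  shows "same_tensors FL1 (carrier FL1) \<delta> cobrL"
proof -
  have tl: "tensor_linear 2 FL1 \<delta>" and br: "\<And>x y. x \<in> carrier FL1 \<Longrightarrow> y \<in> carrier FL1 \<Longrightarrow>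
      teq FL1 (\<delta> (x \<otimes>\<^bsub>FL1\<^esub> y)) (ad2 FL1 x (\<delta> y) - ad2 FL1 y (\<delta> x))"
    using d(1) by (auto simp: lie_bialgebra_def cobracket_def)
  have f: "x \<in> carrier FL1 \<Longrightarrow> \<delta> x \<in> ftens 2 FL1" for x using tl by (simp add: tensor_linear_def)
  have "tev2 cL1 (\<delta> x) = db (cL1 x)" if "x \<in> carrier FL1" for x
    using that
  proof (induction rule: L_induct)
    case zero
    have "teq FL1 (\<delta> (0 \<odot>\<^bsub>FL1\<^esub> \<zero>\<^bsub>FL1\<^esub>)) (scale 0 (\<delta> \<zero>\<^bsub>FL1\<^esub>))" using tl L.zero_closed by (simp only: tensor_linear_def)
    moreover have "0 \<odot>\<^bsub>FL1\<^esub> \<zero>\<^bsub>FL1\<^esub> = \<zero>\<^bsub>FL1\<^esub>" by (intro L.c_eqI) simp_all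
    ultimately have "tev2 cL1 (\<delta> \<zero>\<^bsub>FL1\<^esub>) = tev2 cL1 0" using L.teq_tev(1)[of "\<delta> \<zero>\<^bsub>FL1\<^esub>" 0] by simp
    then show ?case by (simp add: tev_simps semilinD[OF semilin_db])
  next
    case (gen n)
    then have "teq FL1 (\<delta> (lie_gen V n)) (cobrL (lie_gen V n))" using d(2) by (simp add: same_tensors_def)
    then show ?case using gen L.teq_tev(1) cobrL(2) lie_gen_props(1) by metis
  next
    case (add x y)
    then have "tev2 cL1 (\<delta> (x \<oplus>\<^bsub>FL1\<^esub> y)) = tev2 cL1 (\<delta> x + \<delta> y)" using tl by (intro L.teq_tev(1)) (simp add: tensor_linear_def)
    then show ?case using add by (simp add: tev_simps semilinD[OF semilin_db])
  next
    case (smult a x)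
    then have "tev2 cL1 (\<delta> (a \<odot>\<^bsub>FL1\<^esub> x)) = tev2 cL1 (scale a (\<delta> x))" using tl by (intro L.teq_tev(1)) (simp add: tensor_linear_def)
    then show ?case using smult by (simp add: tev_simps semilinD[OF semilin_db])
  next
    case (mult x y)
    then have "tev2 cL1 (\<delta> (x \<otimes>\<^bsub>FL1\<^esub> y)) = tev2 cL1 (ad2 FL1 x (\<delta> y) - ad2 FL1 y (\<delta> x))" by (intro L.teq_tev(1) br)
    then show ?case using mult by (simp add: tev_simps tev2_ad2 f cL_mult db_bracket cL_prim)
  qed
  then show ?thesis unfolding same_tensors_def by (simp add: L.teq2 f cobrL)
qed

lemma rL_basis: "rL V (basis w :: nat list \<Rightarrow>\<^sub>0 'k) =
    (if w = [] then \<zero>\<^bsub>FL1\<^esub> else lie_ideal (free_mag V) +>\<^bsub>(free_mag V :: ('k, _) module)\<^esub> scale (1 / of_nat (length w)) (basis (rb w)))"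
  by (simp add: rL_def betan_def bb_def FL_simps del: scale_simps(5))

text \<open>The retraction sends a word to a multiple of its right-normed bracket, whose expansion
  only permutes the letters and so keeps every weight.\<close>

lemma homog_L: "L.homog (wtw wt)"
  unfolding L.homog_def
proof
  fix w assume "w \<in> lists V"
  then have w: "supin (lists V) (basis w :: nat list \<Rightarrow>\<^sub>0 'k)" by (rule supin_basic(6))
  have c: "cL1 (rL V (basis w)) = scale (1 / of_nat (length w)) (iota (bb w))"
    unfolding rL_def by (subst cL_cos[OF betan_carrier[OF w]]) (simp add: betan_def iota_simps)
  show "supin {v. wtw wt v = wtw wt w} (cL1 (rL V (basis w)))"
  proof (cases "w = []")
    case False
    have "supin {v. wtw wt v = mwt wt (rb w)} (itb (rb w) :: nat list \<Rightarrow>\<^sub>0 'k)" by (rule itb_weight)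
    then show ?thesis unfolding c using False rb_weight[OF False, of wt] by (simp add: bb_def)
  next
    case True
    then show ?thesis unfolding c by (simp add: iota_simps)
  qed
qed

text \<open>Right-normed brackets of words already span each part, since they are, up to factors,
  the values of the retraction on words.\<close>

lemma lie_grading_eq: "lie_grading FL1 V (lie_gen V) wt = L.Gr (wtw wt)"
proof
  fix i
  let ?B = "\<lambda>i. {mag_eval (monoid.mult FL1) (lie_gen V) t | t. set_mag t \<subseteq> V \<and> mwt wt t = i}"
  show "lie_grading FL1 V (lie_gen V) wt i = L.Gr (wtw wt) i"
    unfolding lie_grading_def
  proof (rule L.mspan_eq_Gr)
    fix i
    show "?B i \<subseteq> L.Gr (wtw wt) i"
    proof clarify
      fix t :: "nat mag" assume "set_mag t \<subseteq> V"
      then show "mag_eval (monoid.mult FL1) (lie_gen V) t \<in> L.Gr (wtw wt) (mwt wt t)"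
        using itb_weight[of wt t] by (simp add: mag_eval_L L.Gr_def FL_simps FM_closed cL_cos)
    qed
  next
    fix w assume w: "w \<in> lists V"
    show "rL V (basis w) \<in> mspan FL1 (?B (wtw wt w))"
    proof (cases "w = []")
      case True
      then show ?thesis by (simp add: rL_basis mspan.zero)
    next
      case False
      have sv: "set_mag (rb w) \<subseteq> V" using w rb_set[OF False] by auto
      have "mag_eval (monoid.mult FL1) (lie_gen V) (rb w) \<in> ?B (wtw wt w)"
        using sv rb_weight[OF False, of wt] by blast
      then have "(1 / of_nat (length w)) \<odot>\<^bsub>FL1\<^esub> mag_eval (monoid.mult FL1) (lie_gen V) (rb w) \<in> mspan FL1 (?B (wtw wt w))"
        by (intro mspan.smult mspan.base)
      then show ?thesis using False sv by (simp add: rL_basis mag_eval_L FL_simps FM_closed del: scale_simps(5))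
    qed
  qed
qed

theorem graded_lie_bialgebra_L:
  assumes "\<And>l n. 1 \<le> l \<Longrightarrow> l < n \<Longrightarrow> wt l + wt (n - l) = wt n"
  shows "graded_lie_bialgebra FL1 cobrL (lie_grading FL1 V (lie_gen V) wt)"
  unfolding graded_lie_bialgebra_def lie_grading_eq
proof (intro conjI allI ballI lie_bialgebra_L)
  show "graded_module FL1 (L.Gr (wtw wt))" by (rule graded_module_Gr[OF L.coord_r_axioms homog_L])
  have "homogeneous FL1 (L.Gr (wtw wt)) (int 0) cobrL"
  proof (rule homogeneous_Gr[OF L.coord_r_axioms homog_L cobrL(1)])
    fix i x assume "x \<in> L.Gr (wtw wt) i"
    then have x: "x \<in> carrier FL1" "supin {w. wtw wt w = i} (cL1 x)" by (auto simp: L.Gr_def)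
    have "supin {(v, w). wtw wt v + wtw wt w = i + 0} (db (cL1 x))"
      by (rule supin_semilin[OF semilin_db x(2)]) (use db_weight[of wt 0] assms in auto)
    then show "supin {(v, w). wtw wt v + wtw wt w = i + 0} (tev2 cL1 (cobrL x))" using x by (simp add: cobrL)
  qed
  then show "homogeneous FL1 (L.Gr (wtw wt)) 0 cobrL" by simp
  fix i j x y assume "x \<in> L.Gr (wtw wt) i" "y \<in> L.Gr (wtw wt) j"
  then have x: "x \<in> carrier FL1" "supin {w. wtw wt w = i} (cL1 x)"
    and y: "y \<in> carrier FL1" "supin {w. wtw wt w = j} (cL1 y)" by (auto simp: L.Gr_def)
  have "supin {w. wtw wt w = i + j} (cL1 x * cL1 y)" "supin {w. wtw wt w = i + j} (cL1 y * cL1 x)"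
    by (rule supin_mult[OF x(2) y(2)], auto simp: plus_list_def, rule supin_mult[OF y(2) x(2)], auto simp: plus_list_def)
  then show "x \<otimes>\<^bsub>FL1\<^esub> y \<in> L.Gr (wtw wt) (i + j)" using x y by (simp add: L.Gr_def cL_mult)
qed

end

section \<open>The enveloping algebra\<close>

lemma primT_eps: assumes "primT p" shows "epsT p = (0 :: nat list \<Rightarrow>\<^sub>0 'k::field)"
proof -
  have "p = epsT p + p"
    using counit_left[of 0 p] unfolding assms semilin_add[OF semilin_conv2] conv2_ten[OF semilin_epsT semilin_id(1)] by simp
  then show ?thesis by simp
qed

lemma primT_Sl: assumes "primT p" shows "Sl 0 p = - p"
proof -
  have "Sl 0 p + p = 0"
    using antipode_left[of 0 p] primT_eps[OF assms]
    unfolding assms semilin_add[OF semilin_conv2] conv2_ten[OF semilin_Sl semilin_id(1)] by (simp add: Sl_simps)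
  then show ?thesis by (simp add: eq_neg_iff_add_eq_0)
qed

lemma ring_free_alg: "ring (free_alg V :: ('r::comm_ring_1, 'x list \<Rightarrow>\<^sub>0 'r) module)"
proof -
  interpret coord "free_alg V :: ('r, 'x list \<Rightarrow>\<^sub>0 'r) module" "\<lambda>f. f" by (rule coord_free_alg)
  have c: "f \<in> carrier (free_alg V :: ('r, 'x list \<Rightarrow>\<^sub>0 'r) module) \<longleftrightarrow> supin (lists V) f" for f by (rule free_alg_carrier)
  show ?thesis
    by (rule ringI[OF is_abelian_group])
      (auto intro!: monoidI simp: c algebra_simps simp del: free_alg_simps(1))
qed

lemma free_alg_a_inv: "f \<in> carrier (free_alg V :: ('r::comm_ring_1, 'x list \<Rightarrow>\<^sub>0 'r) module) \<Longrightarrow> \<ominus>\<^bsub>(free_alg V :: ('r, 'x list \<Rightarrow>\<^sub>0 'r) module)\<^esub> f = - f"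
  by (rule coord.c_a_inv[OF coord_free_alg])

lemma ideal_kernel:
  fixes K :: "('x list \<Rightarrow>\<^sub>0 'r::comm_ring_1) \<Rightarrow> 'y::monoid_add \<Rightarrow>\<^sub>0 'r"
  assumes "ringmap id K"
  shows "ideal {f \<in> carrier (free_alg V). K f = 0} (free_alg V :: ('r, 'x list \<Rightarrow>\<^sub>0 'r) module)"
proof (rule idealI[OF ring_free_alg])
  have c: "f \<in> carrier (free_alg V :: ('r, 'x list \<Rightarrow>\<^sub>0 'r) module) \<longleftrightarrow> supin (lists V) f" for f by (rule free_alg_carrier)
  note [simp] = semilinD[OF ringmapD(1)[OF assms]] ringmapD(2,3)[OF assms] c
  note [simp del] = free_alg_simps(1)
  show "subgroup {f \<in> carrier (free_alg V). K f = 0} (add_monoid (free_alg V :: ('r, 'x list \<Rightarrow>\<^sub>0 'r) module))"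
  proof (rule subgroup.intro)
    show "inv\<^bsub>add_monoid (free_alg V :: ('r, 'x list \<Rightarrow>\<^sub>0 'r) module)\<^esub> f \<in> {f \<in> carrier (free_alg V). K f = 0}" if "f \<in> {f \<in> carrier (free_alg V). K f = 0}" for f
      using that free_alg_a_inv[of f V] by (simp add: a_inv_def)
  qed auto
qed (auto simp: semilinD[OF ringmapD(1)[OF assms]] ringmapD(2,3)[OF assms] free_alg_carrier simp del: free_alg_simps(1))

lemma free_hopf_coset: "I +>\<^bsub>free_hopf V D s\<^esub> f = I +>\<^bsub>free_alg V\<^esub> f"
  by (simp add: a_r_coset_def')

context
  fixes V :: "nat set" and TK :: "'k::field_char_0 itself"
  assumes V: "down V"
begin

abbreviation (input) "LL \<equiv> (free_lie V :: ('k, (nat mag \<Rightarrow>\<^sub>0 'k) set) module)"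
abbreviation (input) "cLL \<equiv> (quot.kq iota :: (nat mag \<Rightarrow>\<^sub>0 'k) set \<Rightarrow> nat list \<Rightarrow>\<^sub>0 'k)"
abbreviation (input) "FA \<equiv> (free_alg (carrier LL) :: ('k, (nat mag \<Rightarrow>\<^sub>0 'k) set list \<Rightarrow>\<^sub>0 'k) module)"
abbreviation (input) "FH \<equiv> free_hopf (carrier LL) (\<lambda>x. prim_tensor FA (gen x)) (\<lambda>x. - gen x) :: ('k, (nat mag \<Rightarrow>\<^sub>0 'k) set list \<Rightarrow>\<^sub>0 'k) hopf"
abbreviation "EI \<equiv> env_ideal LL"
abbreviation (input) "UU \<equiv> env LL"

interpretation L: coord_r LL cLL "rL V" "lists V" by (rule coord_r_L)

text \<open>\<open>sub\<close> evaluates words in Lie elements in the free algebra, and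
  \<open>jU\<close> goes back by sending each letter to its Lie generator. They are inverse to each
  other modulo the enveloping relations, which identifies U(L) with the free algebra.\<close>

definition sub :: "((nat mag \<Rightarrow>\<^sub>0 'k) set list \<Rightarrow>\<^sub>0 'k) \<Rightarrow> nat list \<Rightarrow>\<^sub>0 'k" where "sub = alg id cLL"

definition jU :: "(nat list \<Rightarrow>\<^sub>0 'k) \<Rightarrow> (nat mag \<Rightarrow>\<^sub>0 'k) set list \<Rightarrow>\<^sub>0 'k" where "jU = alg id (\<lambda>n. gen (lie_gen V n))"

lemma ringmap_sub [simp]: "ringmap id sub" and ringmap_jU [simp]: "ringmap id jU"
  and sub_gen [simp]: "sub (gen x) = cLL x" and jU_gen [simp]: "jU (gen n) = gen (lie_gen V n)"
  by (simp_all add: sub_def jU_def)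

lemmas sub_simps = semilinD[OF ringmapD(1)[OF ringmap_sub], unfolded id_apply] ringmapD(2,3)[OF ringmap_sub]
lemmas jU_simps = semilinD[OF ringmapD(1)[OF ringmap_jU], unfolded id_apply] ringmapD(2,3)[OF ringmap_jU]

lemma FA_carrier: "f \<in> carrier FA \<longleftrightarrow> supin (lists (carrier LL)) f"
  by (rule free_alg_carrier)

lemma gen_FA: "x \<in> carrier LL \<Longrightarrow> gen x \<in> carrier FA"
  unfolding FA_carrier by simp

lemma jU_carrier: "supin (lists V) p \<Longrightarrow> jU p \<in> carrier FA"
  unfolding FA_carrier jU_def
  by (rule supin_alg[OF rhom_id(1)]) (auto simp: zero_list_def plus_list_def lie_gen_props)

lemma sub_jU: "supin (lists V) p \<Longrightarrow> sub (jU p) = p"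
  by (rule ringmap_ext_on[OF ringmap_comp1[OF ringmap_jU ringmap_sub] ringmap_id(1), where V = V])
    (auto simp: supin_def lie_gen_props)

lemma sub_supin: assumes "f \<in> carrier FA" shows "supin (lists V) (sub f)"
  unfolding sub_def
  by (rule supin_alg[OF rhom_id(1) assms[unfolded FA_carrier]]) (auto simp: zero_list_def plus_list_def L.c_W)

lemma env_rels_sub: "env_rels LL \<subseteq> {f \<in> carrier FA. sub f = 0}"
  unfolding env_rels_def
  by (auto simp: FA_carrier sub_simps cL_mult simp del: free_alg_simps(1))

interpretation E: ideal EI FA
  unfolding env_ideal_def
  by (rule ring.genideal_ideal[OF ring_free_alg]) (use env_rels_sub in auto)

lemma EI_rels: "f \<in> env_rels LL \<Longrightarrow> f \<in> EI"
  unfolding env_ideal_def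
  using ring.genideal_self[OF ring_free_alg, of "env_rels LL" "carrier LL"] env_rels_sub by blast

lemma EI_closed:
  "0 \<in> EI" "f \<in> EI \<Longrightarrow> g \<in> EI \<Longrightarrow> f + g \<in> EI" "f \<in> EI \<Longrightarrow> g \<in> carrier FA \<Longrightarrow> g * f \<in> EI"
  "f \<in> EI \<Longrightarrow> g \<in> carrier FA \<Longrightarrow> f * g \<in> EI"
proof -
  show "0 \<in> EI" "f \<in> EI \<Longrightarrow> g \<in> EI \<Longrightarrow> f + g \<in> EI" "f \<in> EI \<Longrightarrow> g \<in> carrier FA \<Longrightarrow> g * f \<in> EI"
    "f \<in> EI \<Longrightarrow> g \<in> carrier FA \<Longrightarrow> f * g \<in> EI"
    using additive_subgroup.zero_closed[OF E.additive_subgroup_axioms]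
      additive_subgroup.a_closed[OF E.additive_subgroup_axioms, of f g] E.I_l_closed[of f g] E.I_r_closed[of f g]
    by (simp_all only: free_alg_simps)
qed

lemma EI_scale: "f \<in> EI \<Longrightarrow> scale a f \<in> EI"
proof -
  assume "f \<in> EI"
  moreover have "scale a 1 \<in> carrier FA" unfolding FA_carrier by simp
  ultimately have "scale a 1 * f \<in> EI" by (rule EI_closed(3))
  then show ?thesis by (simp only: scale_mult mult_1_left)
qed

lemma EI_diff: "f \<in> EI \<Longrightarrow> g \<in> EI \<Longrightarrow> f - g \<in> EI"
  using EI_closed(2)[of f "scale (- 1) g"] EI_scale[of g "- 1"] by (simp add: scale_linear)

lemma jU_mult_cong:
  assumes "f - jU a \<in> EI" "g - jU b \<in> EI" "g \<in> carrier FA" "supin (lists V) a"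
  shows "f * g - jU (a * b) \<in> EI"
proof -
  have "(f - jU a) * g + jU a * (g - jU b) \<in> EI"
    using assms jU_carrier by (intro EI_closed(2,3,4))
  then show ?thesis by (simp add: algebra_simps jU_simps)
qed

text \<open>Induction over the generation of x by Lie generators. Sums, multiples and brackets each
  use their own family of enveloping relations; the two products in a bracket are handled by
  \<open>jU_mult_cong\<close>.\<close>

lemma gen_jU: "x \<in> carrier LL \<Longrightarrow> gen x - jU (cLL x) \<in> EI"
proof (induction rule: L_induct)
  case zero
  have "gen (0 \<odot>\<^bsub>LL\<^esub> \<zero>\<^bsub>LL\<^esub>) - scale 0 (gen \<zero>\<^bsub>LL\<^esub>) \<in> EI"
    by (rule EI_rels) (unfold env_rels_def, rule UnI1, rule UnI2, use L.zero_closed in blast)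
  moreover have "0 \<odot>\<^bsub>LL\<^esub> \<zero>\<^bsub>LL\<^esub> = \<zero>\<^bsub>LL\<^esub>" by (intro L.c_eqI) simp_all
  ultimately show ?case by (simp add: jU_simps)
next
  case (gen n)
  then show ?case by (simp add: lie_gen_props EI_closed)
next
  case (add x y)
  have "gen (x \<oplus>\<^bsub>LL\<^esub> y) - gen x - gen y \<in> EI"
    by (rule EI_rels) (unfold env_rels_def, rule UnI1, rule UnI1, use add in blast)
  then have "(gen (x \<oplus>\<^bsub>LL\<^esub> y) - gen x - gen y) + ((gen x - jU (cLL x)) + (gen y - jU (cLL y))) \<in> EI"
    using add by (intro EI_closed(2))
  moreover have "(gen (x \<oplus>\<^bsub>LL\<^esub> y) - gen x - gen y) + ((gen x - jU (cLL x)) + (gen y - jU (cLL y))) =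
      gen (x \<oplus>\<^bsub>LL\<^esub> y) - jU (cLL (x \<oplus>\<^bsub>LL\<^esub> y))" using add by (simp add: jU_simps)
  ultimately show ?case by (simp only:)
next
  case (smult a x)
  have "gen (a \<odot>\<^bsub>LL\<^esub> x) - scale a (gen x) \<in> EI"
    by (rule EI_rels) (unfold env_rels_def, rule UnI1, rule UnI2, use smult in blast)
  then have "(gen (a \<odot>\<^bsub>LL\<^esub> x) - scale a (gen x)) + scale a (gen x - jU (cLL x)) \<in> EI"
    using smult by (intro EI_closed(2) EI_scale)
  then show ?case using smult by (simp add: jU_simps scale_linear)
next
  case (mult x y)
  have p: "gen u * gen v - jU (cLL u * cLL v) \<in> EI"
    if "u \<in> carrier LL" "v \<in> carrier LL" "gen u - jU (cLL u) \<in> EI" "gen v - jU (cLL v) \<in> EI" for u v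
    by (rule jU_mult_cong[OF that(3,4) gen_FA[OF that(2)] L.c_W[OF that(1)]])
  have r: "gen x * gen y - gen y * gen x - gen (x \<otimes>\<^bsub>LL\<^esub> y) \<in> EI"
    by (rule EI_rels) (unfold env_rels_def, rule UnI2, use mult in blast)
  have "(gen x * gen y - jU (cLL x * cLL y)) - (gen y * gen x - jU (cLL y * cLL x)) -
      (gen x * gen y - gen y * gen x - gen (x \<otimes>\<^bsub>LL\<^esub> y)) \<in> EI"
    by (rule EI_diff[OF EI_diff[OF p p] r]) (use mult in simp_all)
  then show ?case using mult by (simp add: cL_mult jU_simps algebra_simps)
qed

lemma sub_jU_cong: assumes "f \<in> carrier FA" shows "f - jU (sub f) \<in> EI"
proof -
  have b: "basis w - jU (sub (basis w)) \<in> EI" if "w \<in> lists (carrier LL)" for w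
    using that
  proof (induction rule: lists.induct)
    case Nil
    then show ?case by (simp add: sub_simps jU_simps EI_closed flip: one_list)
  next
    case (Cons x w)
    have "basis w \<in> carrier FA" unfolding FA_carrier using Cons by (intro supin_basic(6))
    then have "gen x * basis w - jU (cLL x * sub (basis w)) \<in> EI"
      using Cons by (intro jU_mult_cong gen_jU L.c_W)
    then show ?case by (simp add: basis_Cons sub_simps)
  qed
  have "(\<Sum>w\<in>I. scale (coef f w) (basis w - jU (sub (basis w)))) \<in> EI" if "I \<subseteq> lists (carrier LL)" for I
    using that by (induction I rule: infinite_finite_induct) (auto intro!: EI_closed(1,2) EI_scale b simp del: scale_simps)
  then have "(\<Sum>w\<in>supp f. scale (coef f w) (basis w - jU (sub (basis w)))) \<in> EI"
    using assms by (simp add: FA_carrier supin_def del: free_alg_simps(1))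
  moreover have "(\<Sum>w\<in>supp f. scale (coef f w) (basis w - jU (sub (basis w)))) = f - jU (sub f)"
    unfolding semilin_expand[OF ringmapD(1)[OF ringmap_comp1[OF ringmap_sub ringmap_jU]], of f]
    using pm_sum[of f] by (simp add: scale_linear sum_subtractf del: scale_simps)
  ultimately show ?thesis by simp
qed

text \<open>An element f of the kernel is congruent to \<open>jU (sub f)\<close>, which is 0, by
  \<open>sub_jU_cong\<close>. This is the description of the ideal that \<open>quot\<close> asks
  for.\<close>

lemma EI_eq: "EI = {f \<in> carrier FA. sub f = 0}"
proof
  show "EI \<subseteq> {f \<in> carrier FA. sub f = 0}"
    unfolding env_ideal_def
    by (rule ring.genideal_minimal[OF ring_free_alg ideal_kernel[OF ringmap_sub] env_rels_sub])
  show "{f \<in> carrier FA. sub f = 0} \<subseteq> EI"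
  proof
    fix f assume "f \<in> {f \<in> carrier FA. sub f = 0}"
    then have "f \<in> carrier FA" "sub f = 0" by (simp_all del: free_alg_simps)
    then show "f \<in> EI" using sub_jU_cong[of f] by (simp add: jU_simps del: free_alg_simps)
  qed
qed

lemma FH_carrier: "carrier FH = carrier FA" by simp

lemma quot_U: "quot_to_classical FH sub id EI id V"
proof -
  have s: "f \<in> carrier FH \<longleftrightarrow> supin (lists (carrier LL)) f" for f unfolding FH_carrier by (rule FA_carrier)
  interpret Q: quot FH sub id EI "(*)"
    by standard (simp_all add: s EI_eq FA_carrier sub_simps del: free_hopf_simps(1) free_alg_simps(1))
  have P: "prim_tensor FA (gen x) \<in> ftens 2 FA" if "x \<in> carrier LL" for x
  proof -
    have "(1 :: (nat mag \<Rightarrow>\<^sub>0 'k) set list \<Rightarrow>\<^sub>0 'k) \<in> carrier FA" unfolding FA_carrier by simp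
    then have "basis [gen x, 1] \<in> ftens 2 FA" and "basis [1, gen x] \<in> ftens 2 FA"
      using ftens_closed(6)[OF tlistsI(1)[OF gen_FA[OF that]]] ftens_closed(6)[OF tlistsI(1)[OF _ gen_FA[OF that]]] by blast+
    then show ?thesis by (simp add: prim_tensor_def)
  qed
  show ?thesis
  proof
    show "rhom (id :: 'k \<Rightarrow> 'k)" by simp
    show "down V" by (rule V)
    show "\<one>\<^bsub>FH\<^esub> \<in> carrier FH" "sub \<one>\<^bsub>FH\<^esub> = 1" unfolding s by (simp_all add: sub_simps)
    show "\<exists>x\<in>carrier FH. sub x = p" if "supin (lists V) p" for p
      using jU_carrier[OF that] sub_jU[OF that] unfolding FH_carrier by blast
    fix x assume x: "x \<in> carrier FH"
    then have sx: "supin (lists (carrier LL)) x" by (simp only: s)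
    show "supin (lists V) (sub x)" using x unfolding FH_carrier by (rule sub_supin)
    show cf: "comult FH x \<in> ftens 2 FH" by (rule free_comult(1)[OF P sx])
    have "tev2 Q.kq (push id Q.coset (comult FH x)) = tev2 sub (comult FH x)"
      by (rule tev2_push_id[OF cf]) (rule Q.kq_coset)
    also have "\<dots> = alg id (\<lambda>x. tev2 sub (prim_tensor FA (gen x))) x"
      by (rule free_comult(2)[OF P sx]) (simp_all add: sub_simps)
    \<comment> \<open>Both sides are algebra maps in x. On a Lie element they agree because its
      image in the free algebra is primitive for h = 0.\<close>
    also have "\<dots> = Dl 0 (sub x)"
    proof (rule ringmap_ext_on[OF ringmap_alg[OF rhom_id(1)] ringmap_comp1[OF ringmap_sub ringmap_Dl], where V = "carrier LL"])
      show "w \<in> supp x \<Longrightarrow> set w \<subseteq> carrier LL" for w using sx by (auto simp: supin_def)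
      show "y \<in> carrier LL \<Longrightarrow> alg id (\<lambda>x. tev2 sub (prim_tensor FA (gen x))) (gen y) = Dl 0 (sub (gen y))" for y
        by (simp add: prim_tensor_def tev_simps tev2_basis sub_simps cL_prim[OF V])
    qed
    finally show "tev2 Q.kq (push id Q.coset (comult FH x)) = Dl 0 (sub x)" .
    have "epsT (f :: (nat mag \<Rightarrow>\<^sub>0 'k) set list \<Rightarrow>\<^sub>0 'k) = (epsT (sub f) :: nat list \<Rightarrow>\<^sub>0 'k)" if "supin (lists (carrier LL)) f" for f
      by (rule ringmap_ext_on[OF ringmap_epsT ringmap_comp1[OF ringmap_sub ringmap_epsT], where V = "carrier LL"])
        (use that primT_eps[OF cL_prim[OF V]] in \<open>auto simp: supin_def\<close>)
    from this[OF sx] have "eps x = eps (sub x)"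
      by (metis epsT_def mult_1_right one_list lookup_single_eq coef_scale)
    then show "id (counit FH x) = eps (sub x)" by simp
    have "supin (lists (carrier LL)) (antialg (\<lambda>x. - gen x) (basis w :: _ \<Rightarrow>\<^sub>0 'k)) \<and>
        sub (antialg (\<lambda>x. - gen x) (basis w)) = Sl 0 (sub (basis w))" if "w \<in> lists (carrier LL)" for w
      using that
    proof (induction rule: lists.induct)
      case Nil
      then show ?case by (simp add: sub_simps Sl_simps flip: one_list)
    next
      case (Cons x w)
      then show ?case by (simp add: basis_Cons antialg_mult sub_simps Sl_simps primT_Sl[OF cL_prim[OF V]] supin_basic(4))
    qed
    note a = this
    show "antipode FH x \<in> carrier FH" unfolding s unfolding free_hopf_simps
      by (rule supin_semilin[OF semilin_antialg sx]) (use a in blast)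
    show "sub (antipode FH x) = Sl 0 (sub x)" unfolding free_hopf_simps
      by (rule semilin_ext_on[OF semilin_comp2[OF semilin_antialg ringmapD(1)[OF ringmap_sub]] semilin_comp2[OF ringmapD(1)[OF ringmap_sub] semilin_Sl]])
        (use a sx in \<open>auto simp: supin_def\<close>)
  qed
qed

abbreviation "cU \<equiv> quot.kq sub"

lemma U_classical: "FB_classical UU cU V"
  unfolding env_def by (rule quot_to_classical.FB_classical_QH[OF quot_U])

lemma env_incl_props: assumes "x \<in> carrier LL" shows "env_incl LL x \<in> carrier UU" "cU (env_incl LL x) = cLL x"
proof -
  interpret Q: quot_to_classical FH sub id EI id V by (rule quot_U)
  have i: "env_incl LL x = Q.coset (gen x)" by (simp add: env_incl_def free_hopf_coset)
  have g: "gen x \<in> carrier FH" unfolding FH_carrier by (rule gen_FA[OF assms])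
  show "cU (env_incl LL x) = cLL x" unfolding i Q.kq_coset[OF g] by simp
  show "env_incl LL x \<in> carrier UU" unfolding i env_def Q.QH_simps Q.Q_simps using g by (rule imageI)
qed

end

text \<open>Both algebras have the same words as coordinates and the same coordinate formulas for
  their operations, so the map that is the identity in coordinates respects all of them.\<close>

lemma hopf_iso_coord:
  assumes "FB_classical A c V" "FB_classical B d V"
  shows "hopf_iso A B (\<lambda>x. coord_b.r B d (c x))"
proof -
  interpret A: FB_classical A c V by fact
  interpret B: FB_classical B d V by fact
  have h: "x \<in> carrier A \<Longrightarrow> B.r (c x) \<in> carrier B" "x \<in> carrier A \<Longrightarrow> d (B.r (c x)) = c x" for x
    using A.c_W[of x] by (auto simp: B.cr)
  show ?thesis
    unfolding hopf_iso_def algebra_hom_def linear_on_def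
  proof (intro conjI ballI allI)
    show "(\<lambda>x. B.r (c x)) \<in> ring_hom A B"
      by (rule ring_hom_memI) (auto intro!: B.c_eqI simp: h)
    show "bij_betw (\<lambda>x. B.r (c x)) (carrier A) (carrier B)"
    proof (rule bij_betwI[where g = "\<lambda>y. A.r (d y)"])
      show "y \<in> carrier B \<Longrightarrow> B.r (c (A.r (d y))) = y" for y using B.c_W[of y] by (simp add: A.cr)
      show "x \<in> carrier A \<Longrightarrow> A.r (d (B.r (c x))) = x" for x by (simp add: h)
    qed (use h B.c_W in auto)
    fix x assume x: "x \<in> carrier A"
    have "push id (\<lambda>x. B.r (c x)) (comult A x) \<in> ftens 2 B"
      by (rule ftens_push[OF rhom_id(1) A.comult_ftens[OF x] h(1)])
    moreover have "tev2 d (push id (\<lambda>x. B.r (c x)) (comult A x)) = tev2 c (comult A x)"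
      by (rule tev2_push_id[OF A.comult_ftens[OF x]]) (rule h(2))
    ultimately show "teq B (push id (\<lambda>x. B.r (c x)) (comult A x)) (comult B (B.r (c x)))"
      using x h by (simp add: B.teq2)
  qed (auto intro!: B.c_eqI simp: h A.c_W B.cr supin_Sl[OF A.down_V])
qed

text \<open>The maps \<phi> and \<theta> leave coordinates unchanged, and all cobrackets are given
  by \<open>db\<close> in coordinates, so each compatibility becomes an equality of coordinates.
  Uniqueness is by induction over generators.\<close>

theorem theorem2p1:
  fixes \<nu> :: enat
  assumes "1 \<le> \<nu>"
  shows
    "let N = index_set \<nu>;
         A = (rees \<nu> :: ('k::field_char_0 poly, nat list \<Rightarrow>\<^sub>0 'k poly fract) hopf);
         A0 = specialize A;
         xbar = (\<lambda>n. mod_hbar A (rees_gen n));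
         L = (free_lie N :: ('k, (nat mag \<Rightarrow>\<^sub>0 'k) set) module);
         U = env L;
         xL = lie_gen N;
         xU = (\<lambda>n. env_incl L (xL n))
     in restricts A (H_alg \<nu>) \<and>
        (\<exists>\<phi> \<delta>0 \<delta>L \<delta>U.
           quantized_env A L \<phi> \<and>
           (\<forall>n\<in>N. \<phi> (xbar n) = xU n) \<and>
           (\<forall>\<psi>. algebra_hom A0 U \<psi> \<and> (\<forall>n\<in>N. \<psi> (xbar n) = xU n) \<longrightarrow> (\<forall>y\<in>carrier A0. \<psi> y = \<phi> y)) \<and>

           semiclassical_cobracket A \<delta>0 \<and> copoisson_hopf A0 \<delta>0 \<and>

           lie_bialgebra L \<delta>L \<and>
           (\<forall>n\<in>N. teq L (\<delta>L (xL n))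
              (\<Sum>l\<in>{1..<n}. scale (of_nat (l + 1)) (wedge (xL l) (xL (n - l))))) \<and>
           (\<forall>\<delta>. lie_bialgebra L \<delta> \<and> same_tensors L (xL ` N) \<delta> \<delta>L \<longrightarrow> same_tensors L (carrier L) \<delta> \<delta>L) \<and>

           copoisson_hopf U \<delta>U \<and>
           same_tensors U (carrier L) (\<lambda>x. \<delta>U (env_incl L x)) (\<lambda>x. push id (env_incl L) (\<delta>L x)) \<and>
           (\<forall>\<delta>. copoisson_hopf U \<delta> \<and>
              same_tensors U (carrier L) (\<lambda>x. \<delta> (env_incl L x)) (\<lambda>x. push id (env_incl L) (\<delta>L x)) \<longrightarrow>
              same_tensors U (carrier U) \<delta> \<delta>U) \<and>

           same_tensors U (carrier A0) (\<lambda>y. push id \<phi> (\<delta>0 y)) (\<lambda>y. \<delta>U (\<phi> y)) \<and>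

           (\<exists>\<theta>. lie_iso L (primitive_lie A0) \<theta> \<and> (\<forall>x\<in>carrier L. \<phi> (\<theta> x) = env_incl L x) \<and>
              same_tensors A0 (carrier L) (\<lambda>x. \<delta>0 (\<theta> x)) (\<lambda>x. push id \<theta> (\<delta>L x))) \<and>

           graded_copoisson_hopf A0 \<delta>0 (alg_grading A0 N xbar (\<lambda>n. 1)) 1 \<and>
           graded_copoisson_hopf U \<delta>U (alg_grading U N xU (\<lambda>n. 1)) 1 \<and>
           graded_hopf A0 (alg_grading A0 N xbar (\<lambda>n. n)) \<and>
           graded_hopf U (alg_grading U N xU (\<lambda>n. n)) \<and>
           graded_lie_bialgebra L \<delta>L (lie_grading L N xL (\<lambda>n. n)))"
proof -
  define N where "N = index_set \<nu>"
  define A where "A = (rees \<nu> :: ('k poly, nat list \<Rightarrow>\<^sub>0 'k poly fract) hopf)"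
  define A0 where "A0 = specialize A"
  define xbar where "xbar = (\<lambda>n. mod_hbar A (rees_gen n))"
  define L where "L = (free_lie N :: ('k, (nat mag \<Rightarrow>\<^sub>0 'k) set) module)"
  define U where "U = env L"
  define xL where "xL = (lie_gen N :: nat \<Rightarrow> (nat mag \<Rightarrow>\<^sub>0 'k) set)"
  define xU where "xU = (\<lambda>n. env_incl L (xL n))"
  define cA where "cA = (quot.kq (\<lambda>y. red (cR y)) :: (nat list \<Rightarrow>\<^sub>0 'k poly fract) set \<Rightarrow> nat list \<Rightarrow>\<^sub>0 'k)"
  define cl where "cl = (quot.kq iota :: (nat mag \<Rightarrow>\<^sub>0 'k) set \<Rightarrow> nat list \<Rightarrow>\<^sub>0 'k)"
  define cu where "cu = (quot.kq sub :: ((nat mag \<Rightarrow>\<^sub>0 'k) set list \<Rightarrow>\<^sub>0 'k) set \<Rightarrow> nat list \<Rightarrow>\<^sub>0 'k)"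
  have dN: "down N" unfolding N_def by (rule down_index_set)
  interpret A: FB_hopf A cR N hbar unfolding A_def N_def by (rule FB_hopf_rees)
  interpret A0: FB_classical A0 cA N unfolding A0_def A_def N_def cA_def by (rule A0_classical)
  interpret U: FB_classical U cu N unfolding U_def L_def cu_def by (rule U_classical[OF dN])
  interpret L: coord_r L cl "rL N" "lists N" unfolding L_def cl_def by (rule coord_r_L)
  define \<phi> where "\<phi> = (\<lambda>y. U.r (cA y))"
  define \<theta> where "\<theta> = (\<lambda>x. A0.r (cl x))"
  define \<delta>L where "\<delta>L = (cobrL N :: (nat mag \<Rightarrow>\<^sub>0 'k) set \<Rightarrow> (nat mag \<Rightarrow>\<^sub>0 'k) set list \<Rightarrow>\<^sub>0 'k)"

  have xbar: "xbar n \<in> carrier A0" "cA (xbar n) = gen n" if "n \<in> N" for n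
    using that rees_gen_props[of n \<nu>, where ?'k = 'k] unfolding xbar_def A0_def A_def cA_def N_def
    by (simp_all add: mod_hbar_carrier cA0_mod_hbar) (simp add: gen_def)
  have xL: "xL n \<in> carrier L" "cl (xL n) = gen n" if "n \<in> N" for n
    unfolding xL_def L_def cl_def using lie_gen_props[OF that, where ?'k = 'k] by simp_all
  have incl: "env_incl L x \<in> carrier U" "cu (env_incl L x) = cl x" if "x \<in> carrier L" for x
    using env_incl_props[OF dN that[unfolded L_def]] unfolding L_def U_def cu_def cl_def by simp_all
  have xU: "xU n \<in> carrier U" "cu (xU n) = gen n" if "n \<in> N" for n
    unfolding xU_def using incl xL that by auto
  have phi: "\<phi> y \<in> carrier U" "cu (\<phi> y) = cA y" if "y \<in> carrier A0" for y
    using A0.c_W[OF that] unfolding \<phi>_def by (auto simp: U.cr)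
  have theta: "\<theta> x \<in> carrier A0" "cA (\<theta> x) = cl x" if "x \<in> carrier L" for x
    using L.c_W[OF that] unfolding \<theta>_def by (auto simp: A0.cr)
  have deltaL: "\<delta>L x \<in> ftens 2 L" "tev2 cl (\<delta>L x) = db (cl x)" if "x \<in> carrier L" for x
    using cobrL[OF dN that[unfolded L_def]] unfolding L_def \<delta>L_def cl_def by simp_all
  have primL: "Dl 0 (cl x) = ten (cl x) 1 + ten 1 (cl x)" if "x \<in> carrier L" for x
    using cL_prim[OF dN that[unfolded L_def]] unfolding cl_def .
  have Lmult: "x \<otimes>\<^bsub>L\<^esub> y \<in> carrier L" "cl (x \<otimes>\<^bsub>L\<^esub> y) = cl x * cl y - cl y * cl x"
    if "x \<in> carrier L" "y \<in> carrier L" for x y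
    using cL_mult[of x N y] that unfolding L_def cl_def by auto
  have phi_xbar: "\<phi> (xbar n) = xU n" if "n \<in> N" for n
    using that by (intro U.c_eqI) (auto simp: phi xbar xU)

  have quantized: "quantized_env A L \<phi>"
    unfolding quantized_env_def
  proof (intro conjI)
    show "hopf_algebra A" by (rule A.is_hopf_algebra)
    show "lie_algebra L" unfolding L_def by (rule lie_algebra_L)
    show "hopf_iso (specialize A) (env L) \<phi>"
      unfolding A0_def[symmetric] U_def[symmetric] \<phi>_def
      by (rule hopf_iso_coord[OF A0.FB_classical_axioms U.FB_classical_axioms])
  qed
  then have phi_hom: "algebra_hom A0 U \<phi>" by (simp add: quantized_env_def hopf_iso_def A0_def U_def)

  have unique_phi: "\<psi> y = \<phi> y"
    if psi: "algebra_hom A0 U \<psi>" "\<And>n. n \<in> N \<Longrightarrow> \<psi> (xbar n) = xU n" and y: "y \<in> carrier A0" for \<psi> y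
  proof -
    have lin: "\<chi> (a \<oplus>\<^bsub>A0\<^esub> b) = \<chi> a \<oplus>\<^bsub>U\<^esub> \<chi> b" "\<chi> (s \<odot>\<^bsub>A0\<^esub> a) = s \<odot>\<^bsub>U\<^esub> \<chi> a" "\<chi> (a \<otimes>\<^bsub>A0\<^esub> b) = \<chi> a \<otimes>\<^bsub>U\<^esub> \<chi> b"
      "\<chi> \<one>\<^bsub>A0\<^esub> = \<one>\<^bsub>U\<^esub>" "\<chi> a \<in> carrier U"
      if "algebra_hom A0 U \<chi>" "a \<in> carrier A0" "b \<in> carrier A0" for \<chi> a b s
      using that unfolding algebra_hom_def linear_on_def ring_hom_def by auto
    \<comment> \<open>\<open>algebra_hom\<close> says nothing about zero directly; it is preserved
      as a multiple by the scalar 0.\<close>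
    have zero: "\<chi> \<zero>\<^bsub>A0\<^esub> = \<zero>\<^bsub>U\<^esub>" if "algebra_hom A0 U \<chi>" for \<chi>
    proof -
      have "0 \<odot>\<^bsub>A0\<^esub> \<zero>\<^bsub>A0\<^esub> = \<zero>\<^bsub>A0\<^esub>" by (intro A0.c_eqI) simp_all
      then have "\<chi> \<zero>\<^bsub>A0\<^esub> = 0 \<odot>\<^bsub>U\<^esub> \<chi> \<zero>\<^bsub>A0\<^esub>" using lin(2)[OF that, of "\<zero>\<^bsub>A0\<^esub>" "\<zero>\<^bsub>A0\<^esub>" 0] by simp
      also have "\<dots> = \<zero>\<^bsub>U\<^esub>" using lin(5)[OF that, of "\<zero>\<^bsub>A0\<^esub>" "\<zero>\<^bsub>A0\<^esub>"] by (intro U.c_eqI) simp_all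
      finally show ?thesis .
    qed
    show ?thesis
    proof (rule A0.carrier_induct[of xbar y "\<lambda>y. \<psi> y = \<phi> y"])
      show "\<psi> \<one>\<^bsub>A0\<^esub> = \<phi> \<one>\<^bsub>A0\<^esub>"
        using lin(4)[OF psi(1) A0.one_closed A0.one_closed] lin(4)[OF phi_hom A0.one_closed A0.one_closed] by simp
      show "\<psi> (xbar n) = \<phi> (xbar n)" if "n \<in> N" for n using that by (simp add: psi phi_xbar)
    qed (use y xbar zero[OF psi(1)] zero[OF phi_hom] lin(1-3)[OF psi(1)] lin(1-3)[OF phi_hom] in auto)
  qed

  have U_L: "same_tensors U (carrier L) (\<lambda>x. U.cobr (env_incl L x)) (\<lambda>x. push id (env_incl L) (\<delta>L x))"
    unfolding same_tensors_def
  proof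
    fix x assume x: "x \<in> carrier L"
    have "tev2 cu (push id (env_incl L) (\<delta>L x)) = tev2 cl (\<delta>L x)"
      by (rule tev2_push_id[OF deltaL(1)[OF x]]) (rule incl(2))
    moreover have "push id (env_incl L) (\<delta>L x) \<in> ftens 2 U"
      by (rule ftens_push[OF rhom_id(1) deltaL(1)[OF x] incl(1)])
    ultimately show "teq U (U.cobr (env_incl L x)) (push id (env_incl L) (\<delta>L x))"
      using x by (simp add: U.teq2 incl deltaL)
  qed

  have U_unique: "same_tensors U (carrier U) \<delta> U.cobr"
    if d: "copoisson_hopf U \<delta>" "same_tensors U (carrier L) (\<lambda>x. \<delta> (env_incl L x)) (\<lambda>x. push id (env_incl L) (\<delta>L x))" for \<delta>
  proof -
    have tl: "tensor_linear 2 U \<delta>" and ml: "\<And>x y. x \<in> carrier U \<Longrightarrow> y \<in> carrier U \<Longrightarrow>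
        teq U (\<delta> (x \<otimes>\<^bsub>U\<^esub> y)) (tmult U (\<delta> x) (comult U y) + tmult U (comult U x) (\<delta> y))"
      using d(1) by (auto simp: copoisson_hopf_def cobracket_def)
    have f: "x \<in> carrier U \<Longrightarrow> \<delta> x \<in> ftens 2 U" for x using tl by (simp add: tensor_linear_def)
    have add: "tev2 cu (\<delta> (x \<oplus>\<^bsub>U\<^esub> y)) = tev2 cu (\<delta> x) + tev2 cu (\<delta> y)" if "x \<in> carrier U" "y \<in> carrier U" for x y
      using U.teq_tev(1)[of "\<delta> (x \<oplus>\<^bsub>U\<^esub> y)" "\<delta> x + \<delta> y"] tl that by (simp add: tensor_linear_def tev_simps)
    have sm: "tev2 cu (\<delta> (a \<odot>\<^bsub>U\<^esub> x)) = scale a (tev2 cu (\<delta> x))" if "x \<in> carrier U" for x a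
      using U.teq_tev(1)[of "\<delta> (a \<odot>\<^bsub>U\<^esub> x)" "scale a (\<delta> x)"] tl that by (simp add: tensor_linear_def tev_simps)
    have mu: "tev2 cu (\<delta> (x \<otimes>\<^bsub>U\<^esub> y)) = tev2 cu (\<delta> x) * Dl 0 (cu y) + Dl 0 (cu x) * tev2 cu (\<delta> y)"
      if "x \<in> carrier U" "y \<in> carrier U" for x y
      using U.teq_tev(1)[OF ml[OF that]] that
      by (simp add: tev_simps tev2_tmult[OF f[OF that(1)] U.comult_ftens[OF that(2)]] tev2_tmult[OF U.comult_ftens[OF that(1)] f[OF that(2)]])
    have "tev2 cu (\<delta> y) = db (cu y)" if y: "y \<in> carrier U" for y
    proof (rule U.carrier_induct[of xU y "\<lambda>y. tev2 cu (\<delta> y) = db (cu y)"])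
      have "0 \<odot>\<^bsub>U\<^esub> \<zero>\<^bsub>U\<^esub> = \<zero>\<^bsub>U\<^esub>" by (intro U.c_eqI) simp_all
      then show "tev2 cu (\<delta> \<zero>\<^bsub>U\<^esub>) = db (cu \<zero>\<^bsub>U\<^esub>)"
        using sm[of "\<zero>\<^bsub>U\<^esub>" 0] by (simp add: semilinD[OF semilin_db])
      have "\<one>\<^bsub>U\<^esub> \<otimes>\<^bsub>U\<^esub> \<one>\<^bsub>U\<^esub> = \<one>\<^bsub>U\<^esub>" by (intro U.c_eqI) simp_all
      \<comment> \<open>The product rule for 1 = 1 * 1 says that the coordinates of \<delta> at 1
        equal twice themselves.\<close>
      then have "tev2 cu (\<delta> \<one>\<^bsub>U\<^esub>) = 0" using mu[of "\<one>\<^bsub>U\<^esub>" "\<one>\<^bsub>U\<^esub>"] by (simp add: Dl_simps)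
      moreover have "db (1 :: nat list \<Rightarrow>\<^sub>0 'k) = 0" using db_mult[of "1 :: nat list \<Rightarrow>\<^sub>0 'k" 1] by (simp add: Dl_simps)
      ultimately show "tev2 cu (\<delta> \<one>\<^bsub>U\<^esub>) = db (cu \<one>\<^bsub>U\<^esub>)" by simp
      show "tev2 cu (\<delta> (xU n)) = db (cu (xU n))" if "n \<in> N" for n
      proof -
        have x: "xL n \<in> carrier L" by (rule xL(1)[OF that])
        have "teq U (\<delta> (xU n)) (push id (env_incl L) (\<delta>L (xL n)))" using d(2) x by (simp add: same_tensors_def xU_def)
        moreover have "teq U (U.cobr (xU n)) (push id (env_incl L) (\<delta>L (xL n)))" using U_L x by (simp add: same_tensors_def xU_def)
        ultimately have "tev2 cu (\<delta> (xU n)) = tev2 cu (U.cobr (xU n))" using U.teq_tev(1) by metis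
        then show ?thesis using xU that by simp
      qed
    qed (use y xU in \<open>auto simp: add sm mu db_mult semilinD[OF semilin_db]\<close>)
    then show ?thesis unfolding same_tensors_def by (simp add: U.teq2 f)
  qed

  have A0_U: "same_tensors U (carrier A0) (\<lambda>y. push id \<phi> (A0.cobr y)) (\<lambda>y. U.cobr (\<phi> y))"
    unfolding same_tensors_def
  proof
    fix y assume y: "y \<in> carrier A0"
    have "tev2 cu (push id \<phi> (A0.cobr y)) = tev2 cA (A0.cobr y)"
      by (rule tev2_push_id[OF A0.cobr(1)[OF y]]) (rule phi(2))
    moreover have "push id \<phi> (A0.cobr y) \<in> ftens 2 U"
      by (rule ftens_push[OF rhom_id(1) A0.cobr(1)[OF y] phi(1)])
    ultimately show "teq U (push id \<phi> (A0.cobr y)) (U.cobr (\<phi> y))"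
      using y by (simp add: U.teq2 phi)
  qed

  have A0_L: "same_tensors A0 (carrier L) (\<lambda>x. A0.cobr (\<theta> x)) (\<lambda>x. push id \<theta> (\<delta>L x))"
    unfolding same_tensors_def
  proof
    fix x assume x: "x \<in> carrier L"
    have "tev2 cA (push id \<theta> (\<delta>L x)) = tev2 cl (\<delta>L x)"
      by (rule tev2_push_id[OF deltaL(1)[OF x]]) (rule theta(2))
    moreover have "push id \<theta> (\<delta>L x) \<in> ftens 2 A0"
      by (rule ftens_push[OF rhom_id(1) deltaL(1)[OF x] theta(1)])
    ultimately show "teq A0 (A0.cobr (\<theta> x)) (push id \<theta> (\<delta>L x))"
      using x by (simp add: A0.teq2 theta deltaL)
  qed

  have prim: "teq A0 (comult A0 y) (prim_tensor A0 y) \<longleftrightarrow> Dl 0 (cA y) = ten (cA y) 1 + ten 1 (cA y)"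
    if "y \<in> carrier A0" for y
    using that by (subst A0.teq2) (simp_all add: prim_tensor_def tev_simps tev2_basis)
  have theta_iso: "lie_iso L (primitive_lie A0) \<theta>"
    unfolding lie_iso_def linear_on_def
  proof (intro conjI ballI allI Pi_I)
    fix x assume x: "x \<in> carrier L"
    then show "\<theta> x \<in> carrier (primitive_lie A0)"
      by (simp add: primitive_lie_def theta prim primL)
    show "\<theta> (a \<odot>\<^bsub>L\<^esub> x) = a \<odot>\<^bsub>primitive_lie A0\<^esub> \<theta> x" for a
      using x by (intro A0.c_eqI) (simp_all add: primitive_lie_def theta)
    fix y assume y: "y \<in> carrier L"
    show "\<theta> (x \<oplus>\<^bsub>L\<^esub> y) = \<theta> x \<oplus>\<^bsub>primitive_lie A0\<^esub> \<theta> y"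
      using x y by (intro A0.c_eqI) (simp_all add: primitive_lie_def theta)
    have "cA ((\<theta> x \<otimes>\<^bsub>A0\<^esub> \<theta> y) \<ominus>\<^bsub>A0\<^esub> (\<theta> y \<otimes>\<^bsub>A0\<^esub> \<theta> x)) = cl x * cl y - cl y * cl x"
      using x y by (simp add: A0.c_minus theta)
    then show "\<theta> (x \<otimes>\<^bsub>L\<^esub> y) = \<theta> x \<otimes>\<^bsub>primitive_lie A0\<^esub> \<theta> y"
      using x y by (intro A0.c_eqI) (simp_all add: primitive_lie_def theta Lmult A0.minus_closed)
  next
    show "bij_betw \<theta> (carrier L) (carrier (primitive_lie A0))"
    proof (rule bij_betwI[where g = "\<lambda>y. rL N (cA y)"])
      show "\<theta> \<in> carrier L \<rightarrow> carrier (primitive_lie A0)"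
        by (auto simp: primitive_lie_def theta prim primL)
      show "(\<lambda>y. rL N (cA y)) \<in> carrier (primitive_lie A0) \<rightarrow> carrier L"
        by (auto simp: primitive_lie_def A0.c_W)
      show "rL N (cA (\<theta> x)) = x" if "x \<in> carrier L" for x using that by (simp add: theta)
      fix y assume "y \<in> carrier (primitive_lie A0)"
      then have y: "y \<in> carrier A0" "Dl 0 (cA y) = ten (cA y) 1 + ten 1 (cA y)"
        using prim by (auto simp: primitive_lie_def)
      have "cl (rL N (cA y)) = iota (betan (cA y))"
        unfolding cl_def rL_def by (rule cL_cos[OF betan_carrier[OF A0.c_W[OF y(1)]]])
      \<comment> \<open>Surjectivity of \<theta> onto the primitive elements is Friedrichs'
        criterion.\<close>
      then have "cl (rL N (cA y)) = cA y" using primT_eq_iota[OF y(2)] by simp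
      then show "\<theta> (rL N (cA y)) = y" using y(1) unfolding \<theta>_def by simp
    qed
  qed

  have grad1: "alg_grading A0 N xbar wt = A0.Gr (wtw wt)" "alg_grading U N xU wt = U.Gr (wtw wt)" for wt
    using A0.alg_grading_eq[of xbar wt] U.alg_grading_eq[of xU wt] xbar xU by blast+

  show ?thesis
    unfolding Let_def N_def[symmetric] A_def[symmetric] A0_def[symmetric] xbar_def[symmetric]
      L_def[symmetric] U_def[symmetric] xL_def[symmetric] xU_def[symmetric]
  proof (intro conjI exI[of _ \<phi>] exI[of _ A0.cobr] exI[of _ \<delta>L] exI[of _ U.cobr] exI[of _ \<theta>] allI impI ballI)
    show "restricts A (H_alg \<nu>)" unfolding A_def by (rule rees_restricts)
    show "semiclassical_cobracket A A0.cobr" unfolding A_def A0_def cA_def by (rule A0_semiclassical)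
    show "lie_bialgebra L \<delta>L" unfolding L_def \<delta>L_def by (rule lie_bialgebra_L[OF dN])
    show "teq L (\<delta>L (xL n)) (\<Sum>l\<in>{1..<n}. scale (of_nat (l + 1)) (wedge (xL l) (xL (n - l))))" if "n \<in> N" for n
      unfolding L_def \<delta>L_def xL_def by (rule cobrL_gen[OF dN that])
    show "same_tensors L (carrier L) \<delta> \<delta>L" if "lie_bialgebra L \<delta> \<and> same_tensors L (xL ` N) \<delta> \<delta>L" for \<delta>
      using that unfolding L_def \<delta>L_def xL_def by (intro lie_bialgebra_unique[OF dN]) auto
    show "\<phi> (\<theta> x) = env_incl L x" if "x \<in> carrier L" for x
      using that by (intro U.c_eqI) (simp_all add: phi theta incl)
    show "graded_copoisson_hopf A0 A0.cobr (alg_grading A0 N xbar (\<lambda>n. 1)) 1"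
      "graded_copoisson_hopf U U.cobr (alg_grading U N xU (\<lambda>n. 1)) 1"
      \<comment> \<open>With weight 1 on each letter the condition of
        \<open>graded_copoisson_Gr\<close> reads 1 + 1 = 1 + s, so the shift is 1.\<close>
      unfolding grad1 using A0.graded_copoisson_Gr[of "\<lambda>n. 1" 1] U.graded_copoisson_Gr[of "\<lambda>n. 1" 1] by simp_all
    show "graded_hopf A0 (alg_grading A0 N xbar (\<lambda>n. n))" "graded_hopf U (alg_grading U N xU (\<lambda>n. n))"
      unfolding grad1 by (rule A0.graded_hopf_Gr U.graded_hopf_Gr)+
    show "graded_lie_bialgebra L \<delta>L (lie_grading L N xL (\<lambda>n. n))"
      unfolding L_def \<delta>L_def xL_def by (rule graded_lie_bialgebra_L[OF dN]) simp
    show "\<phi> (mod_hbar A (rees_gen n)) = env_incl L (xL n)" if "n \<in> N" for n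
      using phi_xbar[OF that] by (simp add: xbar_def xU_def)
    show "\<psi> y = \<phi> y" if "algebra_hom A0 U \<psi> \<and> (\<forall>n\<in>N. \<psi> (mod_hbar A (rees_gen n)) = env_incl L (xL n))" "y \<in> carrier A0" for \<psi> y
      using that by (intro unique_phi) (auto simp: xbar_def xU_def)
  qed (use quantized A0.is_copoisson U.is_copoisson U_L U_unique A0_U theta_iso A0_L in auto)
qed


end
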